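(* A Lagrangian submanifold in the nearly Kähler manifold $\mathbb{S}^3\times\mathbb{S}^3$ all of whose angle functions are constant is locally congruent to one of the following immersions: (1) $f:\mathbb{S}^3\to\mathbb{S}^3\times\mathbb{S}^3$, $u\mapsto(u,1)$; (2) $f:\mathbb{S}^3\to\mathbb{S}^3\times\mathbb{S}^3$, $u\mapsto(1,u)$; (3) $f:\mathbb{S}^3\to\mathbb{S}^3\times\mathbb{S}^3$, $u\mapsto(u,u)$; (4) $f:\mathbb{S}^3\to\mathbb{S}^3\times\mathbb{S}^3$, $u\mapsto(u,ui)$; (5) $f:\mathbb{S}^3\to\mathbb{S}^3\times\mathbb{S}^3$, $u\mapsto(u^{-1},uiu^{-1})$; (6) $f:\mathbb{S}^3\to\mathbb{S}^3\times\mathbb{S}^3$, $u\mapsto(uiu^{-1},u^{-1})$; (7) $f:\mathbb{S}^3\to\mathbb{S}^3\times\mathbb{S}^3$, $u\mapsto(uiu^{-1},uju^{-1})$; (8) $f:\mathbb{R}^3\to\mathbb{S}^3\times\mathbb{S}^3$, $(u,v,w)\mapsto(p(u,w),q(u,v))$, where $p$ and $q$ are the constant mean curvature tori in $\mathbb{S}^3$ given by $$p(u,w)=(\cos u\cos w,\ \cos u\sin w,\ \sin u\cos w,\ \sin u\sin w),$$ $$q(u,v)=\tfrac{1}{\sqrt2}\big(\cos v(\sin u+\cos u),\ \sin v(\sin u+\cos u),\ \cos v(\sin u-\cos u),\ \sin v(\sin u-\cos u)\big).$$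
   Context: Identify $\mathbb{S}^3$ with the unit quaternions in $\mathbb{H}$, where $(x_1,x_2,x_3,x_4)\in\mathbb{R}^4$ corresponds to $x_1+x_2i+x_3j+x_4k$, with Euclidean metric $\langle\cdot,\cdot\rangle$; tangent vectors at $p$ are $p\alpha$ with $\alpha$ an imaginary quaternion. For $(U,V)\in T_{(p,q)}(\mathbb{S}^3\times\mathbb{S}^3)\cong T_p\mathbb{S}^3\oplus T_q\mathbb{S}^3$ define the almost complex structure $$J(U,V)_{(p,q)}=\tfrac{1}{\sqrt3}\left(2pq^{-1}V-U,\,-2qp^{-1}U+V\right),$$ and the metric $g(Z,Z')=\frac12(\langle Z,Z'\rangle+\langle JZ,JZ'\rangle)$, where $\langle\cdot,\cdot\rangle$ is the usual Euclidean product metric on $\mathbb{S}^3\times\mathbb{S}^3$. With $(g,J)$, $\mathbb{S}^3\times\mathbb{S}^3$ is a nearly Kähler manifold. Define also the almost product structure $P(U,V)_{(p,q)}=(pq^{-1}V,\,qp^{-1}U)$. An immersion $f:M\to\mathbb{S}^3\times\mathbb{S}^3$ is Lagrangian if $\dim M=3$ and $J$ maps $df(T_xM)$ into the $g$-normal space for every $x\in M$. $M$ carries the induced metric $f^*g$. For a Lagrangian immersion there are symmetric endomorphisms $A,B$ of $TM$ with $P\,df(X)=df(AX)+J\,df(BX)$; they commute and satisfy $A^2+B^2=\mathrm{Id}$. Hence around each point of an open dense subset of $M$ there is a local orthonormal frame $E_1,E_2,E_3$ and functions $\theta_1,\theta_2,\theta_3$ (the angle functions, each determined modulo $\pi$)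 such that $AE_i=\cos(2\theta_i)E_i$ and $BE_i=\sin(2\theta_i)E_i$, i.e. $P\,df(E_i)=\cos(2\theta_i)\,df(E_i)+\sin(2\theta_i)\,J\,df(E_i)$, for $i=1,2,3$. Saying that an angle function is constant means that it can be chosen equal to one fixed real number over $M$. "Locally congruent to an immersion $f_0:M_0\to\mathbb{S}^3\times\mathbb{S}^3$" means: every point has a neighbourhood $U\subset M$ for which there are a diffeomorphism $\phi$ of $U$ onto an open subset of $M_0$ and an isometry $F$ of $(\mathbb{S}^3\times\mathbb{S}^3,g)$ with $f|_U=F\circ f_0\circ\phi$. *)

theory Defs
  imports "HOL-Analysis.Analysis"
begin

section \<open>Smooth maps\<close>

primrec Ck_on :: "nat \<Rightarrow> 'a::euclidean_space set \<Rightarrow> ('a \<Rightarrow> 'b::real_normed_vector) \<Rightarrow> bool" where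
  "Ck_on 0 S f \<longleftrightarrow> continuous_on S f"
| "Ck_on (Suc k) S f \<longleftrightarrow>
     (\<forall>x\<in>S. f differentiable (at x)) \<and> (\<forall>v. Ck_on k S (\<lambda>x. frechet_derivative f (at x) v))"

text \<open>Smoothness on an arbitrary subset of a Euclidean space: near each of its points the map is the
  restriction of a smooth map defined on an open set. For open subsets this is ordinary smoothness,
  for embedded submanifolds such as spheres it is smoothness on the submanifold.\<close>

definition smooth_on :: "'a::euclidean_space set \<Rightarrow> ('a \<Rightarrow> 'b::real_normed_vector) \<Rightarrow> bool" where
  "smooth_on A f \<longleftrightarrow>
     (\<forall>a\<in>A. \<exists>W g. open W \<and> a \<in> W \<and> (\<forall>k. Ck_on k W g) \<and> (\<forall>x\<in>W \<inter> A. g x = f x))"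


section \<open>Abstract smooth manifolds\<close>

type_synonym ('m, 'e) chart = "'m set \<times> ('m \<Rightarrow> 'e)"

text \<open>The dimension of the manifold is \<open>DIM('e)\<close>. The atlas need not be maximal.\<close>

definition smooth_manifold :: "'m topology \<Rightarrow> ('m, 'e::euclidean_space) chart set \<Rightarrow> bool" where
  "smooth_manifold M \<A> \<longleftrightarrow>
     Hausdorff_space M \<and> second_countable M \<and>
     (\<Union>(U, \<phi>)\<in>\<A>. U) = topspace M \<and>
     (\<forall>(U, \<phi>)\<in>\<A>. openin M U \<and> open (\<phi> ` U) \<and>
        homeomorphic_map (subtopology M U) (top_of_set (\<phi> ` U)) \<phi>) \<and>
     (\<forall>(U, \<phi>)\<in>\<A>. \<forall>(V, \<psi>)\<in>\<A>. smooth_on (\<phi> ` (U \<inter> V)) (\<psi> \<circ> inv_into U \<phi>))"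

definition smooth_map_on ::
  "('m, 'e::euclidean_space) chart set \<Rightarrow> 'm set \<Rightarrow> ('m \<Rightarrow> 'b::real_normed_vector) \<Rightarrow> bool" where
  "smooth_map_on \<A> W f \<longleftrightarrow> (\<forall>(U, \<phi>)\<in>\<A>. smooth_on (\<phi> ` (U \<inter> W)) (f \<circ> inv_into U \<phi>))"

text \<open>The differential of \<open>f\<close> at \<open>x\<close>, applied to the tangent vector at \<open>x\<close> whose coordinates in the
  given chart are \<open>v\<close>.\<close>

fun chart_diff ::
  "('m, 'e::euclidean_space) chart \<Rightarrow> ('m \<Rightarrow> 'b::real_normed_vector) \<Rightarrow> 'm \<Rightarrow> 'e \<Rightarrow> 'b" where
  "chart_diff (U, \<phi>) f x v = frechet_derivative (f \<circ> inv_into U \<phi>) (at (\<phi> x)) v"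

text \<open>Diffeomorphisms of an open subset \<open>U\<close> of a manifold onto an open subset of an embedded
  submanifold \<open>N\<close> of a Euclidean space.\<close>

definition diffeo_onto_open ::
  "'m topology \<Rightarrow> ('m, 'e::euclidean_space) chart set \<Rightarrow> 'm set \<Rightarrow> 'n::euclidean_space set
     \<Rightarrow> ('m \<Rightarrow> 'n) \<Rightarrow> bool" where
  "diffeo_onto_open M \<A> U N \<phi> \<longleftrightarrow>
     openin (top_of_set N) (\<phi> ` U) \<and>
     homeomorphic_map (subtopology M U) (top_of_set (\<phi> ` U)) \<phi> \<and>
     smooth_map_on \<A> U \<phi> \<and>
     (\<forall>(V, \<psi>)\<in>\<A>. smooth_on (\<phi> ` (U \<inter> V)) (\<psi> \<circ> inv_into U \<phi>))"


section \<open>Quaternions\<close>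

type_synonym quat = "real^4"

definition quat_one :: quat where "quat_one = vector [1, 0, 0, 0]"
definition quat_i :: quat where "quat_i = vector [0, 1, 0, 0]"
definition quat_j :: quat where "quat_j = vector [0, 0, 1, 0]"

definition quat_mult :: "quat \<Rightarrow> quat \<Rightarrow> quat" (infixl "\<otimes>\<^sub>H" 70) where
  "a \<otimes>\<^sub>H b = vector
     [a$1 * b$1 - a$2 * b$2 - a$3 * b$3 - a$4 * b$4,
      a$1 * b$2 + a$2 * b$1 + a$3 * b$4 - a$4 * b$3,
      a$1 * b$3 - a$2 * b$4 + a$3 * b$1 + a$4 * b$2,
      a$1 * b$4 + a$2 * b$3 - a$3 * b$2 + a$4 * b$1]"

definition quat_inv :: "quat \<Rightarrow> quat" where
  "quat_inv a = (1 / (norm a)\<^sup>2) *\<^sub>R vector [a$1, - a$2, - a$3, - a$4]"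

definition imaginary :: "quat \<Rightarrow> bool" where
  "imaginary a \<longleftrightarrow> a$1 = 0"


section \<open>The nearly Kaehler manifold \<open>S\<^sup>3 \<times> S\<^sup>3\<close>\<close>

definition S3 :: "quat set" where "S3 = sphere 0 1"

definition S3xS3 :: "(quat \<times> quat) set" where "S3xS3 = S3 \<times> S3"

fun tangent_space :: "quat \<times> quat \<Rightarrow> (quat \<times> quat) set" where
  "tangent_space (p, q) = {(p \<otimes>\<^sub>H \<alpha>, q \<otimes>\<^sub>H \<beta>) | \<alpha> \<beta>. imaginary \<alpha> \<and> imaginary \<beta>}"

fun nk_J :: "quat \<times> quat \<Rightarrow> quat \<times> quat \<Rightarrow> quat \<times> quat" where
  "nk_J (p, q) (U, V) = (1 / sqrt 3) *\<^sub>R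
     (2 *\<^sub>R (p \<otimes>\<^sub>H quat_inv q \<otimes>\<^sub>H V) - U, - 2 *\<^sub>R (q \<otimes>\<^sub>H quat_inv p \<otimes>\<^sub>H U) + V)"

fun nk_P :: "quat \<times> quat \<Rightarrow> quat \<times> quat \<Rightarrow> quat \<times> quat" where
  "nk_P (p, q) (U, V) = (p \<otimes>\<^sub>H quat_inv q \<otimes>\<^sub>H V, q \<otimes>\<^sub>H quat_inv p \<otimes>\<^sub>H U)"

definition nk_metric :: "quat \<times> quat \<Rightarrow> quat \<times> quat \<Rightarrow> quat \<times> quat \<Rightarrow> real" where
  "nk_metric x Z Z' = 1/2 * (Z \<bullet> Z' + nk_J x Z \<bullet> nk_J x Z')"

text \<open>Isometries are diffeomorphisms preserving the metric. A derivative within \<open>S3xS3\<close> is determined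
  on tangent vectors only, which is where it is used.\<close>

definition nk_isometry :: "(quat \<times> quat \<Rightarrow> quat \<times> quat) \<Rightarrow> bool" where
  "nk_isometry F \<longleftrightarrow>
     bij_betw F S3xS3 S3xS3 \<and> smooth_on S3xS3 F \<and> smooth_on S3xS3 (inv_into S3xS3 F) \<and>
     (\<forall>x\<in>S3xS3. \<exists>D. (F has_derivative D) (at x within S3xS3) \<and>
        (\<forall>Z\<in>tangent_space x. \<forall>Z'\<in>tangent_space x.
           nk_metric (F x) (D Z) (D Z') = nk_metric x Z Z'))"


section \<open>Lagrangian immersions and their angle functions\<close>

definition immersion ::
  "'m topology \<Rightarrow> ('m, 'e::euclidean_space) chart set \<Rightarrow> ('m \<Rightarrow> quat \<times> quat) \<Rightarrow> bool" where
  "immersion M \<A> f \<longleftrightarrow>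
     f ` topspace M \<subseteq> S3xS3 \<and> smooth_map_on \<A> (topspace M) f \<and>
     (\<forall>c\<in>\<A>. \<forall>x\<in>fst c. inj (chart_diff c f x))"

text \<open>The condition \<open>dim M = 3\<close> is expressed by the type of the charts.\<close>

definition lagrangian_immersion ::
  "'m topology \<Rightarrow> ('m, real^3) chart set \<Rightarrow> ('m \<Rightarrow> quat \<times> quat) \<Rightarrow> bool" where
  "lagrangian_immersion M \<A> f \<longleftrightarrow>
     immersion M \<A> f \<and>
     (\<forall>c\<in>\<A>. \<forall>x\<in>fst c. \<forall>v w.
        nk_metric (f x) (nk_J (f x) (chart_diff c f x v)) (chart_diff c f x w) = 0)"

text \<open>\<open>E 1, E 2, E 3\<close> are the coordinate expressions, in the given chart, of a smooth frame on \<open>W\<close>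
  that is orthonormal for the induced metric and diagonalises the almost product structure with
  angle functions \<open>\<theta> 1, \<theta> 2, \<theta> 3\<close>.\<close>

fun angle_frame_on ::
  "('m, real^3) chart \<Rightarrow> 'm set \<Rightarrow> ('m \<Rightarrow> quat \<times> quat) \<Rightarrow> (3 \<Rightarrow> 'm \<Rightarrow> real^3)
     \<Rightarrow> (3 \<Rightarrow> 'm \<Rightarrow> real) \<Rightarrow> bool" where
  "angle_frame_on (U, \<phi>) W f E \<theta> \<longleftrightarrow>
     W \<subseteq> U \<and> (\<forall>i. smooth_on (\<phi> ` W) (E i \<circ> inv_into U \<phi>)) \<and>
     (\<forall>x\<in>W. let df = chart_diff (U, \<phi>) f x in
        (\<forall>i j. nk_metric (f x) (df (E i x)) (df (E j x)) = (if i = j then 1 else 0)) \<and>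
        (\<forall>i. nk_P (f x) (df (E i x)) =
           cos (2 * \<theta> i x) *\<^sub>R df (E i x) + sin (2 * \<theta> i x) *\<^sub>R nk_J (f x) (df (E i x))))"

text \<open>The frames exist around the points of an open dense set only, but the three constants are the
  same for all of them.\<close>

definition constant_angle_functions ::
  "'m topology \<Rightarrow> ('m, real^3) chart set \<Rightarrow> ('m \<Rightarrow> quat \<times> quat) \<Rightarrow> bool" where
  "constant_angle_functions M \<A> f \<longleftrightarrow>
     (\<exists>(t :: 3 \<Rightarrow> real) D. openin M D \<and> M closure_of D = topspace M \<and>
        (\<forall>x\<in>D. \<exists>c\<in>\<A>. \<exists>W E. openin M W \<and> x \<in> W \<and> angle_frame_on c W f E (\<lambda>i _. t i)))"


section \<open>Local congruence\<close>

text \<open>Local congruence of \<open>f\<close> to \<open>f0 : N \<rightarrow> S3xS3\<close> around the points of \<open>C\<close>, where \<open>N\<close> is an embedded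
  submanifold of a Euclidean space.\<close>

definition locally_congruent_on ::
  "'m topology \<Rightarrow> ('m, 'e::euclidean_space) chart set \<Rightarrow> 'm set \<Rightarrow> ('m \<Rightarrow> quat \<times> quat)
     \<Rightarrow> 'n::euclidean_space set \<Rightarrow> ('n \<Rightarrow> quat \<times> quat) \<Rightarrow> bool" where
  "locally_congruent_on M \<A> C f N f0 \<longleftrightarrow>
     (\<forall>x\<in>C. \<exists>U \<phi> F. openin M U \<and> x \<in> U \<and> diffeo_onto_open M \<A> U N \<phi> \<and> nk_isometry F \<and>
        (\<forall>y\<in>U. f y = F (f0 (\<phi> y))))"


section \<open>The constant mean curvature tori\<close>

definition torus_p :: "real \<Rightarrow> real \<Rightarrow> quat" where
  "torus_p u w = vector [cos u * cos w, cos u * sin w, sin u * cos w, sin u * sin w]"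

definition torus_q :: "real \<Rightarrow> real \<Rightarrow> quat" where
  "torus_q u v = (1 / sqrt 2) *\<^sub>R vector
     [cos v * (sin u + cos u), sin v * (sin u + cos u),
      cos v * (sin u - cos u), sin v * (sin u - cos u)]"

end

theory Submission
  imports Defs
begin

text \<open>Write the immersion in a chart as a pair \<open>(p, q)\<close> of maps into the unit quaternions. If \<open>E\<close>
  is a leg of the orthonormal frame with angle function \<open>t\<close>, the equation
  \<open>P E = cos (2 t) E + sin (2 t) J E\<close> says that \<open>p\<inverse> dp(E)\<close> and \<open>q\<inverse> dq(E)\<close> are the multiples \<open>a e\<close>
  and \<open>b e\<close> of one imaginary quaternion \<open>e\<close>, where \<open>a = cos (t + pi/6)\<close> and \<open>b = cos (t - pi/6)\<close>.
  Orthonormality of the frame together with the Lagrangian condition makes the three quaternions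
  \<open>e1, e2, e3\<close> orthonormal (\<open>angle_frame_pointwise\<close>). Constant angle functions therefore mean
  constant numbers \<open>a1, \<dots>, b3\<close>, and the theorem becomes a question about maps with prescribed
  logarithmic differentials \<open>p\<inverse> dp = (a1 e1, a2 e2, a3 e3)\<close> and \<open>q\<inverse> dq = (b1 e1, b2 e2, b3 e3)\<close>,
  whose unknowns are the tangent frame \<open>E\<close> and the moving frame \<open>e\<close>.

  The frames are given on a dense set only. A suitable combination \<open>\<gamma>\<close> of the two logarithmic
  differentials is invertible everywhere, and the frames are the orthonormal eigenframes of an
  operator \<open>T\<close> on the imaginary quaternions that depends smoothly on the point and has constant
  eigenvalues on the dense set. By compactness eigenframes exist at every point, and spectral
  projections make them smooth (\<open>local_adapted_frame\<close>).

  The Maurer-Cartan equations of \<open>p\<close> and \<open>q\<close> are two systems of equations for the same bracket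
  coefficients of the tangent frame and the same connection coefficients of \<open>e\<close>
  (\<open>structure_equations\<close>). Two legs with non-parallel vectors \<open>(ai, bi)\<close> make them independent,
  which kills most coefficients, and integrability of \<open>e\<close> itself gives a third system. All vectors
  satisfy \<open>a\<^sup>2 + b\<^sup>2 - a b = 3/4\<close>, so parallel ones are equal up to sign. If all three are
  parallel, then \<open>a = 0\<close>, \<open>b = 0\<close> or \<open>a = b\<close>, and one of \<open>p\<close>, \<open>q\<close>, \<open>q p\<inverse>\<close> is constant: these are
  the first three models. If exactly two are parallel, the third leg \<open>e3\<close> satisfies a closed
  equation with three solutions (\<open>double_slope_cases\<close>), and suitable products of \<open>p\<close>, \<open>q\<close> and \<open>e3\<close>
  are constant: these are the next three models. If no two are parallel, the frame \<open>e\<close> rotates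
  along \<open>Ei\<close> about \<open>ei\<close> with a constant speed \<open>wi\<close>, and the frames \<open>e\<close>, \<open>p e p\<inverse>\<close>, \<open>q e q\<inverse>\<close> give
  three diagonal homomorphisms from one three-dimensional Lie algebra to the imaginary
  quaternions. There are so few of these that, up to the order of the legs, \<open>a2 = 0\<close>, \<open>b3 = 0\<close> and
  \<open>b1 = a1\<close>, with two possibilities for \<open>w\<close> (\<open>nonparallel_slopes\<close>, \<open>model_slopes_connection\<close>). For
  the first one \<open>p e2\<close> and \<open>q e3\<close> are constant, so \<open>p\<close> and \<open>q\<close> are up to constant factors two legs
  of the frame, and a lift of the frame to the unit quaternions is the parameter of the seventh
  model (\<open>model_frame_pair\<close>); for the second one \<open>e1\<close> is constant and everything integrates to
  one-parameter groups, which gives the torus (\<open>model_torus\<close>). All congruences are of the form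
  \<open>(p, q) \<mapsto> (a p c, b q c)\<close>.

  The constants are the same for the whole manifold, and they determine the model, except that the
  last two models have the same constants. These two are told apart by whether \<open>p\<close> lies in a
  hyperplane locally, which it does for the sphere and on no open set for the torus
  (\<open>torus_spans\<close>). The set of points of the first kind is therefore open and closed, and the model
  is constant on each connected component.\<close>

section \<open>Calculus of smooth maps\<close>

abbreviation dder :: "('a::euclidean_space \<Rightarrow> 'b::real_normed_vector) \<Rightarrow> 'a \<Rightarrow> 'a \<Rightarrow> 'b" where
  "dder f x v \<equiv> frechet_derivative f (at x) v"

definition Cinf_on :: "'a::euclidean_space set \<Rightarrow> ('a \<Rightarrow> 'b::real_normed_vector) \<Rightarrow> bool" where
  "Cinf_on S f \<longleftrightarrow> (\<forall>k. Ck_on k S f)"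

lemma dder_eqI: "(f has_derivative f') (at x) \<Longrightarrow> dder f x v = f' v"
  using frechet_derivative_at by metis

lemma dder_cong_open:
  assumes "open S" "x \<in> S" "\<And>y. y \<in> S \<Longrightarrow> f y = g y"
  shows "dder f x = dder g x"
proof -
  have "(f has_derivative D) (at x) \<longleftrightarrow> (g has_derivative D) (at x)" for D
    using assms has_derivative_transform_within_open by (metis (no_types, lifting))
  then show ?thesis by (simp add: frechet_derivative_def)
qed

lemma Ck_on_subset: "Ck_on k S f \<Longrightarrow> T \<subseteq> S \<Longrightarrow> Ck_on k T f"
  by (induction k arbitrary: f) (auto intro: continuous_on_subset)

lemma Ck_on_cong:
  assumes "open S" "\<And>x. x \<in> S \<Longrightarrow> f x = g x" "Ck_on k S f"
  shows "Ck_on k S g"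
  using assms(2,3)
proof (induction k arbitrary: f g)
  case 0
  then show ?case using continuous_on_cong by (metis Ck_on.simps(1))
next
  case (Suc k)
  have 1: "g differentiable (at x)" if "x \<in> S" for x
    using Suc.prems that assms(1) differentiable_transform_within
    by (metis (no_types, opaque_lifting) Ck_on.simps(2) has_derivative_transform_within_open differentiable_def)
  have "Ck_on k S (\<lambda>x. dder g x v)" for v
    by (rule Suc.IH[where f="\<lambda>x. dder f x v"])
       (use Suc.prems dder_cong_open[OF assms(1), of _ f g] in auto)
  with 1 show ?case by simp
qed

lemma Ck_on_SucI:
  assumes "open S" "\<And>x. x \<in> S \<Longrightarrow> (f has_derivative f' x) (at x)" "\<And>v. Ck_on k S (\<lambda>x. f' x v)"
  shows "Ck_on (Suc k) S f"
proof -
  have "Ck_on k S (\<lambda>x. dder f x v)" for v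
    by (rule Ck_on_cong[OF assms(1) _ assms(3)[of v]]) (use assms(2) dder_eqI in metis)
  then show ?thesis using assms(2) by (auto simp: differentiable_def)
qed

lemma Ck_on_SucD: "Ck_on (Suc k) S f \<Longrightarrow> Ck_on k S f"
proof (induction k arbitrary: f)
  case 0
  then show ?case by (auto intro!: continuous_at_imp_continuous_on differentiable_imp_continuous_within)
next
  case (Suc k)
  then show ?case by (metis Ck_on.simps(2))
qed

lemma Ck_on_imp_has_derivative:
  "Ck_on (Suc k) S f \<Longrightarrow> x \<in> S \<Longrightarrow> (f has_derivative dder f x) (at x)"
  by (simp add: frechet_derivative_works)

lemma Cinf_on_continuous: "Cinf_on S f \<Longrightarrow> continuous_on S f"
  by (metis Cinf_on_def Ck_on.simps(1))

lemma Cinf_on_derivative: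
  "Cinf_on S f \<Longrightarrow> x \<in> S \<Longrightarrow> (f has_derivative dder f x) (at x)"
  unfolding Cinf_on_def using Ck_on_imp_has_derivative by blast

lemma Cinf_on_dder: "Cinf_on S f \<Longrightarrow> Cinf_on S (\<lambda>x. dder f x v)"
  unfolding Cinf_on_def by (metis Ck_on.simps(2))

lemma Cinf_on_subset: "Cinf_on S f \<Longrightarrow> T \<subseteq> S \<Longrightarrow> Cinf_on T f"
  unfolding Cinf_on_def using Ck_on_subset by blast

lemma Cinf_on_cong:
  "open S \<Longrightarrow> (\<And>x. x \<in> S \<Longrightarrow> f x = g x) \<Longrightarrow> Cinf_on S f \<Longrightarrow> Cinf_on S g"
  unfolding Cinf_on_def using Ck_on_cong by blast

text \<open>Only the derivative has to be checked, because differentiability already gives continuity;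
  this is the form in which explicit functions are shown to be smooth.\<close>

lemma Cinf_on_deriv_I:
  assumes "open S" "\<And>x. x \<in> S \<Longrightarrow> (f has_derivative f' x) (at x)" "\<And>v. Cinf_on S (\<lambda>x. f' x v)"
  shows "Cinf_on S f"
proof -
  have "Ck_on k S f" for k
  proof (cases k)
    case 0
    have "continuous_on S f"
      by (meson assms(2) continuous_at_imp_continuous_on has_derivative_continuous)
    then show ?thesis using 0 by simp
  next
    case (Suc m)
    have "Ck_on (Suc m) S f"
      by (rule Ck_on_SucI[OF assms(1,2)]) (use assms(3) Cinf_on_def in blast)+
    then show ?thesis using Suc by simp
  qed
  then show ?thesis by (simp add: Cinf_on_def)
qed

lemma Ck_on_local:
  assumes "\<And>x. x \<in> S \<Longrightarrow> \<exists>T. open T \<and> x \<in> T \<and> Ck_on k T f"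
  shows "Ck_on k S f"
  using assms
proof (induction k arbitrary: f)
  case 0
  show ?case unfolding Ck_on.simps
  proof (rule continuous_at_imp_continuous_on, rule ballI)
    fix x assume "x \<in> S"
    then obtain T where "open T" "x \<in> T" "continuous_on T f" using 0 by auto
    then show "isCont f x" using continuous_on_eq_continuous_at by blast
  qed
next
  case (Suc k)
  have "Ck_on k S (\<lambda>x. dder f x v)" for v
    by (rule Suc.IH) (use Suc.prems in fastforce)
  then show ?case using Suc.prems by fastforce
qed

lemma Cinf_on_local:
  assumes "\<And>x. x \<in> S \<Longrightarrow> \<exists>T. open T \<and> x \<in> T \<and> Cinf_on T f"
  shows "Cinf_on S f"
  unfolding Cinf_on_def
proof
  fix k show "Ck_on k S f"
    by (rule Ck_on_local) (use assms in \<open>auto simp: Cinf_on_def\<close>)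
qed

lemma Ck_on_const: "Ck_on k S (\<lambda>x. c)"
  by (induction k arbitrary: c) (auto simp: frechet_derivative_const)

lemma Cinf_on_const [intro]: "Cinf_on S (\<lambda>x. c)"
  by (simp add: Cinf_on_def Ck_on_const)

lemma Ck_on_add:
  assumes "open S" "Ck_on k S f" "Ck_on k S g"
  shows "Ck_on k S (\<lambda>x. f x + g x)"
  using assms(2,3)
proof (induction k arbitrary: f g)
  case 0
  then show ?case by (auto intro: continuous_on_add)
next
  case (Suc k)
  show ?case
    by (rule Ck_on_SucI[OF assms(1), where f'="\<lambda>x v. dder f x v + dder g x v"])
      (use Suc in \<open>auto intro!: has_derivative_add simp: frechet_derivative_works[symmetric]\<close>)
qed

lemma Ck_on_bilinear:
  assumes "bounded_bilinear h" "open S" "Ck_on k S f" "Ck_on k S g"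
  shows "Ck_on k S (\<lambda>x. h (f x) (g x))"
  using assms(3,4)
proof (induction k arbitrary: f g)
  case 0
  then show ?case using bounded_bilinear.continuous_on[OF assms(1)] by auto
next
  case (Suc k)
  show ?case
  proof (rule Ck_on_SucI[OF assms(2), where f'="\<lambda>x v. h (f x) (dder g x v) + h (dder f x v) (g x)"])
    fix x assume "x \<in> S"
    then show "((\<lambda>x. h (f x) (g x)) has_derivative (\<lambda>v. h (f x) (dder g x v) + h (dder f x v) (g x))) (at x)"
      by (intro bounded_bilinear.FDERIV[OF assms(1)])
        (use Ck_on_imp_has_derivative Suc.prems in blast)+
  next
    fix v
    show "Ck_on k S (\<lambda>x. h (f x) (dder g x v) + h (dder f x v) (g x))"
      by (intro Ck_on_add assms Suc.IH) (use Suc.prems Ck_on_SucD in auto)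
  qed
qed

lemma Cinf_on_add: "open S \<Longrightarrow> Cinf_on S f \<Longrightarrow> Cinf_on S g \<Longrightarrow> Cinf_on S (\<lambda>x. f x + g x)"
  unfolding Cinf_on_def using Ck_on_add by blast

lemma Cinf_on_bilinear:
  "bounded_bilinear h \<Longrightarrow> open S \<Longrightarrow> Cinf_on S f \<Longrightarrow> Cinf_on S g \<Longrightarrow> Cinf_on S (\<lambda>x. h (f x) (g x))"
  unfolding Cinf_on_def using Ck_on_bilinear by blast

lemma Cinf_on_linear:
  assumes "bounded_linear L" "open S" "Cinf_on S f"
  shows "Cinf_on S (\<lambda>x. L (f x))"
proof -
  have "bounded_bilinear (\<lambda>(c::real) x. c *\<^sub>R L x)"
    by (rule bounded_bilinear.comp[OF bounded_bilinear_scaleR bounded_linear_ident assms(1)])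
  from Cinf_on_bilinear[OF this assms(2) Cinf_on_const[of S 1] assms(3)] show ?thesis by simp
qed

lemma Cinf_on_ident [intro]: "open S \<Longrightarrow> Cinf_on S (\<lambda>x. x)"
  by (rule Cinf_on_deriv_I[where f'="\<lambda>x v. v"]) auto

lemma Cinf_on_sum:
  assumes "open S" "finite I" "\<And>i. i \<in> I \<Longrightarrow> Cinf_on S (f i)"
  shows "Cinf_on S (\<lambda>x. \<Sum>i\<in>I. f i x)"
  using assms(2,3) by (induction I rule: finite_induct) (auto intro: Cinf_on_add[OF assms(1)])

lemma Ck_on_sum:
  assumes "open S" "finite I" "\<And>i. i \<in> I \<Longrightarrow> Ck_on k S (f i)"
  shows "Ck_on k S (\<lambda>x. \<Sum>i\<in>I. f i x)"
  using assms(2,3) by (induction I rule: finite_induct) (auto intro: Ck_on_add[OF assms(1)] Ck_on_const)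

lemmas Cinf_on_scaleR = Cinf_on_bilinear[OF bounded_bilinear_scaleR]
lemmas Cinf_on_inner = Cinf_on_bilinear[OF bounded_bilinear_inner]
lemmas Cinf_on_mult = Cinf_on_bilinear[OF bounded_bilinear_mult]
lemmas Cinf_on_minus = Cinf_on_linear[OF bounded_linear_minus[OF bounded_linear_ident]]

lemma Cinf_on_diff: "open S \<Longrightarrow> Cinf_on S f \<Longrightarrow> Cinf_on S g \<Longrightarrow> Cinf_on S (\<lambda>x. f x - g x)"
  using Cinf_on_add[of S f "\<lambda>x. - g x"] Cinf_on_minus[of S g] by simp

lemma linear_derivative_expand:
  fixes f :: "'a::euclidean_space \<Rightarrow> 'b::real_normed_vector"
  assumes "(f has_derivative f') F"
  shows "f' w = (\<Sum>b\<in>Basis. (w \<bullet> b) *\<^sub>R f' b)"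
proof -
  have "linear f'" using assms has_derivative_linear by blast
  have "f' w = f' (\<Sum>b\<in>Basis. (w \<bullet> b) *\<^sub>R b)" by (simp add: euclidean_representation)
  also have "\<dots> = (\<Sum>b\<in>Basis. (w \<bullet> b) *\<^sub>R f' b)"
    using \<open>linear f'\<close> by (simp add: linear_sum linear_scale)
  finally show ?thesis .
qed

lemma Ck_on_compose:
  fixes f :: "'a::euclidean_space \<Rightarrow> 'b::euclidean_space" and g :: "'b \<Rightarrow> 'c::real_normed_vector"
  assumes "open S" "open T" "f ` S \<subseteq> T" "Ck_on k S f" "Ck_on k T g"
  shows "Ck_on k S (\<lambda>x. g (f x))"
  using assms(4,5)
proof (induction k arbitrary: g)
  case 0
  then show ?case using assms(3) continuous_on_compose2 by (metis Ck_on.simps(1))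
next
  case (Suc k)
  show ?case
  proof (rule Ck_on_SucI[OF assms(1), where f'="\<lambda>x v. \<Sum>b\<in>Basis. (dder f x v \<bullet> b) *\<^sub>R dder g (f x) b"])
    fix x assume "x \<in> S"
    then have f: "(f has_derivative dder f x) (at x)"
      using Ck_on_imp_has_derivative Suc.prems by blast
    have g: "(g has_derivative dder g (f x)) (at (f x))"
      using Ck_on_imp_has_derivative Suc.prems \<open>x \<in> S\<close> assms(3) by blast
    show "((\<lambda>x. g (f x)) has_derivative (\<lambda>v. \<Sum>b\<in>Basis. (dder f x v \<bullet> b) *\<^sub>R dder g (f x) b)) (at x)"
      using has_derivative_compose[OF f g] by (simp add: linear_derivative_expand[OF g, symmetric])
  next
    fix v
    show "Ck_on k S (\<lambda>x. \<Sum>b\<in>Basis. (dder f x v \<bullet> b) *\<^sub>R dder g (f x) b)"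
      by (intro Ck_on_sum assms Ck_on_bilinear[OF bounded_bilinear_scaleR] Suc.IH
           Ck_on_bilinear[OF bounded_bilinear_inner] Ck_on_const)
        (use Suc.prems Ck_on_SucD in auto)
  qed
qed

lemma Cinf_on_compose:
  fixes f :: "'a::euclidean_space \<Rightarrow> 'b::euclidean_space" and g :: "'b \<Rightarrow> 'c::real_normed_vector"
  assumes "open S" "open T" "f ` S \<subseteq> T" "Cinf_on S f" "Cinf_on T g"
  shows "Cinf_on S (\<lambda>x. g (f x))"
  using assms Ck_on_compose unfolding Cinf_on_def by blast

text \<open>The derivative along a field is a combination of the partial derivatives with smooth
  coefficients.\<close>

lemma Cinf_on_dder_field:
  fixes f :: "'a::euclidean_space \<Rightarrow> 'b::real_normed_vector"
  assumes "open S" "Cinf_on S f" "Cinf_on S X"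
  shows "Cinf_on S (\<lambda>x. dder f x (X x))"
proof (rule Cinf_on_cong[OF assms(1)])
  show "Cinf_on S (\<lambda>x. \<Sum>b\<in>Basis. (X x \<bullet> b) *\<^sub>R dder f x b)"
    by (intro Cinf_on_sum Cinf_on_scaleR Cinf_on_inner assms Cinf_on_dder) auto
  show "(\<Sum>b\<in>Basis. (X x \<bullet> b) *\<^sub>R dder f x b) = dder f x (X x)" if "x \<in> S" for x
    using linear_derivative_expand[OF Cinf_on_derivative[OF assms(2) that]] by metis
qed

text \<open>All powers are treated at once because the derivative of one power is a multiple of another;
  inverses and normalization to length one follow from the exponents \<open>-1\<close> and \<open>-1/2\<close>.\<close>

lemma Cinf_on_powr_real:
  "Cinf_on {0<..} (\<lambda>x::real. x powr s)"
proof -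
  have "Ck_on k {0<..} (\<lambda>x::real. x powr s)" for k
  proof (induction k arbitrary: s)
    case 0
    then show ?case by (auto intro!: continuous_intros)
  next
    case (Suc k)
    show ?case
    proof (rule Ck_on_SucI[where f'="\<lambda>x v. v *\<^sub>R (s *\<^sub>R x powr (s - 1))"])
      fix x :: real assume "x \<in> {0<..}"
      then have "((\<lambda>x. x powr s) has_derivative (*) (s * x powr (s - 1))) (at x)"
        using has_real_derivative_powr[of x s] by (simp add: has_field_derivative_def)
      also have "(*) (s * x powr (s - 1)) = (\<lambda>v. v *\<^sub>R s *\<^sub>R x powr (s - 1))"
        by (simp add: fun_eq_iff)
      finally show "((\<lambda>x. x powr s) has_derivative (\<lambda>v. v *\<^sub>R s *\<^sub>R x powr (s - 1))) (at x)" .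
    next
      fix v :: real
      show "Ck_on k {0<..} (\<lambda>x. v *\<^sub>R (s *\<^sub>R x powr (s - 1)))"
        by (intro Ck_on_bilinear[OF bounded_bilinear_scaleR] Ck_on_const Suc) auto
    qed auto
  qed
  then show ?thesis by (simp add: Cinf_on_def)
qed

lemma Cinf_on_powr:
  fixes f :: "'a::euclidean_space \<Rightarrow> real"
  assumes "open S" "Cinf_on S f" "\<And>x. x \<in> S \<Longrightarrow> f x > 0"
  shows "Cinf_on S (\<lambda>x. f x powr s)"
  by (rule Cinf_on_compose[OF assms(1) _ _ assms(2) Cinf_on_powr_real]) (use assms(3) in auto)

lemma Cinf_on_inverse:
  fixes f :: "'a::euclidean_space \<Rightarrow> real"
  assumes "open S" "Cinf_on S f" "\<And>x. x \<in> S \<Longrightarrow> f x \<noteq> 0"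
  shows "Cinf_on S (\<lambda>x. inverse (f x))"
proof (rule Cinf_on_cong[OF assms(1)])
  show "Cinf_on S (\<lambda>x. f x * (f x * f x) powr (-1))"
    by (intro Cinf_on_mult Cinf_on_powr assms) (use assms(3) in \<open>metis not_real_square_gt_zero\<close>)
  show "f x * (f x * f x) powr (-1) = inverse (f x)" if "x \<in> S" for x
    using assms(3)[OF that] by (simp add: powr_minus powr_one' field_simps)
qed

lemma Cinf_on_normalize:
  fixes f :: "'a::euclidean_space \<Rightarrow> 'b::euclidean_space"
  assumes "open S" "Cinf_on S f" "\<And>x. x \<in> S \<Longrightarrow> f x \<noteq> 0"
  shows "Cinf_on S (\<lambda>x. (1 / norm (f x)) *\<^sub>R f x)"
proof (rule Cinf_on_cong[OF assms(1)])
  show "Cinf_on S (\<lambda>x. (f x \<bullet> f x) powr (-1/2) *\<^sub>R f x)"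
    by (intro Cinf_on_scaleR Cinf_on_powr Cinf_on_inner assms) (use assms(3) in auto)
  show "(f x \<bullet> f x) powr (-1/2) *\<^sub>R f x = (1 / norm (f x)) *\<^sub>R f x" if "x \<in> S" for x
  proof -
    have "(f x \<bullet> f x) powr (-1/2) = 1 / (f x \<bullet> f x) powr (1/2)"
      using powr_minus_divide[of "f x \<bullet> f x" "1/2"] by simp
    also have "\<dots> = 1 / norm (f x)"
      by (subst powr_half_sqrt) (auto simp: norm_eq_sqrt_inner[of "f x"])
    finally show ?thesis by simp
  qed
qed

lemmas Cinf_intros = Cinf_on_const Cinf_on_ident Cinf_on_add Cinf_on_diff Cinf_on_minus
  Cinf_on_scaleR Cinf_on_inner Cinf_on_mult Cinf_on_dder Cinf_on_dder_field

text \<open>Near a point of an open set every local extension coincides with the map itself.\<close>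

lemma smooth_on_open_iff:
  assumes "open S"
  shows "smooth_on S f \<longleftrightarrow> Cinf_on S f"
proof
  assume s: "smooth_on S f"
  show "Cinf_on S f"
  proof (rule Cinf_on_local)
    fix x assume "x \<in> S"
    then obtain W g where W: "open W" "x \<in> W" "\<forall>k. Ck_on k W g" "\<forall>x\<in>W \<inter> S. g x = f x"
      using s unfolding smooth_on_def by meson
    then have "Cinf_on (W \<inter> S) g" using Cinf_on_subset[of W g] by (auto simp: Cinf_on_def)
    then have "Cinf_on (W \<inter> S) f"
      using Cinf_on_cong[of "W \<inter> S" g f] W assms by auto
    then show "\<exists>T. open T \<and> x \<in> T \<and> Cinf_on T f"
      using W assms \<open>x \<in> S\<close> by (intro exI[of _ "W \<inter> S"]) auto
  qed
next
  assume "Cinf_on S f"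
  then show "smooth_on S f" unfolding smooth_on_def Cinf_on_def using assms by blast
qed

subsection \<open>Symmetry of second derivatives and Lie brackets\<close>

lemma has_derivative_along_line:
  assumes "(f has_derivative f') (at (x + s *\<^sub>R u))"
  shows "((\<lambda>s. f (x + s *\<^sub>R u)) has_derivative (\<lambda>h. h *\<^sub>R f' u)) (at s)"
proof -
  have "((\<lambda>s. x + s *\<^sub>R u) has_derivative (\<lambda>h. h *\<^sub>R u)) (at s)"
    by (auto intro!: derivative_eq_intros)
  from has_derivative_compose[OF this assms] show ?thesis
    using has_derivative_linear[OF assms] by (simp add: linear_scale)
qed

text \<open>The mean value theorem, used first in the direction \<open>u\<close> and then in the direction \<open>v\<close>, turns
  the second difference into a mixed derivative. The difference is symmetric in \<open>u\<close> and \<open>v\<close>, so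
  letting \<open>h\<close> tend to zero exchanges the order of differentiation.\<close>

lemma second_difference_mvt:
  fixes g :: "'a::euclidean_space \<Rightarrow> real"
  assumes "0 < h" "\<And>s t. 0 \<le> s \<Longrightarrow> s \<le> h \<Longrightarrow> 0 \<le> t \<Longrightarrow> t \<le> h \<Longrightarrow> x + s *\<^sub>R u + t *\<^sub>R v \<in> S"
    and g: "Cinf_on S g"
  shows "\<exists>s t. 0 < s \<and> s < h \<and> 0 < t \<and> t < h \<and>
    g (x + h *\<^sub>R u + h *\<^sub>R v) - g (x + h *\<^sub>R u) - g (x + h *\<^sub>R v) + g x
      = h * h * dder (\<lambda>y. dder g y u) (x + s *\<^sub>R u + t *\<^sub>R v) v"
proof -
  let ?p = "\<lambda>s. g ((x + h *\<^sub>R v) + s *\<^sub>R u) - g (x + s *\<^sub>R u)"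
  let ?p' = "\<lambda>s d. d *\<^sub>R dder g ((x + h *\<^sub>R v) + s *\<^sub>R u) u - d *\<^sub>R dder g (x + s *\<^sub>R u) u"
  have mem: "x + h *\<^sub>R v + s *\<^sub>R u \<in> S" "x + s *\<^sub>R u \<in> S" if "0 \<le> s" "s \<le> h" for s
    using assms(2)[of s h] assms(2)[of s 0] that \<open>0 < h\<close> by (auto simp: algebra_simps)
  have p': "(?p has_derivative ?p' s) (at s)" if "0 \<le> s" "s \<le> h" for s
    using has_derivative_diff[OF has_derivative_along_line[OF Cinf_on_derivative[OF g mem(1)[OF that]]]
        has_derivative_along_line[OF Cinf_on_derivative[OF g mem(2)[OF that]]]] .
  have "\<exists>s\<in>{0<..<h}. ?p h - ?p 0 = ?p' s (h - 0)"
    by (rule mvt_simple[OF \<open>0 < h\<close>]) (rule has_derivative_at_withinI, rule p', auto)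
  then obtain s where s: "0 < s" "s < h" "?p h - ?p 0 = ?p' s h" by auto
  let ?q = "\<lambda>t. dder g ((x + s *\<^sub>R u) + t *\<^sub>R v) u"
  let ?q' = "\<lambda>t d. d *\<^sub>R dder (\<lambda>y. dder g y u) ((x + s *\<^sub>R u) + t *\<^sub>R v) v"
  have q': "(?q has_derivative ?q' t) (at t)" if "0 \<le> t" "t \<le> h" for t
    using has_derivative_along_line[OF Cinf_on_derivative[OF Cinf_on_dder[OF g, of u]
        assms(2)[OF less_imp_le[OF s(1)] less_imp_le[OF s(2)] that]]] .
  have "\<exists>t\<in>{0<..<h}. ?q h - ?q 0 = ?q' t (h - 0)"
    by (rule mvt_simple[OF \<open>0 < h\<close>]) (rule has_derivative_at_withinI, rule q', auto)
  then obtain t where t: "0 < t" "t < h" "?q h - ?q 0 = ?q' t h" by auto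
  have "?p h - ?p 0 = h * (?q h - ?q 0)"
    using s(3) by (simp add: algebra_simps)
  also have "\<dots> = h * h * dder (\<lambda>y. dder g y u) (x + s *\<^sub>R u + t *\<^sub>R v) v"
    using t(3) by simp
  finally have "?p h - ?p 0 = h * h * dder (\<lambda>y. dder g y u) (x + s *\<^sub>R u + t *\<^sub>R v) v" .
  moreover have "?p h - ?p 0 = g (x + h *\<^sub>R u + h *\<^sub>R v) - g (x + h *\<^sub>R u) - g (x + h *\<^sub>R v) + g x"
    by (simp add: algebra_simps)
  ultimately show ?thesis using s t by metis
qed

lemma symmetric_second_derivative_real:
  fixes g :: "'a::euclidean_space \<Rightarrow> real"
  assumes "open S" "x \<in> S" "Cinf_on S g"
  shows "dder (\<lambda>y. dder g y u) x v = dder (\<lambda>y. dder g y v) x u"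
proof (rule ccontr)
  let ?A = "\<lambda>z. dder (\<lambda>y. dder g y u) z v" and ?B = "\<lambda>z. dder (\<lambda>y. dder g y v) z u"
  assume ne: "?A x \<noteq> ?B x"
  define \<epsilon> where "\<epsilon> = \<bar>?A x - ?B x\<bar> / 2"
  have "\<epsilon> > 0" using ne by (simp add: \<epsilon>_def)
  have "isCont ?A x" "isCont ?B x"
    using Cinf_on_continuous[OF Cinf_on_dder[OF Cinf_on_dder[OF assms(3)]]] assms
    by (auto simp: continuous_on_eq_continuous_at)
  then obtain d1 d2 where d: "d1 > 0" "\<And>z. dist z x < d1 \<Longrightarrow> dist (?A z) (?A x) < \<epsilon>"
      "d2 > 0" "\<And>z. dist z x < d2 \<Longrightarrow> dist (?B z) (?B x) < \<epsilon>"
    using \<open>\<epsilon> > 0\<close> unfolding continuous_at_eps_delta by metis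
  obtain d3 where d3: "d3 > 0" "ball x d3 \<subseteq> S" using assms openE by blast
  define d where "d = min d1 (min d2 d3)"
  define h where "h = d / (2 * (norm u + norm v + 1))"
  have "d > 0" using d d3 by (simp add: d_def)
  have pos: "norm u + norm v + 1 > 0" by (smt (verit) norm_ge_zero)
  have "h > 0" using \<open>d > 0\<close> pos by (simp add: h_def)
  have close: "dist (x + s *\<^sub>R u + t *\<^sub>R v) x < d" if "0 \<le> s" "s \<le> h" "0 \<le> t" "t \<le> h" for s t
  proof -
    have "dist (x + s *\<^sub>R u + t *\<^sub>R v) x \<le> norm (s *\<^sub>R u) + norm (t *\<^sub>R v)"
      using norm_triangle_ineq[of "s *\<^sub>R u" "t *\<^sub>R v"] by (simp add: dist_norm add.assoc)
    also have "\<dots> \<le> h * norm u + h * norm v" using that by (simp add: add_mono mult_right_mono)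
    also have "\<dots> < 2 * h * (norm u + norm v + 1)" using \<open>h > 0\<close> by (simp add: algebra_simps add_pos_nonneg add_nonneg_pos)
    also have "\<dots> = d" using pos by (simp add: h_def field_simps)
    finally show ?thesis .
  qed
  have inS: "x + s *\<^sub>R u + t *\<^sub>R v \<in> S" "x + s *\<^sub>R v + t *\<^sub>R u \<in> S"
    if "0 \<le> s" "s \<le> h" "0 \<le> t" "t \<le> h" for s t
    using close[of s t] close[of t s] that d3 by (auto simp: d_def dist_commute subset_iff algebra_simps)
  obtain s t where st: "0 < s" "s < h" "0 < t" "t < h"
    "g (x + h *\<^sub>R u + h *\<^sub>R v) - g (x + h *\<^sub>R u) - g (x + h *\<^sub>R v) + g x = h * h * ?A (x + s *\<^sub>R u + t *\<^sub>R v)"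
    using second_difference_mvt[OF \<open>h > 0\<close> inS(1) assms(3)] by blast
  obtain s' t' where st': "0 < s'" "s' < h" "0 < t'" "t' < h"
    "g (x + h *\<^sub>R v + h *\<^sub>R u) - g (x + h *\<^sub>R v) - g (x + h *\<^sub>R u) + g x = h * h * ?B (x + s' *\<^sub>R v + t' *\<^sub>R u)"
    using second_difference_mvt[OF \<open>h > 0\<close> inS(2) assms(3)] by blast
  have "h * h * ?A (x + s *\<^sub>R u + t *\<^sub>R v) = h * h * ?B (x + s' *\<^sub>R v + t' *\<^sub>R u)"
    using st(5) st'(5) by (simp add: algebra_simps)
  then have eq: "?A (x + s *\<^sub>R u + t *\<^sub>R v) = ?B (x + s' *\<^sub>R v + t' *\<^sub>R u)" using \<open>h > 0\<close> by simp
  have "dist (?A (x + s *\<^sub>R u + t *\<^sub>R v)) (?A x) < \<epsilon>"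
    by (rule d(2)) (use close[of s t] st in \<open>auto simp: d_def\<close>)
  moreover have "dist (?B (x + s' *\<^sub>R v + t' *\<^sub>R u)) (?B x) < \<epsilon>"
    by (rule d(4)) (use close[of t' s'] st' in \<open>auto simp: d_def algebra_simps\<close>)
  ultimately show False using eq unfolding \<epsilon>_def dist_real_def by (smt (verit) field_sum_of_halves)
qed

lemma dder_inner_const:
  assumes "(f has_derivative f') (at x)"
  shows "dder (\<lambda>y. f y \<bullet> c) x v = f' v \<bullet> c"
  by (rule dder_eqI) (rule has_derivative_inner_left[OF assms])

lemma symmetric_second_derivative:
  fixes g :: "'a::euclidean_space \<Rightarrow> 'b::euclidean_space"
  assumes S: "open S" "x \<in> S" and g: "Cinf_on S g"
  shows "dder (\<lambda>y. dder g y u) x v = dder (\<lambda>y. dder g y v) x u"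
proof (rule euclidean_eqI)
  fix b :: 'b
  have 1: "dder (\<lambda>y. dder (\<lambda>y. g y \<bullet> b) y u) x v = dder (\<lambda>y. dder g y u) x v \<bullet> b" for u v
  proof -
    have "dder (\<lambda>y. dder (\<lambda>y. g y \<bullet> b) y u) x v = dder (\<lambda>y. dder g y u \<bullet> b) x v"
      by (subst dder_cong_open[OF S, where g="\<lambda>y. dder g y u \<bullet> b"])
        (simp_all add: dder_inner_const[OF Cinf_on_derivative[OF g]])
    then show ?thesis
      using dder_inner_const[OF Cinf_on_derivative[OF Cinf_on_dder[OF g] S(2)]] by metis
  qed
  have "Cinf_on S (\<lambda>y. g y \<bullet> b)" by (intro Cinf_intros assms)
  from symmetric_second_derivative_real[OF S this]
  show "dder (\<lambda>y. dder g y u) x v \<bullet> b = dder (\<lambda>y. dder g y v) x u \<bullet> b"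
    by (simp add: 1)
qed

lemma dder_bilinear:
  assumes "bounded_bilinear h" "(f has_derivative dder f x) (at x)" "(g has_derivative dder g x) (at x)"
  shows "dder (\<lambda>y. h (f y) (g y)) x v = h (f x) (dder g x v) + h (dder f x v) (g x)"
  by (rule dder_eqI) (rule bounded_bilinear.FDERIV[OF assms])

text \<open>The second derivative of \<open>g\<close> and the derivative of the field \<open>X\<close> contribute separately. The
  first summand is symmetric in \<open>X x\<close> and \<open>v\<close>, so only the second one survives in a commutator.\<close>

lemma dder_dder_field:
  fixes g :: "'a::euclidean_space \<Rightarrow> 'b::euclidean_space"
  assumes S: "open S" "x \<in> S" and g: "Cinf_on S g" and X: "Cinf_on S X"
  shows "dder (\<lambda>y. dder g y (X y)) x v = dder (\<lambda>y. dder g y (X x)) x v + dder g x (dder X x v)"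
proof -
  have "dder (\<lambda>y. dder g y (X y)) x v = dder (\<lambda>y. \<Sum>b\<in>Basis. (X y \<bullet> b) *\<^sub>R dder g y b) x v"
    by (rule fun_cong[OF dder_cong_open[OF S]])
      (rule linear_derivative_expand[OF Cinf_on_derivative[OF g]], assumption)
  also have "\<dots> = (\<Sum>b\<in>Basis. (X x \<bullet> b) *\<^sub>R dder (\<lambda>y. dder g y b) x v + (dder X x v \<bullet> b) *\<^sub>R dder g x b)"
    by (rule dder_eqI, rule has_derivative_sum, rule bounded_bilinear.FDERIV[OF bounded_bilinear_scaleR])
      (rule has_derivative_inner_left, rule Cinf_on_derivative[OF X S(2)],
        rule Cinf_on_derivative[OF Cinf_on_dder[OF g] S(2)])
  also have "\<dots> = (\<Sum>b\<in>Basis. (X x \<bullet> b) *\<^sub>R dder (\<lambda>y. dder g y b) x v) + dder g x (dder X x v)"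
    using linear_derivative_expand[OF Cinf_on_derivative[OF g S(2)], of "dder X x v"]
    by (simp add: sum.distrib)
  also have "(\<Sum>b\<in>Basis. (X x \<bullet> b) *\<^sub>R dder (\<lambda>y. dder g y b) x v) = (\<Sum>b\<in>Basis. (X x \<bullet> b) *\<^sub>R dder (\<lambda>y. dder g y v) x b)"
    by (intro sum.cong refl arg_cong[where f="\<lambda>z. _ *\<^sub>R z"] symmetric_second_derivative[OF S g])
  also have "\<dots> = dder (\<lambda>y. dder g y v) x (X x)"
    by (rule linear_derivative_expand[OF Cinf_on_derivative[OF Cinf_on_dder[OF g] S(2)], symmetric])
  also have "\<dots> = dder (\<lambda>y. dder g y (X x)) x v"
    by (rule symmetric_second_derivative[OF S g])
  finally show ?thesis .
qed

text \<open>The Lie bracket of two fields acts on functions as the commutator of the derivations. This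
  is the integrability condition from which all structure equations below are derived.\<close>

lemma dder_commutator:
  fixes g :: "'a::euclidean_space \<Rightarrow> 'b::euclidean_space"
  assumes S: "open S" "x \<in> S" and g: "Cinf_on S g" and X: "Cinf_on S X" and Y: "Cinf_on S Y"
  shows "dder (\<lambda>y. dder g y (Y y)) x (X x) - dder (\<lambda>y. dder g y (X y)) x (Y x)
       = dder g x (dder Y x (X x) - dder X x (Y x))"
proof -
  have "dder g x (dder Y x (X x) - dder X x (Y x)) = dder g x (dder Y x (X x)) - dder g x (dder X x (Y x))"
    by (rule linear_diff[OF has_derivative_linear[OF Cinf_on_derivative[OF g S(2)]]])
  moreover have "dder (\<lambda>y. dder g y (X x)) x (Y x) = dder (\<lambda>y. dder g y (Y x)) x (X x)"
    by (rule symmetric_second_derivative[OF S g])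
  ultimately show ?thesis
    unfolding dder_dder_field[OF S g X, of "Y x"] dder_dder_field[OF S g Y, of "X x"] by simp
qed

section \<open>Quaternion algebra\<close>

lemma vector4_nth [simp]:
  "(vector [a, b, c, d] :: real^4) $ 1 = a" "(vector [a, b, c, d] :: real^4) $ 2 = b"
  "(vector [a, b, c, d] :: real^4) $ 3 = c" "(vector [a, b, c, d] :: real^4) $ 4 = d"
  by (simp_all add: vector_def)

lemma quat_eq_iff: "(x::quat) = y \<longleftrightarrow> x$1 = y$1 \<and> x$2 = y$2 \<and> x$3 = y$3 \<and> x$4 = y$4"
  by (simp add: vec_eq_iff forall_4)

lemma inner_quat: "(x::quat) \<bullet> y = x$1 * y$1 + x$2 * y$2 + x$3 * y$3 + x$4 * y$4"
  by (simp add: inner_vec_def sum_4)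

definition quat_cnj :: "quat \<Rightarrow> quat" where
  "quat_cnj a = vector [a$1, - a$2, - a$3, - a$4]"

definition quat_k :: quat where "quat_k = vector [0, 0, 0, 1]"

lemmas quat_comp = quat_eq_iff quat_mult_def quat_cnj_def quat_one_def quat_i_def quat_j_def quat_k_def
  imaginary_def inner_quat

lemma quat_mult_assoc: "a \<otimes>\<^sub>H b \<otimes>\<^sub>H c = a \<otimes>\<^sub>H (b \<otimes>\<^sub>H c)"
  by (simp add: quat_comp algebra_simps)

lemma bounded_bilinear_quat_mult: "bounded_bilinear quat_mult"
proof -
  have "bilinear quat_mult"
    unfolding bilinear_def
    by (intro conjI allI linearI) (simp_all add: quat_comp algebra_simps)
  then show ?thesis using bilinear_conv_bounded_bilinear by blast
qed

interpretation qm: bounded_bilinear quat_mult by (rule bounded_bilinear_quat_mult)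

lemmas qm_simps = qm.add_left qm.add_right qm.diff_left qm.diff_right qm.minus_left qm.minus_right
  qm.scaleR_left qm.scaleR_right qm.zero_left qm.zero_right

lemma quat_one_left [simp]: "quat_one \<otimes>\<^sub>H a = a" and quat_one_right [simp]: "a \<otimes>\<^sub>H quat_one = a"
  by (simp_all add: quat_comp)

lemma quat_cnj_mult: "quat_cnj (a \<otimes>\<^sub>H b) = quat_cnj b \<otimes>\<^sub>H quat_cnj a"
  by (simp add: quat_comp algebra_simps)

lemma quat_cnj_cnj [simp]: "quat_cnj (quat_cnj a) = a"
  by (simp add: quat_comp)

lemma bounded_linear_quat_cnj: "bounded_linear quat_cnj"
  by (intro linear_conv_bounded_linear[THEN iffD1] linearI) (simp_all add: quat_comp)

lemma quat_mult_cnj: "a \<otimes>\<^sub>H quat_cnj a = (a \<bullet> a) *\<^sub>R quat_one"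
  and quat_cnj_mult_self: "quat_cnj a \<otimes>\<^sub>H a = (a \<bullet> a) *\<^sub>R quat_one"
  by (simp_all add: quat_comp algebra_simps)

lemma inner_quat_mult_left: "(a \<otimes>\<^sub>H b) \<bullet> (a \<otimes>\<^sub>H c) = (a \<bullet> a) * (b \<bullet> c)"
  and inner_quat_mult_right: "(b \<otimes>\<^sub>H a) \<bullet> (c \<otimes>\<^sub>H a) = (a \<bullet> a) * (b \<bullet> c)"
  by (simp_all add: quat_comp algebra_simps)

lemma norm_quat_mult: "norm (a \<otimes>\<^sub>H b) = norm a * norm b"
  by (simp add: norm_eq_sqrt_inner inner_quat_mult_left real_sqrt_mult)

lemma norm_quat_cnj [simp]: "norm (quat_cnj a) = norm a"
  by (simp add: norm_eq_sqrt_inner inner_quat quat_cnj_def)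

lemma S3_iff: "a \<in> S3 \<longleftrightarrow> a \<bullet> a = 1"
  by (simp add: S3_def norm_eq_1)

lemma S3_norm: "a \<in> S3 \<longleftrightarrow> norm a = 1"
  by (simp add: S3_def)

lemma quat_inv_S3: "a \<in> S3 \<Longrightarrow> quat_inv a = quat_cnj a"
  by (simp add: quat_inv_def quat_cnj_def S3_norm)

lemma S3_mult: "a \<in> S3 \<Longrightarrow> b \<in> S3 \<Longrightarrow> a \<otimes>\<^sub>H b \<in> S3"
  by (simp add: S3_norm norm_quat_mult)

lemma S3_cnj: "a \<in> S3 \<Longrightarrow> quat_cnj a \<in> S3"
  by (simp add: S3_norm)

lemma S3_one: "quat_one \<in> S3" and S3_j: "quat_j \<in> S3"
  by (simp_all add: S3_iff quat_comp)

lemma S3_minus: "a \<in> S3 \<Longrightarrow> - a \<in> S3"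
  by (simp add: S3_norm)

lemma S3_cancel [simp]:
  assumes "a \<in> S3"
  shows "a \<otimes>\<^sub>H quat_cnj a = quat_one" "quat_cnj a \<otimes>\<^sub>H a = quat_one"
    "a \<otimes>\<^sub>H (quat_cnj a \<otimes>\<^sub>H b) = b" "quat_cnj a \<otimes>\<^sub>H (a \<otimes>\<^sub>H b) = b"
proof -
  show 1: "a \<otimes>\<^sub>H quat_cnj a = quat_one" "quat_cnj a \<otimes>\<^sub>H a = quat_one"
    using assms by (simp_all add: quat_mult_cnj quat_cnj_mult_self S3_iff)
  show "a \<otimes>\<^sub>H (quat_cnj a \<otimes>\<^sub>H b) = b" "quat_cnj a \<otimes>\<^sub>H (a \<otimes>\<^sub>H b) = b"
    by (simp_all add: quat_mult_assoc[symmetric] 1)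
qed

lemma quat_cnj_imaginary: "imaginary e \<Longrightarrow> quat_cnj e = - e"
  by (simp add: quat_comp)

lemma imaginary_iff_inner: "imaginary e \<longleftrightarrow> e \<bullet> quat_one = 0"
  by (simp add: quat_comp)

lemma imaginary_unit_square:
  "imaginary e \<Longrightarrow> e \<bullet> e = 1 \<Longrightarrow> e \<otimes>\<^sub>H e = - quat_one"
  using quat_mult_cnj[of e] by (simp add: quat_cnj_imaginary qm_simps minus_equation_iff)

lemma imaginary_orthogonal_anticommute:
  "imaginary e \<Longrightarrow> imaginary f \<Longrightarrow> e \<bullet> f = 0 \<Longrightarrow> f \<otimes>\<^sub>H e = - (e \<otimes>\<^sub>H f)"
  and imaginary_orthogonal_mult: "imaginary e \<Longrightarrow> imaginary f \<Longrightarrow> e \<bullet> f = 0 \<Longrightarrow> imaginary (e \<otimes>\<^sub>H f)"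
  by (auto simp: quat_comp algebra_simps)

lemma commute_all_imaginary:
  assumes "w \<otimes>\<^sub>H quat_i = quat_i \<otimes>\<^sub>H w" "w \<otimes>\<^sub>H quat_j = quat_j \<otimes>\<^sub>H w" "imaginary w"
  shows "w = 0"
  using assms by (auto simp: quat_comp)

lemma orthonormal_expand_quat:
  fixes b1 b2 b3 b4 v :: quat
  assumes "b1 \<bullet> b1 = 1" "b2 \<bullet> b2 = 1" "b3 \<bullet> b3 = 1" "b4 \<bullet> b4 = 1"
    "b1 \<bullet> b2 = 0" "b1 \<bullet> b3 = 0" "b1 \<bullet> b4 = 0" "b2 \<bullet> b3 = 0" "b2 \<bullet> b4 = 0" "b3 \<bullet> b4 = 0"
  shows "v = (v \<bullet> b1) *\<^sub>R b1 + (v \<bullet> b2) *\<^sub>R b2 + (v \<bullet> b3) *\<^sub>R b3 + (v \<bullet> b4) *\<^sub>R b4"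
proof -
  let ?B = "{b1, b2, b3, b4}"
  have ne: "b1 \<noteq> b2" "b1 \<noteq> b3" "b1 \<noteq> b4" "b2 \<noteq> b3" "b2 \<noteq> b4" "b3 \<noteq> b4"
    using assms by auto
  have card: "card ?B = 4" using ne by simp
  have po: "pairwise orthogonal ?B"
    using assms by (auto simp: pairwise_insert orthogonal_def inner_commute)
  have "0 \<notin> ?B" using assms by auto
  then have "independent ?B" using pairwise_orthogonal_independent[OF po] by blast
  then have "UNIV \<subseteq> span ?B" by (rule card_ge_dim_independent[rotated]) (simp_all add: card)
  then have "(\<Sum>b\<in>?B. (v \<bullet> b) *\<^sub>R b) = v"
    by (intro orthonormal_basis_expand[OF po]) (use assms in \<open>auto simp: norm_eq_1\<close>)
  then show ?thesis using ne by (simp add: add.assoc)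
qed

lemma imaginary_expand:
  assumes "imaginary e1" "imaginary e2" "imaginary e3"
    "e1 \<bullet> e1 = 1" "e2 \<bullet> e2 = 1" "e3 \<bullet> e3 = 1" "e1 \<bullet> e2 = 0" "e1 \<bullet> e3 = 0" "e2 \<bullet> e3 = 0"
  shows "v = (v \<bullet> quat_one) *\<^sub>R quat_one + (v \<bullet> e1) *\<^sub>R e1 + (v \<bullet> e2) *\<^sub>R e2 + (v \<bullet> e3) *\<^sub>R e3"
  by (rule orthonormal_expand_quat)
    (use assms in \<open>auto simp: imaginary_iff_inner inner_commute S3_iff[symmetric] S3_one\<close>)

text \<open>The product \<open>e1 e2\<close> is the cross product, so an orthonormal imaginary frame satisfies
  \<open>e1 e2 = e3\<close> up to the sign that records its orientation.\<close>

lemma quat_triple_product: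
  assumes e: "imaginary e1" "imaginary e2" "imaginary e3"
    "e1 \<bullet> e1 = 1" "e2 \<bullet> e2 = 1" "e3 \<bullet> e3 = 1" "e1 \<bullet> e2 = 0" "e1 \<bullet> e3 = 0" "e2 \<bullet> e3 = 0"
  shows "e1 \<otimes>\<^sub>H e2 = ((e1 \<otimes>\<^sub>H e2) \<bullet> e3) *\<^sub>R e3" and "\<bar>(e1 \<otimes>\<^sub>H e2) \<bullet> e3\<bar> = 1"
proof -
  let ?m = "e1 \<otimes>\<^sub>H e2"
  have 0: "?m \<bullet> e1 = 0" "?m \<bullet> e2 = 0"
    using inner_quat_mult_left[of e1 e2 quat_one] inner_quat_mult_right[of e1 e2 quat_one] e
    by (simp_all add: imaginary_iff_inner)
  have 1: "?m \<bullet> quat_one = 0" using imaginary_orthogonal_mult[OF e(1,2,7)] by (simp add: imaginary_iff_inner)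
  show 2: "?m = (?m \<bullet> e3) *\<^sub>R e3"
    using imaginary_expand[OF e, of ?m] 0 1 by simp
  have "norm e1 = 1" "norm e2 = 1" using e by (simp_all only: norm_eq_1)
  then have "norm ?m = 1" by (simp add: norm_quat_mult)
  moreover have "norm ?m = \<bar>?m \<bullet> e3\<bar> * norm e3" using 2 by (metis norm_scaleR)
  moreover have "norm e3 = 1" using e by (simp add: norm_eq_1)
  ultimately show "\<bar>?m \<bullet> e3\<bar> = 1" by simp
qed

text \<open>Conjugation by unit quaternions rotates the imaginary quaternions transitively. The
  quaternion \<open>s = 1 - e i\<close> satisfies \<open>e s = s i\<close>, and it vanishes only for \<open>e = -i\<close>, where \<open>j\<close>
  does the job.\<close>

lemma unit_imaginary_conjugate_i:
  assumes "imaginary e" "e \<bullet> e = 1"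
  shows "\<exists>h\<in>S3. e = h \<otimes>\<^sub>H quat_i \<otimes>\<^sub>H quat_cnj h"
proof (cases "e = - quat_i")
  case True
  then have "e = quat_j \<otimes>\<^sub>H quat_i \<otimes>\<^sub>H quat_cnj quat_j" by (simp add: quat_comp)
  then show ?thesis using S3_j by blast
next
  case False
  define s where "s = quat_one - e \<otimes>\<^sub>H quat_i"
  have es: "e \<otimes>\<^sub>H s = s \<otimes>\<^sub>H quat_i"
  proof -
    have "e \<otimes>\<^sub>H s = e + quat_i"
      by (simp add: s_def qm_simps quat_mult_assoc[symmetric] imaginary_unit_square[OF assms])
    moreover have "quat_i \<otimes>\<^sub>H quat_i = - quat_one" by (simp add: quat_comp)
    ultimately show ?thesis by (simp add: s_def qm_simps quat_mult_assoc)
  qed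
  have "s \<noteq> 0"
  proof
    assume "s = 0"
    then have "e \<otimes>\<^sub>H (quat_i \<otimes>\<^sub>H quat_i) = quat_i" by (simp add: s_def quat_mult_assoc[symmetric])
    moreover have "quat_i \<otimes>\<^sub>H quat_i = - quat_one" by (simp add: quat_comp)
    ultimately show False using False by (simp add: qm_simps minus_equation_iff)
  qed
  define h where "h = (1 / norm s) *\<^sub>R s"
  have h: "h \<in> S3" using \<open>s \<noteq> 0\<close> by (simp add: h_def S3_norm)
  have "e \<otimes>\<^sub>H h = h \<otimes>\<^sub>H quat_i" by (simp add: h_def qm_simps es)
  then have "e = h \<otimes>\<^sub>H quat_i \<otimes>\<^sub>H quat_cnj h"
    using h by (metis S3_cancel(1) quat_mult_assoc quat_one_right)
  then show ?thesis using h by blast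
qed

text \<open>After \<open>e1\<close> has been moved to \<open>i\<close>, the vector \<open>e2\<close> lies in the plane of \<open>j\<close> and \<open>k\<close>, and a
  rotation about \<open>i\<close> moves it to \<open>j\<close>.\<close>

lemma oriented_frame_conjugate:
  assumes e: "imaginary e1" "imaginary e2" "e1 \<bullet> e1 = 1" "e2 \<bullet> e2 = 1" "e1 \<bullet> e2 = 0"
  shows "\<exists>h\<in>S3. e1 = h \<otimes>\<^sub>H quat_i \<otimes>\<^sub>H quat_cnj h \<and> e2 = h \<otimes>\<^sub>H quat_j \<otimes>\<^sub>H quat_cnj h"
proof -
  obtain g where g: "g \<in> S3" "e1 = g \<otimes>\<^sub>H quat_i \<otimes>\<^sub>H quat_cnj g"
    using unit_imaginary_conjugate_i e by blast
  define f where "f = quat_cnj g \<otimes>\<^sub>H e2 \<otimes>\<^sub>H g"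
  have fe: "g \<otimes>\<^sub>H f \<otimes>\<^sub>H quat_cnj g = e2" using g by (simp add: f_def quat_mult_assoc)
  have inner: "(g \<otimes>\<^sub>H x \<otimes>\<^sub>H quat_cnj g) \<bullet> (g \<otimes>\<^sub>H y \<otimes>\<^sub>H quat_cnj g) = x \<bullet> y" for x y
    using g S3_cnj[of g] by (simp add: inner_quat_mult_left inner_quat_mult_right S3_iff)
  have f: "f \<bullet> f = 1" "f \<bullet> quat_i = 0" "f \<bullet> quat_one = 0"
    using inner[of f f] inner[of f quat_i] inner[of f quat_one] e g fe
    by (simp_all add: inner_commute imaginary_iff_inner)
  have f0: "f$1 = 0" "f$2 = 0" "(f$3)\<^sup>2 + (f$4)\<^sup>2 = 1"
    using f by (simp_all add: quat_comp power2_eq_square)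
  then obtain t where t: "f$3 = cos t" "f$4 = sin t" using sincos_total_2pi by metis
  \<comment> \<open>conjugation by \<open>r\<close> rotates by the angle \<open>t\<close>, twice the angle of \<open>r\<close> itself\<close>
  define r where "r = (vector [cos (t/2), sin (t/2), 0, 0] :: quat)"
  have r: "r \<in> S3" by (simp add: r_def S3_iff inner_quat flip: power2_eq_square)
  have "cos t = cos (t/2) * cos (t/2) - sin (t/2) * sin (t/2)" "sin t = 2 * sin (t/2) * cos (t/2)"
    using cos_add[of "t/2" "t/2"] sin_add[of "t/2" "t/2"] by simp_all
  then have "r \<otimes>\<^sub>H quat_j \<otimes>\<^sub>H quat_cnj r = f"
    using f0 t by (simp add: quat_comp r_def)
  moreover have "r \<otimes>\<^sub>H quat_i \<otimes>\<^sub>H quat_cnj r = quat_i"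
    by (simp add: quat_comp r_def flip: power2_eq_square)
  moreover have "(g \<otimes>\<^sub>H r) \<otimes>\<^sub>H x \<otimes>\<^sub>H quat_cnj (g \<otimes>\<^sub>H r)
      = g \<otimes>\<^sub>H (r \<otimes>\<^sub>H x \<otimes>\<^sub>H quat_cnj r) \<otimes>\<^sub>H quat_cnj g" for x
    by (simp add: quat_cnj_mult quat_mult_assoc)
  ultimately have "e1 = (g \<otimes>\<^sub>H r) \<otimes>\<^sub>H quat_i \<otimes>\<^sub>H quat_cnj (g \<otimes>\<^sub>H r)"
     "e2 = (g \<otimes>\<^sub>H r) \<otimes>\<^sub>H quat_j \<otimes>\<^sub>H quat_cnj (g \<otimes>\<^sub>H r)"
    using g(2) fe by simp_all
  then show ?thesis using S3_mult[OF g(1) r] by blast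
qed

section \<open>Isometries given by multiplication with unit quaternions\<close>

definition mult_isometry :: "quat \<Rightarrow> quat \<Rightarrow> quat \<Rightarrow> quat \<times> quat \<Rightarrow> quat \<times> quat" where
  "mult_isometry a b c x = (a \<otimes>\<^sub>H fst x \<otimes>\<^sub>H c, b \<otimes>\<^sub>H snd x \<otimes>\<^sub>H c)"

lemma bounded_linear_mult_isometry: "bounded_linear (mult_isometry a b c)"
proof -
  have "linear (mult_isometry a b c)"
    by (rule linearI) (simp_all add: mult_isometry_def qm_simps)
  then show ?thesis by (simp add: linear_conv_bounded_linear)
qed

lemma mult_isometry_inverse:
  assumes "a \<in> S3" "b \<in> S3" "c \<in> S3"
  shows "mult_isometry (quat_cnj a) (quat_cnj b) (quat_cnj c) (mult_isometry a b c x) = x"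
  using assms by (simp add: mult_isometry_def quat_mult_assoc)

lemma mult_isometry_S3xS3:
  "a \<in> S3 \<Longrightarrow> b \<in> S3 \<Longrightarrow> c \<in> S3 \<Longrightarrow> x \<in> S3xS3 \<Longrightarrow> mult_isometry a b c x \<in> S3xS3"
  by (auto simp: mult_isometry_def S3xS3_def S3_mult)

lemma smooth_on_bounded_linear:
  fixes L :: "'a::euclidean_space \<Rightarrow> 'b::real_normed_vector"
  assumes "bounded_linear L" "\<And>x. x \<in> A \<Longrightarrow> f x = L x"
  shows "smooth_on A f"
proof -
  have "Cinf_on UNIV L" using Cinf_on_linear[OF assms(1) open_UNIV Cinf_on_ident] by simp
  then show ?thesis unfolding smooth_on_def Cinf_on_def using assms(2)
    by (intro ballI exI[of _ UNIV] exI[of _ L]) auto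
qed

text \<open>The maps \<open>(p, q) \<mapsto> (a p c, b q c)\<close> commute with \<open>J\<close>, since the inner factors cancel in
  \<open>p q\<inverse>\<close>, and they preserve the Euclidean product metric. These are the only isometries needed for
  the congruences below.\<close>

lemma nk_isometry_mult:
  assumes abc: "a \<in> S3" "b \<in> S3" "c \<in> S3"
  shows "nk_isometry (mult_isometry a b c)"
proof -
  let ?F = "mult_isometry a b c" and ?G = "mult_isometry (quat_cnj a) (quat_cnj b) (quat_cnj c)"
  have GF: "?G (?F x) = x" for x using mult_isometry_inverse[OF abc] .
  have FG: "?F (?G x) = x" for x using mult_isometry_inverse[OF S3_cnj S3_cnj S3_cnj, OF abc] by simp
  have bij: "bij_betw ?F S3xS3 S3xS3"
    by (rule bij_betw_byWitness[where f'="?G"])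
      (use GF FG mult_isometry_S3xS3 abc S3_cnj in auto)
  have inv: "inv_into S3xS3 ?F x = ?G x" if "x \<in> S3xS3" for x
    using that FG GF bij mult_isometry_S3xS3[OF S3_cnj S3_cnj S3_cnj, OF abc]
    by (metis bij_betw_def inv_into_f_f)
  have J: "nk_J (?F x) (?F Z) = ?F (nk_J x Z)" if "x \<in> S3xS3" for x Z
  proof -
    obtain p q U V where x: "x = (p, q)" and Z: "Z = (U, V)" by (cases x, cases Z)
    have "p \<in> S3" "q \<in> S3" using that x by (auto simp: S3xS3_def)
    then show ?thesis using abc unfolding x Z
      by (simp add: mult_isometry_def quat_inv_S3 S3_mult quat_cnj_mult quat_mult_assoc qm_simps)
  qed
  have in_eq: "?F Z \<bullet> ?F Z' = Z \<bullet> Z'" for Z Z'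
    using abc by (simp add: mult_isometry_def inner_prod_def inner_quat_mult_left inner_quat_mult_right S3_iff)
  have "\<forall>x\<in>S3xS3. \<exists>D. (?F has_derivative D) (at x within S3xS3) \<and>
        (\<forall>Z\<in>tangent_space x. \<forall>Z'\<in>tangent_space x. nk_metric (?F x) (D Z) (D Z') = nk_metric x Z Z')"
    by (intro ballI exI[of _ ?F] conjI bounded_linear_imp_has_derivative bounded_linear_mult_isometry)
      (simp add: nk_metric_def J in_eq)
  moreover have "smooth_on S3xS3 ?F" "smooth_on S3xS3 (inv_into S3xS3 ?F)"
    using smooth_on_bounded_linear[OF bounded_linear_mult_isometry] inv by blast+
  ultimately show ?thesis using bij by (simp add: nk_isometry_def)
qed

section \<open>Local diffeomorphisms\<close>

text \<open>The reparametrization of the source that local congruence asks for, expressed in a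
  coordinate domain \<open>W\<close>.\<close>

definition smooth_embedding_onto_open ::
  "'a::euclidean_space set \<Rightarrow> 'n::euclidean_space set \<Rightarrow> ('a \<Rightarrow> 'n) \<Rightarrow> bool" where
  "smooth_embedding_onto_open W N u \<longleftrightarrow>
     open W \<and> Cinf_on W u \<and> inj_on u W \<and> openin (top_of_set N) (u ` W) \<and>
     smooth_on (u ` W) (inv_into W u)"

text \<open>A smooth family of right inverses of the derivative replaces the smoothness of matrix
  inversion: the inverse map has derivative \<open>H v \<circ> g\<close> in direction \<open>v\<close>, so its order of
  differentiability improves by induction.\<close>

lemma local_smooth_inverse:
  fixes \<Phi> :: "'a::euclidean_space \<Rightarrow> 'a"
  assumes W: "open W" "x0 \<in> W" and \<Phi>: "Cinf_on W \<Phi>"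
    and H: "\<And>v. Cinf_on W (H v)" "\<And>v y. y \<in> W \<Longrightarrow> dder \<Phi> y (H v y) = v"
  obtains U where "open U" "x0 \<in> U" "U \<subseteq> W" "inj_on \<Phi> U" "open (\<Phi> ` U)"
    "Cinf_on (\<Phi> ` U) (inv_into U \<Phi>)"
proof -
  define f' where "f' y = Blinfun (dder \<Phi> y)" for y
  have der: "(\<Phi> has_derivative dder \<Phi> y) (at y)" if "y \<in> W" for y
    using Cinf_on_derivative[OF \<Phi> that] .
  have f': "blinfun_apply (f' y) = dder \<Phi> y" if "y \<in> W" for y
    unfolding f'_def by (rule bounded_linear_Blinfun_apply) (use der[OF that] has_derivative_bounded_linear in blast)
  have cont: "continuous_on W f'"
  proof (rule continuous_on_blinfun_componentwise)
    fix i :: 'a assume "i \<in> Basis"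
    have "continuous_on W (\<lambda>y. dder \<Phi> y i)" by (intro Cinf_on_continuous Cinf_on_dder \<Phi>)
    then show "continuous_on W (\<lambda>x. blinfun_apply (f' x) i)"
      by (subst continuous_on_cong[OF refl]) (simp_all add: f')
  qed
  have bij: "bij (dder \<Phi> y)" if "y \<in> W" for y
  proof -
    have lin: "linear (dder \<Phi> y)" using der[OF that] has_derivative_linear by blast
    have "surj (dder \<Phi> y)" using H(2)[OF that] by (rule surjI)
    then show ?thesis using linear_surjective_imp_injective[OF lin] by (simp add: bij_def)
  qed
  have lin0: "linear (dder \<Phi> x0)" "inj (dder \<Phi> x0)"
    using der[OF W(2)] has_derivative_linear bij[OF W(2)] by (auto simp: bij_def)
  obtain L where L: "linear L" "L \<circ> dder \<Phi> x0 = id"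
    using linear_injective_left_inverse[OF lin0] by blast
  define invf where "invf = Blinfun L"
  have "blinfun_apply invf = L"
    unfolding invf_def by (rule bounded_linear_Blinfun_apply) (use L linear_conv_bounded_linear in blast)
  then have invf: "invf o\<^sub>L f' x0 = id_blinfun"
    using L(2) W(2) by (intro blinfun_eqI) (simp add: f' fun_eq_iff)
  obtain U V g g' where UV: "open U" "U \<subseteq> W" "x0 \<in> U" "open V" "\<Phi> x0 \<in> V" and hom: "homeomorphism U V \<Phi> g"
    and g: "\<And>y. y \<in> V \<Longrightarrow> (g has_derivative (g' y)) (at y)"
    and g': "\<And>y. y \<in> V \<Longrightarrow> g' y = inv (blinfun_apply (f' (g y)))"
    using inverse_function_theorem[OF W(1) _ cont W(2) invf] der f' by metis
  have gV: "g y \<in> W" if "y \<in> V" for y using hom that UV by (auto simp: homeomorphism_def)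
  have gH: "g' y v = H v (g y)" if "y \<in> V" for y v
    using g'[OF that] f'[OF gV[OF that]] bij[OF gV[OF that]] H(2)[OF gV[OF that]]
    by (metis bij_def inv_f_f)
  have "Ck_on k V g" for k
  proof (induction k)
    case 0
    then show ?case using hom by (simp add: homeomorphism_def)
  next
    case (Suc k)
    show ?case
    proof (rule Ck_on_SucI[OF UV(4), where f'="\<lambda>y v. H v (g y)"])
      fix y assume "y \<in> V"
      then show "(g has_derivative (\<lambda>v. H v (g y))) (at y)" using g[of y] gH[of y] by (metis ext)
    next
      fix v show "Ck_on k V (\<lambda>y. H v (g y))"
        by (rule Ck_on_compose[OF UV(4) W(1) _ Suc]) (use gV H(1) in \<open>auto simp: Cinf_on_def\<close>)
    qed
  qed
  then have g_smooth: "Cinf_on V g" by (simp add: Cinf_on_def)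
  have img: "\<Phi> ` U = V" and inj: "inj_on \<Phi> U"
    using hom by (auto simp: homeomorphism_def inj_on_def) metis
  have "Cinf_on (\<Phi> ` U) (inv_into U \<Phi>)"
    by (rule Cinf_on_cong[OF _ _ g_smooth, unfolded img[symmetric]])
       (use UV img inj hom in \<open>auto simp: homeomorphism_def\<close>)
  then show ?thesis using that[of U] UV img inj by auto
qed

text \<open>The frame and the nonzero factors provide the right inverses of the derivative.\<close>

lemma local_diffeo_R3:
  fixes u :: "real^3 \<Rightarrow> real^3"
  assumes W: "open W" "x0 \<in> W" and u: "Cinf_on W u"
    and E: "Cinf_on W E1" "Cinf_on W E2" "Cinf_on W E3"
    and k: "k1 \<noteq> 0" "k2 \<noteq> 0" "k3 \<noteq> 0"
    and du: "\<And>y. y \<in> W \<Longrightarrow> dder u y (E1 y) = k1 *\<^sub>R axis 1 1"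
       "\<And>y. y \<in> W \<Longrightarrow> dder u y (E2 y) = k2 *\<^sub>R axis 2 1"
       "\<And>y. y \<in> W \<Longrightarrow> dder u y (E3 y) = k3 *\<^sub>R axis 3 1"
  obtains U where "x0 \<in> U" "U \<subseteq> W" "smooth_embedding_onto_open U UNIV u"
proof -
  let ?H = "\<lambda>v y. (v$1/k1) *\<^sub>R E1 y + (v$2/k2) *\<^sub>R E2 y + (v$3/k3) *\<^sub>R E3 y"
  have 1: "Cinf_on W (?H v)" for v by (intro Cinf_intros W E)
  have 2: "dder u y (?H v y) = v" if "y \<in> W" for v y
  proof -
    have lin: "linear (dder u y)" using Cinf_on_derivative[OF u that] has_derivative_linear by blast
    show ?thesis
      unfolding linear_add[OF lin] linear_scale[OF lin] du[OF that]
      using k by (simp add: vec_eq_iff forall_3 axis_def)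
  qed
  obtain U where U: "open U" "x0 \<in> U" "U \<subseteq> W" "inj_on u U" "open (u ` U)" "Cinf_on (u ` U) (inv_into U u)"
    using local_smooth_inverse[OF W u, of ?H] 1 2 by blast
  then have "smooth_embedding_onto_open U UNIV u"
    using Cinf_on_subset[OF u] by (simp add: smooth_embedding_onto_open_def smooth_on_open_iff)
  then show ?thesis using that U by blast
qed

definition quat_vec :: "quat \<Rightarrow> real^3" where "quat_vec z = vector [z$2, z$3, z$4]"

definition vec_quat :: "real \<Rightarrow> real^3 \<Rightarrow> quat" where "vec_quat r y = vector [r, y$1, y$2, y$3]"

lemma quat_vec_vec_quat [simp]: "quat_vec (vec_quat r y) = y" "vec_quat r y $ 1 = r"
  by (simp_all add: quat_vec_def vec_quat_def vec_eq_iff forall_3)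

lemma vec_quat_quat_vec [simp]: "vec_quat (z$1) (quat_vec z) = z"
  by (simp add: quat_vec_def vec_quat_def quat_eq_iff)

lemma bounded_linear_quat_vec: "bounded_linear quat_vec"
  by (intro linear_conv_bounded_linear[THEN iffD1] linearI)
    (simp_all add: quat_vec_def vec_eq_iff forall_3)

lemma bounded_linear_vec_quat: "bounded_linear (vec_quat 0)"
  by (intro linear_conv_bounded_linear[THEN iffD1] linearI)
    (simp_all add: vec_quat_def quat_eq_iff)

lemma Cinf_on_nth:
  fixes f :: "'a::euclidean_space \<Rightarrow> real^'n"
  shows "open S \<Longrightarrow> Cinf_on S f \<Longrightarrow> Cinf_on S (\<lambda>x. f x $ i)"
  by (rule Cinf_on_linear[OF bounded_linear_vec_nth])

text \<open>A map into the unit sphere is extended radially, \<open>(r, y) \<mapsto> r u(y)\<close>, to a map between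
  four-dimensional spaces, to which the inverse function theorem applies. Its first coordinate is
  the norm of its value, so it maps the slice \<open>r = 1\<close>, and only this slice, into the sphere.\<close>

lemma local_diffeo_S3:
  fixes u :: "real^3 \<Rightarrow> quat"
  assumes W: "open W" "x0 \<in> W" and u: "Cinf_on W u" and u1: "\<And>y. y \<in> W \<Longrightarrow> u y \<in> S3"
    and E: "Cinf_on W E1" "Cinf_on W E2" "Cinf_on W E3"
    and m: "Cinf_on W m1" "Cinf_on W m2" "Cinf_on W m3"
    and k: "k1 \<noteq> 0" "k2 \<noteq> 0" "k3 \<noteq> 0"
    and du: "\<And>y. y \<in> W \<Longrightarrow> dder u y (E1 y) = k1 *\<^sub>R m1 y"
       "\<And>y. y \<in> W \<Longrightarrow> dder u y (E2 y) = k2 *\<^sub>R m2 y"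
       "\<And>y. y \<in> W \<Longrightarrow> dder u y (E3 y) = k3 *\<^sub>R m3 y"
    and on: "\<And>y. y \<in> W \<Longrightarrow> m1 y \<bullet> m1 y = 1" "\<And>y. y \<in> W \<Longrightarrow> m2 y \<bullet> m2 y = 1" "\<And>y. y \<in> W \<Longrightarrow> m3 y \<bullet> m3 y = 1"
       "\<And>y. y \<in> W \<Longrightarrow> m1 y \<bullet> m2 y = 0" "\<And>y. y \<in> W \<Longrightarrow> m1 y \<bullet> m3 y = 0" "\<And>y. y \<in> W \<Longrightarrow> m2 y \<bullet> m3 y = 0"
       "\<And>y. y \<in> W \<Longrightarrow> u y \<bullet> m1 y = 0" "\<And>y. y \<in> W \<Longrightarrow> u y \<bullet> m2 y = 0" "\<And>y. y \<in> W \<Longrightarrow> u y \<bullet> m3 y = 0"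
  obtains U where "x0 \<in> U" "U \<subseteq> W" "smooth_embedding_onto_open U S3 u"
proof -
  define W' where "W' = {z :: quat. quat_vec z \<in> W \<and> z$1 > 0}"
  define \<Phi> where "\<Phi> z = (z$1) *\<^sub>R u (quat_vec z)" for z
  have cv: "continuous_on UNIV quat_vec" using bounded_linear_quat_vec linear_continuous_on by blast
  have W'o: "open W'"
  proof -
    have "W' = (quat_vec -` W) \<inter> {z. 0 < z$1}" by (auto simp: W'_def)
    moreover have "open (quat_vec -` W)" by (rule open_vimage[OF W(1) cv])
    moreover have "open {z::quat. 0 < z$1}" by (intro open_Collect_less continuous_intros)
    ultimately show ?thesis by auto
  qed
  have comp: "Cinf_on W' (\<lambda>z. f (quat_vec z))" if "Cinf_on W f" for f :: "real^3 \<Rightarrow> 'b::euclidean_space"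
    by (rule Cinf_on_compose[OF W'o W(1) _ Cinf_on_linear[OF bounded_linear_quat_vec W'o Cinf_on_ident[OF W'o]] that])
      (auto simp: W'_def)
  have nth: "Cinf_on W' (\<lambda>z. z$1)" by (rule Cinf_on_nth[OF W'o Cinf_on_ident[OF W'o]])
  have \<Phi>s: "Cinf_on W' \<Phi>" unfolding \<Phi>_def by (intro Cinf_on_scaleR W'o nth comp u)
  have d\<Phi>: "dder \<Phi> z w = (w$1) *\<^sub>R u (quat_vec z) + (z$1) *\<^sub>R dder u (quat_vec z) (quat_vec w)"
    if "z \<in> W'" for z w
  proof -
    have "quat_vec z \<in> W" using that by (simp add: W'_def)
    then have "((\<lambda>z. u (quat_vec z)) has_derivative (\<lambda>w. dder u (quat_vec z) (quat_vec w))) (at z)"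
      using has_derivative_compose[OF bounded_linear_imp_has_derivative[OF bounded_linear_quat_vec]
          Cinf_on_derivative[OF u]] by blast
    moreover have "((\<lambda>z::quat. z$1) has_derivative (\<lambda>w. w$1)) (at z)"
      by (rule bounded_linear_imp_has_derivative[OF bounded_linear_vec_nth])
    ultimately show ?thesis unfolding \<Phi>_def
      by (intro dder_eqI) (auto intro!: derivative_eq_intros)
  qed
  let ?e = "\<lambda>v y. ((v \<bullet> m1 y) / k1) *\<^sub>R E1 y + ((v \<bullet> m2 y) / k2) *\<^sub>R E2 y + ((v \<bullet> m3 y) / k3) *\<^sub>R E3 y"
  \<comment> \<open>the right inverse: the radial component of \<open>v\<close> goes to \<open>r\<close>, the tangential components to the
    frame, which is rescaled because \<open>r u\<close> stretches tangent vectors by \<open>r\<close>\<close>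
  let ?H = "\<lambda>v z. (v \<bullet> u (quat_vec z)) *\<^sub>R quat_one + inverse (z$1) *\<^sub>R vec_quat 0 (?e v (quat_vec z))"
  have es: "Cinf_on W (?e v)" for v
    unfolding divide_inverse by (intro Cinf_intros W E m)
  have Hs: "Cinf_on W' (?H v)" for v
    by (intro Cinf_on_add Cinf_on_scaleR Cinf_on_inner Cinf_on_const W'o comp u Cinf_on_inverse nth
        Cinf_on_linear[OF bounded_linear_vec_quat] comp[OF es]) (simp add: W'_def)
  have dH: "dder \<Phi> z (?H v z) = v" if "z \<in> W'" for v z
  proof -
    let ?y = "quat_vec z"
    have y: "?y \<in> W" and z1: "z$1 > 0" using that by (auto simp: W'_def)
    have lin: "linear (dder u ?y)" using Cinf_on_derivative[OF u y] has_derivative_linear by blast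
    have "quat_vec (?H v z) = inverse (z$1) *\<^sub>R ?e v ?y"
      by (simp add: quat_vec_def vec_quat_def quat_one_def vec_eq_iff forall_3)
    moreover have "?H v z $ 1 = v \<bullet> u ?y" by (simp add: vec_quat_def quat_one_def)
    ultimately have "dder \<Phi> z (?H v z) = (v \<bullet> u ?y) *\<^sub>R u ?y + dder u ?y (?e v ?y)"
      using d\<Phi>[OF that, of "?H v z"] z1 linear_scale[OF lin, of "inverse (z$1)" "?e v ?y"] by simp
    also have "dder u ?y (?e v ?y) = (v \<bullet> m1 ?y) *\<^sub>R m1 ?y + (v \<bullet> m2 ?y) *\<^sub>R m2 ?y + (v \<bullet> m3 ?y) *\<^sub>R m3 ?y"
      unfolding linear_add[OF lin] linear_scale[OF lin] du[OF y] using k by simp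
    also have "(v \<bullet> u ?y) *\<^sub>R u ?y + \<dots> = v"
      using orthonormal_expand_quat[of "u ?y" "m1 ?y" "m2 ?y" "m3 ?y" v, symmetric] u1[OF y] on[OF y]
      by (simp add: S3_iff add.assoc)
    finally show ?thesis .
  qed
  have x0: "vec_quat 1 x0 \<in> W'" using W by (simp add: W'_def)
  obtain V where V: "open V" "vec_quat 1 x0 \<in> V" "V \<subseteq> W'" "inj_on \<Phi> V" "open (\<Phi> ` V)"
      "Cinf_on (\<Phi> ` V) (inv_into V \<Phi>)"
    using local_smooth_inverse[OF W'o x0 \<Phi>s, of ?H] Hs dH by blast
  define U where "U = {y. vec_quat 1 y \<in> V}"
  have \<Phi>1: "\<Phi> (vec_quat 1 y) = u y" for y by (simp add: \<Phi>_def)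
  have vq: "vec_quat 1 y = quat_one + vec_quat 0 y" for y
    by (simp add: vec_quat_def quat_one_def quat_eq_iff)
  have Uo: "open U"
  proof -
    have "continuous_on UNIV (vec_quat 1)"
      unfolding vq[abs_def] by (intro continuous_intros linear_continuous_on bounded_linear_vec_quat)
    then show ?thesis using open_vimage[OF V(1)] by (simp add: U_def vimage_def)
  qed
  have UW: "U \<subseteq> W" using V(3) by (force simp: U_def W'_def)
  have inj: "inj_on u U"
  proof (rule inj_onI)
    fix y y' assume "y \<in> U" "y' \<in> U" "u y = u y'"
    then have "vec_quat 1 y = vec_quat 1 y'"
      using V(4) by (auto simp: U_def inj_on_def \<Phi>1[symmetric])
    then show "y = y'" by (metis quat_vec_vec_quat(1))
  qed
  have img: "u ` U = S3 \<inter> \<Phi> ` V"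
  proof (intro equalityI subsetI)
    fix s assume "s \<in> u ` U"
    then show "s \<in> S3 \<inter> \<Phi> ` V" using u1 UW by (auto simp: U_def \<Phi>1[symmetric])
  next
    fix s assume "s \<in> S3 \<inter> \<Phi> ` V"
    then obtain z where z: "z \<in> V" "s = \<Phi> z" "norm s = 1" by (auto simp: S3_norm)
    have "z$1 > 0" "norm (u (quat_vec z)) = 1" using V(3) z u1 by (auto simp: W'_def S3_norm)
    then have "z$1 = 1" using z by (simp add: \<Phi>_def)
    then have "z = vec_quat 1 (quat_vec z)" using vec_quat_quat_vec[of z] by simp
    then show "s \<in> u ` U" using z \<Phi>1 by (metis (mono_tags, lifting) U_def image_eqI mem_Collect_eq)
  qed
  have inv: "inv_into U u s = quat_vec (inv_into V \<Phi> s)" if s: "s \<in> u ` U" for s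
  proof -
    obtain y where y: "y \<in> U" "s = u y" using s by blast
    then have "inv_into V \<Phi> s = vec_quat 1 y"
      using V(4) by (metis U_def \<Phi>1 inv_into_f_f mem_Collect_eq)
    then show ?thesis using y inj by (simp add: inv_into_f_f)
  qed
  have "smooth_on (u ` U) (inv_into U u)"
    unfolding smooth_on_def
  proof
    fix a assume "a \<in> u ` U"
    have "Cinf_on (\<Phi> ` V) (\<lambda>s. quat_vec (inv_into V \<Phi> s))"
      by (rule Cinf_on_linear[OF bounded_linear_quat_vec V(5,6)])
    then show "\<exists>W g. open W \<and> a \<in> W \<and> (\<forall>k. Ck_on k W g) \<and> (\<forall>x\<in>W \<inter> u ` U. g x = inv_into U u x)"
      using \<open>a \<in> u ` U\<close> img V(5) inv
      by (intro exI[of _ "\<Phi> ` V"] exI[of _ "\<lambda>s. quat_vec (inv_into V \<Phi> s)"]) (auto simp: Cinf_on_def)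
  qed
  moreover have "openin (top_of_set S3) (u ` U)" using V(5) img openin_open by blast
  ultimately have "smooth_embedding_onto_open U S3 u"
    using Uo inj Cinf_on_subset[OF u UW] by (simp add: smooth_embedding_onto_open_def)
  then show ?thesis using that[of U] UW V(2) by (simp add: U_def)
qed

section \<open>Adapted frames and their structure equations\<close>

lemma dder_cong_on:
  "open S \<Longrightarrow> x \<in> S \<Longrightarrow> (\<And>y. y \<in> S \<Longrightarrow> f y = g y) \<Longrightarrow> dder f x v = dder g x v"
  using dder_cong_open by metis

lemma dder_linear_simps:
  assumes "Cinf_on S f" "x \<in> S"
  shows "dder f x (v + w) = dder f x v + dder f x w" "dder f x (v - w) = dder f x v - dder f x w"
    "dder f x (c *\<^sub>R v) = c *\<^sub>R dder f x v" "dder f x (- v) = - dder f x v" "dder f x 0 = 0"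
proof -
  have l: "linear (dder f x)" using Cinf_on_derivative[OF assms] has_derivative_linear by blast
  show "dder f x (v + w) = dder f x v + dder f x w" "dder f x (v - w) = dder f x v - dder f x w"
    "dder f x (c *\<^sub>R v) = c *\<^sub>R dder f x v" "dder f x (- v) = - dder f x v" "dder f x 0 = 0"
    using l by (simp_all add: linear_add linear_diff linear_scale linear_neg linear_0)
qed

lemma dder_add:
  assumes "Cinf_on S f" "Cinf_on S g" "x \<in> S"
  shows "dder (\<lambda>y. f y + g y) x v = dder f x v + dder g x v"
  by (rule dder_eqI has_derivative_add Cinf_on_derivative assms)+

lemma dder_minus: "Cinf_on S f \<Longrightarrow> x \<in> S \<Longrightarrow> dder (\<lambda>y. - f y) x v = - dder f x v"
  by (rule dder_eqI has_derivative_minus Cinf_on_derivative | assumption)+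

lemma dder_const [simp]: "dder (\<lambda>y. c) x v = 0"
  by (simp add: frechet_derivative_const)

lemma dder_bilinear_on:
  assumes "bounded_bilinear h" "Cinf_on S f" "Cinf_on S g" "x \<in> S"
  shows "dder (\<lambda>y. h (f y) (g y)) x v = h (f x) (dder g x v) + h (dder f x v) (g x)"
  by (rule dder_bilinear[OF assms(1) Cinf_on_derivative[OF assms(2,4)] Cinf_on_derivative[OF assms(3,4)]])

lemmas dder_mult = dder_bilinear_on[OF bounded_bilinear_quat_mult]
lemmas dder_inner = dder_bilinear_on[OF bounded_bilinear_inner]
lemmas dder_scaleR = dder_bilinear_on[OF bounded_bilinear_scaleR]

lemma dder_linear:
  assumes "bounded_linear L" "Cinf_on S f" "x \<in> S"
  shows "dder (\<lambda>y. L (f y)) x v = L (dder f x v)"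
  by (rule dder_eqI) (rule bounded_linear.has_derivative[OF assms(1) Cinf_on_derivative[OF assms(2,3)]])

lemma dder_scaleR_const:
  "Cinf_on S f \<Longrightarrow> x \<in> S \<Longrightarrow> dder (\<lambda>y. c *\<^sub>R f y) x v = c *\<^sub>R dder f x v"
  using dder_linear[OF bounded_linear_scaleR_right] .

lemmas Cinf_on_quat_mult = Cinf_on_bilinear[OF bounded_bilinear_quat_mult]
lemmas Cinf_on_quat_cnj = Cinf_on_linear[OF bounded_linear_quat_cnj]

lemma inner_const_dder:
  assumes "open S" "Cinf_on S f" "Cinf_on S g" "\<And>y. y \<in> S \<Longrightarrow> f y \<bullet> g y = c" "x \<in> S"
  shows "dder f x v \<bullet> g x + f x \<bullet> dder g x v = 0"
proof -
  have "dder (\<lambda>y. f y \<bullet> g y) x v = dder (\<lambda>y. c) x v"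
    by (rule dder_cong_on[OF assms(1,5)]) (rule assms(4))
  then show ?thesis by (simp add: dder_inner[OF assms(2,3,5)] add.commute)
qed

lemma logarithmic_derivative_imaginary:
  assumes "open S" "Cinf_on S g" "\<And>y. y \<in> S \<Longrightarrow> g y \<in> S3" "y \<in> S"
  shows "imaginary (quat_cnj (g y) \<otimes>\<^sub>H dder g y v)"
proof -
  have "dder g y v \<bullet> g y = 0"
    using inner_const_dder[OF assms(1,2,2) _ assms(4), of 1 v] assms(3) by (simp add: S3_iff inner_commute)
  then show ?thesis
    using inner_quat_mult_left[of "quat_cnj (g y)" "dder g y v" "g y"] assms(3)[OF assms(4)]
    by (simp add: imaginary_iff_inner)
qed

lemma oriented_frame_products:
  assumes "imaginary e1" "imaginary e2" "e1 \<bullet> e1 = 1" "e2 \<bullet> e2 = 1" "e1 \<bullet> e2 = 0" "e1 \<otimes>\<^sub>H e2 = e3"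
  shows "imaginary e3" "e3 \<bullet> e3 = 1" "e1 \<bullet> e3 = 0" "e2 \<bullet> e3 = 0"
    "e2 \<otimes>\<^sub>H e1 = - e3" "e2 \<otimes>\<^sub>H e3 = e1" "e3 \<otimes>\<^sub>H e2 = - e1" "e3 \<otimes>\<^sub>H e1 = e2" "e1 \<otimes>\<^sub>H e3 = - e2"
    "e1 \<otimes>\<^sub>H e1 = - quat_one" "e2 \<otimes>\<^sub>H e2 = - quat_one" "e3 \<otimes>\<^sub>H e3 = - quat_one"
proof -
  show i: "imaginary e3" using imaginary_orthogonal_mult[OF assms(1,2,5)] assms(6) by simp
  show n: "e3 \<bullet> e3 = 1" using assms inner_quat_mult_left[of e1 e2 e2] by simp
  show o: "e1 \<bullet> e3 = 0" "e2 \<bullet> e3 = 0"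
    using assms inner_quat_mult_left[of e1 e2 quat_one] inner_quat_mult_right[of e1 e2 quat_one]
    by (auto simp: imaginary_iff_inner inner_commute)
  show sq: "e1 \<otimes>\<^sub>H e1 = - quat_one" "e2 \<otimes>\<^sub>H e2 = - quat_one" "e3 \<otimes>\<^sub>H e3 = - quat_one"
    using assms i n imaginary_unit_square by auto
  show 21: "e2 \<otimes>\<^sub>H e1 = - e3" using imaginary_orthogonal_anticommute[OF assms(1,2,5)] assms(6) by simp
  have "e3 \<otimes>\<^sub>H e2 = e1 \<otimes>\<^sub>H (e2 \<otimes>\<^sub>H e2)" by (simp add: quat_mult_assoc flip: assms(6))
  then show 32: "e3 \<otimes>\<^sub>H e2 = - e1" by (simp add: sq qm_simps)
  have "e1 \<otimes>\<^sub>H e3 = (e1 \<otimes>\<^sub>H e1) \<otimes>\<^sub>H e2" by (simp add: quat_mult_assoc assms(6))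
  then show 13: "e1 \<otimes>\<^sub>H e3 = - e2" by (simp add: sq qm_simps)
  show "e2 \<otimes>\<^sub>H e3 = e1" "e3 \<otimes>\<^sub>H e1 = e2"
    using imaginary_orthogonal_anticommute[OF i assms(2)] imaginary_orthogonal_anticommute[OF assms(1) i]
      o 32 13 by (simp_all add: inner_commute)
qed

text \<open>The situation of the theorem in a convex chart domain: \<open>p\<close> and \<open>q\<close> are the components of the
  immersion, and the Lagrangian frame \<open>E1, E2, E3\<close> is mapped by both logarithmic differentials
  \<open>p\<inverse> dp\<close> and \<open>q\<inverse> dq\<close> to multiples of one orthonormal frame \<open>e1, e2, e3\<close> of imaginary quaternions.
  Constancy of the angle functions means constancy of the factors \<open>a1, \<dots>, b3\<close>. The frame is
  oriented by \<open>e1 e2 = e3\<close>. The pair of factors of each leg is nonzero because the map is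
  immersive.\<close>

locale adapted_frame =
  fixes W :: "(real^3) set" and p q :: "real^3 \<Rightarrow> quat" and a1 a2 a3 b1 b2 b3 :: real
    and e1 e2 e3 :: "real^3 \<Rightarrow> quat" and E1 E2 E3 :: "real^3 \<Rightarrow> real^3"
  assumes W: "open W" "convex W"
    and smooth_pq: "Cinf_on W p" "Cinf_on W q"
    and smooth_e: "Cinf_on W e1" "Cinf_on W e2" "Cinf_on W e3"
    and smooth_E: "Cinf_on W E1" "Cinf_on W E2" "Cinf_on W E3"
    and pq_S3: "y \<in> W \<Longrightarrow> p y \<in> S3" "y \<in> W \<Longrightarrow> q y \<in> S3"
    and frame: "y \<in> W \<Longrightarrow> imaginary (e1 y)" "y \<in> W \<Longrightarrow> imaginary (e2 y)"
      "y \<in> W \<Longrightarrow> e1 y \<bullet> e1 y = 1" "y \<in> W \<Longrightarrow> e2 y \<bullet> e2 y = 1" "y \<in> W \<Longrightarrow> e1 y \<bullet> e2 y = 0"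
      "y \<in> W \<Longrightarrow> e1 y \<otimes>\<^sub>H e2 y = e3 y"
    and dp: "y \<in> W \<Longrightarrow> dder p y (E1 y) = a1 *\<^sub>R (p y \<otimes>\<^sub>H e1 y)"
      "y \<in> W \<Longrightarrow> dder p y (E2 y) = a2 *\<^sub>R (p y \<otimes>\<^sub>H e2 y)"
      "y \<in> W \<Longrightarrow> dder p y (E3 y) = a3 *\<^sub>R (p y \<otimes>\<^sub>H e3 y)"
    and dq: "y \<in> W \<Longrightarrow> dder q y (E1 y) = b1 *\<^sub>R (q y \<otimes>\<^sub>H e1 y)"
      "y \<in> W \<Longrightarrow> dder q y (E2 y) = b2 *\<^sub>R (q y \<otimes>\<^sub>H e2 y)"
      "y \<in> W \<Longrightarrow> dder q y (E3 y) = b3 *\<^sub>R (q y \<otimes>\<^sub>H e3 y)"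
    and ab: "a1 \<noteq> 0 \<or> b1 \<noteq> 0" "a2 \<noteq> 0 \<or> b2 \<noteq> 0" "a3 \<noteq> 0 \<or> b3 \<noteq> 0"
begin

lemmas smooths = smooth_pq smooth_e smooth_E

lemmas frame_products = oriented_frame_products[OF frame]

lemma imaginary_frame: "y \<in> W \<Longrightarrow> imaginary (e1 y)" "y \<in> W \<Longrightarrow> imaginary (e2 y)" "y \<in> W \<Longrightarrow> imaginary (e3 y)"
  using frame frame_products by auto

lemma frame_inner:
  assumes "y \<in> W"
  shows "e1 y \<bullet> e1 y = 1" "e2 y \<bullet> e2 y = 1" "e3 y \<bullet> e3 y = 1" "e1 y \<bullet> e2 y = 0" "e1 y \<bullet> e3 y = 0" "e2 y \<bullet> e3 y = 0"
    "e2 y \<bullet> e1 y = 0" "e3 y \<bullet> e1 y = 0" "e3 y \<bullet> e2 y = 0"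
  using frame[OF assms] frame_products[OF assms assms assms assms assms assms] by (simp_all add: inner_commute)

lemma S3_frame: "y \<in> W \<Longrightarrow> e1 y \<in> S3" "y \<in> W \<Longrightarrow> e2 y \<in> S3" "y \<in> W \<Longrightarrow> e3 y \<in> S3"
  using frame_inner by (auto simp: S3_iff)

lemma frame_mult:
  assumes "y \<in> W"
  shows "e1 y \<otimes>\<^sub>H e1 y = - quat_one" "e2 y \<otimes>\<^sub>H e2 y = - quat_one" "e3 y \<otimes>\<^sub>H e3 y = - quat_one"
    "e1 y \<otimes>\<^sub>H e2 y = e3 y" "e2 y \<otimes>\<^sub>H e1 y = - e3 y" "e2 y \<otimes>\<^sub>H e3 y = e1 y" "e3 y \<otimes>\<^sub>H e2 y = - e1 y"
    "e3 y \<otimes>\<^sub>H e1 y = e2 y" "e1 y \<otimes>\<^sub>H e3 y = - e2 y"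
  using frame(6)[OF assms] frame_products[OF assms assms assms assms assms assms] by simp_all

lemma inner_zero_frame:
  assumes "y \<in> W" "v = x1 *\<^sub>R e1 y + x2 *\<^sub>R e2 y + x3 *\<^sub>R e3 y"
  shows "v \<bullet> e1 y = x1" "v \<bullet> e2 y = x2" "v \<bullet> e3 y = x3"
  using assms frame_inner[OF assms(1)] by (simp_all add: inner_add_left)

lemma frame_coeffs_eq:
  assumes "y \<in> W" "x1 *\<^sub>R e1 y + x2 *\<^sub>R e2 y + x3 *\<^sub>R e3 y = z1 *\<^sub>R e1 y + z2 *\<^sub>R e2 y + z3 *\<^sub>R e3 y"
  shows "x1 = z1" "x2 = z2" "x3 = z3"
  using inner_zero_frame[OF assms(1,2)] inner_zero_frame[OF assms(1) refl] by metis+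

text \<open>A linear relation between the \<open>Ei\<close> is mapped by \<open>dp\<close> and \<open>dq\<close> to relations between the \<open>ei\<close>,
  and for every \<open>i\<close> one of the two factors is nonzero.\<close>

lemma span_E:
  assumes y: "y \<in> W"
  shows "\<exists>c1 c2 c3. v = c1 *\<^sub>R E1 y + c2 *\<^sub>R E2 y + c3 *\<^sub>R E3 y"
proof -
  define T where "T x = x$1 *\<^sub>R E1 y + x$2 *\<^sub>R E2 y + x$3 *\<^sub>R E3 y" for x :: "real^3"
  have lin: "linear T" by (rule linearI) (simp_all add: T_def algebra_simps)
  have zero: "x$1 * k1 = 0 \<and> x$2 * k2 = 0 \<and> x$3 * k3 = 0"
    if g: "Cinf_on W g" "g y \<in> S3" "dder g y (E1 y) = k1 *\<^sub>R (g y \<otimes>\<^sub>H e1 y)"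
      "dder g y (E2 y) = k2 *\<^sub>R (g y \<otimes>\<^sub>H e2 y)" "dder g y (E3 y) = k3 *\<^sub>R (g y \<otimes>\<^sub>H e3 y)" and T: "T x = 0" for x g k1 k2 k3
  proof -
    have "dder g y (T x) = 0" using dder_linear_simps[OF g(1) y] T by simp
    then have "g y \<otimes>\<^sub>H ((x$1 * k1) *\<^sub>R e1 y + (x$2 * k2) *\<^sub>R e2 y + (x$3 * k3) *\<^sub>R e3 y) = 0"
      by (simp add: T_def dder_linear_simps[OF g(1) y] g qm_simps)
    then have "(x$1 * k1) *\<^sub>R e1 y + (x$2 * k2) *\<^sub>R e2 y + (x$3 * k3) *\<^sub>R e3 y = 0"
      using g(2) by (metis S3_cancel(4) qm.zero_right)
    then show ?thesis using frame_coeffs_eq[OF y, of "x$1 * k1" "x$2 * k2" "x$3 * k3" 0 0 0] by simp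
  qed
  have "x = 0" if "T x = 0" for x
  proof -
    have "x$1 * a1 = 0 \<and> x$2 * a2 = 0 \<and> x$3 * a3 = 0" "x$1 * b1 = 0 \<and> x$2 * b2 = 0 \<and> x$3 * b3 = 0"
      by (rule zero[OF smooth_pq(1) pq_S3(1)[OF y] dp[OF y] that])
         (rule zero[OF smooth_pq(2) pq_S3(2)[OF y] dq[OF y] that])
    then show ?thesis using ab by (auto simp: vec_eq_iff forall_3)
  qed
  then have "inj T" using linear_injective_0[OF lin] by blast
  then have "surj T" using linear_injective_imp_surjective[OF lin] by simp
  then obtain x where "v = T x" by (metis surjD)
  then show ?thesis unfolding T_def by blast
qed

lemma constant_if_dder_zero:
  assumes "Cinf_on W g" "\<And>y. y \<in> W \<Longrightarrow> dder g y (E1 y) = 0" "\<And>y. y \<in> W \<Longrightarrow> dder g y (E2 y) = 0"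
    "\<And>y. y \<in> W \<Longrightarrow> dder g y (E3 y) = 0"
  shows "\<exists>c. \<forall>y\<in>W. g y = c"
proof (rule has_derivative_zero_constant[OF W(2)])
  fix y assume y: "y \<in> W"
  have "dder g y v = 0" for v
  proof -
    obtain c1 c2 c3 where "v = c1 *\<^sub>R E1 y + c2 *\<^sub>R E2 y + c3 *\<^sub>R E3 y" using span_E[OF y] by blast
    then show ?thesis using assms(2-4)[OF y] by (simp add: dder_linear_simps[OF assms(1) y])
  qed
  then have "dder g y = (\<lambda>h. 0)" by blast
  then show "(g has_derivative (\<lambda>h. 0)) (at y within W)"
    using Cinf_on_derivative[OF assms(1) y] has_derivative_at_withinI by metis
qed

text \<open>An orthonormal frame moves by infinitesimal rotations: by differentiation of the
  orthonormality relations, three connection coefficients describe its derivative.\<close>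

lemma dder_frame:
  assumes y: "y \<in> W"
  shows "dder e1 y v = (dder e1 y v \<bullet> e2 y) *\<^sub>R e2 y - (dder e3 y v \<bullet> e1 y) *\<^sub>R e3 y"
    and "dder e2 y v = - (dder e1 y v \<bullet> e2 y) *\<^sub>R e1 y + (dder e2 y v \<bullet> e3 y) *\<^sub>R e3 y"
    and "dder e3 y v = (dder e3 y v \<bullet> e1 y) *\<^sub>R e1 y - (dder e2 y v \<bullet> e3 y) *\<^sub>R e2 y"
proof -
  note ic = inner_const_dder[OF W(1) _ _ _ y]
  have i: "dder e1 y v \<bullet> quat_one = 0" "dder e2 y v \<bullet> quat_one = 0" "dder e3 y v \<bullet> quat_one = 0"
    using ic[OF smooth_e(1) Cinf_on_const, of quat_one 0 v] ic[OF smooth_e(2) Cinf_on_const, of quat_one 0 v]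
      ic[OF smooth_e(3) Cinf_on_const, of quat_one 0 v] imaginary_frame
    by (auto simp: imaginary_iff_inner)
  have d: "dder e1 y v \<bullet> e1 y = 0" "dder e2 y v \<bullet> e2 y = 0" "dder e3 y v \<bullet> e3 y = 0"
    using ic[OF smooth_e(1) smooth_e(1), of 1 v] ic[OF smooth_e(2) smooth_e(2), of 1 v]
      ic[OF smooth_e(3) smooth_e(3), of 1 v] frame_inner by (auto simp: inner_commute)
  have o: "dder e2 y v \<bullet> e1 y = - (dder e1 y v \<bullet> e2 y)" "dder e3 y v \<bullet> e2 y = - (dder e2 y v \<bullet> e3 y)"
     "dder e1 y v \<bullet> e3 y = - (dder e3 y v \<bullet> e1 y)"
    using ic[OF smooth_e(2) smooth_e(1), of 0 v] ic[OF smooth_e(3) smooth_e(2), of 0 v]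
      ic[OF smooth_e(1) smooth_e(3), of 0 v] frame_inner by (auto simp: inner_commute)
  note ex = imaginary_expand[OF imaginary_frame[OF y] frame_inner(1-6)[OF y]]
  show "dder e1 y v = (dder e1 y v \<bullet> e2 y) *\<^sub>R e2 y - (dder e3 y v \<bullet> e1 y) *\<^sub>R e3 y"
    using ex[of "dder e1 y v"] unfolding i d o by simp
  show "dder e2 y v = - (dder e1 y v \<bullet> e2 y) *\<^sub>R e1 y + (dder e2 y v \<bullet> e3 y) *\<^sub>R e3 y"
    using ex[of "dder e2 y v"] unfolding i d o by simp
  show "dder e3 y v = (dder e3 y v \<bullet> e1 y) *\<^sub>R e1 y - (dder e2 y v \<bullet> e3 y) *\<^sub>R e2 y"
    using ex[of "dder e3 y v"] unfolding i d o by simp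
qed

text \<open>The Maurer-Cartan equation of the logarithmic differential of \<open>g\<close>, evaluated on the pair
  \<open>E1, E2\<close>. It is stated for a general map \<open>g\<close> because it is applied to both \<open>p\<close> and \<open>q\<close>, with the
  same bracket coefficients \<open>c1, c2, c3\<close>.\<close>

lemma maurer_cartan:
  assumes y: "y \<in> W" and g: "Cinf_on W g" "\<And>y. y \<in> W \<Longrightarrow> g y \<in> S3"
    and dg: "\<And>y. y \<in> W \<Longrightarrow> dder g y (E1 y) = k1 *\<^sub>R (g y \<otimes>\<^sub>H e1 y)"
      "\<And>y. y \<in> W \<Longrightarrow> dder g y (E2 y) = k2 *\<^sub>R (g y \<otimes>\<^sub>H e2 y)"
      "\<And>y. y \<in> W \<Longrightarrow> dder g y (E3 y) = k3 *\<^sub>R (g y \<otimes>\<^sub>H e3 y)"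
    and c: "dder E2 y (E1 y) - dder E1 y (E2 y) = c1 *\<^sub>R E1 y + c2 *\<^sub>R E2 y + c3 *\<^sub>R E3 y"
  shows "(2 * k1 * k2) *\<^sub>R e3 y + k2 *\<^sub>R dder e2 y (E1 y) - k1 *\<^sub>R dder e1 y (E2 y)
    = (c1 * k1) *\<^sub>R e1 y + (c2 * k2) *\<^sub>R e2 y + (c3 * k3) *\<^sub>R e3 y"
proof -
  have "dder (\<lambda>z. dder g z (E2 z)) y (E1 y) = dder (\<lambda>z. k2 *\<^sub>R (g z \<otimes>\<^sub>H e2 z)) y (E1 y)"
    by (rule dder_cong_on[OF W(1) y dg(2)])
  also have "\<dots> = k2 *\<^sub>R (g y \<otimes>\<^sub>H dder e2 y (E1 y) + (k1 *\<^sub>R (g y \<otimes>\<^sub>H e1 y)) \<otimes>\<^sub>H e2 y)"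
    by (subst dder_scaleR_const[OF Cinf_on_quat_mult[OF W(1) g(1) smooth_e(2)] y])
      (simp only: dder_mult[OF g(1) smooth_e(2) y] dg(1)[OF y])
  also have "\<dots> = g y \<otimes>\<^sub>H (k2 *\<^sub>R dder e2 y (E1 y) + (k1 * k2) *\<^sub>R e3 y)"
    by (simp add: qm_simps quat_mult_assoc frame_mult[OF y] algebra_simps)
  finally have 1: "dder (\<lambda>z. dder g z (E2 z)) y (E1 y) = \<dots>" .
  have "dder (\<lambda>z. dder g z (E1 z)) y (E2 y) = dder (\<lambda>z. k1 *\<^sub>R (g z \<otimes>\<^sub>H e1 z)) y (E2 y)"
    by (rule dder_cong_on[OF W(1) y dg(1)])
  also have "\<dots> = k1 *\<^sub>R (g y \<otimes>\<^sub>H dder e1 y (E2 y) + (k2 *\<^sub>R (g y \<otimes>\<^sub>H e2 y)) \<otimes>\<^sub>H e1 y)"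
    by (subst dder_scaleR_const[OF Cinf_on_quat_mult[OF W(1) g(1) smooth_e(1)] y])
      (simp only: dder_mult[OF g(1) smooth_e(1) y] dg(2)[OF y])
  also have "\<dots> = g y \<otimes>\<^sub>H (k1 *\<^sub>R dder e1 y (E2 y) - (k1 * k2) *\<^sub>R e3 y)"
    by (simp add: qm_simps quat_mult_assoc frame_mult[OF y] algebra_simps)
  finally have 2: "dder (\<lambda>z. dder g z (E1 z)) y (E2 y) = \<dots>" .
  have "dder g y (dder E2 y (E1 y) - dder E1 y (E2 y)) = c1 *\<^sub>R dder g y (E1 y) + c2 *\<^sub>R dder g y (E2 y) + c3 *\<^sub>R dder g y (E3 y)"
    unfolding c by (simp add: dder_linear_simps[OF g(1) y])
  also have "\<dots> = g y \<otimes>\<^sub>H ((c1 * k1) *\<^sub>R e1 y + (c2 * k2) *\<^sub>R e2 y + (c3 * k3) *\<^sub>R e3 y)"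
    by (simp add: dg[OF y] qm_simps)
  finally have "g y \<otimes>\<^sub>H (k2 *\<^sub>R dder e2 y (E1 y) + (k1 * k2) *\<^sub>R e3 y - (k1 *\<^sub>R dder e1 y (E2 y) - (k1 * k2) *\<^sub>R e3 y))
     = g y \<otimes>\<^sub>H ((c1 * k1) *\<^sub>R e1 y + (c2 * k2) *\<^sub>R e2 y + (c3 * k3) *\<^sub>R e3 y)"
    using dder_commutator[OF W(1) y g(1) smooth_E(1,2)] by (simp only: 1 2 qm.diff_right)
  then have "k2 *\<^sub>R dder e2 y (E1 y) + (k1 * k2) *\<^sub>R e3 y - (k1 *\<^sub>R dder e1 y (E2 y) - (k1 * k2) *\<^sub>R e3 y)
     = (c1 * k1) *\<^sub>R e1 y + (c2 * k2) *\<^sub>R e2 y + (c3 * k3) *\<^sub>R e3 y"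
    using g(2)[OF y] by (metis S3_cancel(4))
  moreover have "(2 * k1 * k2) *\<^sub>R e3 y = (k1 * k2) *\<^sub>R e3 y + (k1 * k2) *\<^sub>R e3 y"
    by (simp flip: scaleR_add_left)
  ultimately show ?thesis by (simp add: algebra_simps)
qed

lemma second_derivative:
  fixes g :: "real^3 \<Rightarrow> 'c::euclidean_space"
  assumes y: "y \<in> W" and g: "Cinf_on W g"
    and c: "dder E2 y (E1 y) - dder E1 y (E2 y) = c1 *\<^sub>R E1 y + c2 *\<^sub>R E2 y + c3 *\<^sub>R E3 y"
  shows "dder (\<lambda>z. dder g z (E2 z)) y (E1 y) - dder (\<lambda>z. dder g z (E1 z)) y (E2 y)
    = c1 *\<^sub>R dder g y (E1 y) + c2 *\<^sub>R dder g y (E2 y) + c3 *\<^sub>R dder g y (E3 y)"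
  using dder_commutator[OF W(1) y g smooth_E(1,2)] unfolding c
  by (simp add: dder_linear_simps[OF g y])

text \<open>The components along \<open>e1, e2, e3\<close> of the Maurer-Cartan equations of \<open>p\<close> and \<open>q\<close>. The
  equations for the other two pairs of legs follow by cyclic permutation.\<close>

lemma structure_equations:
  assumes y: "y \<in> W"
  obtains c1 c2 c3 where
    "dder E2 y (E1 y) - dder E1 y (E2 y) = c1 *\<^sub>R E1 y + c2 *\<^sub>R E2 y + c3 *\<^sub>R E3 y"
    "- a2 * (dder e1 y (E1 y) \<bullet> e2 y) = c1 * a1" "- b2 * (dder e1 y (E1 y) \<bullet> e2 y) = c1 * b1"
    "- a1 * (dder e1 y (E2 y) \<bullet> e2 y) = c2 * a2" "- b1 * (dder e1 y (E2 y) \<bullet> e2 y) = c2 * b2"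
    "2 * a1 * a2 + a2 * (dder e2 y (E1 y) \<bullet> e3 y) + a1 * (dder e3 y (E2 y) \<bullet> e1 y) = c3 * a3"
    "2 * b1 * b2 + b2 * (dder e2 y (E1 y) \<bullet> e3 y) + b1 * (dder e3 y (E2 y) \<bullet> e1 y) = c3 * b3"
proof -
  obtain c1 c2 c3 where c: "dder E2 y (E1 y) - dder E1 y (E2 y) = c1 *\<^sub>R E1 y + c2 *\<^sub>R E2 y + c3 *\<^sub>R E3 y"
    using span_E[OF y] by blast
  have k: "- k2 * (dder e1 y (E1 y) \<bullet> e2 y) = c1 * k1 \<and> - k1 * (dder e1 y (E2 y) \<bullet> e2 y) = c2 * k2
    \<and> 2 * k1 * k2 + k2 * (dder e2 y (E1 y) \<bullet> e3 y) + k1 * (dder e3 y (E2 y) \<bullet> e1 y) = c3 * k3"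
    if mc: "(2 * k1 * k2) *\<^sub>R e3 y + k2 *\<^sub>R dder e2 y (E1 y) - k1 *\<^sub>R dder e1 y (E2 y)
      = (c1 * k1) *\<^sub>R e1 y + (c2 * k2) *\<^sub>R e2 y + (c3 * k3) *\<^sub>R e3 y" for k1 k2 k3
  proof -
    let ?L = "(2 * k1 * k2) *\<^sub>R e3 y + k2 *\<^sub>R dder e2 y (E1 y) - k1 *\<^sub>R dder e1 y (E2 y)"
    define r s t u where "r = dder e1 y (E1 y) \<bullet> e2 y" and "s = dder e2 y (E1 y) \<bullet> e3 y"
      and "t = dder e1 y (E2 y) \<bullet> e2 y" and "u = dder e3 y (E2 y) \<bullet> e1 y"
    note defs = r_def s_def t_def u_def
    have X: "dder e2 y (E1 y) = - r *\<^sub>R e1 y + s *\<^sub>R e3 y" "dder e1 y (E2 y) = t *\<^sub>R e2 y - u *\<^sub>R e3 y"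
      using dder_frame(2)[OF y, of "E1 y"] dder_frame(1)[OF y, of "E2 y"] unfolding defs .
    have "?L = (- k2 * r) *\<^sub>R e1 y + (- k1 * t) *\<^sub>R e2 y + (2 * k1 * k2 + k2 * s + k1 * u) *\<^sub>R e3 y"
      unfolding X by (simp add: algebra_simps)
    then have "?L = (- k2 * (dder e1 y (E1 y) \<bullet> e2 y)) *\<^sub>R e1 y + (- k1 * (dder e1 y (E2 y) \<bullet> e2 y)) *\<^sub>R e2 y
      + (2 * k1 * k2 + k2 * (dder e2 y (E1 y) \<bullet> e3 y) + k1 * (dder e3 y (E2 y) \<bullet> e1 y)) *\<^sub>R e3 y"
      unfolding defs .
    then show ?thesis using frame_coeffs_eq[OF y] mc by metis
  qed
  show ?thesis
    using that[OF c] k[OF maurer_cartan[OF y smooth_pq(1) pq_S3(1) dp c]]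
      k[OF maurer_cartan[OF y smooth_pq(2) pq_S3(2) dq c]] by blast
qed

text \<open>If \<open>g\<close> and \<open>h\<close> take values in the unit sphere, \<open>v \<mapsto> g v h\<close> is an isometry, so the
  derivatives of \<open>u\<close> along the frame are orthogonal to each other and to \<open>u\<close>. All
  reparametrizations by the three-sphere are of this form.\<close>

lemma frame_map_local_diffeo:
  assumes u: "\<And>y. y \<in> W \<Longrightarrow> u y = g y \<otimes>\<^sub>H h y" and g: "Cinf_on W g" "\<And>y. y \<in> W \<Longrightarrow> g y \<in> S3"
    and h: "Cinf_on W h" "\<And>y. y \<in> W \<Longrightarrow> h y \<in> S3"
    and k: "k1 \<noteq> 0" "k2 \<noteq> 0" "k3 \<noteq> 0"
    and du: "\<And>y. y \<in> W \<Longrightarrow> dder u y (E1 y) = k1 *\<^sub>R (g y \<otimes>\<^sub>H e1 y \<otimes>\<^sub>H h y)"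
       "\<And>y. y \<in> W \<Longrightarrow> dder u y (E2 y) = k2 *\<^sub>R (g y \<otimes>\<^sub>H e2 y \<otimes>\<^sub>H h y)"
       "\<And>y. y \<in> W \<Longrightarrow> dder u y (E3 y) = k3 *\<^sub>R (g y \<otimes>\<^sub>H e3 y \<otimes>\<^sub>H h y)"
    and x0: "x0 \<in> W"
  obtains U where "x0 \<in> U" "U \<subseteq> W" "smooth_embedding_onto_open U S3 u"
proof -
  have "Cinf_on W (\<lambda>y. g y \<otimes>\<^sub>H h y)" by (intro Cinf_on_quat_mult W g h)
  then have us: "Cinf_on W u" by (rule Cinf_on_cong[OF W(1), rotated]) (simp add: u)
  have in_eq: "(g y \<otimes>\<^sub>H v \<otimes>\<^sub>H h y) \<bullet> (g y \<otimes>\<^sub>H w \<otimes>\<^sub>H h y) = v \<bullet> w" if "y \<in> W" for v w y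
    using g(2)[OF that] h(2)[OF that] by (simp add: inner_quat_mult_left inner_quat_mult_right S3_iff)
  have u': "u y = g y \<otimes>\<^sub>H quat_one \<otimes>\<^sub>H h y" if "y \<in> W" for y using u[OF that] by simp
  have uS: "u y \<in> S3" if "y \<in> W" for y using u[OF that] S3_mult g h that by simp
  have um: "u y \<bullet> (g y \<otimes>\<^sub>H v \<otimes>\<^sub>H h y) = 0" if "y \<in> W" "imaginary v" for v y
    using that in_eq[of y quat_one v] unfolding u'[OF that(1)] by (simp add: imaginary_iff_inner inner_commute)
  have ms: "Cinf_on W (\<lambda>y. g y \<otimes>\<^sub>H v y \<otimes>\<^sub>H h y)" if "Cinf_on W v" for v
    by (intro Cinf_on_quat_mult W g h that)
  show ?thesis
    by (rule local_diffeo_S3[OF W(1) x0 us uS smooth_E ms[OF smooth_e(1)] ms[OF smooth_e(2)] ms[OF smooth_e(3)] k du])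
      (auto simp: in_eq frame_inner um imaginary_frame intro: that)
qed

text \<open>The symmetries of the situation. Changing the sign of one leg of the tangent frame changes
  the signs of both its factors; a transposition of two legs reverses the orientation, which is
  restored by changing the sign of the whole frame.\<close>

lemma cyclic: "adapted_frame W p q a2 a3 a1 b2 b3 b1 e2 e3 e1 E2 E3 E1"
  by unfold_locales (use W smooths pq_S3 imaginary_frame frame_inner frame_mult dp dq ab in auto)

lemma exchange: "adapted_frame W q p b1 b2 b3 a1 a2 a3 e1 e2 e3 E1 E2 E3"
  by unfold_locales (use W smooths pq_S3 imaginary_frame frame_inner frame_mult dp dq ab in auto)

lemma flip: "adapted_frame W p q (- a1) a2 a3 (- b1) b2 b3 e1 e2 e3 (\<lambda>y. - E1 y) E2 E3"
  by unfold_locales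
    (use W smooths pq_S3 imaginary_frame frame_inner frame_mult dp dq ab Cinf_on_minus in
      \<open>auto simp: dder_linear_simps[OF smooth_pq(1)] dder_linear_simps[OF smooth_pq(2)]\<close>)

lemma transpose:
  "adapted_frame W p q a2 a1 a3 b2 b1 b3 (\<lambda>y. - e2 y) (\<lambda>y. - e1 y) (\<lambda>y. - e3 y)
     (\<lambda>y. - E2 y) (\<lambda>y. - E1 y) (\<lambda>y. - E3 y)"
proof -
  have "imaginary (- e1 y)" "imaginary (- e2 y)" if "y \<in> W" for y
    using frame(1,2)[OF that] by (simp_all add: imaginary_iff_inner)
  then show ?thesis
    by unfold_locales
      (simp_all add: W smooths pq_S3 Cinf_on_minus[OF W(1)] frame_inner frame_mult dp dq qm_simps
        dder_linear_simps[OF smooth_pq(1)] dder_linear_simps[OF smooth_pq(2)], use ab in auto)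
qed

lemma subset:
  assumes "open V" "convex V" "V \<subseteq> W"
  shows "adapted_frame V p q a1 a2 a3 b1 b2 b3 e1 e2 e3 E1 E2 E3"
proof -
  have V: "y \<in> W" if "y \<in> V" for y using that assms(3) by blast
  show ?thesis
    by unfold_locales
      (simp_all add: V assms(1,2) smooths[THEN Cinf_on_subset[OF _ assms(3)]] pq_S3
        imaginary_frame frame_inner frame_mult dp dq, use ab in auto)
qed

end

section \<open>Integration of the structure equations: the model immersions\<close>

text \<open>Local congruence at the point \<open>x\<close> for a map given in a chart domain \<open>W\<close> by its components
  \<open>p\<close> and \<open>q\<close>.\<close>

definition locally_model ::
  "(real^3) set \<Rightarrow> (real^3 \<Rightarrow> quat) \<Rightarrow> (real^3 \<Rightarrow> quat) \<Rightarrow> 'n::euclidean_space set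
     \<Rightarrow> ('n \<Rightarrow> quat \<times> quat) \<Rightarrow> real^3 \<Rightarrow> bool" where
  "locally_model W p q N f0 x \<longleftrightarrow>
     (\<exists>U u F. x \<in> U \<and> U \<subseteq> W \<and> smooth_embedding_onto_open U N u \<and> nk_isometry F \<and>
        (\<forall>y\<in>U. (p y, q y) = F (f0 (u y))))"

lemma locally_modelI:
  assumes "x \<in> U" "U \<subseteq> W" "smooth_embedding_onto_open U N u" "a \<in> S3" "b \<in> S3" "c \<in> S3"
    "\<And>y. y \<in> U \<Longrightarrow> p y = a \<otimes>\<^sub>H fst (f0 (u y)) \<otimes>\<^sub>H c" "\<And>y. y \<in> U \<Longrightarrow> q y = b \<otimes>\<^sub>H snd (f0 (u y)) \<otimes>\<^sub>H c"
  shows "locally_model W p q N f0 x"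
  unfolding locally_model_def
  by (intro exI[of _ U] exI[of _ u] exI[of _ "mult_isometry a b c"] conjI assms(1-3) nk_isometry_mult assms(4-6))
    (use assms(7,8) in \<open>auto simp: mult_isometry_def\<close>)

subsection \<open>Periodic phases\<close>

lemma Cinf_on_cos_sin: "Cinf_on UNIV (cos :: real \<Rightarrow> real)" "Cinf_on UNIV (sin :: real \<Rightarrow> real)"
proof -
  have "Ck_on k UNIV (cos :: real \<Rightarrow> real) \<and> Ck_on k UNIV (sin :: real \<Rightarrow> real)" for k
  proof (induction k)
    case 0
    show ?case by (auto intro!: continuous_intros)
  next
    case (Suc k)
    have c: "(cos has_derivative (\<lambda>v. v *\<^sub>R ((-1) *\<^sub>R sin x))) (at x)" for x :: real
      by (auto intro!: derivative_eq_intros)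
    have s: "(sin has_derivative (\<lambda>v. v *\<^sub>R cos x)) (at x)" for x :: real
      by (auto intro!: derivative_eq_intros)
    show ?case
      by (intro conjI Ck_on_SucI[OF open_UNIV c] Ck_on_SucI[OF open_UNIV s]
          Ck_on_bilinear[OF bounded_bilinear_scaleR] Ck_on_const) (use Suc in auto)
  qed
  then show "Cinf_on UNIV (cos :: real \<Rightarrow> real)" "Cinf_on UNIV (sin :: real \<Rightarrow> real)"
    by (auto simp: Cinf_on_def)
qed

lemma Cinf_on_cos: "open S \<Longrightarrow> Cinf_on S f \<Longrightarrow> Cinf_on S (\<lambda>x. cos (f x :: real))"
  and Cinf_on_sin: "open S \<Longrightarrow> Cinf_on S f \<Longrightarrow> Cinf_on S (\<lambda>x. sin (f x :: real))"
  by (erule (1) Cinf_on_compose[OF _ open_UNIV subset_UNIV _ Cinf_on_cos_sin(1)]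
      Cinf_on_compose[OF _ open_UNIV subset_UNIV _ Cinf_on_cos_sin(2)])+

text \<open>The one-parameter group \<open>exp (r n)\<close> of a unit imaginary quaternion \<open>n\<close>.\<close>

definition qexp :: "quat \<Rightarrow> real \<Rightarrow> quat" where
  "qexp n r = cos r *\<^sub>R quat_one + sin r *\<^sub>R n"

lemma qexp_add:
  assumes "imaginary n" "n \<bullet> n = 1"
  shows "qexp n r \<otimes>\<^sub>H qexp n s = qexp n (r + s)"
  using imaginary_unit_square[OF assms]
  by (simp add: qexp_def qm_simps cos_add sin_add algebra_simps)

lemma qexp_0 [simp]: "qexp n 0 = quat_one" by (simp add: qexp_def)

lemma qexp_cnj: "imaginary n \<Longrightarrow> quat_cnj (qexp n r) = qexp n (- r)"
  using bounded_linear.linear[OF bounded_linear_quat_cnj]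
  by (simp add: qexp_def linear_add linear_scale quat_cnj_imaginary) (simp add: quat_comp)

lemma qexp_S3: "imaginary n \<Longrightarrow> n \<bullet> n = 1 \<Longrightarrow> qexp n r \<in> S3"
  by (simp add: S3_iff qexp_def inner_add_left inner_add_right imaginary_iff_inner inner_commute
      S3_one[unfolded S3_iff] flip: power2_eq_square)

lemma qexp_conj:
  "h \<in> S3 \<Longrightarrow> qexp (h \<otimes>\<^sub>H n \<otimes>\<^sub>H quat_cnj h) r = h \<otimes>\<^sub>H qexp n r \<otimes>\<^sub>H quat_cnj h"
  by (simp add: qexp_def qm_simps quat_mult_assoc)

lemma qexp_commute_n: "qexp n r \<otimes>\<^sub>H n = n \<otimes>\<^sub>H qexp n r"
  by (simp add: qexp_def qm_simps)

lemma qexp_anticommute: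
  "m \<otimes>\<^sub>H n = - (n \<otimes>\<^sub>H m) \<Longrightarrow> m \<otimes>\<^sub>H qexp n r = qexp n (- r) \<otimes>\<^sub>H m"
  by (simp add: qexp_def qm_simps)

lemma Cinf_on_qexp: "open S \<Longrightarrow> Cinf_on S f \<Longrightarrow> Cinf_on S (\<lambda>x. qexp n (f x))"
  unfolding qexp_def by (intro Cinf_on_add Cinf_on_scaleR Cinf_on_cos Cinf_on_sin Cinf_on_const)

lemma dder_qexp:
  assumes "Cinf_on S f" "x \<in> S" "imaginary n" "n \<bullet> n = 1"
  shows "dder (\<lambda>x. qexp n (f x)) x v = dder f x v *\<^sub>R (n \<otimes>\<^sub>H qexp n (f x))"
proof -
  have "((\<lambda>x. qexp n (f x)) has_derivative
     (\<lambda>v. (- sin (f x) * dder f x v) *\<^sub>R quat_one + (cos (f x) * dder f x v) *\<^sub>R n)) (at x)"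
    unfolding qexp_def
    by (rule has_derivative_eq_rhs, (rule derivative_intros Cinf_on_derivative[OF assms(1,2)])+)
      (simp add: fun_eq_iff mult_ac)
  then show ?thesis
    by (simp add: dder_eqI qexp_def qm_simps imaginary_unit_square[OF assms(3,4)] algebra_simps)
qed

context adapted_frame
begin

text \<open>A map whose logarithmic differential points in the fixed direction \<open>n\<close> stays in the circle
  \<open>g(x0) exp(r n)\<close>. Its angle is taken from the arc tangent of the two components of
  \<open>w = g(x0)\<inverse> g\<close>, on a ball where the real part of \<open>w\<close> is positive; then \<open>w exp(-r n)\<close> has
  vanishing derivative.\<close>

lemma phase_function:
  assumes g: "Cinf_on W g" "\<And>y. y \<in> W \<Longrightarrow> g y \<in> S3" and n: "imaginary n" "n \<bullet> n = 1"
    and dg: "\<And>y. y \<in> W \<Longrightarrow> dder g y (E1 y) = k1 *\<^sub>R (g y \<otimes>\<^sub>H n)"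
      "\<And>y. y \<in> W \<Longrightarrow> dder g y (E2 y) = k2 *\<^sub>R (g y \<otimes>\<^sub>H n)"
      "\<And>y. y \<in> W \<Longrightarrow> dder g y (E3 y) = k3 *\<^sub>R (g y \<otimes>\<^sub>H n)"
    and x0: "x0 \<in> W"
  obtains V r where "open V" "convex V" "x0 \<in> V" "V \<subseteq> W" "Cinf_on V r" "r x0 = 0"
    "\<And>y. y \<in> V \<Longrightarrow> dder r y (E1 y) = k1" "\<And>y. y \<in> V \<Longrightarrow> dder r y (E2 y) = k2"
    "\<And>y. y \<in> V \<Longrightarrow> dder r y (E3 y) = k3" "\<And>y. y \<in> V \<Longrightarrow> g y = g x0 \<otimes>\<^sub>H qexp n (r y)"
proof -
  define w where "w y = quat_cnj (g x0) \<otimes>\<^sub>H g y" for y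
  define w0 w1 where "w0 y = w y \<bullet> quat_one" and "w1 y = w y \<bullet> n" for y
  have ws: "Cinf_on W w" unfolding w_def by (intro Cinf_on_quat_mult W Cinf_on_const g)
  have w0s: "Cinf_on W w0" and w1s: "Cinf_on W w1"
    unfolding w0_def w1_def by (intro Cinf_on_inner W ws Cinf_on_const)+
  have gx0: "g x0 \<in> S3" by (rule g(2)[OF x0])
  have w_x0: "w x0 = quat_one" by (simp add: w_def gx0)
  have dw: "dder w y v = quat_cnj (g x0) \<otimes>\<^sub>H dder g y v" if "y \<in> W" for y v
    unfolding w_def by (simp add: dder_mult[OF Cinf_on_const g(1) that] qm_simps)
  have dwk: "dder w y v = k *\<^sub>R (w y \<otimes>\<^sub>H n)" if "y \<in> W" "dder g y v = k *\<^sub>R (g y \<otimes>\<^sub>H n)" for y v k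
    by (simp add: dw[OF that(1)] that(2) qm_simps w_def quat_mult_assoc)
  have dw01: "dder w0 y v = dder w y v \<bullet> quat_one" "dder w1 y v = dder w y v \<bullet> n" if "y \<in> W" for y v
    unfolding w0_def w1_def by (simp_all add: dder_inner[OF ws Cinf_on_const that])
  have wn: "(z \<otimes>\<^sub>H n) \<bullet> quat_one = - (z \<bullet> n)" "(z \<otimes>\<^sub>H n) \<bullet> n = z \<bullet> quat_one" for z
    using inner_quat_mult_right[of z n "- n"] inner_quat_mult_right[of z n quat_one] n imaginary_unit_square[OF n]
    by (simp_all add: qm_simps)
  obtain d where d: "d > 0" "ball x0 d \<subseteq> {y \<in> W. w0 y > 0}"
  proof -
    have "{y \<in> W. w0 y > 0} = W \<inter> (w0 -` {0<..})" by auto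
    then have "open {y \<in> W. w0 y > 0}"
      using continuous_open_preimage[OF Cinf_on_continuous[OF w0s] W(1) open_greaterThan] by simp
    moreover have "x0 \<in> {y \<in> W. w0 y > 0}" using x0 S3_one by (simp add: w0_def w_x0 S3_iff)
    ultimately show ?thesis using that openE by blast
  qed
  define V where "V = ball x0 d"
  have V: "open V" "convex V" "x0 \<in> V" "V \<subseteq> W" and w0pos: "\<And>y. y \<in> V \<Longrightarrow> w0 y > 0"
    using d by (auto simp: V_def)
  interpret V: adapted_frame V p q a1 a2 a3 b1 b2 b3 e1 e2 e3 E1 E2 E3
    using V by (intro subset)
  define r where "r y = arctan (w1 y * inverse (w0 y))" for y
  define r' where "r' y v = inverse (1 + (w1 y * inverse (w0 y)) * (w1 y * inverse (w0 y)))
      * (dder w1 y v * inverse (w0 y) - w1 y * (inverse (w0 y) * dder w0 y v * inverse (w0 y)))" for y v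
  have rder: "(r has_derivative r' y) (at y)" if "y \<in> V" for y
  proof -
    have "y \<in> W" "w0 y \<noteq> 0" using that V w0pos by fastforce+
    note D = Cinf_on_derivative[OF w0s \<open>y \<in> W\<close>] Cinf_on_derivative[OF w1s \<open>y \<in> W\<close>]
    have "((\<lambda>y. w1 y * inverse (w0 y)) has_derivative
       (\<lambda>v. dder w1 y v * inverse (w0 y) - w1 y * (inverse (w0 y) * dder w0 y v * inverse (w0 y)))) (at y)"
      by (rule has_derivative_eq_rhs, rule has_derivative_mult[OF D(2) Deriv.has_derivative_inverse[OF \<open>w0 y \<noteq> 0\<close> D(1)]])
        (simp add: fun_eq_iff)
    from has_derivative_compose[OF this, of arctan] show ?thesis
      unfolding r_def[abs_def] r'_def[abs_def]
      using DERIV_arctan[of "w1 y * inverse (w0 y)"]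
      by (simp add: has_field_derivative_def power2_eq_square)
  qed
  have pos: "1 + z * z \<noteq> (0::real)" for z by (smt (verit) zero_le_square)
  have rs: "Cinf_on V r"
  proof (rule Cinf_on_deriv_I[OF V(1) rder])
    note s = Cinf_on_subset[OF w0s V(4)] Cinf_on_subset[OF w1s V(4)]
    fix v show "Cinf_on V (\<lambda>y. r' y v)" unfolding r'_def
      by (intro Cinf_on_mult Cinf_on_add Cinf_on_diff Cinf_on_inverse Cinf_on_const V Cinf_on_dder s)
        (use pos w0pos in fastforce)+
  qed
  have dr: "dder r y v = k" if "y \<in> V" "dder g y v = k *\<^sub>R (g y \<otimes>\<^sub>H n)" for y v k
  proof -
    have y: "y \<in> W" "w0 y > 0" using that V w0pos by auto
    have 0: "dder w0 y v = - k * w1 y" "dder w1 y v = k * w0 y"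
      by (simp_all add: dw01[OF y(1)] dwk[OF y(1) that(2)] wn) (simp_all add: w0_def w1_def)
    let ?t = "w1 y * inverse (w0 y)"
    have "k * w0 y * inverse (w0 y) - w1 y * (inverse (w0 y) * (- k * w1 y) * inverse (w0 y)) = (1 + ?t * ?t) * k"
      using y(2) by (simp add: field_simps)
    then have "r' y v = k" unfolding r'_def 0 using pos[of ?t]
      by (simp flip: mult.assoc)
    then show ?thesis using dder_eqI[OF rder[OF that(1)]] by simp
  qed
  define z where "z y = w y \<otimes>\<^sub>H qexp n (- r y)" for y
  have ms: "Cinf_on V (\<lambda>y. - r y)" by (rule Cinf_on_minus[OF V(1) rs])
  have zs: "Cinf_on V z" unfolding z_def
    by (intro Cinf_on_quat_mult Cinf_on_subset[OF ws V(4)] V Cinf_on_qexp ms)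
  have dz: "dder z y v = 0" if "y \<in> V" "dder g y v = k *\<^sub>R (g y \<otimes>\<^sub>H n)" for y v k
  proof -
    have y: "y \<in> W" using that V by auto
    have "dder z y v = w y \<otimes>\<^sub>H (- k *\<^sub>R (n \<otimes>\<^sub>H qexp n (- r y))) + k *\<^sub>R (w y \<otimes>\<^sub>H n) \<otimes>\<^sub>H qexp n (- r y)"
      unfolding z_def
      by (simp add: dder_mult[OF Cinf_on_subset[OF ws V(4)] Cinf_on_qexp[OF V(1) ms] that(1)]
        dder_qexp[OF ms that(1) n] dder_minus[OF rs that(1)] dr[OF that] dwk[OF y that(2)])
    then show ?thesis by (simp add: qm_simps quat_mult_assoc)
  qed
  obtain c where "\<And>y. y \<in> V \<Longrightarrow> z y = c"
    using V.constant_if_dder_zero[OF zs] dz[OF _ dg(1)] dz[OF _ dg(2)] dz[OF _ dg(3)] V(4) by blast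
  moreover have r0: "r x0 = 0" using n by (simp add: r_def w1_def w_x0 imaginary_iff_inner inner_commute)
  ultimately have z1: "z y = quat_one" if "y \<in> V" for y
    using that V(3) by (metis z_def w_x0 qexp_0 quat_one_right minus_zero)
  have "g y = g x0 \<otimes>\<^sub>H qexp n (r y)" if "y \<in> V" for y
  proof -
    have "w y = w y \<otimes>\<^sub>H (qexp n (- r y) \<otimes>\<^sub>H qexp n (r y))" by (simp add: qexp_add[OF n])
    also have "\<dots> = qexp n (r y)" using z1[OF that] by (simp add: z_def flip: quat_mult_assoc)
    finally show ?thesis using gx0 by (metis w_def S3_cancel(3))
  qed
  then show ?thesis using that[OF V rs r0] dr dg V(4) by blast
qed

subsection \<open>Totally geodesic models\<close>

text \<open>If all \<open>bi\<close> vanish then \<open>q\<close> is constant and \<open>p\<close> is a local diffeomorphism onto the sphere.\<close>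

lemma model_second_constant:
  assumes "b1 = 0" "b2 = 0" "b3 = 0" and x0: "x0 \<in> W"
  shows "locally_model W p q S3 (\<lambda>u. (u, quat_one)) x0"
proof -
  obtain c where c: "\<And>y. y \<in> W \<Longrightarrow> q y = c"
    using constant_if_dder_zero[OF smooth_pq(2)] dq assms by force
  obtain U where U: "x0 \<in> U" "U \<subseteq> W" "smooth_embedding_onto_open U S3 p"
    by (rule frame_map_local_diffeo[of p p "\<lambda>_. quat_one" a1 a2 a3 x0])
      (use ab assms smooth_pq pq_S3 dp S3_one in auto)
  show ?thesis
    by (rule locally_modelI[OF U S3_one _ S3_one]) (use c pq_S3(2) x0 U(2) in auto)
qed

text \<open>If \<open>p\<close> and \<open>q\<close> have the same logarithmic differential, then \<open>q p\<inverse>\<close> is constant.\<close>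

lemma model_diagonal:
  assumes "a1 = b1" "a2 = b2" "a3 = b3" and x0: "x0 \<in> W"
  shows "locally_model W p q S3 (\<lambda>u. (u, u)) x0"
proof -
  let ?g = "\<lambda>y. q y \<otimes>\<^sub>H quat_cnj (p y)"
  have cs: "Cinf_on W (\<lambda>y. quat_cnj (p y))" by (rule Cinf_on_quat_cnj[OF W(1) smooth_pq(1)])
  have "dder ?g y v = 0" if y: "y \<in> W" and v: "dder p y v = k *\<^sub>R (p y \<otimes>\<^sub>H e)" "dder q y v = k *\<^sub>R (q y \<otimes>\<^sub>H e)" "imaginary e" for y v k e
    using v(3)
    by (simp add: dder_mult[OF smooth_pq(2) cs y] dder_linear[OF bounded_linear_quat_cnj smooth_pq(1) y] v(1,2)
      linear_scale[OF bounded_linear.linear[OF bounded_linear_quat_cnj]] quat_cnj_mult quat_cnj_imaginary qm_simps quat_mult_assoc)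
  then obtain c where c: "\<And>y. y \<in> W \<Longrightarrow> ?g y = c"
    using constant_if_dder_zero[OF Cinf_on_quat_mult[OF W(1) smooth_pq(2) cs]] dp dq imaginary_frame assms(1-3)
    by (smt (verit, best))
  have q: "q y = c \<otimes>\<^sub>H p y" if "y \<in> W" for y
    using c[OF that, symmetric] pq_S3[OF that] by (simp add: quat_mult_assoc)
  have "c \<in> S3" using c[OF x0] pq_S3[OF x0] S3_mult S3_cnj by metis
  obtain U where U: "x0 \<in> U" "U \<subseteq> W" "smooth_embedding_onto_open U S3 p"
    by (rule frame_map_local_diffeo[of p p "\<lambda>_. quat_one" a1 a2 a3 x0])
      (use ab assms smooth_pq pq_S3 dp S3_one in auto)
  show ?thesis
    by (rule locally_modelI[OF U S3_one \<open>c \<in> S3\<close> S3_one]) (use q U(2) in auto)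
qed

text \<open>The direction \<open>n\<close> of \<open>e3\<close> is constant and anticommutes with \<open>e1\<close> and \<open>e2\<close>, where the two
  logarithmic differentials are opposite, while it commutes with \<open>e3\<close>, where they agree. Hence
  \<open>q n p\<inverse>\<close> is constant, and a rotation of \<open>n\<close> to \<open>i\<close> gives the model.\<close>

lemma model_right_translate:
  assumes "b1 = - a1" "b2 = - a2" "b3 = a3"
    and de3: "\<And>y. y \<in> W \<Longrightarrow> dder e3 y (E1 y) = 0" "\<And>y. y \<in> W \<Longrightarrow> dder e3 y (E2 y) = 0"
      "\<And>y. y \<in> W \<Longrightarrow> dder e3 y (E3 y) = 0"
    and x0: "x0 \<in> W"
  shows "locally_model W p q S3 (\<lambda>u. (u, u \<otimes>\<^sub>H quat_i)) x0"
proof -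
  obtain n where n: "\<And>y. y \<in> W \<Longrightarrow> e3 y = n" using constant_if_dder_zero[OF smooth_e(3) de3] by blast
  have n1: "imaginary n" "n \<bullet> n = 1" using n[OF x0] imaginary_frame(3)[OF x0] frame_inner(3)[OF x0] by auto
  obtain h where h: "h \<in> S3" "n = h \<otimes>\<^sub>H quat_i \<otimes>\<^sub>H quat_cnj h" using unit_imaginary_conjugate_i[OF n1] by blast
  let ?g = "\<lambda>y. q y \<otimes>\<^sub>H (n \<otimes>\<^sub>H quat_cnj (p y))"
  have cs: "Cinf_on W (\<lambda>y. quat_cnj (p y))" by (rule Cinf_on_quat_cnj[OF W(1) smooth_pq(1)])
  have ncs: "Cinf_on W (\<lambda>y. n \<otimes>\<^sub>H quat_cnj (p y))" by (rule Cinf_on_quat_mult[OF W(1) Cinf_on_const cs])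
  have dgen: "dder ?g y v = 0"
    if y: "y \<in> W" and v: "dder p y v = k *\<^sub>R (p y \<otimes>\<^sub>H e)" "dder q y v = l *\<^sub>R (q y \<otimes>\<^sub>H e)" "imaginary e"
      "l *\<^sub>R (e \<otimes>\<^sub>H n) = k *\<^sub>R (n \<otimes>\<^sub>H e)" for y v k l e
  proof -
    have "dder ?g y v = q y \<otimes>\<^sub>H (l *\<^sub>R (e \<otimes>\<^sub>H n)  - k *\<^sub>R (n \<otimes>\<^sub>H e)) \<otimes>\<^sub>H quat_cnj (p y)"
      using v(3)
      by (simp add: dder_mult[OF smooth_pq(2) ncs y] dder_mult[OF Cinf_on_const cs y]
        dder_linear[OF bounded_linear_quat_cnj smooth_pq(1) y] v(1,2)
        linear_scale[OF bounded_linear.linear[OF bounded_linear_quat_cnj]] quat_cnj_mult quat_cnj_imaginary qm_simps quat_mult_assoc)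
    then show ?thesis by (simp add: v(4) qm_simps)
  qed
  have dgz: "dder ?g y (E1 y) = 0" "dder ?g y (E2 y) = 0" "dder ?g y (E3 y) = 0" if y: "y \<in> W" for y
    by (rule dgen[OF y dp(1)[OF y] dq(1)[OF y] imaginary_frame(1)[OF y]]
          dgen[OF y dp(2)[OF y] dq(2)[OF y] imaginary_frame(2)[OF y]]
          dgen[OF y dp(3)[OF y] dq(3)[OF y] imaginary_frame(3)[OF y]],
        simp add: assms(1-3) frame_mult[OF y] flip: n[OF y])+
  obtain c where c: "\<And>y. y \<in> W \<Longrightarrow> ?g y = c"
    using constant_if_dder_zero[OF Cinf_on_quat_mult[OF W(1) smooth_pq(2) ncs] dgz] by blast
  have nS: "n \<in> S3" using n1 by (simp add: S3_iff)
  have cS: "c \<in> S3" using c[OF x0] pq_S3[OF x0] nS S3_mult S3_cnj by metis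
  have q: "q y = - c \<otimes>\<^sub>H (p y \<otimes>\<^sub>H n)" if "y \<in> W" for y
    using c[OF that, symmetric] pq_S3[OF that] imaginary_unit_square[OF n1]
    by (simp add: quat_mult_assoc qm_simps)
  let ?u = "\<lambda>y. p y \<otimes>\<^sub>H h"
  have du: "dder ?u y v = dder p y v \<otimes>\<^sub>H h" if "y \<in> W" for y v
    by (simp add: dder_mult[OF smooth_pq(1) Cinf_on_const that] qm_simps)
  obtain U where U: "x0 \<in> U" "U \<subseteq> W" "smooth_embedding_onto_open U S3 ?u"
    by (rule frame_map_local_diffeo[of ?u p "\<lambda>_. h" a1 a2 a3 x0])
      (use ab assms smooth_pq pq_S3 h(1) x0 in \<open>auto simp: du dp qm_simps\<close>)
  show ?thesis
    by (rule locally_modelI[OF U S3_one S3_minus[OF cS] S3_cnj[OF h(1)]])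
      (use q U(2) h in \<open>auto simp: quat_mult_assoc\<close>)
qed

text \<open>The given connection makes both \<open>p e3 p\<inverse>\<close> and \<open>q e3\<close> constant, so \<open>q\<close> is, up to a constant
  factor, the conjugate of a fixed imaginary quaternion by \<open>p\<inverse>\<close>. The conclusion is not yet
  formulated as local congruence, because it also serves for the mirror image with \<open>p\<close> and \<open>q\<close>
  exchanged.\<close>

lemma model_conjugation:
  assumes "b1 = 2 * a1" "b2 = 2 * a2" "b3 = 0"
    and de3: "\<And>y. y \<in> W \<Longrightarrow> dder e3 y (E1 y) = (2 * a1) *\<^sub>R e2 y"
      "\<And>y. y \<in> W \<Longrightarrow> dder e3 y (E2 y) = (- 2 * a2) *\<^sub>R e1 y" "\<And>y. y \<in> W \<Longrightarrow> dder e3 y (E3 y) = 0"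
    and x0: "x0 \<in> W"
  obtains U u c h where "x0 \<in> U" "U \<subseteq> W" "smooth_embedding_onto_open U S3 u" "c \<in> S3" "h \<in> S3"
    "\<And>y. y \<in> U \<Longrightarrow> p y = h \<otimes>\<^sub>H quat_inv (u y)" "\<And>y. y \<in> U \<Longrightarrow> q y = c \<otimes>\<^sub>H (u y \<otimes>\<^sub>H quat_i \<otimes>\<^sub>H quat_inv (u y))"
proof -
  have cs: "Cinf_on W (\<lambda>y. quat_cnj (p y))" by (rule Cinf_on_quat_cnj[OF W(1) smooth_pq(1)])
  have ecs: "Cinf_on W (\<lambda>y. e3 y \<otimes>\<^sub>H quat_cnj (p y))" by (rule Cinf_on_quat_mult[OF W(1) smooth_e(3) cs])
  let ?m = "\<lambda>y. p y \<otimes>\<^sub>H (e3 y \<otimes>\<^sub>H quat_cnj (p y))" and ?g = "\<lambda>y. q y \<otimes>\<^sub>H e3 y"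
  have dm: "dder ?m y v = p y \<otimes>\<^sub>H (k *\<^sub>R (e \<otimes>\<^sub>H e3 y) + dder e3 y v - k *\<^sub>R (e3 y \<otimes>\<^sub>H e)) \<otimes>\<^sub>H quat_cnj (p y)"
    if y: "y \<in> W" and v: "dder p y v = k *\<^sub>R (p y \<otimes>\<^sub>H e)" "imaginary e" for y v k e
    using v(2)
    by (simp add: dder_mult[OF smooth_pq(1) ecs y] dder_mult[OF smooth_e(3) cs y]
        dder_linear[OF bounded_linear_quat_cnj smooth_pq(1) y] v(1)
        linear_scale[OF bounded_linear.linear[OF bounded_linear_quat_cnj]] quat_cnj_mult quat_cnj_imaginary qm_simps quat_mult_assoc)
  have two: "(2 * k) *\<^sub>R v = k *\<^sub>R v + k *\<^sub>R v" for k and v :: quat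
    by (simp flip: scaleR_add_left)
  have dmz: "dder ?m y (E1 y) = 0" "dder ?m y (E2 y) = 0" "dder ?m y (E3 y) = 0" if y: "y \<in> W" for y
    by (simp_all add: dm[OF y dp(1)[OF y] imaginary_frame(1)[OF y]] dm[OF y dp(2)[OF y] imaginary_frame(2)[OF y]]
      dm[OF y dp(3)[OF y] imaginary_frame(3)[OF y]] de3[OF y] frame_mult[OF y] qm_simps two)
  obtain n where n: "\<And>y. y \<in> W \<Longrightarrow> ?m y = n"
    using constant_if_dder_zero[OF Cinf_on_quat_mult[OF W(1) smooth_pq(1) ecs] dmz] by blast
  have dg: "dder ?g y (E1 y) = 0" "dder ?g y (E2 y) = 0" "dder ?g y (E3 y) = 0" if y: "y \<in> W" for y
    by (simp_all add: dder_mult[OF smooth_pq(2) smooth_e(3) y] dq[OF y] de3[OF y] assms(1-3) qm_simps quat_mult_assoc frame_mult[OF y])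
  obtain c where c: "\<And>y. y \<in> W \<Longrightarrow> ?g y = c"
    using constant_if_dder_zero[OF Cinf_on_quat_mult[OF W(1) smooth_pq(2) smooth_e(3)] dg] by blast
  have cS: "c \<in> S3" using c[OF x0] pq_S3[OF x0] S3_frame[OF x0] S3_mult by metis
  have e3: "e3 y = quat_cnj (p y) \<otimes>\<^sub>H n \<otimes>\<^sub>H p y" if "y \<in> W" for y
    using n[OF that, symmetric] pq_S3[OF that] by (simp add: quat_mult_assoc)
  have q: "q y = - c \<otimes>\<^sub>H e3 y" if "y \<in> W" for y
    using c[OF that, symmetric] frame_mult[OF that] by (simp add: quat_mult_assoc qm_simps)
  have n1: "n \<in> S3" using n[OF x0] pq_S3[OF x0] S3_frame[OF x0] S3_mult S3_cnj by metis
  have n0: "imaginary n"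
    using inner_quat_mult_left[of "p x0" "e3 x0 \<otimes>\<^sub>H quat_cnj (p x0)" "quat_cnj (p x0)"] pq_S3[OF x0]
      inner_quat_mult_right[of "e3 x0" "quat_cnj (p x0)" quat_one] imaginary_frame(3)[OF x0]
    by (simp add: n[OF x0] imaginary_iff_inner)
  obtain h where h: "h \<in> S3" "n = h \<otimes>\<^sub>H quat_i \<otimes>\<^sub>H quat_cnj h"
    using unit_imaginary_conjugate_i[OF n0] n1 by (metis S3_iff)
  let ?u = "\<lambda>y. quat_cnj (p y) \<otimes>\<^sub>H h"
  have us: "Cinf_on W ?u" by (rule Cinf_on_quat_mult[OF W(1) cs Cinf_on_const])
  have uS: "y \<in> W \<Longrightarrow> ?u y \<in> S3" for y using pq_S3 S3_cnj S3_mult h(1) by blast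
  have du: "dder ?u y v = quat_cnj (dder p y v) \<otimes>\<^sub>H h" if "y \<in> W" for y v
    by (simp add: dder_mult[OF cs Cinf_on_const that] qm_simps dder_linear[OF bounded_linear_quat_cnj smooth_pq(1) that])
  obtain U where U: "x0 \<in> U" "U \<subseteq> W" "smooth_embedding_onto_open U S3 ?u"
    by (rule frame_map_local_diffeo[of ?u "\<lambda>_. quat_one" ?u "- a1" "- a2" "- a3" x0])
      (use ab assms us uS S3_one x0 in \<open>auto simp: du dp qm_simps quat_cnj_mult imaginary_frame quat_cnj_imaginary quat_mult_assoc
         linear_scale[OF bounded_linear.linear[OF bounded_linear_quat_cnj]]\<close>)
  have "p y = h \<otimes>\<^sub>H quat_inv (?u y)" "q y = - c \<otimes>\<^sub>H (?u y \<otimes>\<^sub>H quat_i \<otimes>\<^sub>H quat_inv (?u y))" if "y \<in> U" for y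
    using that U(2) q e3 h by (auto simp: quat_inv_S3[OF uS] quat_cnj_mult quat_mult_assoc)
  then show ?thesis using that[OF U S3_minus[OF cS] h(1)] by blast
qed

end

subsection \<open>The models with diagonal connection\<close>

text \<open>Sending \<open>i, j, k\<close> to the oriented orthonormal frame \<open>f2, f3, f1\<close> extends to a homomorphism
  of the quaternion group. The sum \<open>s\<close> of the products of the images with the inverses, over the
  four elements \<open>1, i, j, k\<close>, intertwines the two copies of the group, because multiplication
  permutes the summands. It equals \<open>4\<close> at the standard frame, so after normalization it lifts
  every frame close to that one.\<close>

lemma frame_lift_identities:
  assumes "imaginary f2" "imaginary f3" "f2 \<bullet> f2 = 1" "f3 \<bullet> f3 = 1" "f2 \<bullet> f3 = 0" "f2 \<otimes>\<^sub>H f3 = f1"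
  defines "s \<equiv> quat_one - f2 \<otimes>\<^sub>H quat_i - f3 \<otimes>\<^sub>H quat_j - f1 \<otimes>\<^sub>H quat_k"
  shows "f2 \<otimes>\<^sub>H s = s \<otimes>\<^sub>H quat_i" "f3 \<otimes>\<^sub>H s = s \<otimes>\<^sub>H quat_j"
proof -
  note f = oriented_frame_products[OF assms(1-6)] assms(6)
  have ijk: "quat_i \<otimes>\<^sub>H quat_i = - quat_one" "quat_j \<otimes>\<^sub>H quat_j = - quat_one"
    "quat_i \<otimes>\<^sub>H quat_j = quat_k" "quat_j \<otimes>\<^sub>H quat_i = - quat_k"
    "quat_k \<otimes>\<^sub>H quat_i = quat_j" "quat_k \<otimes>\<^sub>H quat_j = - quat_i"
    by (simp_all add: quat_comp)
  show "f2 \<otimes>\<^sub>H s = s \<otimes>\<^sub>H quat_i" "f3 \<otimes>\<^sub>H s = s \<otimes>\<^sub>H quat_j"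
    unfolding s_def qm_simps by (simp_all add: quat_mult_assoc ijk qm_simps) (simp_all add: f qm_simps flip: quat_mult_assoc)
qed

context adapted_frame
begin

text \<open>Along \<open>Ei\<close> the frame rotates about \<open>ei\<close> with the constant speed \<open>wi\<close>.\<close>

definition diagonal_connection :: "real \<Rightarrow> real \<Rightarrow> real \<Rightarrow> bool" where
  "diagonal_connection w1 w2 w3 \<longleftrightarrow> (\<forall>y\<in>W.
     dder e1 y (E1 y) = 0 \<and> dder e2 y (E1 y) = w1 *\<^sub>R e3 y \<and> dder e3 y (E1 y) = - w1 *\<^sub>R e2 y \<and>
     dder e1 y (E2 y) = - w2 *\<^sub>R e3 y \<and> dder e2 y (E2 y) = 0 \<and> dder e3 y (E2 y) = w2 *\<^sub>R e1 y \<and>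
     dder e1 y (E3 y) = w3 *\<^sub>R e2 y \<and> dder e2 y (E3 y) = - w3 *\<^sub>R e1 y \<and> dder e3 y (E3 y) = 0)"

lemma dder_frame_diagonal:
  assumes "diagonal_connection w1 w2 w3" "y \<in> W"
  shows "dder e1 y (E1 y) = 0" "dder e2 y (E1 y) = w1 *\<^sub>R e3 y" "dder e3 y (E1 y) = - w1 *\<^sub>R e2 y"
     "dder e1 y (E2 y) = - w2 *\<^sub>R e3 y" "dder e2 y (E2 y) = 0" "dder e3 y (E2 y) = w2 *\<^sub>R e1 y"
     "dder e1 y (E3 y) = w3 *\<^sub>R e2 y" "dder e2 y (E3 y) = - w3 *\<^sub>R e1 y" "dder e3 y (E3 y) = 0"
  using assms unfolding diagonal_connection_def by blast+

text \<open>A rotating frame lifts locally to the double cover of the rotation group: it is the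
  conjugate of \<open>i, j\<close> by a smooth unit quaternion \<open>u\<close>.\<close>

lemma frame_lift:
  assumes x0: "x0 \<in> W"
  obtains V u where "open V" "convex V" "x0 \<in> V" "V \<subseteq> W" "Cinf_on V u" "\<And>y. y \<in> V \<Longrightarrow> u y \<in> S3"
    "\<And>y. y \<in> V \<Longrightarrow> e2 y \<otimes>\<^sub>H u y = u y \<otimes>\<^sub>H quat_i" "\<And>y. y \<in> V \<Longrightarrow> e3 y \<otimes>\<^sub>H u y = u y \<otimes>\<^sub>H quat_j"
proof -
  obtain h where h: "h \<in> S3" "e2 x0 = h \<otimes>\<^sub>H quat_i \<otimes>\<^sub>H quat_cnj h" "e3 x0 = h \<otimes>\<^sub>H quat_j \<otimes>\<^sub>H quat_cnj h"
    using oriented_frame_conjugate[OF imaginary_frame(2,3)[OF x0] frame_inner(2,3,6)[OF x0]] by blast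
  \<comment> \<open>conjugation by a constant brings the frame at \<open>x0\<close> to the standard position, where \<open>s\<close> does
    not vanish\<close>
  define f where "f e y = quat_cnj h \<otimes>\<^sub>H e y \<otimes>\<^sub>H h" for e :: "real^3 \<Rightarrow> quat" and y
  have fs: "Cinf_on W (f e)" if "Cinf_on W e" for e
    unfolding f_def by (intro Cinf_on_quat_mult W Cinf_on_const that)
  define s where "s y = quat_one - f e2 y \<otimes>\<^sub>H quat_i - f e3 y \<otimes>\<^sub>H quat_j - f e1 y \<otimes>\<^sub>H quat_k" for y
  have ss: "Cinf_on W s" unfolding s_def
    by (intro Cinf_on_diff Cinf_on_quat_mult W Cinf_on_const fs smooth_e)
  have hS: "quat_cnj h \<bullet> quat_cnj h = 1" "h \<bullet> h = 1" using h(1) S3_cnj S3_iff by blast+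
  have f_inner: "f e y \<bullet> f e' y = e y \<bullet> e' y" for e e' y
    unfolding f_def inner_quat_mult_right inner_quat_mult_left hS by simp
  have f_im: "imaginary (f e y)" if "imaginary (e y)" for e y
    using f_inner[of e y "\<lambda>_. quat_one"] that h(1) by (simp add: f_def imaginary_iff_inner)
  have f_mult: "f e y \<otimes>\<^sub>H f e' y = f (\<lambda>y. e y \<otimes>\<^sub>H e' y) y" for e e' y
    using h(1) by (simp add: f_def quat_mult_assoc)
  have s_comm: "f e2 y \<otimes>\<^sub>H s y = s y \<otimes>\<^sub>H quat_i" "f e3 y \<otimes>\<^sub>H s y = s y \<otimes>\<^sub>H quat_j" if "y \<in> W" for y
  proof -
    have "f (\<lambda>y. e2 y \<otimes>\<^sub>H e3 y) y = f e1 y" by (simp add: f_def frame_mult[OF that])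
    then show "f e2 y \<otimes>\<^sub>H s y = s y \<otimes>\<^sub>H quat_i" "f e3 y \<otimes>\<^sub>H s y = s y \<otimes>\<^sub>H quat_j"
      unfolding s_def using frame_lift_identities[of "f e2 y" "f e3 y" "f e1 y"]
        f_im imaginary_frame[OF that] by (simp_all add: f_inner f_mult frame_inner[OF that])
  qed
  have "f e2 x0 = quat_i" "f e3 x0 = quat_j" using h by (simp_all add: f_def quat_mult_assoc)
  moreover from this have "f e1 x0 = quat_k"
    using f_mult[of e2 x0 e3] by (simp add: f_def frame_mult[OF x0]) (simp add: quat_comp)
  ultimately have "s x0 \<noteq> 0" by (simp add: s_def quat_comp)
  then have "x0 \<in> {y \<in> W. s y \<noteq> 0}" using x0 by simp
  moreover have "open {y \<in> W. s y \<noteq> 0}"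
    using continuous_open_preimage[OF Cinf_on_continuous[OF ss] W(1) open_Compl[OF closed_singleton[of 0]]]
    by (simp add: vimage_def Collect_conj_eq)
  ultimately obtain d where d: "d > 0" "ball x0 d \<subseteq> {y \<in> W. s y \<noteq> 0}" using openE by blast
  define V where "V = ball x0 d"
  have V: "open V" "convex V" "x0 \<in> V" "V \<subseteq> W" and sV: "\<And>y. y \<in> V \<Longrightarrow> s y \<noteq> 0"
    using d by (auto simp: V_def)
  define u where "u y = h \<otimes>\<^sub>H ((1 / norm (s y)) *\<^sub>R s y)" for y
  have us: "Cinf_on V u" unfolding u_def
    by (intro Cinf_on_quat_mult V Cinf_on_const Cinf_on_normalize Cinf_on_subset[OF ss] sV)
  have uS: "u y \<in> S3" if "y \<in> V" for y using h(1) sV[OF that] by (simp add: u_def S3_norm norm_quat_mult)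
  have he: "h \<otimes>\<^sub>H f e y = e y \<otimes>\<^sub>H h" for e y using h(1) by (simp add: f_def quat_mult_assoc)
  have eu: "e y \<otimes>\<^sub>H u y = u y \<otimes>\<^sub>H n" if "f e y \<otimes>\<^sub>H s y = s y \<otimes>\<^sub>H n" for e y n
  proof -
    have "e y \<otimes>\<^sub>H u y = (1 / norm (s y)) *\<^sub>R ((e y \<otimes>\<^sub>H h) \<otimes>\<^sub>H s y)" by (simp add: u_def qm_simps quat_mult_assoc)
    also have "\<dots> = (1 / norm (s y)) *\<^sub>R (h \<otimes>\<^sub>H (f e y \<otimes>\<^sub>H s y))" by (simp flip: he add: quat_mult_assoc)
    finally show ?thesis by (simp add: that u_def qm_simps quat_mult_assoc)
  qed
  show ?thesis using that[OF V us uS] eu s_comm V(4) by blast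
qed

text \<open>With this connection \<open>p e2\<close> and \<open>q e3\<close> are constant, so \<open>p\<close> and \<open>q\<close> are, up to constant
  factors, two legs of the frame itself, and the lift \<open>u\<close> of the frame is the parameter of the
  model. Since \<open>e2\<close> is imaginary, \<open>p\<close> stays in a great two-sphere; this property distinguishes the
  model from the torus, which has the same constants.\<close>

lemma model_frame_pair:
  assumes ab7: "a2 = 0" "b3 = 0" "b1 = a1" and D: "diagonal_connection (- a1) (- b2) (- a3)"
    and x0: "x0 \<in> W"
  shows "locally_model W p q S3 (\<lambda>u. (u \<otimes>\<^sub>H quat_i \<otimes>\<^sub>H quat_inv u, u \<otimes>\<^sub>H quat_j \<otimes>\<^sub>H quat_inv u)) x0"
    and "\<exists>c\<in>S3. \<forall>y\<in>W. c \<bullet> p y = 0"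
proof -
  note de = dder_frame_diagonal[OF D]
  let ?P = "\<lambda>y. p y \<otimes>\<^sub>H e2 y" and ?Q = "\<lambda>y. q y \<otimes>\<^sub>H e3 y"
  have d0: "dder ?P y (E1 y) = 0" "dder ?P y (E2 y) = 0" "dder ?P y (E3 y) = 0"
    "dder ?Q y (E1 y) = 0" "dder ?Q y (E2 y) = 0" "dder ?Q y (E3 y) = 0" if y: "y \<in> W" for y
    by (simp_all add: dder_mult[OF smooth_pq(1) smooth_e(2) y] dder_mult[OF smooth_pq(2) smooth_e(3) y]
      dp[OF y] dq[OF y] de[OF y] ab7 qm_simps quat_mult_assoc frame_mult[OF y])
  obtain c where c: "\<And>y. y \<in> W \<Longrightarrow> ?P y = c"
    using constant_if_dder_zero[OF Cinf_on_quat_mult[OF W(1) smooth_pq(1) smooth_e(2)] d0(1-3)] by blast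
  obtain c' where c': "\<And>y. y \<in> W \<Longrightarrow> ?Q y = c'"
    using constant_if_dder_zero[OF Cinf_on_quat_mult[OF W(1) smooth_pq(2) smooth_e(3)] d0(4-6)] by blast
  have cS: "c \<in> S3" "c' \<in> S3" using c[OF x0] c'[OF x0] pq_S3[OF x0] S3_frame[OF x0] S3_mult by metis+
  have pe: "p y = - c \<otimes>\<^sub>H e2 y" "q y = - c' \<otimes>\<^sub>H e3 y" if "y \<in> W" for y
    using c[OF that, symmetric] c'[OF that, symmetric] frame_mult[OF that] by (simp_all add: quat_mult_assoc qm_simps)
  have "c \<bullet> p y = 0" if "y \<in> W" for y
    using inner_quat_mult_left[of c quat_one "e2 y"] imaginary_frame(2)[OF that]
    by (simp add: pe[OF that] qm_simps imaginary_iff_inner inner_commute)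
  then show "\<exists>c\<in>S3. \<forall>y\<in>W. c \<bullet> p y = 0" using cS by blast
  obtain V u where V: "open V" "convex V" "x0 \<in> V" "V \<subseteq> W" and u: "Cinf_on V u" "\<And>y. y \<in> V \<Longrightarrow> u y \<in> S3"
    and eu: "\<And>y. y \<in> V \<Longrightarrow> e2 y \<otimes>\<^sub>H u y = u y \<otimes>\<^sub>H quat_i" "\<And>y. y \<in> V \<Longrightarrow> e3 y \<otimes>\<^sub>H u y = u y \<otimes>\<^sub>H quat_j"
    using frame_lift[OF x0] by blast
  interpret V: adapted_frame V p q a1 a2 a3 b1 b2 b3 e1 e2 e3 E1 E2 E3 by (rule subset[OF V(1,2,4)])
  \<comment> \<open>the lift of a rotation with angular velocity \<open>2 r\<close> moves by left multiplication with \<open>r\<close>: the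
    difference \<open>w\<close> commutes with \<open>i\<close> and \<open>j\<close> and is imaginary, so it vanishes\<close>
  have du: "dder u y v = r \<otimes>\<^sub>H u y"
    if y: "y \<in> V" and r: "imaginary r" "dder e2 y v = r \<otimes>\<^sub>H e2 y - e2 y \<otimes>\<^sub>H r" "dder e3 y v = r \<otimes>\<^sub>H e3 y - e3 y \<otimes>\<^sub>H r"
    for y v r
  proof -
    note uS = u(2)[OF y]
    define w where "w = quat_cnj (u y) \<otimes>\<^sub>H (dder u y v - r \<otimes>\<^sub>H u y)"
    have key: "w \<otimes>\<^sub>H n = n \<otimes>\<^sub>H w"
      if e: "Cinf_on V e" "\<And>y. y \<in> V \<Longrightarrow> e y \<otimes>\<^sub>H u y = u y \<otimes>\<^sub>H n" "dder e y v = r \<otimes>\<^sub>H e y - e y \<otimes>\<^sub>H r" for e n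
    proof -
      have "dder (\<lambda>y. e y \<otimes>\<^sub>H u y) y v = dder (\<lambda>y. u y \<otimes>\<^sub>H n) y v"
        by (rule dder_cong_on[OF V(1) y e(2)])
      then have "e y \<otimes>\<^sub>H dder u y v + (r \<otimes>\<^sub>H e y - e y \<otimes>\<^sub>H r) \<otimes>\<^sub>H u y = dder u y v \<otimes>\<^sub>H n"
        by (simp add: dder_mult[OF e(1) u(1) y] dder_mult[OF u(1) Cinf_on_const y] e(3) qm_simps)
      then have 1: "e y \<otimes>\<^sub>H (dder u y v - r \<otimes>\<^sub>H u y) = (dder u y v - r \<otimes>\<^sub>H u y) \<otimes>\<^sub>H n"
        using e(2)[OF y] by (simp add: qm_simps quat_mult_assoc algebra_simps)
      have "quat_cnj (u y) \<otimes>\<^sub>H e y = n \<otimes>\<^sub>H quat_cnj (u y)"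
        using arg_cong[OF e(2)[OF y], of "\<lambda>z. quat_cnj (u y) \<otimes>\<^sub>H z \<otimes>\<^sub>H quat_cnj (u y)"] uS
        by (simp add: quat_mult_assoc)
      then show ?thesis using 1 by (metis w_def quat_mult_assoc)
    qed
    have "imaginary w"
    proof -
      have "dder u y v \<bullet> u y = 0"
        using inner_const_dder[OF V(1) u(1) u(1) _ y, of 1 v] u(2) by (simp add: S3_iff inner_commute)
      moreover have "(r \<otimes>\<^sub>H u y) \<bullet> u y = 0"
        using inner_quat_mult_right[of r "u y" quat_one] r(1) by (simp add: imaginary_iff_inner)
      ultimately have "(dder u y v - r \<otimes>\<^sub>H u y) \<bullet> u y = 0" by (simp add: inner_diff_left)
      then show ?thesis
        using inner_quat_mult_left[of "quat_cnj (u y)" "dder u y v - r \<otimes>\<^sub>H u y" "u y"] uS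
        by (simp add: w_def imaginary_iff_inner)
    qed
    then have "w = 0"
      using commute_all_imaginary key[OF V.smooth_e(2) eu(1) r(2)] key[OF V.smooth_e(3) eu(2) r(3)] by blast
    then show ?thesis using uS by (metis w_def S3_cancel(3) qm.zero_right right_minus_eq)
  qed
  have comm: "k *\<^sub>R g = ((k / 2) *\<^sub>R e) \<otimes>\<^sub>H f - f \<otimes>\<^sub>H ((k / 2) *\<^sub>R e)"
    if "e \<otimes>\<^sub>H f = g" "f \<otimes>\<^sub>H e = - g" for k e f g
  proof -
    have "((k / 2) *\<^sub>R e) \<otimes>\<^sub>H f - f \<otimes>\<^sub>H ((k / 2) *\<^sub>R e) = (k / 2) *\<^sub>R g + (k / 2) *\<^sub>R g"
      by (simp only: qm.scaleR_left qm.scaleR_right that scaleR_minus_right diff_minus_eq_add)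
    then show ?thesis by (simp flip: scaleR_add_left)
  qed
  have im: "imaginary (k *\<^sub>R e)" if "imaginary e" for k e using that by (simp add: imaginary_iff_inner)
  have du': "dder u y (E1 y) = (- a1 / 2) *\<^sub>R (quat_one \<otimes>\<^sub>H e1 y \<otimes>\<^sub>H u y)"
      "dder u y (E2 y) = (- b2 / 2) *\<^sub>R (quat_one \<otimes>\<^sub>H e2 y \<otimes>\<^sub>H u y)"
      "dder u y (E3 y) = (- a3 / 2) *\<^sub>R (quat_one \<otimes>\<^sub>H e3 y \<otimes>\<^sub>H u y)" if y: "y \<in> V" for y
  proof -
    have yW: "y \<in> W" using y V by blast
    note fm = frame_mult[OF yW] and i = im[OF V.imaginary_frame(1)[OF y]] im[OF V.imaginary_frame(2)[OF y]]
      im[OF V.imaginary_frame(3)[OF y]]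
    have "dder e2 y (E1 y) = ((- a1 / 2) *\<^sub>R e1 y) \<otimes>\<^sub>H e2 y - e2 y \<otimes>\<^sub>H ((- a1 / 2) *\<^sub>R e1 y)"
      using comm[OF fm(4,5), of "- a1"] de(2)[OF yW] by metis
    moreover have "dder e3 y (E1 y) = ((- a1 / 2) *\<^sub>R e1 y) \<otimes>\<^sub>H e3 y - e3 y \<otimes>\<^sub>H ((- a1 / 2) *\<^sub>R e1 y)"
      using comm[of "e1 y" "e3 y" "- e2 y" "- a1"] fm de(3)[OF yW] by simp
    ultimately show "dder u y (E1 y) = (- a1 / 2) *\<^sub>R (quat_one \<otimes>\<^sub>H e1 y \<otimes>\<^sub>H u y)"
      using du[OF y i(1)] by (simp only: qm.scaleR_left quat_one_left)
    have "dder e2 y (E2 y) = ((- b2 / 2) *\<^sub>R e2 y) \<otimes>\<^sub>H e2 y - e2 y \<otimes>\<^sub>H ((- b2 / 2) *\<^sub>R e2 y)"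
      using de(5)[OF yW] by (simp only: qm.scaleR_left qm.scaleR_right diff_self)
    moreover have "dder e3 y (E2 y) = ((- b2 / 2) *\<^sub>R e2 y) \<otimes>\<^sub>H e3 y - e3 y \<otimes>\<^sub>H ((- b2 / 2) *\<^sub>R e2 y)"
      using comm[OF fm(6,7), of "- b2"] de(6)[OF yW] by metis
    ultimately show "dder u y (E2 y) = (- b2 / 2) *\<^sub>R (quat_one \<otimes>\<^sub>H e2 y \<otimes>\<^sub>H u y)"
      using du[OF y i(2)] by (simp only: qm.scaleR_left quat_one_left)
    have "dder e2 y (E3 y) = ((- a3 / 2) *\<^sub>R e3 y) \<otimes>\<^sub>H e2 y - e2 y \<otimes>\<^sub>H ((- a3 / 2) *\<^sub>R e3 y)"
      using comm[of "e3 y" "e2 y" "- e1 y" "- a3"] fm de(8)[OF yW] by simp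
    moreover have "dder e3 y (E3 y) = ((- a3 / 2) *\<^sub>R e3 y) \<otimes>\<^sub>H e3 y - e3 y \<otimes>\<^sub>H ((- a3 / 2) *\<^sub>R e3 y)"
      using de(9)[OF yW] by (simp only: qm.scaleR_left qm.scaleR_right diff_self)
    ultimately show "dder u y (E3 y) = (- a3 / 2) *\<^sub>R (quat_one \<otimes>\<^sub>H e3 y \<otimes>\<^sub>H u y)"
      using du[OF y i(3)] by (simp only: qm.scaleR_left quat_one_left)
  qed
  have nz: "- a1 / 2 \<noteq> 0" "- b2 / 2 \<noteq> 0" "- a3 / 2 \<noteq> 0" using ab ab7 by auto
  obtain U where U: "x0 \<in> U" "U \<subseteq> V" "smooth_embedding_onto_open U S3 u"
    by (rule V.frame_map_local_diffeo[of u "\<lambda>_. quat_one" u, OF _ Cinf_on_const S3_one u nz du' V(3)]) auto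
  have conj: "e2 y = u y \<otimes>\<^sub>H quat_i \<otimes>\<^sub>H quat_inv (u y)" "e3 y = u y \<otimes>\<^sub>H quat_j \<otimes>\<^sub>H quat_inv (u y)" if "y \<in> V" for y
    using eu[OF that, symmetric] u(2)[OF that] by (simp_all add: quat_inv_S3 quat_mult_assoc)
  have pqu: "p y = - c \<otimes>\<^sub>H (u y \<otimes>\<^sub>H quat_i \<otimes>\<^sub>H quat_inv (u y))"
    "q y = - c' \<otimes>\<^sub>H (u y \<otimes>\<^sub>H quat_j \<otimes>\<^sub>H quat_inv (u y))" if "y \<in> U" for y
    using pe[of y] conj[of y] that U(2) V(4) by (simp_all add: subset_iff)
  show "locally_model W p q S3 (\<lambda>u. (u \<otimes>\<^sub>H quat_i \<otimes>\<^sub>H quat_inv u, u \<otimes>\<^sub>H quat_j \<otimes>\<^sub>H quat_inv u)) x0"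
    by (rule locally_modelI[OF U(1) _ U(3) S3_minus[OF cS(1)] S3_minus[OF cS(2)] S3_one])
      (use U(2) V(4) pqu in auto)
qed

end

text \<open>Both tori are products of one-parameter subgroups, up to a constant left factor for \<open>q\<close>;
  this is the form in which they come out of the integration.\<close>

lemma torus_p_qexp: "torus_p u w = qexp quat_i w \<otimes>\<^sub>H qexp quat_j u"
  by (simp add: quat_comp torus_p_def qexp_def mult.commute)

definition torus_shift :: quat where "torus_shift = (1 / sqrt 2) *\<^sub>R (quat_one - quat_j)"

lemma torus_shift_S3: "torus_shift \<in> S3"
  by (simp add: S3_iff torus_shift_def quat_comp)

lemma torus_q_qexp: "torus_q u v = torus_shift \<otimes>\<^sub>H (qexp quat_k (- v) \<otimes>\<^sub>H qexp quat_j u)"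
  by (simp add: quat_comp torus_q_def qexp_def torus_shift_def algebra_simps)

context adapted_frame
begin

text \<open>The leg \<open>e1\<close> is constant and the other two rotate about it with a phase \<open>r\<close>. In the frame
  that follows the rotation, which is reached by right multiplication with \<open>u = exp(-r n1 / 2)\<close>,
  the logarithmic differential of \<open>p\<close> points in the fixed direction \<open>n3\<close> and that of \<open>q\<close> in the
  fixed direction \<open>n2\<close>. Their phases together with \<open>r\<close> are the coordinates of the torus.\<close>

lemma model_torus:
  assumes ab8: "a2 = 0" "b3 = 0" "b1 = a1" and D: "diagonal_connection (- 2 * a1) 0 0"
    and x0: "x0 \<in> W"
  shows "locally_model W p q (UNIV :: (real^3) set) (\<lambda>x. (torus_p (x$1) (x$3), torus_q (x$1) (x$2))) x0"
proof -
  note de = dder_frame_diagonal[OF D]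
  have nz: "a1 \<noteq> 0" "b2 \<noteq> 0" "a3 \<noteq> 0" using ab ab8 by auto
  obtain n1 where n1: "\<And>y. y \<in> W \<Longrightarrow> e1 y = n1"
    using constant_if_dder_zero[OF smooth_e(1)] de(1,4,7) by force
  define n2 n3 where "n2 = e2 x0" and "n3 = e3 x0"
  have n: "imaginary n1" "n1 \<bullet> n1 = 1" "imaginary n2" "n2 \<bullet> n2 = 1" "imaginary n3" "n3 \<bullet> n3 = 1"
    and nn: "n2 \<otimes>\<^sub>H n1 = - (n1 \<otimes>\<^sub>H n2)" "n3 \<otimes>\<^sub>H n1 = - (n1 \<otimes>\<^sub>H n3)" "n3 \<otimes>\<^sub>H n1 = n2"
    and n31: "n3 \<bullet> n1 = 0"
    using imaginary_frame[OF x0] frame_inner[OF x0] frame_mult[OF x0] n1[OF x0] by (auto simp: n2_def n3_def)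
  have "dder e2 y (E1 y) = (2 * a1) *\<^sub>R (e2 y \<otimes>\<^sub>H n1)" "dder e2 y (E2 y) = 0 *\<^sub>R (e2 y \<otimes>\<^sub>H n1)"
     "dder e2 y (E3 y) = 0 *\<^sub>R (e2 y \<otimes>\<^sub>H n1)" if "y \<in> W" for y
    using frame_mult[OF that] by (simp_all add: de[OF that] n1[OF that])
  from phase_function[OF smooth_e(2) S3_frame(2) n(1,2) this x0]
  obtain V r where V: "open V" "convex V" "x0 \<in> V" "V \<subseteq> W" and r: "Cinf_on V r" "r x0 = 0"
    "\<And>y. y \<in> V \<Longrightarrow> dder r y (E1 y) = 2 * a1" "\<And>y. y \<in> V \<Longrightarrow> dder r y (E2 y) = 0"
    "\<And>y. y \<in> V \<Longrightarrow> dder r y (E3 y) = 0" and e2r: "\<And>y. y \<in> V \<Longrightarrow> e2 y = n2 \<otimes>\<^sub>H qexp n1 (r y)"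
    unfolding n2_def by metis
  interpret V: adapted_frame V p q a1 a2 a3 b1 b2 b3 e1 e2 e3 E1 E2 E3 by (rule subset[OF V(1,2,4)])
  define s where "s y = (- 1 / 2) *\<^sub>R r y" for y
  have s: "Cinf_on V s" unfolding s_def by (intro Cinf_on_scaleR Cinf_on_const V r)
  have ds: "dder s y v = - dder r y v / 2" if "y \<in> V" for y v
    using dder_scaleR_const[OF r(1) that, of "- 1 / 2" v] unfolding s_def by simp
  define u where "u y = qexp n1 (s y)" for y
  have us: "Cinf_on V u" unfolding u_def by (rule Cinf_on_qexp[OF V(1) s])
  have uS: "u y \<in> S3" for y unfolding u_def by (rule qexp_S3[OF n(1,2)])
  have u0: "u x0 = quat_one" by (simp add: u_def s_def r)
  have du: "dder u y v = (- dder r y v / 2) *\<^sub>R (n1 \<otimes>\<^sub>H u y)" if "y \<in> V" for y v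
    unfolding u_def dder_qexp[OF s that n(1,2)] ds[OF that] by simp
  have n1u: "n1 \<otimes>\<^sub>H u y = u y \<otimes>\<^sub>H n1" for y unfolding u_def by (simp add: qexp_commute_n)
  have cnju: "quat_cnj (u y) = qexp n1 (r y / 2)" for y unfolding u_def qexp_cnj[OF n(1)] by (simp add: s_def)
  have e2u: "e2 y \<otimes>\<^sub>H u y = u y \<otimes>\<^sub>H n2" if "y \<in> V" for y
  proof -
    have "e2 y \<otimes>\<^sub>H u y = n2 \<otimes>\<^sub>H qexp n1 (- s y)"
      by (simp add: e2r[OF that] quat_mult_assoc u_def qexp_add[OF n(1,2)] s_def)
    also have "\<dots> = u y \<otimes>\<^sub>H n2" using qexp_anticommute[OF nn(1), of "- s y"] by (simp add: u_def)
    finally show ?thesis .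
  qed
  have e3u: "e3 y \<otimes>\<^sub>H u y = u y \<otimes>\<^sub>H n3" if "y \<in> V" for y
  proof -
    have yW: "y \<in> W" using that V by blast
    have "e3 y = n1 \<otimes>\<^sub>H e2 y" "n3 = n1 \<otimes>\<^sub>H n2"
      using frame_mult(4)[OF yW] frame_mult(4)[OF x0] n1[OF yW] n1[OF x0] by (auto simp: n2_def n3_def)
    then show ?thesis using e2u[OF that] n1u[of y] by (metis quat_mult_assoc)
  qed
  have pus: "Cinf_on V (\<lambda>y. p y \<otimes>\<^sub>H u y)" "Cinf_on V (\<lambda>y. q y \<otimes>\<^sub>H u y)"
    by (intro Cinf_on_quat_mult V us V.smooth_pq)+
  have puS: "p y \<otimes>\<^sub>H u y \<in> S3" "q y \<otimes>\<^sub>H u y \<in> S3" if "y \<in> V" for y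
    using V.pq_S3[OF that] uS S3_mult by blast+
  have dpu: "dder (\<lambda>y. p y \<otimes>\<^sub>H u y) y (E1 y) = 0 *\<^sub>R (p y \<otimes>\<^sub>H u y \<otimes>\<^sub>H n3)"
      "dder (\<lambda>y. p y \<otimes>\<^sub>H u y) y (E2 y) = 0 *\<^sub>R (p y \<otimes>\<^sub>H u y \<otimes>\<^sub>H n3)"
      "dder (\<lambda>y. p y \<otimes>\<^sub>H u y) y (E3 y) = a3 *\<^sub>R (p y \<otimes>\<^sub>H u y \<otimes>\<^sub>H n3)"
    and dqu: "dder (\<lambda>y. q y \<otimes>\<^sub>H u y) y (E1 y) = 0 *\<^sub>R (q y \<otimes>\<^sub>H u y \<otimes>\<^sub>H n2)"
      "dder (\<lambda>y. q y \<otimes>\<^sub>H u y) y (E2 y) = b2 *\<^sub>R (q y \<otimes>\<^sub>H u y \<otimes>\<^sub>H n2)"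
      "dder (\<lambda>y. q y \<otimes>\<^sub>H u y) y (E3 y) = 0 *\<^sub>R (q y \<otimes>\<^sub>H u y \<otimes>\<^sub>H n2)" if y: "y \<in> V" for y
  proof -
    have "y \<in> W" using y V by blast
    note 1 = dder_mult[OF V.smooth_pq(1) us y] dder_mult[OF V.smooth_pq(2) us y] V.dp[OF y] V.dq[OF y]
      du[OF y] r(3-5)[OF y] qm_simps quat_mult_assoc e2u[OF y] e3u[OF y] n1[OF \<open>y \<in> W\<close>] ab8
    show "dder (\<lambda>y. p y \<otimes>\<^sub>H u y) y (E1 y) = 0 *\<^sub>R (p y \<otimes>\<^sub>H u y \<otimes>\<^sub>H n3)"
      "dder (\<lambda>y. p y \<otimes>\<^sub>H u y) y (E2 y) = 0 *\<^sub>R (p y \<otimes>\<^sub>H u y \<otimes>\<^sub>H n3)"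
      "dder (\<lambda>y. p y \<otimes>\<^sub>H u y) y (E3 y) = a3 *\<^sub>R (p y \<otimes>\<^sub>H u y \<otimes>\<^sub>H n3)"
      "dder (\<lambda>y. q y \<otimes>\<^sub>H u y) y (E1 y) = 0 *\<^sub>R (q y \<otimes>\<^sub>H u y \<otimes>\<^sub>H n2)"
      "dder (\<lambda>y. q y \<otimes>\<^sub>H u y) y (E2 y) = b2 *\<^sub>R (q y \<otimes>\<^sub>H u y \<otimes>\<^sub>H n2)"
      "dder (\<lambda>y. q y \<otimes>\<^sub>H u y) y (E3 y) = 0 *\<^sub>R (q y \<otimes>\<^sub>H u y \<otimes>\<^sub>H n2)"
      by (simp_all add: 1)
  qed
  from V.phase_function[OF pus(1) puS(1) n(5,6) dpu V(3)]
  obtain V3 r3 where V3: "open V3" "x0 \<in> V3" "V3 \<subseteq> V" and r3: "Cinf_on V3 r3"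
    "\<And>y. y \<in> V3 \<Longrightarrow> dder r3 y (E1 y) = 0" "\<And>y. y \<in> V3 \<Longrightarrow> dder r3 y (E2 y) = 0"
    "\<And>y. y \<in> V3 \<Longrightarrow> dder r3 y (E3 y) = a3" and pr: "\<And>y. y \<in> V3 \<Longrightarrow> p y \<otimes>\<^sub>H u y = p x0 \<otimes>\<^sub>H qexp n3 (r3 y)"
    unfolding u0 quat_one_right by metis
  from V.phase_function[OF pus(2) puS(2) n(3,4) dqu V(3)]
  obtain V2 r2 where V2: "open V2" "x0 \<in> V2" "V2 \<subseteq> V" and r2: "Cinf_on V2 r2"
    "\<And>y. y \<in> V2 \<Longrightarrow> dder r2 y (E1 y) = 0" "\<And>y. y \<in> V2 \<Longrightarrow> dder r2 y (E2 y) = b2"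
    "\<And>y. y \<in> V2 \<Longrightarrow> dder r2 y (E3 y) = 0" and qr: "\<And>y. y \<in> V2 \<Longrightarrow> q y \<otimes>\<^sub>H u y = q x0 \<otimes>\<^sub>H qexp n2 (r2 y)"
    unfolding u0 quat_one_right by metis
  define X where "X = V2 \<inter> V3"
  have X: "open X" "x0 \<in> X" "X \<subseteq> V" "X \<subseteq> V2" "X \<subseteq> V3" using V2 V3 by (auto simp: X_def)
  \<comment> \<open>the factor \<open>1/2\<close> and the sign match the parametrization of the tori by \<open>u, v, w\<close>\<close>
  define t where "t y = r y *\<^sub>R axis 1 (1/2) + r2 y *\<^sub>R axis 2 (-1) + r3 y *\<^sub>R (axis 3 1 :: real^3)" for y
  note rX = Cinf_on_subset[OF r(1) X(3)] Cinf_on_subset[OF r2(1) X(4)] Cinf_on_subset[OF r3(1) X(5)]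
  have ts: "Cinf_on X t" unfolding t_def by (intro Cinf_on_add Cinf_on_scaleR Cinf_on_const X rX)
  have dt: "dder t y v = dder r y v *\<^sub>R axis 1 (1/2) + dder r2 y v *\<^sub>R axis 2 (-1) + dder r3 y v *\<^sub>R axis 3 1"
    if "y \<in> X" for y v
    unfolding t_def
    by (rule dder_eqI, rule has_derivative_eq_rhs,
        (rule has_derivative_add has_derivative_scaleR has_derivative_const Cinf_on_derivative[OF rX(1) that]
          Cinf_on_derivative[OF rX(2) that] Cinf_on_derivative[OF rX(3) that])+) simp
  have dtE: "dder t y (E1 y) = a1 *\<^sub>R axis 1 1" "dder t y (E2 y) = (- b2) *\<^sub>R axis 2 1" "dder t y (E3 y) = a3 *\<^sub>R axis 3 1"
    if "y \<in> X" for y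
    using that X by (auto simp: dt[OF that] r r2 r3 subset_iff vec_eq_iff forall_3 axis_def)
  obtain U where U: "x0 \<in> U" "U \<subseteq> X" "smooth_embedding_onto_open U UNIV t"
    by (rule local_diffeo_R3[OF X(1,2) ts _ _ _ nz(1) _ nz(3) dtE])
      (use nz Cinf_on_subset[OF V.smooth_E(1) X(3)] Cinf_on_subset[OF V.smooth_E(2) X(3)] Cinf_on_subset[OF V.smooth_E(3) X(3)] in auto)
  obtain h where h: "h \<in> S3" "n3 = h \<otimes>\<^sub>H quat_i \<otimes>\<^sub>H quat_cnj h" "n1 = h \<otimes>\<^sub>H quat_j \<otimes>\<^sub>H quat_cnj h"
    using oriented_frame_conjugate[OF n(5,1) n(6,2) n31] by blast
  have "quat_i \<otimes>\<^sub>H quat_j = quat_k" by (simp add: quat_comp)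
  then have h2: "n2 = h \<otimes>\<^sub>H quat_k \<otimes>\<^sub>H quat_cnj h"
    using nn(3) h by (metis (no_types, lifting) S3_cancel(4) quat_mult_assoc)
  have tcomp: "t y $ 1 = r y / 2" "t y $ 2 = - r2 y" "t y $ 3 = r3 y" for y by (simp_all add: t_def axis_def)
  have pq: "p y = (p x0 \<otimes>\<^sub>H h) \<otimes>\<^sub>H torus_p (t y $ 1) (t y $ 3) \<otimes>\<^sub>H quat_cnj h"
      "q y = (q x0 \<otimes>\<^sub>H h \<otimes>\<^sub>H quat_cnj torus_shift) \<otimes>\<^sub>H torus_q (t y $ 1) (t y $ 2) \<otimes>\<^sub>H quat_cnj h" if "y \<in> U" for y
  proof -
    have y: "y \<in> V2" "y \<in> V3" using that U X by blast+
    have "p y = (p x0 \<otimes>\<^sub>H qexp n3 (r3 y)) \<otimes>\<^sub>H qexp n1 (r y / 2)"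
      using pr[OF y(2), symmetric] uS[of y] by (simp flip: cnju add: quat_mult_assoc)
    then show "p y = (p x0 \<otimes>\<^sub>H h) \<otimes>\<^sub>H torus_p (t y $ 1) (t y $ 3) \<otimes>\<^sub>H quat_cnj h"
      using h(1) by (simp add: h(2,3) qexp_conj[unfolded quat_mult_assoc] torus_p_qexp tcomp quat_mult_assoc)
    have "q y = (q x0 \<otimes>\<^sub>H qexp n2 (r2 y)) \<otimes>\<^sub>H qexp n1 (r y / 2)"
      using qr[OF y(1), symmetric] uS[of y] by (simp flip: cnju add: quat_mult_assoc)
    then show "q y = (q x0 \<otimes>\<^sub>H h \<otimes>\<^sub>H quat_cnj torus_shift) \<otimes>\<^sub>H torus_q (t y $ 1) (t y $ 2) \<otimes>\<^sub>H quat_cnj h"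
      using h(1) torus_shift_S3 by (simp add: h2 h(3) qexp_conj[unfolded quat_mult_assoc] torus_q_qexp tcomp quat_mult_assoc)
  qed
  show ?thesis
    by (rule locally_modelI[OF U(1) _ U(3), where a="p x0 \<otimes>\<^sub>H h" and b="q x0 \<otimes>\<^sub>H h \<otimes>\<^sub>H quat_cnj torus_shift" and c="quat_cnj h"])
      (use pq U(2) X(3) V(4) S3_mult S3_cnj h(1) torus_shift_S3 pq_S3[OF x0] in auto)
qed

text \<open>In the torus case the derivatives of \<open>p\<close> of order at most two along the frame contain a
  basis, so \<open>p\<close> is not contained in a hyperplane on any open set. This separates the torus from
  the model in which \<open>p\<close> lies in a great two-sphere.\<close>

lemma torus_spans:
  assumes ab8: "a2 = 0" "b3 = 0" "b1 = a1" and D: "diagonal_connection (- 2 * a1) 0 0"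
    and V: "open V" "V \<subseteq> W" "V \<noteq> {}" and c: "\<And>y. y \<in> V \<Longrightarrow> c \<bullet> p y = 0"
  shows "c = 0"
proof -
  note de = dder_frame_diagonal[OF D]
  have nz: "a1 \<noteq> 0" "a3 \<noteq> 0" using ab ab8 by auto
  have D0: "c \<bullet> dder g y v = 0" if "Cinf_on W g" "\<And>y. y \<in> V \<Longrightarrow> c \<bullet> g y = 0" "y \<in> V" for g :: "real^3 \<Rightarrow> quat" and y v
    using inner_const_dder[OF V(1) Cinf_on_const Cinf_on_subset[OF that(1) V(2)] that(2,3), of v] by simp
  have c1: "c \<bullet> (p y \<otimes>\<^sub>H e1 y) = 0" and c3: "c \<bullet> (p y \<otimes>\<^sub>H e3 y) = 0" if "y \<in> V" for y
    using D0[OF smooth_pq(1) c that, of "E1 y"] D0[OF smooth_pq(1) c that, of "E3 y"] V(2) that nz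
    by (auto simp: dp subset_iff)
  obtain y where y: "y \<in> V" using V by blast
  then have yW: "y \<in> W" using V by blast
  have c2: "c \<bullet> (p y \<otimes>\<^sub>H e2 y) = 0"
    using D0[OF Cinf_on_quat_mult[OF W(1) smooth_pq(1) smooth_e(1)] c1 y, of "E3 y"] nz
    by (simp add: dder_mult[OF smooth_pq(1) smooth_e(1) yW] dp[OF yW] de[OF yW] qm_simps quat_mult_assoc frame_mult[OF yW])
  have "c \<bullet> (p y \<otimes>\<^sub>H quat_one) = 0" using c[OF y] by simp
  moreover have "(p y \<otimes>\<^sub>H v) \<bullet> (p y \<otimes>\<^sub>H w) = v \<bullet> w" for v w
    using pq_S3[OF yW] by (simp add: inner_quat_mult_left S3_iff)
  moreover have "c = (c \<bullet> (p y \<otimes>\<^sub>H quat_one)) *\<^sub>R (p y \<otimes>\<^sub>H quat_one) + (c \<bullet> (p y \<otimes>\<^sub>H e1 y)) *\<^sub>R (p y \<otimes>\<^sub>H e1 y)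
     + (c \<bullet> (p y \<otimes>\<^sub>H e2 y)) *\<^sub>R (p y \<otimes>\<^sub>H e2 y) + (c \<bullet> (p y \<otimes>\<^sub>H e3 y)) *\<^sub>R (p y \<otimes>\<^sub>H e3 y)"
    by (rule orthonormal_expand_quat)
      (use imaginary_frame[OF yW] S3_one in \<open>simp_all add: calculation(2) frame_inner[OF yW] imaginary_iff_inner inner_commute S3_iff
        del: quat_one_right\<close>)
  ultimately show ?thesis using c1[OF y] c2 c3[OF y] by simp
qed

end

section \<open>The algebra of the constants\<close>

text \<open>Two proportionality relations with linearly independent pairs of constants force both
  unknowns to vanish; this makes most connection coefficients zero.\<close>

lemma parallel_scalar_zero:
  fixes a b a' b' g c :: real
  assumes "- a' * g = c * a" "- b' * g = c * b" "a * b' \<noteq> a' * b"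
  shows "g = 0" "c = 0"
proof -
  have "g * (a * b' - a' * b) = 0" "c * (a * b' - a' * b) = 0" using assms(1,2) by algebra+
  then show "g = 0" "c = 0" using assms(3) by auto
qed

text \<open>The relations say that the diagonal map with entries \<open>V1, V2, V3\<close> is a homomorphism of Lie
  algebras from the one with structure constants \<open>c1, c2, c3\<close> to the imaginary quaternions. The
  source is simple if all \<open>ci\<close> are nonzero, so the map is zero or injective, and in the second
  case it is unique up to signs.\<close>

lemma diagonal_homomorphism_cases:
  fixes V1 V2 V3 c1 c2 c3 :: real
  assumes "V1 * V2 = c3 * V3" "V2 * V3 = c1 * V1" "V3 * V1 = c2 * V2" "c1 \<noteq> 0" "c2 \<noteq> 0" "c3 \<noteq> 0"
  shows "V1 = 0 \<and> V2 = 0 \<and> V3 = 0 \<or>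
    V1\<^sup>2 = c2 * c3 \<and> V2\<^sup>2 = c3 * c1 \<and> V3\<^sup>2 = c1 * c2 \<and> V1 * V2 * V3 = c1 * c2 * c3"
proof (cases "V1 = 0 \<or> V2 = 0 \<or> V3 = 0")
  case True
  then show ?thesis using assms by auto
next
  case False
  have "V1\<^sup>2 * (V2 * V3) = (c2 * c3) * (V2 * V3)" "V2\<^sup>2 * (V1 * V3) = (c3 * c1) * (V1 * V3)"
    "V3\<^sup>2 * (V1 * V2) = (c1 * c2) * (V1 * V2)"
    using assms(1-3) by algebra+
  then have 1: "V1\<^sup>2 = c2 * c3" "V2\<^sup>2 = c3 * c1" "V3\<^sup>2 = c1 * c2" using False by auto
  moreover have "V1 * V2 * V3 = c3 * V3\<^sup>2" using assms(1) by (simp add: power2_eq_square)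
  ultimately show ?thesis by simp
qed

text \<open>The constants shared by the last sphere model and by the torus, up to the order of the
  legs.\<close>

definition model_slopes :: "real \<Rightarrow> real \<Rightarrow> real \<Rightarrow> real \<Rightarrow> real \<Rightarrow> real \<Rightarrow> bool" where
  "model_slopes a1 a2 a3 b1 b2 b3 \<longleftrightarrow> b1 = a1 \<and> a2 = 0 \<and> b3 = 0"

text \<open>The numbers \<open>wi\<close>, \<open>2 ai + wi\<close> and \<open>2 bi + wi\<close> are the speeds at which the frames \<open>e\<close>,
  \<open>p e p\<inverse>\<close> and \<open>q e q\<inverse>\<close> rotate along the tangent frame. Each triple gives a diagonal homomorphism
  from the Lie algebra with structure constants \<open>c1, c2, c3\<close> to the imaginary quaternions. If that
  algebra is simple, its nonzero diagonal homomorphisms agree up to signs. Then \<open>w = 0\<close> would give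
  \<open>ai = \<plusminus> bi\<close> for every \<open>i\<close>, hence two parallel pairs; so \<open>w\<close> is nonzero, and in units of \<open>-wi\<close>
  the numbers \<open>ai\<close> are either all \<open>1/2\<close> or all in \<open>{0, 1}\<close>, and likewise the \<open>bi\<close>. If the algebra
  is abelian, each homomorphism has at most one nonzero entry. In the remaining cases all three
  homomorphisms vanish at a common index \<open>i\<close>, which gives \<open>ai = bi = 0\<close>. Pairwise linear
  independence of the pairs \<open>(ai, bi)\<close> leaves only the stated pattern.\<close>

lemma nonparallel_slopes:
  fixes a1 a2 a3 b1 b2 b3 w1 w2 w3 c1 c2 c3 :: real
  assumes a: "2 * a1 * a2 + a2 * w1 + a1 * w2 = c3 * a3" "2 * a2 * a3 + a3 * w2 + a2 * w3 = c1 * a1"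
      "2 * a3 * a1 + a1 * w3 + a3 * w1 = c2 * a2"
    and b: "2 * b1 * b2 + b2 * w1 + b1 * w2 = c3 * b3" "2 * b2 * b3 + b3 * w2 + b2 * w3 = c1 * b1"
      "2 * b3 * b1 + b1 * w3 + b3 * w1 = c2 * b2"
    and w: "w1 * w2 = c3 * w3" "w2 * w3 = c1 * w1" "w3 * w1 = c2 * w2"
    and np: "a1 * b2 \<noteq> a2 * b1" "a2 * b3 \<noteq> a3 * b2" "a3 * b1 \<noteq> a1 * b3"
  shows "model_slopes a1 a2 a3 b1 b2 b3 \<or> model_slopes a1 a3 a2 b1 b3 b2 \<or> model_slopes a2 a1 a3 b2 b1 b3 \<or>
    model_slopes a2 a3 a1 b2 b3 b1 \<or> model_slopes a3 a1 a2 b3 b1 b2 \<or> model_slopes a3 a2 a1 b3 b2 b1"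
proof -
  define A1 A2 A3 B1 B2 B3 where AB: "A1 = 2 * a1 + w1" "A2 = 2 * a2 + w2" "A3 = 2 * a3 + w3"
    "B1 = 2 * b1 + w1" "B2 = 2 * b2 + w2" "B3 = 2 * b3 + w3"
  have A: "A1 * A2 = c3 * A3" "A2 * A3 = c1 * A1" "A3 * A1 = c2 * A2" unfolding AB using a w by algebra+
  have B: "B1 * B2 = c3 * B3" "B2 * B3 = c1 * B1" "B3 * B1 = c2 * B2" unfolding AB using b w by algebra+
  have z: "a1 \<noteq> 0 \<or> b1 \<noteq> 0" "a2 \<noteq> 0 \<or> b2 \<noteq> 0" "a3 \<noteq> 0 \<or> b3 \<noteq> 0" using np by auto
  consider "c1 \<noteq> 0" "c2 \<noteq> 0" "c3 \<noteq> 0" | "c1 = 0" "c2 = 0" "c3 = 0"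
    | "c1 = 0 \<or> c2 = 0 \<or> c3 = 0" "c1 \<noteq> 0 \<or> c2 \<noteq> 0 \<or> c3 \<noteq> 0" by blast
  then show ?thesis
  proof cases
    case 1
    let ?N = "\<lambda>V1 V2 V3. V1\<^sup>2 = c2 * c3 \<and> V2\<^sup>2 = c3 * c1 \<and> V3\<^sup>2 = c1 * c2 \<and> V1 * V2 * V3 = c1 * c2 * c3"
    note c = diagonal_homomorphism_cases[OF _ _ _ 1]
    have nA: "\<not> (a1 = 0 \<and> a2 = 0 \<and> a3 = 0)" and nB: "\<not> (b1 = 0 \<and> b2 = 0 \<and> b3 = 0)" using np by auto
    show ?thesis
    proof (cases "w1 = 0 \<and> w2 = 0 \<and> w3 = 0")
      case w0: True
      then have "?N A1 A2 A3" "?N B1 B2 B3" using c[OF A] c[OF B] nA nB by (auto simp: AB)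
      then have "a1\<^sup>2 = b1\<^sup>2" "a2\<^sup>2 = b2\<^sup>2" "a3\<^sup>2 = b3\<^sup>2" using w0 by (auto simp: AB power_mult_distrib)
      then have "a1 = b1 \<or> a1 = - b1" "a2 = b2 \<or> a2 = - b2" "a3 = b3 \<or> a3 = - b3"
        by (auto simp: power2_eq_iff)
      then have False using np by auto
      then show ?thesis ..
    next
      case False
      then have w: "?N w1 w2 w3" using c[OF w] by blast
      have wnz: "w1 \<noteq> 0" "w2 \<noteq> 0" "w3 \<noteq> 0" using w 1 by auto
      define x1 x2 x3 y1 y2 y3 where "x1 = - a1 / w1" "x2 = - a2 / w2" "x3 = - a3 / w3"
        "y1 = - b1 / w1" "y2 = - b2 / w2" "y3 = - b3 / w3"
      then have xy: "a1 = - w1 * x1" "a2 = - w2 * x2" "a3 = - w3 * x3" "b1 = - w1 * y1" "b2 = - w2 * y2" "b3 = - w3 * y3"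
        using wnz by simp_all
      have rat: "x = 0 \<or> x = 1" if "(2 * (- v * x) + v)\<^sup>2 = v\<^sup>2" "v \<noteq> 0" for x v :: real
      proof -
        have "4 * v\<^sup>2 * (x * (x - 1)) = 0" using that(1) by (simp add: power2_eq_square algebra_simps)
        then show ?thesis using that(2) by simp
      qed
      have half: "2 * (- v * x) + v = 0 \<Longrightarrow> x = 1 / 2" if "v \<noteq> 0" for x v :: real
        using that by (auto simp: field_simps)
      have A': "x1 = 1/2 \<and> x2 = 1/2 \<and> x3 = 1/2 \<or> (x1 = 0 \<or> x1 = 1) \<and> (x2 = 0 \<or> x2 = 1) \<and> (x3 = 0 \<or> x3 = 1)"
        using c[OF A] w rat[of w1 x1] rat[of w2 x2] rat[of w3 x3] half[of w1 x1] half[of w2 x2] half[of w3 x3] wnz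
        unfolding AB xy by metis
      have B': "y1 = 1/2 \<and> y2 = 1/2 \<and> y3 = 1/2 \<or> (y1 = 0 \<or> y1 = 1) \<and> (y2 = 0 \<or> y2 = 1) \<and> (y3 = 0 \<or> y3 = 1)"
        using c[OF B] w rat[of w1 y1] rat[of w2 y2] rat[of w3 y3] half[of w1 y1] half[of w2 y2] half[of w3 y3] wnz
        unfolding AB xy by metis
      have np': "x1 * y2 \<noteq> x2 * y1" "x2 * y3 \<noteq> x3 * y2" "x3 * y1 \<noteq> x1 * y3"
        using np unfolding xy by auto
      have "(y1 = x1 \<and> x2 = 0 \<and> y3 = 0) \<or> (y1 = x1 \<and> x3 = 0 \<and> y2 = 0) \<or> (y2 = x2 \<and> x1 = 0 \<and> y3 = 0)
          \<or> (y2 = x2 \<and> x3 = 0 \<and> y1 = 0) \<or> (y3 = x3 \<and> x1 = 0 \<and> y2 = 0) \<or> (y3 = x3 \<and> x2 = 0 \<and> y1 = 0)"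
        using A' B' np' by (elim disjE conjE) simp_all
      then show ?thesis unfolding model_slopes_def xy by auto
    qed
  next
    case 2
    \<comment> \<open>at most one \<open>vi\<close> is nonzero, and \<open>a\<close> and \<open>b\<close> each differ from \<open>v\<close> at no more than one
      index\<close>
    define v1 v2 v3 where v: "v1 = - w1 / 2" "v2 = - w2 / 2" "v3 = - w3 / 2"
    have "w1 = 0 \<or> w2 = 0" "w2 = 0 \<or> w3 = 0" "w3 = 0 \<or> w1 = 0" using 2 w by auto
    then have w': "v1 = 0 \<and> v2 = 0 \<or> v2 = 0 \<and> v3 = 0 \<or> v3 = 0 \<and> v1 = 0" unfolding v by auto
    have "A1 = 0 \<or> A2 = 0" "A2 = 0 \<or> A3 = 0" "A3 = 0 \<or> A1 = 0" using 2 A by auto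
    moreover have "A1 = 0 \<longleftrightarrow> a1 = v1" "A2 = 0 \<longleftrightarrow> a2 = v2" "A3 = 0 \<longleftrightarrow> a3 = v3" unfolding AB v by auto
    ultimately have A': "a1 = v1 \<and> a2 = v2 \<or> a2 = v2 \<and> a3 = v3 \<or> a3 = v3 \<and> a1 = v1" by blast
    have "B1 = 0 \<or> B2 = 0" "B2 = 0 \<or> B3 = 0" "B3 = 0 \<or> B1 = 0" using 2 B by auto
    moreover have "B1 = 0 \<longleftrightarrow> b1 = v1" "B2 = 0 \<longleftrightarrow> b2 = v2" "B3 = 0 \<longleftrightarrow> b3 = v3" unfolding AB v by auto
    ultimately have B': "b1 = v1 \<and> b2 = v2 \<or> b2 = v2 \<and> b3 = v3 \<or> b3 = v3 \<and> b1 = v1" by blast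
    show ?thesis using w' A' B' np unfolding model_slopes_def by (elim disjE conjE) simp_all
  next
    case 3
    have "(w1 = 0 \<and> A1 = 0 \<and> B1 = 0) \<or> (w2 = 0 \<and> A2 = 0 \<and> B2 = 0) \<or> (w3 = 0 \<and> A3 = 0 \<and> B3 = 0)"
      using 3 w A B by auto
    then have False using z by (auto simp: AB)
    then show ?thesis ..
  qed
qed

text \<open>These constants admit only two connections, the one of the last sphere model and the one of
  the torus.\<close>

lemma model_slopes_connection:
  fixes a1 a2 a3 b1 b2 b3 w1 w2 w3 c1 c2 c3 :: real
  assumes a: "2 * a1 * a2 + a2 * w1 + a1 * w2 = c3 * a3" "2 * a2 * a3 + a3 * w2 + a2 * w3 = c1 * a1"
      "2 * a3 * a1 + a1 * w3 + a3 * w1 = c2 * a2"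
    and b: "2 * b1 * b2 + b2 * w1 + b1 * w2 = c3 * b3" "2 * b2 * b3 + b3 * w2 + b2 * w3 = c1 * b1"
      "2 * b3 * b1 + b1 * w3 + b3 * w1 = c2 * b2"
    and w: "w1 * w2 = c3 * w3" "w2 * w3 = c1 * w1" "w3 * w1 = c2 * w2"
    and s: "a2 = 0" "b3 = 0" "b1 = a1" and nz: "a1 \<noteq> 0" "b2 \<noteq> 0" "a3 \<noteq> 0"
  shows "w1 = - a1 \<and> w2 = - b2 \<and> w3 = - a3 \<or> w1 = - 2 * a1 \<and> w2 = 0 \<and> w3 = 0"
proof (cases "w2 = 0")
  case True
  have "c1 = 0" using a(2) s nz True by simp
  then have "w3 = 0" using b(2) s nz by simp
  moreover from this have "a3 * (2 * a1 + w1) = 0" using a(3) s(1) by algebra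
  ultimately show ?thesis using nz True by auto
next
  case False
  have c: "a1 * w2 = c3 * a3" "a3 * w2 = c1 * a1" "b2 * w3 = c1 * a1" using a(1,2) b(2) s by auto
  have "w1 * w2 * a3 = a1 * w2 * w3" using w(1) c(1) by algebra
  then have 1: "w1 * a3 = a1 * w3" using False by simp
  have 2: "b2 * w3 = a3 * w2" using c by simp
  have "w1 * b2 * a3 = a1 * w2 * a3" using 1 2 by algebra
  then have 3: "w1 * b2 = a1 * w2" using nz by simp
  have "2 * a1 * b2 + b2 * w1 + a1 * w2 = 0" using b(1) s by simp
  then have "a1 * (b2 + w2) = 0" using 3 by (simp add: algebra_simps)
  then have w2: "w2 = - b2" using nz by simp
  have "b2 * (w1 + a1) = 0" "b2 * (w3 + a3) = 0" using 3 2 w2 by algebra+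
  then have "w1 = - a1" "w3 = - a3" using nz by auto
  then show ?thesis using w2 by simp
qed

text \<open>The structure equations for \<open>(a1, b1) = (a2, b2) = (a, b)\<close> and \<open>(a3, b3) = (A, B)\<close>, where
  \<open>k\<close> is the rotation speed of \<open>e3\<close>. The three alternatives belong to the three models in which
  exactly two pairs coincide.\<close>

lemma double_slope_cases:
  fixes a b A B k m c c' :: real
  assumes np: "a * B \<noteq> A * b"
    and e: "2 * a * a + a * k + a * k = c * A" "2 * b * b + b * k + b * k = c * B"
      "2 * a * A + A * k + a * m = c' * a" "2 * b * B + B * k + b * m = c' * b" "k * m = c' * k"
  shows "k = 0 \<and> A = B \<and> b = - a \<or> B = 0 \<and> b = 2 * a \<and> k = - 2 * a \<or> A = 0 \<and> a = 2 * b \<and> k = - 2 * b"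
proof (cases "k = 0")
  case True
  have "a * b * (A - B) * 2 = 0" using e(3,4) True by algebra
  moreover have ab: "a\<^sup>2 * B = b\<^sup>2 * A" using e(1,2) True by algebra
  moreover have "a \<noteq> 0" "b \<noteq> 0" using ab np by auto
  ultimately have AB: "A = B" by simp
  moreover have "A \<noteq> 0" using AB np by auto
  ultimately have "a\<^sup>2 = b\<^sup>2" using ab by simp
  then show ?thesis using AB np True by (auto simp: power2_eq_iff)
next
  case False
  then have "m = c'" using e(5) by simp
  then have f: "A * (2 * a + k) = 0" "B * (2 * b + k) = 0" using e(3,4) by (auto simp: algebra_simps)
  show ?thesis
  proof (cases "A = 0")
    case True
    then have "B \<noteq> 0" "a \<noteq> 0" using np by auto
    then have k: "k = - 2 * b" using f(2) by simp
    have "a * (2 * a + k + k) = 0" using e(1) True by algebra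
    then show ?thesis using \<open>a \<noteq> 0\<close> True k by simp
  next
    case A: False
    then have k: "k = - 2 * a" using f(1) by simp
    show ?thesis
    proof (cases "B = 0")
      case True
      then have "b \<noteq> 0" using np by auto
      have "b * (2 * b + k + k) = 0" using e(2) True by algebra
      then show ?thesis using \<open>b \<noteq> 0\<close> True k by simp
    next
      case B: False
      then have "b = a" using f(2) k by simp
      then have "c * A = c * B" using e(1,2) by simp
      then have "c * (A - B) = 0" by (simp add: right_diff_distrib)
      moreover have "A \<noteq> B" using \<open>b = a\<close> np by auto
      ultimately have "c = 0" by simp
      then show ?thesis using e(1) k False by simp
    qed
  qed
qed

text \<open>The quadratic form \<open>a\<^sup>2 + b\<^sup>2 - a b\<close> is definite, so parallel vectors of the same norm agree
  up to sign.\<close>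

lemma parallel_same_norm:
  fixes a b a' b' :: real
  assumes "a * b' = a' * b" "a\<^sup>2 + b\<^sup>2 - a * b = n" "a'\<^sup>2 + b'\<^sup>2 - a' * b' = n" "a \<noteq> 0 \<or> b \<noteq> 0"
  shows "a' = a \<and> b' = b \<or> a' = - a \<and> b' = - b"
proof -
  have "\<exists>l. a' = l * a \<and> b' = l * b"
  proof (cases "a = 0")
    case True
    then show ?thesis using assms by (intro exI[of _ "b' / b"]) auto
  next
    case False
    then show ?thesis using assms(1) by (intro exI[of _ "a' / a"]) (auto simp: field_simps)
  qed
  then obtain l where l: "a' = l * a" "b' = l * b" by blast
  have "l\<^sup>2 * (a\<^sup>2 + b\<^sup>2 - a * b) = n"
    using assms(3) unfolding l by (simp add: power2_eq_square algebra_simps)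
  then have "(l\<^sup>2 - 1) * n = 0" unfolding assms(2) by (simp add: algebra_simps)
  moreover have "n \<noteq> 0"
  proof -
    have "2 * n = a\<^sup>2 + b\<^sup>2 + (a - b)\<^sup>2" using assms(2) by (simp add: power2_eq_square algebra_simps)
    moreover have "a\<^sup>2 + b\<^sup>2 > 0" using assms(4) by (simp add: sum_power2_gt_zero_iff)
    moreover have "(a - b)\<^sup>2 \<ge> 0" by simp
    ultimately show ?thesis by linarith
  qed
  ultimately have "l = 1 \<or> l = -1" by (simp add: power2_eq_1_iff)
  then show ?thesis using l by auto
qed

section \<open>The connection of an adapted frame\<close>

context adapted_frame
begin

text \<open>The first two components of the structure equations relate these coefficients to the bracket
  coefficients through both pairs of constants.\<close>

lemma nonparallel_zero:
  assumes np: "a1 * b2 \<noteq> a2 * b1" and y: "y \<in> W"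
  shows "dder e1 y (E1 y) \<bullet> e2 y = 0" "dder e1 y (E2 y) \<bullet> e2 y = 0"
proof -
  have np': "a2 * b1 \<noteq> a1 * b2" using np by simp
  obtain c1 c2 where C: "- a2 * (dder e1 y (E1 y) \<bullet> e2 y) = c1 * a1" "- b2 * (dder e1 y (E1 y) \<bullet> e2 y) = c1 * b1"
    "- a1 * (dder e1 y (E2 y) \<bullet> e2 y) = c2 * a2" "- b1 * (dder e1 y (E2 y) \<bullet> e2 y) = c2 * b2"
    by (rule structure_equations[OF y])
  show "dder e1 y (E1 y) \<bullet> e2 y = 0" "dder e1 y (E2 y) \<bullet> e2 y = 0"
    using parallel_scalar_zero(1)[OF C(1,2) np] parallel_scalar_zero(1)[OF C(3,4) np'] by auto
qed

text \<open>The components along \<open>e3\<close> of the structure equations of \<open>p\<close> and \<open>q\<close>, divided by \<open>a1\<close> and by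
  \<open>b1\<close>, differ only in the terms \<open>2 a1\<close> and \<open>2 b1\<close>.\<close>

lemma all_parallel_cases:
  assumes "a2 = a1" "a3 = a1" "b2 = b1" "b3 = b1" "y \<in> W"
  shows "a1 = 0 \<or> b1 = 0 \<or> a1 = b1"
proof -
  obtain c where "2 * a1 * a1 + a1 * (dder e2 y (E1 y) \<bullet> e3 y) + a1 * (dder e3 y (E2 y) \<bullet> e1 y) = c * a1"
    "2 * b1 * b1 + b1 * (dder e2 y (E1 y) \<bullet> e3 y) + b1 * (dder e3 y (E2 y) \<bullet> e1 y) = c * b1"
    using structure_equations[OF assms(5)] unfolding assms(1-4) by metis
  then have "a1 * b1 * (a1 - b1) * 2 = 0" by algebra
  then show ?thesis by auto
qed

text \<open>Each of the pairs \<open>(E1, E3)\<close> and \<open>(E2, E3)\<close> has linearly independent constants, so a single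
  coefficient \<open>k\<close> describes the derivative of \<open>e3\<close>, and the structure equations of \<open>p\<close> and \<open>q\<close>
  together express it through the constants. The integrability condition for \<open>e3\<close> itself, in the
  form \<open>k m = c' k\<close>, then leaves three cases. The derivatives of \<open>e1\<close> and \<open>e2\<close> along \<open>E3\<close> stay
  free, since these two legs may be rotated arbitrarily.\<close>

lemma pair_parallel_cases:
  assumes par: "a2 = a1" "b2 = b1" and np: "a1 * b3 \<noteq> a3 * b1" and ne: "W \<noteq> {}"
  obtains k where "\<And>y. y \<in> W \<Longrightarrow> dder e3 y (E1 y) = - k *\<^sub>R e2 y" "\<And>y. y \<in> W \<Longrightarrow> dder e3 y (E2 y) = k *\<^sub>R e1 y"
     "\<And>y. y \<in> W \<Longrightarrow> dder e3 y (E3 y) = 0"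
     "k = 0 \<and> a3 = b3 \<and> b1 = - a1 \<or> b3 = 0 \<and> b1 = 2 * a1 \<and> k = - 2 * a1 \<or> a3 = 0 \<and> a1 = 2 * b1 \<and> k = - 2 * b1"
proof -
  interpret c: adapted_frame W p q a2 a3 a1 b2 b3 b1 e2 e3 e1 E2 E3 E1 by (rule cyclic)
  interpret d: adapted_frame W p q a3 a1 a2 b3 b1 b2 e3 e1 e2 E3 E1 E2 by (rule c.cyclic)
  define k where "k = 2 * a1 * b1 * (a3 - b3) / (a1 * b3 - a3 * b1)"
  have np2: "a2 * b3 \<noteq> a3 * b2" using np par by simp
  have np3: "a3 * b1 \<noteq> a1 * b3" using np by simp
  \<comment> \<open>elimination of \<open>m - c\<close>\<close>
  have kk: "x = k" if "2 * a1 * a3 + a3 * x + a1 * m = c * a1" "2 * b1 * b3 + b3 * x + b1 * m = c * b1" for x m c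
  proof -
    have "x * (a1 * b3 - a3 * b1) = 2 * a1 * b1 * (a3 - b3)" using that by algebra
    then show ?thesis using np by (simp add: k_def field_simps)
  qed
  have at: "dder e3 y (E1 y) = - k *\<^sub>R e2 y \<and> dder e3 y (E2 y) = k *\<^sub>R e1 y \<and> dder e3 y (E3 y) = 0 \<and>
     dder e2 y (E1 y) \<bullet> e3 y = k \<and> dder e3 y (E2 y) \<bullet> e1 y = k \<and> dder e1 y (E3 y) = (dder e1 y (E3 y) \<bullet> e2 y) *\<^sub>R e2 y \<and>
     (\<exists>c'. 2 * a1 * a3 + a3 * k + a1 * (dder e1 y (E3 y) \<bullet> e2 y) = c' * a1 \<and>
       2 * b1 * b3 + b3 * k + b1 * (dder e1 y (E3 y) \<bullet> e2 y) = c' * b1 \<and>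
       dder E3 y (E2 y) - dder E2 y (E3 y) = c' *\<^sub>R E1 y)" if y: "y \<in> W" for y
  proof -
    obtain c1 c2 c3 where C: "dder E3 y (E2 y) - dder E2 y (E3 y) = c1 *\<^sub>R E2 y + c2 *\<^sub>R E3 y + c3 *\<^sub>R E1 y"
      "- a3 * (dder e2 y (E2 y) \<bullet> e3 y) = c1 * a2" "- b3 * (dder e2 y (E2 y) \<bullet> e3 y) = c1 * b2"
      "- a2 * (dder e2 y (E3 y) \<bullet> e3 y) = c2 * a3" "- b2 * (dder e2 y (E3 y) \<bullet> e3 y) = c2 * b3"
      "2 * a2 * a3 + a3 * (dder e3 y (E2 y) \<bullet> e1 y) + a2 * (dder e1 y (E3 y) \<bullet> e2 y) = c3 * a1"
      "2 * b2 * b3 + b3 * (dder e3 y (E2 y) \<bullet> e1 y) + b2 * (dder e1 y (E3 y) \<bullet> e2 y) = c3 * b1"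
      by (rule c.structure_equations[OF y])
    obtain d1 d2 d3 where D: "- a1 * (dder e3 y (E3 y) \<bullet> e1 y) = d1 * a3" "- b1 * (dder e3 y (E3 y) \<bullet> e1 y) = d1 * b3"
      "- a3 * (dder e3 y (E1 y) \<bullet> e1 y) = d2 * a1" "- b3 * (dder e3 y (E1 y) \<bullet> e1 y) = d2 * b1"
      "2 * a3 * a1 + a1 * (dder e1 y (E3 y) \<bullet> e2 y) + a3 * (dder e2 y (E1 y) \<bullet> e3 y) = d3 * a2"
      "2 * b3 * b1 + b1 * (dder e1 y (E3 y) \<bullet> e2 y) + b3 * (dder e2 y (E1 y) \<bullet> e3 y) = d3 * b2"
      by (rule d.structure_equations[OF y])
    have 1: "dder e2 y (E2 y) \<bullet> e3 y = 0" "c1 = 0" using parallel_scalar_zero[OF C(2,3) np2] by auto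
    have 2: "dder e2 y (E3 y) \<bullet> e3 y = 0" "c2 = 0"
      using parallel_scalar_zero[OF C(4,5)] np2 by (metis mult.commute)+
    have 3: "dder e3 y (E3 y) \<bullet> e1 y = 0" using parallel_scalar_zero(1)[OF D(1,2)] np3 by metis
    have 4: "dder e3 y (E1 y) \<bullet> e1 y = 0" using parallel_scalar_zero(1)[OF D(3,4)] np by metis
    have t: "dder e3 y (E2 y) \<bullet> e1 y = k" using kk C(6,7) unfolding par by blast
    have s: "dder e2 y (E1 y) \<bullet> e3 y = k"
      by (rule kk[of _ "dder e1 y (E3 y) \<bullet> e2 y" d3]) (use D(5,6) par in \<open>simp_all add: algebra_simps\<close>)
    show ?thesis
      using dder_frame(3)[OF y, of "E1 y"] dder_frame(3)[OF y, of "E2 y"] dder_frame(3)[OF y, of "E3 y"]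
        dder_frame(1)[OF y, of "E3 y"] C(1,6,7) par
      unfolding 1 2 3 4 s t by auto
  qed
  obtain y where y: "y \<in> W" using ne by blast
  let ?m = "dder e1 y (E3 y) \<bullet> e2 y"
  obtain c' where c': "2 * a1 * a3 + a3 * k + a1 * ?m = c' * a1" "2 * b1 * b3 + b3 * k + b1 * ?m = c' * b1"
    "dder E3 y (E2 y) - dder E2 y (E3 y) = 0 *\<^sub>R E2 y + 0 *\<^sub>R E3 y + c' *\<^sub>R E1 y" using at[OF y] by auto
  have "dder (\<lambda>z. dder e3 z (E3 z)) y (E2 y) = dder (\<lambda>z. 0) y (E2 y)"
    by (rule dder_cong_on[OF W(1) y]) (use at in blast)
  moreover have "dder (\<lambda>z. dder e3 z (E2 z)) y (E3 y) = dder (\<lambda>z. k *\<^sub>R e1 z) y (E3 y)"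
    by (rule dder_cong_on[OF W(1) y]) (use at in blast)
  ultimately have eq: "- (k *\<^sub>R dder e1 y (E3 y)) = c' *\<^sub>R dder e3 y (E1 y)"
    using c.second_derivative[OF y smooth_e(3) c'(3)] by (simp add: dder_scaleR_const[OF smooth_e(1) y])
  have "dder e3 y (E1 y) = - k *\<^sub>R e2 y" using at[OF y] by blast
  then have "dder e3 y (E1 y) \<bullet> e2 y = - k" using frame_inner(2)[OF y] by simp
  moreover have "- (k *\<^sub>R dder e1 y (E3 y)) \<bullet> e2 y = - (k * ?m)" by simp
  ultimately have km: "k * ?m = c' * k" using arg_cong[OF eq, of "\<lambda>v. v \<bullet> e2 y"] by simp
  obtain c where "2 * a1 * a1 + a1 * k + a1 * k = c * a3" "2 * b1 * b1 + b1 * k + b1 * k = c * b3"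
    using structure_equations[OF y] at[OF y] unfolding par by metis
  from double_slope_cases[OF np this c'(1,2) km] show ?thesis
    by (intro that[of k]) (use at in blast)+
qed

text \<open>The diagonal connection before its coefficients are known to be constant.\<close>

definition diagonal_field :: "(real^3 \<Rightarrow> real) \<Rightarrow> (real^3 \<Rightarrow> real) \<Rightarrow> (real^3 \<Rightarrow> real) \<Rightarrow> bool" where
  "diagonal_field w1 w2 w3 \<longleftrightarrow> (\<forall>y\<in>W.
     dder e1 y (E1 y) = 0 \<and> dder e2 y (E1 y) = w1 y *\<^sub>R e3 y \<and> dder e3 y (E1 y) = - w1 y *\<^sub>R e2 y \<and>
     dder e1 y (E2 y) = - w2 y *\<^sub>R e3 y \<and> dder e2 y (E2 y) = 0 \<and> dder e3 y (E2 y) = w2 y *\<^sub>R e1 y \<and>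
     dder e1 y (E3 y) = w3 y *\<^sub>R e2 y \<and> dder e2 y (E3 y) = - w3 y *\<^sub>R e1 y \<and> dder e3 y (E3 y) = 0)"

text \<open>The structure equations for the pair \<open>(E1, E2)\<close> together with the symmetry of the second
  derivatives of \<open>e1\<close> and \<open>e2\<close>.\<close>

lemma diagonal_field_structure:
  assumes D: "diagonal_field w1 w2 w3" and ws: "Cinf_on W w1" "Cinf_on W w2"
    and np: "a1 * b2 \<noteq> a2 * b1" and y: "y \<in> W"
  obtains c3 where "2 * a1 * a2 + a2 * w1 y + a1 * w2 y = c3 * a3" "2 * b1 * b2 + b2 * w1 y + b1 * w2 y = c3 * b3"
    "w1 y * w2 y = c3 * w3 y" "dder w2 y (E1 y) = 0" "dder w1 y (E2 y) = 0"
proof -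
  note de = D[unfolded diagonal_field_def, rule_format]
  obtain c1 c2 c3 where C: "dder E2 y (E1 y) - dder E1 y (E2 y) = c1 *\<^sub>R E1 y + c2 *\<^sub>R E2 y + c3 *\<^sub>R E3 y"
    "- a2 * (dder e1 y (E1 y) \<bullet> e2 y) = c1 * a1" "- b2 * (dder e1 y (E1 y) \<bullet> e2 y) = c1 * b1"
    "- a1 * (dder e1 y (E2 y) \<bullet> e2 y) = c2 * a2" "- b1 * (dder e1 y (E2 y) \<bullet> e2 y) = c2 * b2"
    "2 * a1 * a2 + a2 * (dder e2 y (E1 y) \<bullet> e3 y) + a1 * (dder e3 y (E2 y) \<bullet> e1 y) = c3 * a3"
    "2 * b1 * b2 + b2 * (dder e2 y (E1 y) \<bullet> e3 y) + b1 * (dder e3 y (E2 y) \<bullet> e1 y) = c3 * b3"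
    by (rule structure_equations[OF y])
  have "c1 = 0" using parallel_scalar_zero(2)[OF C(2,3) np] .
  moreover have "c2 = 0" using parallel_scalar_zero(2)[OF C(4,5)] np by (metis mult.commute)
  ultimately have C0: "dder E2 y (E1 y) - dder E1 y (E2 y) = 0 *\<^sub>R E1 y + 0 *\<^sub>R E2 y + c3 *\<^sub>R E3 y" using C(1) by simp
  have ds: "dder (\<lambda>z. - w z *\<^sub>R e z) y v = - w y *\<^sub>R dder e y v - dder w y v *\<^sub>R e y"
      "dder (\<lambda>z. w z *\<^sub>R e z) y v = w y *\<^sub>R dder e y v + dder w y v *\<^sub>R e y"
    if "Cinf_on W w" "Cinf_on W e" for w and e :: "real^3 \<Rightarrow> quat" and v
    using dder_scaleR[OF Cinf_on_minus[OF W(1) that(1)] that(2) y] dder_scaleR[OF that y]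
    by (simp_all add: dder_minus[OF that(1) y])
  have "dder (\<lambda>z. dder e1 z (E2 z)) y (E1 y) = dder (\<lambda>z. - w2 z *\<^sub>R e3 z) y (E1 y)"
    by (rule dder_cong_on[OF W(1) y]) (use de in blast)
  also have "\<dots> = (w2 y * w1 y) *\<^sub>R e2 y - dder w2 y (E1 y) *\<^sub>R e3 y"
    unfolding ds(1)[OF ws(2) smooth_e(3)] using de[OF y] by simp
  finally have L: "dder (\<lambda>z. dder e1 z (E2 z)) y (E1 y) = \<dots>" .
  have "dder (\<lambda>z. dder e1 z (E1 z)) y (E2 y) = dder (\<lambda>z. 0) y (E2 y)"
    by (rule dder_cong_on[OF W(1) y]) (use de in blast)
  then have "(w2 y * w1 y) *\<^sub>R e2 y - dder w2 y (E1 y) *\<^sub>R e3 y = (c3 * w3 y) *\<^sub>R e2 y"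
    using second_derivative[OF y smooth_e(1) C0] de[OF y] unfolding L by simp
  then have 1: "w2 y * w1 y = c3 * w3 y" "- dder w2 y (E1 y) = 0"
    using frame_coeffs_eq[OF y, of 0 "w2 y * w1 y" "- dder w2 y (E1 y)" 0 "c3 * w3 y" 0] by simp_all
  have "dder (\<lambda>z. dder e2 z (E1 z)) y (E2 y) = dder (\<lambda>z. w1 z *\<^sub>R e3 z) y (E2 y)"
    by (rule dder_cong_on[OF W(1) y]) (use de in blast)
  also have "\<dots> = (w1 y * w2 y) *\<^sub>R e1 y + dder w1 y (E2 y) *\<^sub>R e3 y"
    unfolding ds(2)[OF ws(1) smooth_e(3)] using de[OF y] by simp
  finally have L': "dder (\<lambda>z. dder e2 z (E1 z)) y (E2 y) = \<dots>" .
  have "dder (\<lambda>z. dder e2 z (E2 z)) y (E1 y) = dder (\<lambda>z. 0) y (E1 y)"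
    by (rule dder_cong_on[OF W(1) y]) (use de in blast)
  then have "- (w1 y * w2 y) *\<^sub>R e1 y - dder w1 y (E2 y) *\<^sub>R e3 y = - (c3 * w3 y) *\<^sub>R e1 y"
    using second_derivative[OF y smooth_e(2) C0] de[OF y] unfolding L' by simp
  then have 2: "- dder w1 y (E2 y) = 0"
    using frame_coeffs_eq[OF y, of "- (w1 y * w2 y)" 0 "- dder w1 y (E2 y)" "- (c3 * w3 y)" 0 0] by simp
  show ?thesis
    by (rule that[of c3]) (use C(6,7) 1 2 de[OF y] frame_inner[OF y] in \<open>auto simp: mult.commute\<close>)
qed

text \<open>Pairwise independence makes the connection diagonal. The integrability conditions for the
  frame give the derivative of \<open>wi\<close> along \<open>Ej\<close> for \<open>j \<noteq> i\<close>, namely zero; elimination of the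
  bracket coefficient from the structure equations gives a linear relation with constant
  coefficients between two of the \<open>wi\<close>, and it transfers the vanishing to \<open>j = i\<close>.\<close>

lemma nonparallel_connection:
  assumes np: "a1 * b2 \<noteq> a2 * b1" "a2 * b3 \<noteq> a3 * b2" "a3 * b1 \<noteq> a1 * b3" and ne: "W \<noteq> {}"
  obtains w1 w2 w3 c1 c2 c3 where "diagonal_connection w1 w2 w3"
    "2 * a1 * a2 + a2 * w1 + a1 * w2 = c3 * a3" "2 * a2 * a3 + a3 * w2 + a2 * w3 = c1 * a1"
    "2 * a3 * a1 + a1 * w3 + a3 * w1 = c2 * a2"
    "2 * b1 * b2 + b2 * w1 + b1 * w2 = c3 * b3" "2 * b2 * b3 + b3 * w2 + b2 * w3 = c1 * b1"
    "2 * b3 * b1 + b1 * w3 + b3 * w1 = c2 * b2"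
    "w1 * w2 = c3 * w3" "w2 * w3 = c1 * w1" "w3 * w1 = c2 * w2"
proof -
  interpret c: adapted_frame W p q a2 a3 a1 b2 b3 b1 e2 e3 e1 E2 E3 E1 by (rule cyclic)
  interpret d: adapted_frame W p q a3 a1 a2 b3 b1 b2 e3 e1 e2 E3 E1 E2 by (rule c.cyclic)
  define w1 w2 w3 where w_def: "w1 y = dder e2 y (E1 y) \<bullet> e3 y" "w2 y = dder e3 y (E2 y) \<bullet> e1 y"
    "w3 y = dder e1 y (E3 y) \<bullet> e2 y" for y
  have ws: "Cinf_on W w1" "Cinf_on W w2" "Cinf_on W w3" unfolding w_def
    by (intro Cinf_on_inner Cinf_on_dder_field W smooths)+
  have z: "dder e1 y (E1 y) \<bullet> e2 y = 0" "dder e1 y (E2 y) \<bullet> e2 y = 0" "dder e2 y (E2 y) \<bullet> e3 y = 0"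
    "dder e2 y (E3 y) \<bullet> e3 y = 0" "dder e3 y (E3 y) \<bullet> e1 y = 0" "dder e3 y (E1 y) \<bullet> e1 y = 0" if y: "y \<in> W" for y
    using nonparallel_zero[OF np(1) y] c.nonparallel_zero[OF np(2) y] d.nonparallel_zero[OF np(3) y] by auto
  have D: "diagonal_field w1 w2 w3" unfolding diagonal_field_def
  proof
    fix y assume y: "y \<in> W"
    show "dder e1 y (E1 y) = 0 \<and> dder e2 y (E1 y) = w1 y *\<^sub>R e3 y \<and> dder e3 y (E1 y) = - w1 y *\<^sub>R e2 y \<and>
     dder e1 y (E2 y) = - w2 y *\<^sub>R e3 y \<and> dder e2 y (E2 y) = 0 \<and> dder e3 y (E2 y) = w2 y *\<^sub>R e1 y \<and>
     dder e1 y (E3 y) = w3 y *\<^sub>R e2 y \<and> dder e2 y (E3 y) = - w3 y *\<^sub>R e1 y \<and> dder e3 y (E3 y) = 0"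
      using dder_frame[OF y, of "E1 y"] dder_frame[OF y, of "E2 y"] dder_frame[OF y, of "E3 y"]
      unfolding z[OF y] w_def by auto
  qed
  have Dc: "c.diagonal_field w2 w3 w1" and Dd: "d.diagonal_field w3 w1 w2"
    using D unfolding diagonal_field_def c.diagonal_field_def d.diagonal_field_def by auto
  note S = diagonal_field_structure[OF D ws(1,2) np(1)] c.diagonal_field_structure[OF Dc ws(2,3) np(2)]
    d.diagonal_field_structure[OF Dd ws(3,1) np(3)]
  have cross: "dder w2 y (E1 y) = 0" "dder w1 y (E2 y) = 0" "dder w3 y (E2 y) = 0" "dder w2 y (E3 y) = 0"
    "dder w1 y (E3 y) = 0" "dder w3 y (E1 y) = 0" if y: "y \<in> W" for y
    using S(1)[OF y] S(2)[OF y] S(3)[OF y] by metis+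
  have self: "dder v y (E y) = 0"
    if y: "y \<in> W" and v: "Cinf_on W v" "Cinf_on W v'" and z: "dder v' y (E y) = 0"
      and rel: "\<And>y. y \<in> W \<Longrightarrow> \<exists>c. 2 * k * k' + k' * v y + k * v' y = c * k'' \<and> 2 * l * l' + l' * v y + l * v' y = c * l''"
      and n: "k' * l'' \<noteq> k'' * l'" for v v' :: "real^3 \<Rightarrow> real" and E y and k k' k'' l l' l'' :: real
  proof -
    let ?g = "\<lambda>y. (k' * l'' - k'' * l') *\<^sub>R v y + (k * l'' - k'' * l) *\<^sub>R v' y"
    have "?g y = 2 * (l * l' * k'' - k * k' * l'')" if y: "y \<in> W" for y
    proof -
      obtain c where "2 * k * k' + k' * v y + k * v' y = c * k''" "2 * l * l' + l' * v y + l * v' y = c * l''"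
        using rel[OF y] by blast
      then have "(k' * l'' - k'' * l') * v y + (k * l'' - k'' * l) * v' y = 2 * (l * l' * k'' - k * k' * l'')" by algebra
      then show ?thesis by simp
    qed
    then have "dder ?g y (E y) = dder (\<lambda>_. 2 * (l * l' * k'' - k * k' * l'')) y (E y)"
      by (intro dder_cong_on[OF W(1) y]) auto
    moreover have "dder ?g y (E y) = (k' * l'' - k'' * l') *\<^sub>R dder v y (E y) + (k * l'' - k'' * l) *\<^sub>R dder v' y (E y)"
      by (simp only: dder_add[OF Cinf_on_scaleR[OF W(1) Cinf_on_const v(1)] Cinf_on_scaleR[OF W(1) Cinf_on_const v(2)] y]
          dder_scaleR_const[OF v(1) y] dder_scaleR_const[OF v(2) y])
    ultimately show ?thesis using z n by simp
  qed
  have s1: "dder w1 y (E1 y) = 0" if y: "y \<in> W" for y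
    by (rule self[where E=E1, OF y ws(1,2) cross(1)[OF y], of a1 a2 a3 b1 b2 b3]) (use S(1) np in metis)+
  have s2: "dder w2 y (E2 y) = 0" if y: "y \<in> W" for y
    by (rule self[where E=E2, OF y ws(2,3) cross(3)[OF y], of a2 a3 a1 b2 b3 b1]) (use S(2) np in metis)+
  have s3: "dder w3 y (E3 y) = 0" if y: "y \<in> W" for y
    by (rule self[where E=E3, OF y ws(3,1) cross(5)[OF y], of a3 a1 a2 b3 b1 b2]) (use S(3) np in metis)+
  obtain k1 where k1: "\<And>y. y \<in> W \<Longrightarrow> w1 y = k1" using constant_if_dder_zero[OF ws(1) s1 cross(2) cross(5)] by blast
  obtain k2 where k2: "\<And>y. y \<in> W \<Longrightarrow> w2 y = k2" using constant_if_dder_zero[OF ws(2) cross(1) s2 cross(4)] by blast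
  obtain k3 where k3: "\<And>y. y \<in> W \<Longrightarrow> w3 y = k3" using constant_if_dder_zero[OF ws(3) cross(6) cross(3) s3] by blast
  have DC: "diagonal_connection k1 k2 k3"
    using D k1 k2 k3 unfolding diagonal_field_def diagonal_connection_def by auto
  obtain y where y: "y \<in> W" using ne by blast
  obtain c3 where c3: "2 * a1 * a2 + a2 * k1 + a1 * k2 = c3 * a3" "2 * b1 * b2 + b2 * k1 + b1 * k2 = c3 * b3" "k1 * k2 = c3 * k3"
    using S(1)[OF y] unfolding k1[OF y] k2[OF y] k3[OF y] by metis
  obtain c1 where c1: "2 * a2 * a3 + a3 * k2 + a2 * k3 = c1 * a1" "2 * b2 * b3 + b3 * k2 + b2 * k3 = c1 * b1" "k2 * k3 = c1 * k1"
    using S(2)[OF y] unfolding k1[OF y] k2[OF y] k3[OF y] by metis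
  obtain c2 where c2: "2 * a3 * a1 + a1 * k3 + a3 * k1 = c2 * a2" "2 * b3 * b1 + b1 * k3 + b3 * k1 = c2 * b2" "k3 * k1 = c2 * k2"
    using S(3)[OF y] unfolding k1[OF y] k2[OF y] k3[OF y] by metis
  show ?thesis using that[OF DC c3(1) c1(1) c2(1) c3(2) c1(2) c2(2) c3(3) c1(3) c2(3)] .
qed

end

section \<open>Classification for given constants\<close>

text \<open>The immersions of convex chart domains that admit an adapted frame with the given
  constants.\<close>

definition realized :: "real \<Rightarrow> real \<Rightarrow> real \<Rightarrow> real \<Rightarrow> real \<Rightarrow> real
    \<Rightarrow> ((real^3) set \<times> (real^3 \<Rightarrow> quat) \<times> (real^3 \<Rightarrow> quat)) set" where
  "realized a1 a2 a3 b1 b2 b3 =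
     {(W, p, q). \<exists>e1 e2 e3 E1 E2 E3. adapted_frame W p q a1 a2 a3 b1 b2 b3 e1 e2 e3 E1 E2 E3}"

lemma realizedI: "adapted_frame W p q a1 a2 a3 b1 b2 b3 e1 e2 e3 E1 E2 E3 \<Longrightarrow> (W, p, q) \<in> realized a1 a2 a3 b1 b2 b3"
  unfolding realized_def by blast

lemma realizedE:
  assumes "(W, p, q) \<in> realized a1 a2 a3 b1 b2 b3"
  obtains e1 e2 e3 E1 E2 E3 where "adapted_frame W p q a1 a2 a3 b1 b2 b3 e1 e2 e3 E1 E2 E3"
  using assms unfolding realized_def by auto

text \<open>The order of the three pairs of constants and a common sign of the two members of a pair are
  immaterial. Inclusions suffice, since the classification is inherited by smaller families.\<close>

lemma realized_cyclic: "realized a1 a2 a3 b1 b2 b3 \<subseteq> realized a2 a3 a1 b2 b3 b1"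
  by (clarify, erule realizedE, rule realizedI, erule adapted_frame.cyclic)

lemma realized_flip: "realized a1 a2 a3 b1 b2 b3 \<subseteq> realized (- a1) a2 a3 (- b1) b2 b3"
  by (clarify, erule realizedE, rule realizedI, erule adapted_frame.flip)

lemma realized_transpose: "realized a1 a2 a3 b1 b2 b3 \<subseteq> realized a2 a1 a3 b2 b1 b3"
  by (clarify, erule realizedE, rule realizedI, erule adapted_frame.transpose)

lemma realized_flip2: "realized a1 a2 a3 b1 b2 b3 \<subseteq> realized a1 (- a2) a3 b1 (- b2) b3"
  using realized_cyclic[of a1 a2 a3 b1 b2 b3] realized_flip[of a2 a3 a1 b2 b3 b1]
    realized_cyclic[of "- a2" a3 a1 "- b2" b3 b1] realized_cyclic[of a3 a1 "- a2" b3 b1 "- b2"] by blast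

lemma realized_flip3: "realized a1 a2 a3 b1 b2 b3 \<subseteq> realized a1 a2 (- a3) b1 b2 (- b3)"
  using realized_cyclic[of a1 a2 a3 b1 b2 b3] realized_flip2[of a2 a3 a1 b2 b3 b1]
    realized_cyclic[of a2 "- a3" a1 b2 "- b3" b1] realized_cyclic[of "- a3" a1 a2 "- b3" b1 b2] by blast

definition modelled :: "((real^3) set \<times> (real^3 \<Rightarrow> quat) \<times> (real^3 \<Rightarrow> quat)) set
    \<Rightarrow> 'n::euclidean_space set \<Rightarrow> ('n \<Rightarrow> quat \<times> quat) \<Rightarrow> bool" where
  "modelled S N f0 \<longleftrightarrow> (\<forall>(W, p, q)\<in>S. \<forall>x\<in>W. locally_model W p q N f0 x)"

definition in_hyperplane :: "'a set \<Rightarrow> ('a \<Rightarrow> quat) \<Rightarrow> bool" where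
  "in_hyperplane V p \<longleftrightarrow> (\<exists>c. c \<noteq> 0 \<and> (\<forall>y\<in>V. c \<bullet> p y = 0))"

text \<open>The one case in which the constants do not determine the model. The position of \<open>p\<close> relative
  to hyperplanes is recorded because it decides between the two models and propagates from one
  chart domain to the next.\<close>

definition sphere_or_torus :: "((real^3) set \<times> (real^3 \<Rightarrow> quat) \<times> (real^3 \<Rightarrow> quat)) set \<Rightarrow> bool" where
  "sphere_or_torus S \<longleftrightarrow> (\<forall>(W, p, q)\<in>S. W \<noteq> {} \<longrightarrow>
     (\<forall>x\<in>W. locally_model W p q S3 (\<lambda>u. (u \<otimes>\<^sub>H quat_i \<otimes>\<^sub>H quat_inv u, u \<otimes>\<^sub>H quat_j \<otimes>\<^sub>H quat_inv u)) x)
       \<and> in_hyperplane W p \<or>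
     (\<forall>x\<in>W. locally_model W p q (UNIV :: (real^3) set) (\<lambda>x. (torus_p (x$1) (x$3), torus_q (x$1) (x$2))) x)
       \<and> (\<forall>V. open V \<and> V \<subseteq> W \<and> V \<noteq> {} \<longrightarrow> \<not> in_hyperplane V p))"

text \<open>One model serves all maps of the family at once. This is stronger than a model for each map,
  and it is what makes the model independent of the point of the manifold.\<close>

definition single_model :: "((real^3) set \<times> (real^3 \<Rightarrow> quat) \<times> (real^3 \<Rightarrow> quat)) set \<Rightarrow> bool" where
  "single_model S \<longleftrightarrow>
     modelled S S3 (\<lambda>u. (u, quat_one)) \<or>
     modelled S S3 (\<lambda>u. (quat_one, u)) \<or>
     modelled S S3 (\<lambda>u. (u, u)) \<or>
     modelled S S3 (\<lambda>u. (u, u \<otimes>\<^sub>H quat_i)) \<or>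
     modelled S S3 (\<lambda>u. (quat_inv u, u \<otimes>\<^sub>H quat_i \<otimes>\<^sub>H quat_inv u)) \<or>
     modelled S S3 (\<lambda>u. (u \<otimes>\<^sub>H quat_i \<otimes>\<^sub>H quat_inv u, quat_inv u)) \<or>
     sphere_or_torus S"

lemma modelled_subset: "modelled T N f0 \<Longrightarrow> S \<subseteq> T \<Longrightarrow> modelled S N f0"
  unfolding modelled_def by blast

lemma sphere_or_torus_subset: "sphere_or_torus T \<Longrightarrow> S \<subseteq> T \<Longrightarrow> sphere_or_torus S"
  unfolding sphere_or_torus_def by (meson subsetD)

lemma single_model_subset: "single_model T \<Longrightarrow> S \<subseteq> T \<Longrightarrow> single_model S"
  unfolding single_model_def using modelled_subset sphere_or_torus_subset by meson

text \<open>A family without a map on a nonempty domain is vacuously modelled, so the constants may be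
  assumed to satisfy the necessary conditions derived from an actual frame.\<close>

lemma single_modelI:
  assumes "\<And>W p q. (W, p, q) \<in> S \<Longrightarrow> W \<noteq> {} \<Longrightarrow> single_model S"
  shows "single_model S"
proof (cases "\<exists>W p q. (W, p, q) \<in> S \<and> W \<noteq> {}")
  case True
  then show ?thesis using assms by blast
next
  case False
  then have "modelled S S3 (\<lambda>u. (u, quat_one))" unfolding modelled_def by auto
  then show ?thesis unfolding single_model_def by blast
qed

lemma (in adapted_frame) model_first_constant:
  assumes "a1 = 0" "a2 = 0" "a3 = 0" and x0: "x0 \<in> W"
  shows "locally_model W p q S3 (\<lambda>u. (quat_one, u)) x0"
proof -
  interpret x: adapted_frame W q p b1 b2 b3 a1 a2 a3 e1 e2 e3 E1 E2 E3 by (rule exchange)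
  obtain c where c: "\<And>y. y \<in> W \<Longrightarrow> p y = c"
    using constant_if_dder_zero[OF smooth_pq(1)] dp assms by force
  obtain U where U: "x0 \<in> U" "U \<subseteq> W" "smooth_embedding_onto_open U S3 q"
    by (rule frame_map_local_diffeo[of q q "\<lambda>_. quat_one" b1 b2 b3 x0])
      (use ab assms smooth_pq pq_S3 dq S3_one in auto)
  show ?thesis
    by (rule locally_modelI[OF U _ S3_one S3_one]) (use c pq_S3(1) x0 U(2) in auto)
qed

lemma single_model_all_parallel: "single_model (realized a a a b b b)"
proof (rule single_modelI)
  fix W p q assume "(W, p, q) \<in> realized a a a b b b" "W \<noteq> {}"
  then consider "a = 0" | "b = 0" | "a = b"
    using adapted_frame.all_parallel_cases[OF _ refl refl refl refl] realizedE by (metis equals0I)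
  then show "single_model (realized a a a b b b)"
  proof cases
    case 1
    have "modelled (realized a a a b b b) S3 (\<lambda>u. (quat_one, u))"
      unfolding modelled_def by (clarify, erule realizedE) (rule adapted_frame.model_first_constant[OF _ 1 1 1])
    then show ?thesis unfolding single_model_def by blast
  next
    case 2
    have "modelled (realized a a a b b b) S3 (\<lambda>u. (u, quat_one))"
      unfolding modelled_def by (clarify, erule realizedE) (rule adapted_frame.model_second_constant[OF _ 2 2 2])
    then show ?thesis unfolding single_model_def by blast
  next
    case 3
    have "modelled (realized a a a b b b) S3 (\<lambda>u. (u, u))"
      unfolding modelled_def by (clarify, erule realizedE) (rule adapted_frame.model_diagonal[OF _ 3 3 3])
    then show ?thesis unfolding single_model_def by blast
  qed
qed

text \<open>Of the three alternatives for the connection only one is compatible with the given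
  constants; the same holds for the next model.\<close>

lemma (in adapted_frame) pair_parallel_right_translate:
  assumes "a2 = a1" "b2 = b1" "a1 * b3 \<noteq> a3 * b1" "a3 = b3" "b1 = - a1" "x \<in> W"
  shows "locally_model W p q S3 (\<lambda>u. (u, u \<otimes>\<^sub>H quat_i)) x"
proof -
  have ne: "W \<noteq> {}" using assms(6) by blast
  obtain k where k: "\<And>y. y \<in> W \<Longrightarrow> dder e3 y (E1 y) = - k *\<^sub>R e2 y" "\<And>y. y \<in> W \<Longrightarrow> dder e3 y (E2 y) = k *\<^sub>R e1 y"
     "\<And>y. y \<in> W \<Longrightarrow> dder e3 y (E3 y) = 0"
     "k = 0 \<and> a3 = b3 \<and> b1 = - a1 \<or> b3 = 0 \<and> b1 = 2 * a1 \<and> k = - 2 * a1 \<or> a3 = 0 \<and> a1 = 2 * b1 \<and> k = - 2 * b1"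
    by (rule pair_parallel_cases[OF assms(1-3) ne]) blast
  have "k = 0" using k(4) assms(3,4,5) by auto
  then show ?thesis using model_right_translate[OF _ _ _ _ _ k(3) assms(6)] k(1,2) assms by simp
qed

lemma (in adapted_frame) pair_parallel_conjugation:
  assumes "a2 = a1" "b2 = b1" "a1 * b3 \<noteq> a3 * b1" "b3 = 0" "b1 = 2 * a1" and x: "x \<in> W"
  obtains U u c h where "x \<in> U" "U \<subseteq> W" "smooth_embedding_onto_open U S3 u" "c \<in> S3" "h \<in> S3"
    "\<And>y. y \<in> U \<Longrightarrow> p y = h \<otimes>\<^sub>H quat_inv (u y)" "\<And>y. y \<in> U \<Longrightarrow> q y = c \<otimes>\<^sub>H (u y \<otimes>\<^sub>H quat_i \<otimes>\<^sub>H quat_inv (u y))"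
proof -
  have ne: "W \<noteq> {}" using x by blast
  obtain k where k: "\<And>y. y \<in> W \<Longrightarrow> dder e3 y (E1 y) = - k *\<^sub>R e2 y" "\<And>y. y \<in> W \<Longrightarrow> dder e3 y (E2 y) = k *\<^sub>R e1 y"
     "\<And>y. y \<in> W \<Longrightarrow> dder e3 y (E3 y) = 0"
     "k = 0 \<and> a3 = b3 \<and> b1 = - a1 \<or> b3 = 0 \<and> b1 = 2 * a1 \<and> k = - 2 * a1 \<or> a3 = 0 \<and> a1 = 2 * b1 \<and> k = - 2 * b1"
    by (rule pair_parallel_cases[OF assms(1-3) ne]) blast
  have "a3 \<noteq> 0" using assms(3,4) by auto
  then have "k = - 2 * a1" using k(4) assms(4) by auto
  then have de: "\<And>y. y \<in> W \<Longrightarrow> dder e3 y (E1 y) = (2 * a1) *\<^sub>R e2 y" "\<And>y. y \<in> W \<Longrightarrow> dder e3 y (E2 y) = (- 2 * a2) *\<^sub>R e1 y"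
    using k(1,2) assms(1) by simp_all
  have bb: "b2 = 2 * a2" using assms by simp
  show ?thesis by (rule model_conjugation[OF assms(5) bb assms(4) de k(3) x that])
qed

lemma single_model_pair_parallel:
  assumes np: "a * B \<noteq> A * b"
  shows "single_model (realized a a A b b B)"
proof (rule single_modelI)
  let ?S = "realized a a A b b B"
  fix W p q assume S: "(W, p, q) \<in> ?S" and ne: "W \<noteq> {}"
  obtain e1 e2 e3 E1 E2 E3 where "adapted_frame W p q a a A b b B e1 e2 e3 E1 E2 E3"
    by (rule realizedE[OF S])
  then interpret F: adapted_frame W p q a a A b b B e1 e2 e3 E1 E2 E3 .
  consider "A = B" "b = - a" | "B = 0" "b = 2 * a" | "A = 0" "a = 2 * b"
    using F.pair_parallel_cases[OF refl refl np ne] by metis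
  then show "single_model ?S"
  proof cases
    case 1
    have "modelled ?S S3 (\<lambda>u. (u, u \<otimes>\<^sub>H quat_i))"
      unfolding modelled_def
      by (clarify, erule realizedE) (rule adapted_frame.pair_parallel_right_translate[OF _ refl refl np 1])
    then show ?thesis unfolding single_model_def by blast
  next
    case 2
    have "modelled ?S S3 (\<lambda>u. (quat_inv u, u \<otimes>\<^sub>H quat_i \<otimes>\<^sub>H quat_inv u))"
      unfolding modelled_def
    proof clarify
      fix W p q x assume "(W, p, q) \<in> ?S" and x: "x \<in> W"
      then obtain e1 e2 e3 E1 E2 E3 where F: "adapted_frame W p q a a A b b B e1 e2 e3 E1 E2 E3"
        by (elim realizedE)
      obtain U u c h where U: "x \<in> U" "U \<subseteq> W" "smooth_embedding_onto_open U S3 u" and ch: "c \<in> S3" "h \<in> S3"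
        and pq: "\<And>y. y \<in> U \<Longrightarrow> p y = h \<otimes>\<^sub>H quat_inv (u y)" "\<And>y. y \<in> U \<Longrightarrow> q y = c \<otimes>\<^sub>H (u y \<otimes>\<^sub>H quat_i \<otimes>\<^sub>H quat_inv (u y))"
        by (rule adapted_frame.pair_parallel_conjugation[OF F refl refl np 2 x]) blast
      show "locally_model W p q S3 (\<lambda>u. (quat_inv u, u \<otimes>\<^sub>H quat_i \<otimes>\<^sub>H quat_inv u)) x"
        by (rule locally_modelI[OF U ch(2,1) S3_one]) (use pq in auto)
    qed
    then show ?thesis unfolding single_model_def by blast
  next
    case 3
    have np': "b * A \<noteq> B * a" using np by (simp add: mult.commute)
    have "modelled ?S S3 (\<lambda>u. (u \<otimes>\<^sub>H quat_i \<otimes>\<^sub>H quat_inv u, quat_inv u))"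
      unfolding modelled_def
    proof clarify
      fix W p q x assume "(W, p, q) \<in> ?S" and x: "x \<in> W"
      then obtain e1 e2 e3 E1 E2 E3 where F: "adapted_frame W p q a a A b b B e1 e2 e3 E1 E2 E3"
        by (elim realizedE)
      obtain U u c h where U: "x \<in> U" "U \<subseteq> W" "smooth_embedding_onto_open U S3 u" and ch: "c \<in> S3" "h \<in> S3"
        and pq: "\<And>y. y \<in> U \<Longrightarrow> q y = h \<otimes>\<^sub>H quat_inv (u y)" "\<And>y. y \<in> U \<Longrightarrow> p y = c \<otimes>\<^sub>H (u y \<otimes>\<^sub>H quat_i \<otimes>\<^sub>H quat_inv (u y))"
        by (rule adapted_frame.pair_parallel_conjugation[OF adapted_frame.exchange[OF F] refl refl np' 3 x]) blast
      show "locally_model W p q S3 (\<lambda>u. (u \<otimes>\<^sub>H quat_i \<otimes>\<^sub>H quat_inv u, quat_inv u)) x"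
        by (rule locally_modelI[OF U ch S3_one]) (use pq in auto)
    qed
    then show ?thesis unfolding single_model_def by blast
  qed
qed

text \<open>For these constants the connection decides: it is that of the frame pair or that of the
  torus.\<close>

lemma sphere_or_torus_model_slopes:
  assumes s: "model_slopes a1 a2 a3 b1 b2 b3"
    and np: "a1 * b2 \<noteq> a2 * b1" "a2 * b3 \<noteq> a3 * b2" "a3 * b1 \<noteq> a1 * b3"
  shows "sphere_or_torus (realized a1 a2 a3 b1 b2 b3)"
proof -
  have s': "a2 = 0" "b3 = 0" "b1 = a1" using s by (auto simp: model_slopes_def)
  have nz: "a1 \<noteq> 0" "b2 \<noteq> 0" "a3 \<noteq> 0" using np s' by auto
  have "(\<forall>x\<in>W. locally_model W p q S3 (\<lambda>u. (u \<otimes>\<^sub>H quat_i \<otimes>\<^sub>H quat_inv u, u \<otimes>\<^sub>H quat_j \<otimes>\<^sub>H quat_inv u)) x)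
       \<and> in_hyperplane W p \<or>
     (\<forall>x\<in>W. locally_model W p q (UNIV :: (real^3) set) (\<lambda>x. (torus_p (x$1) (x$3), torus_q (x$1) (x$2))) x)
       \<and> (\<forall>V. open V \<and> V \<subseteq> W \<and> V \<noteq> {} \<longrightarrow> \<not> in_hyperplane V p)" (is "?sphere \<or> ?torus")
    if S: "(W, p, q) \<in> realized a1 a2 a3 b1 b2 b3" and ne: "W \<noteq> {}" for W p q
  proof -
  obtain e1 e2 e3 E1 E2 E3 where "adapted_frame W p q a1 a2 a3 b1 b2 b3 e1 e2 e3 E1 E2 E3"
    using S by (rule realizedE)
  then interpret F: adapted_frame W p q a1 a2 a3 b1 b2 b3 e1 e2 e3 E1 E2 E3 .
  obtain w1 w2 w3 c1 c2 c3 where D: "F.diagonal_connection w1 w2 w3" and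
    C: "2 * a1 * a2 + a2 * w1 + a1 * w2 = c3 * a3" "2 * a2 * a3 + a3 * w2 + a2 * w3 = c1 * a1"
    "2 * a3 * a1 + a1 * w3 + a3 * w1 = c2 * a2"
    "2 * b1 * b2 + b2 * w1 + b1 * w2 = c3 * b3" "2 * b2 * b3 + b3 * w2 + b2 * w3 = c1 * b1"
    "2 * b3 * b1 + b1 * w3 + b3 * w1 = c2 * b2"
    "w1 * w2 = c3 * w3" "w2 * w3 = c1 * w1" "w3 * w1 = c2 * w2"
    by (rule F.nonparallel_connection[OF np ne])
  from model_slopes_connection[OF C s' nz]
  show ?thesis
  proof
    assume "w1 = - a1 \<and> w2 = - b2 \<and> w3 = - a3"
    then have "F.diagonal_connection (- a1) (- b2) (- a3)" using D by simp
    note m = F.model_frame_pair[OF s' this]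
    have "0 \<notin> S3" by (simp add: S3_norm)
    then have "in_hyperplane W p" using m(2) ne unfolding in_hyperplane_def by (metis equals0I)
    then show ?thesis using m(1) by blast
  next
    assume "w1 = - 2 * a1 \<and> w2 = 0 \<and> w3 = 0"
    then have D8: "F.diagonal_connection (- 2 * a1) 0 0" using D by simp
    have "?torus" using F.model_torus[OF s' D8] F.torus_spans[OF s' D8]
      unfolding in_hyperplane_def by blast
    then show ?thesis ..
  qed
  qed
  then show ?thesis unfolding sphere_or_torus_def by blast
qed

lemma single_model_nonparallel:
  assumes np: "a1 * b2 \<noteq> a2 * b1" "a2 * b3 \<noteq> a3 * b2" "a3 * b1 \<noteq> a1 * b3"
  shows "single_model (realized a1 a2 a3 b1 b2 b3)"
proof (rule single_modelI)
  let ?S = "realized a1 a2 a3 b1 b2 b3"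
  fix W p q assume S: "(W, p, q) \<in> ?S" and ne: "W \<noteq> {}"
  obtain e1 e2 e3 E1 E2 E3 where F: "adapted_frame W p q a1 a2 a3 b1 b2 b3 e1 e2 e3 E1 E2 E3"
    by (rule realizedE[OF S])
  have "model_slopes a1 a2 a3 b1 b2 b3 \<or> model_slopes a1 a3 a2 b1 b3 b2 \<or> model_slopes a2 a1 a3 b2 b1 b3 \<or>
    model_slopes a2 a3 a1 b2 b3 b1 \<or> model_slopes a3 a1 a2 b3 b1 b2 \<or> model_slopes a3 a2 a1 b3 b2 b1"
    by (rule adapted_frame.nonparallel_connection[OF F np ne], rule nonparallel_slopes[OF _ _ _ _ _ _ _ _ _ np])
  moreover have "?S \<subseteq> realized a1 a3 a2 b1 b3 b2" "?S \<subseteq> realized a2 a1 a3 b2 b1 b3"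
    "?S \<subseteq> realized a2 a3 a1 b2 b3 b1" "?S \<subseteq> realized a3 a1 a2 b3 b1 b2" "?S \<subseteq> realized a3 a2 a1 b3 b2 b1"
    using realized_cyclic[of a1 a2 a3 b1 b2 b3] realized_cyclic[of a2 a3 a1 b2 b3 b1]
      realized_transpose[of a1 a2 a3 b1 b2 b3] realized_transpose[of a2 a3 a1 b2 b3 b1]
      realized_transpose[of a3 a1 a2 b3 b1 b2] by blast+
  moreover have "model_slopes a1 a2 a3 b1 b2 b3 \<Longrightarrow> sphere_or_torus (realized a1 a2 a3 b1 b2 b3)"
    "model_slopes a1 a3 a2 b1 b3 b2 \<Longrightarrow> sphere_or_torus (realized a1 a3 a2 b1 b3 b2)"
    "model_slopes a2 a1 a3 b2 b1 b3 \<Longrightarrow> sphere_or_torus (realized a2 a1 a3 b2 b1 b3)"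
    "model_slopes a2 a3 a1 b2 b3 b1 \<Longrightarrow> sphere_or_torus (realized a2 a3 a1 b2 b3 b1)"
    "model_slopes a3 a1 a2 b3 b1 b2 \<Longrightarrow> sphere_or_torus (realized a3 a1 a2 b3 b1 b2)"
    "model_slopes a3 a2 a1 b3 b2 b1 \<Longrightarrow> sphere_or_torus (realized a3 a2 a1 b3 b2 b1)"
    by (rule sphere_or_torus_model_slopes; use np in \<open>simp add: mult.commute eq_commute\<close>)+
  ultimately have "sphere_or_torus ?S"
    by (meson sphere_or_torus_subset)
  then show "single_model ?S" unfolding single_model_def by blast
qed

text \<open>The cases are distinguished by which of the three vectors \<open>(ai, bi)\<close> are parallel. Parallel
  vectors may be assumed to be equal, since they have the same norm and signs are immaterial. If
  all three are parallel, \<open>p\<close> or \<open>q\<close> is constant or the two agree up to a left factor. If exactly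
  one pair is parallel, one of the next three models results. If no two are parallel, the map is a
  frame pair or a torus.\<close>

theorem single_model_realized:
  assumes n: "a1\<^sup>2 + b1\<^sup>2 - a1 * b1 = n" "a2\<^sup>2 + b2\<^sup>2 - a2 * b2 = n" "a3\<^sup>2 + b3\<^sup>2 - a3 * b3 = n"
  shows "single_model (realized a1 a2 a3 b1 b2 b3)"
proof (rule single_modelI)
  let ?S = "realized a1 a2 a3 b1 b2 b3"
  fix W p q assume S: "(W, p, q) \<in> ?S" and ne: "W \<noteq> {}"
  obtain e1 e2 e3 E1 E2 E3 where F: "adapted_frame W p q a1 a2 a3 b1 b2 b3 e1 e2 e3 E1 E2 E3"
    by (rule realizedE[OF S])
  note nz = adapted_frame.ab[OF F]
  have pair: "single_model (realized a1 a2 a3 b1 b2 b3)"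
    if par: "a1 * b2 = a2 * b1" and n: "a1\<^sup>2 + b1\<^sup>2 - a1 * b1 = n" "a2\<^sup>2 + b2\<^sup>2 - a2 * b2 = n" "a3\<^sup>2 + b3\<^sup>2 - a3 * b3 = n"
      and nz: "a1 \<noteq> 0 \<or> b1 \<noteq> 0" for a1 a2 a3 b1 b2 b3
  proof -
    have "realized a1 a2 a3 b1 b2 b3 \<subseteq> realized a1 a1 a3 b1 b1 b3"
      using parallel_same_norm[OF par n(1,2) nz] realized_flip2[of a1 a2 a3 b1 b2 b3] by auto
    moreover have "single_model (realized a1 a1 a3 b1 b1 b3)"
    proof (cases "a1 * b3 = a3 * b1")
      case True
      have "realized a1 a1 a3 b1 b1 b3 \<subseteq> realized a1 a1 a1 b1 b1 b1"
        using parallel_same_norm[OF True n(1,3) nz] realized_flip3[of a1 a1 a3 b1 b1 b3] by auto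
      then show ?thesis using single_model_all_parallel single_model_subset by blast
    next
      case False
      then show ?thesis by (rule single_model_pair_parallel)
    qed
    ultimately show ?thesis using single_model_subset by blast
  qed
  consider "a1 * b2 = a2 * b1" | "a2 * b3 = a3 * b2" | "a3 * b1 = a1 * b3"
    | "a1 * b2 \<noteq> a2 * b1" "a2 * b3 \<noteq> a3 * b2" "a3 * b1 \<noteq> a1 * b3" by blast
  then show "single_model ?S"
  proof cases
    case 1
    then show ?thesis using pair n nz by blast
  next
    case 2
    then have "single_model (realized a2 a3 a1 b2 b3 b1)" using pair n nz by blast
    then show ?thesis using realized_cyclic[of a1 a2 a3 b1 b2 b3] single_model_subset by blast
  next
    case 3
    then have "single_model (realized a3 a1 a2 b3 b1 b2)" using pair n nz by blast
    moreover have "?S \<subseteq> realized a3 a1 a2 b3 b1 b2"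
      using realized_cyclic[of a1 a2 a3 b1 b2 b3] realized_cyclic[of a2 a3 a1 b2 b3 b1] by blast
    ultimately show ?thesis using single_model_subset by blast
  next
    case 4
    then show ?thesis by (rule single_model_nonparallel)
  qed
qed

section \<open>Smooth frames around every point\<close>

text \<open>Cramer's rule in terms of cross products. It makes the inverse of a linear map depend
  visibly smoothly on the columns.\<close>

lemma three_pairs:
  fixes g1 g2 g3 z :: "real^3"
  shows "(z \<bullet> cross3 g2 g3) *\<^sub>R g1 + (z \<bullet> cross3 g3 g1) *\<^sub>R g2 + (z \<bullet> cross3 g1 g2) *\<^sub>R g3 = (g1 \<bullet> cross3 g2 g3) *\<^sub>R z"
  by (simp add: cross3_def vec_eq_iff forall_3 inner_vec_def sum_3 algebra_simps)

lemma bounded_bilinear_cross3: "bounded_bilinear cross3"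
proof -
  have "bilinear cross3"
    unfolding bilinear_def
    by (intro conjI allI linearI) (simp_all add: cross3_def vec_eq_iff forall_3 algebra_simps)
  then show ?thesis using bilinear_conv_bounded_bilinear by blast
qed

lemma triple_product_nonzero:
  fixes g1 g2 g3 :: "real^3"
  assumes inj: "\<And>v::real^3. v$1 *\<^sub>R g1 + v$2 *\<^sub>R g2 + v$3 *\<^sub>R g3 = 0 \<Longrightarrow> v = 0"
  shows "g1 \<bullet> cross3 g2 g3 \<noteq> 0"
proof
  assume 0: "g1 \<bullet> cross3 g2 g3 = 0"
  have "z \<bullet> cross3 g2 g3 = 0" for z
    using inj[of "vector [z \<bullet> cross3 g2 g3, z \<bullet> cross3 g3 g1, z \<bullet> cross3 g1 g2]"] three_pairs[of z g2 g3 g1] 0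
    by (simp add: vec_eq_iff forall_3)
  then have c: "cross3 g2 g3 = 0" by (metis inner_eq_zero_iff)
  have "(g2 \<bullet> g2) *\<^sub>R g3 - (g2 \<bullet> g3) *\<^sub>R g2 = - cross3 g2 (cross3 g2 g3)"
    by (simp add: cross3_def vec_eq_iff forall_3 inner_vec_def sum_3 algebra_simps)
  also have "\<dots> = 0" unfolding c by (simp add: cross3_def vec_eq_iff forall_3)
  finally have "(g2 \<bullet> g2) = 0"
    using inj[of "vector [0, - (g2 \<bullet> g3), g2 \<bullet> g2]"] by (simp add: vec_eq_iff forall_3)
  then have "g2 = 0" by simp
  then show False using inj[of "vector [0, 1, 0]"] by (simp add: vec_eq_iff forall_3)
qed

definition orthonormal3 :: "(3 \<Rightarrow> quat) \<Rightarrow> bool" where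
  "orthonormal3 e \<longleftrightarrow> (\<forall>i. imaginary (e i)) \<and> (\<forall>i j. e i \<bullet> e j = (if i = j then 1 else 0))"

lemma orthonormal3_expand:
  assumes "orthonormal3 e" "imaginary z"
  shows "z = (\<Sum>i\<in>UNIV. (z \<bullet> e i) *\<^sub>R e i)"
  using imaginary_expand[of "e 1" "e 2" "e 3" z] assms
  by (simp add: orthonormal3_def sum_3 imaginary_iff_inner)

lemma orthonormal3_inner_sum:
  assumes "orthonormal3 e"
  shows "(\<Sum>i\<in>UNIV. x i *\<^sub>R e i) \<bullet> (\<Sum>i\<in>UNIV. y i *\<^sub>R e i) = (\<Sum>i\<in>UNIV. x i * y i)"
  using assms by (simp add: orthonormal3_def sum_3 inner_add_left inner_add_right)

lemma nonneg_on_dense: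
  fixes f :: "'a::topological_space \<Rightarrow> real"
  assumes "open S" "continuous_on S f" "S \<subseteq> closure D" "\<And>y. y \<in> D \<Longrightarrow> y \<in> S \<Longrightarrow> f y \<ge> 0" "x \<in> S"
  shows "f x \<ge> 0"
proof (rule ccontr)
  assume "\<not> f x \<ge> 0"
  moreover have "open (S \<inter> f -` {..<0})" using continuous_open_preimage[OF assms(2,1) open_lessThan] .
  ultimately have "(S \<inter> f -` {..<0}) \<inter> D \<noteq> {}"
    using assms(3,5) open_Int_closure_eq_empty[of "S \<inter> f -` {..<0}" D] by auto
  then show False using assms(4) by force
qed

text \<open>The hypothesis of the theorem in a chart: pointwise frames exist on a dense set only,
  without any regularity, but with constants \<open>a i, b i\<close> that do not depend on the point. The aim
  is a smooth adapted frame around every point. Coinciding constants are allowed, so the legs of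
  the frame need not be unique even up to sign.\<close>

locale dense_frames =
  fixes \<Omega> \<Delta> :: "(real^3) set" and p q :: "real^3 \<Rightarrow> quat" and a b :: "3 \<Rightarrow> real"
  assumes \<Omega>: "open \<Omega>" and smooth: "Cinf_on \<Omega> p" "Cinf_on \<Omega> q"
    and S3: "y \<in> \<Omega> \<Longrightarrow> p y \<in> S3" "y \<in> \<Omega> \<Longrightarrow> q y \<in> S3"
    and immersed: "y \<in> \<Omega> \<Longrightarrow> dder p y v = 0 \<Longrightarrow> dder q y v = 0 \<Longrightarrow> v = 0"
    and dense: "\<Delta> \<subseteq> \<Omega>" "\<Omega> \<subseteq> closure \<Delta>"
    and frames: "y \<in> \<Delta> \<Longrightarrow> \<exists>e E. orthonormal3 e \<and>
       (\<forall>i. dder p y (E i) = a i *\<^sub>R (p y \<otimes>\<^sub>H e i) \<and> dder q y (E i) = b i *\<^sub>R (q y \<otimes>\<^sub>H e i))"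
    and nonzero: "a i \<noteq> 0 \<or> b i \<noteq> 0"
begin

definition \<alpha> :: "real^3 \<Rightarrow> real^3 \<Rightarrow> quat" where "\<alpha> y v = quat_cnj (p y) \<otimes>\<^sub>H dder p y v"
definition \<beta> :: "real^3 \<Rightarrow> real^3 \<Rightarrow> quat" where "\<beta> y v = quat_cnj (q y) \<otimes>\<^sub>H dder q y v"

lemma slope_exists: "\<exists>l. \<forall>i. l * a i + b i \<noteq> 0"
proof -
  have "finite (range (\<lambda>i. - b i / a i))" by simp
  then obtain l where l: "l \<notin> range (\<lambda>i. - b i / a i)"
    using ex_new_if_finite[OF infinite_UNIV_char_0] by blast
  have "l * a i + b i \<noteq> 0" for i
  proof (cases "a i = 0")
    case True
    then show ?thesis using nonzero[of i] by simp
  next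
    case False
    then have "l * a i + b i = 0 \<Longrightarrow> l = - b i / a i" by (simp add: field_simps)
    then show ?thesis using l by blast
  qed
  then show ?thesis by blast
qed

text \<open>A linear combination \<open>\<gamma>\<close> of the logarithmic differentials whose factors \<open>c i\<close> along the
  frames are all nonzero. It identifies the tangent spaces with the imaginary quaternions, and the
  frames become eigenframes of the operator \<open>T\<close> defined below.\<close>

definition l where "l = (SOME l. \<forall>i. l * a i + b i \<noteq> 0)"
definition c where "c i = l * a i + b i"
definition \<gamma> where "\<gamma> y v = l *\<^sub>R \<alpha> y v + \<beta> y v"

lemma c_nonzero: "c i \<noteq> 0"
  using someI_ex[OF slope_exists] unfolding c_def l_def by blast

lemma \<alpha>\<beta>_linear:
  assumes "y \<in> \<Omega>"
  shows "linear (\<alpha> y)" "linear (\<beta> y)" "linear (\<gamma> y)"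
proof -
  show 1: "linear (\<alpha> y)" "linear (\<beta> y)"
    by (rule linearI; simp add: \<alpha>_def \<beta>_def dder_linear_simps[OF smooth(1) assms] dder_linear_simps[OF smooth(2) assms] qm_simps)+
  show "linear (\<gamma> y)" unfolding \<gamma>_def by (intro linear_compose_add linear_compose_scale_right 1)
qed

lemma \<alpha>\<beta>_imaginary:
  assumes "y \<in> \<Omega>"
  shows "imaginary (\<alpha> y v)" "imaginary (\<beta> y v)" "imaginary (\<gamma> y v)"
proof -
  show "imaginary (\<alpha> y v)" "imaginary (\<beta> y v)" unfolding \<alpha>_def \<beta>_def
    using logarithmic_derivative_imaginary[OF \<Omega> _ _ assms] smooth S3 by blast+
  then show "imaginary (\<gamma> y v)" by (simp add: \<gamma>_def imaginary_def)
qed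

lemma dder_eq:
  assumes "y \<in> \<Omega>"
  shows "dder p y v = p y \<otimes>\<^sub>H \<alpha> y v" "dder q y v = q y \<otimes>\<^sub>H \<beta> y v"
  using S3[OF assms] by (simp_all add: \<alpha>_def \<beta>_def)

lemma smooth_fields:
  assumes "open S" "S \<subseteq> \<Omega>" "Cinf_on S X"
  shows "Cinf_on S (\<lambda>y. \<alpha> y (X y))" "Cinf_on S (\<lambda>y. \<beta> y (X y))" "Cinf_on S (\<lambda>y. \<gamma> y (X y))"
  unfolding \<gamma>_def \<alpha>_def \<beta>_def
  by (intro Cinf_on_add Cinf_on_scaleR Cinf_on_const Cinf_on_quat_mult Cinf_on_quat_cnj Cinf_on_dder_field assms
      smooth[THEN Cinf_on_subset])+

lemma frame_at_dense:
  assumes "y \<in> \<Delta>"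
  obtains e E where "orthonormal3 e" "\<forall>i. \<alpha> y (E i) = a i *\<^sub>R e i" "\<forall>i. \<beta> y (E i) = b i *\<^sub>R e i"
    "\<forall>i. \<gamma> y (E i) = c i *\<^sub>R e i" "\<forall>v. \<exists>x. v = (\<Sum>i\<in>UNIV. x i *\<^sub>R E i)"
proof -
  have y: "y \<in> \<Omega>" using assms dense by blast
  obtain e E where e: "orthonormal3 e" and E: "\<And>i. dder p y (E i) = a i *\<^sub>R (p y \<otimes>\<^sub>H e i)"
    "\<And>i. dder q y (E i) = b i *\<^sub>R (q y \<otimes>\<^sub>H e i)"
    using frames[OF assms] by blast
  have \<alpha>: "\<alpha> y (E i) = a i *\<^sub>R e i" and \<beta>: "\<beta> y (E i) = b i *\<^sub>R e i" for i
    unfolding \<alpha>_def \<beta>_def E using S3[OF y] by (simp_all add: qm_simps)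
  have \<gamma>: "\<gamma> y (E i) = c i *\<^sub>R e i" for i
    by (simp add: \<gamma>_def \<alpha> \<beta> c_def algebra_simps)
  define T where "T x = (\<Sum>i\<in>UNIV. (x$i) *\<^sub>R E i)" for x :: "real^3"
  have lin: "linear T" unfolding T_def by (rule linearI) (simp_all add: scaleR_left_distrib sum.distrib scaleR_sum_right)
  have "x = 0" if "T x = 0" for x
  proof -
    have "\<gamma> y (T x) = (\<Sum>i\<in>UNIV. (x$i * c i) *\<^sub>R e i)"
      unfolding T_def using \<alpha>\<beta>_linear(3)[OF y] by (simp add: linear_sum linear_scale \<gamma>)
    then have "(\<Sum>i\<in>UNIV. (x$i * c i) * (x$i * c i)) = 0"
      using orthonormal3_inner_sum[OF e, of "\<lambda>i. x$i * c i" "\<lambda>i. x$i * c i"] that linear_0[OF \<alpha>\<beta>_linear(3)[OF y]] by simp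
    then have "\<forall>i. (x$i * c i) * (x$i * c i) = 0"
      by (simp add: sum_nonneg_eq_0_iff)
    then show "x = 0" using c_nonzero by (simp add: vec_eq_iff)
  qed
  then have "inj T" using linear_injective_0[OF lin] by blast
  then have "surj T" using linear_injective_imp_surjective[OF lin] by simp
  have "\<exists>x. v = (\<Sum>i\<in>UNIV. x i *\<^sub>R E i)" for v
  proof -
    obtain x where "v = T x" using \<open>surj T\<close> by (rule surjE)
    then show ?thesis unfolding T_def by (intro exI[of _ "\<lambda>i. x $ i"])
  qed
  then show ?thesis using that[OF e] \<alpha> \<beta> \<gamma> by blast
qed

text \<open>The estimate \<open>|\<gamma> v|\<^sup>2 \<ge> \<kappa> (|\<alpha> v|\<^sup>2 + |\<beta> v|\<^sup>2)\<close> holds on the dense set with a constant that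
  depends on \<open>a\<close> and \<open>b\<close> only, hence everywhere.\<close>

lemma \<gamma>_injective:
  assumes "y \<in> \<Omega>" "\<gamma> y v = 0"
  shows "v = 0"
proof -
  define \<kappa> where "\<kappa> = Min (range (\<lambda>i. (c i)\<^sup>2 / ((a i)\<^sup>2 + (b i)\<^sup>2)))"
  have pos: "(a i)\<^sup>2 + (b i)\<^sup>2 > 0" for i using nonzero[of i] by (simp add: sum_power2_gt_zero_iff)
  have "\<kappa> > 0" unfolding \<kappa>_def using pos c_nonzero by (subst Min_gr_iff) auto
  have \<kappa>: "\<kappa> * ((a i)\<^sup>2 + (b i)\<^sup>2) \<le> (c i)\<^sup>2" for i
  proof -
    have "\<kappa> \<le> (c i)\<^sup>2 / ((a i)\<^sup>2 + (b i)\<^sup>2)" unfolding \<kappa>_def by (rule Min_le) auto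
    then show ?thesis using pos[of i] by (simp add: pos_le_divide_eq)
  qed
  let ?f = "\<lambda>y. \<gamma> y v \<bullet> \<gamma> y v - \<kappa> * (\<alpha> y v \<bullet> \<alpha> y v + \<beta> y v \<bullet> \<beta> y v)"
  have "?f y \<ge> 0"
  proof (rule nonneg_on_dense[OF \<Omega> _ dense(2) _ assms(1)])
    show "continuous_on \<Omega> ?f"
      by (intro Cinf_on_continuous Cinf_on_diff Cinf_on_mult Cinf_on_add Cinf_on_inner smooth_fields Cinf_on_const \<Omega>) auto
  next
    fix y assume y: "y \<in> \<Delta>" "y \<in> \<Omega>"
    obtain e E where e: "orthonormal3 e" and E: "\<forall>i. \<alpha> y (E i) = a i *\<^sub>R e i" "\<forall>i. \<beta> y (E i) = b i *\<^sub>R e i"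
      "\<forall>i. \<gamma> y (E i) = c i *\<^sub>R e i" "\<forall>v. \<exists>x. v = (\<Sum>i\<in>UNIV. x i *\<^sub>R E i)"
      by (rule frame_at_dense[OF y(1)])
    obtain x where x: "v = (\<Sum>i\<in>UNIV. x i *\<^sub>R E i)" using E(4) by blast
    note L = \<alpha>\<beta>_linear[OF y(2)]
    have 1: "\<alpha> y v = (\<Sum>i\<in>UNIV. (x i * a i) *\<^sub>R e i)" "\<beta> y v = (\<Sum>i\<in>UNIV. (x i * b i) *\<^sub>R e i)"
      "\<gamma> y v = (\<Sum>i\<in>UNIV. (x i * c i) *\<^sub>R e i)"
      unfolding x by (simp_all add: linear_sum[OF L(1)] linear_scale[OF L(1)] linear_sum[OF L(2)] linear_scale[OF L(2)]
        linear_sum[OF L(3)] linear_scale[OF L(3)] E)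
    have "\<kappa> * (\<alpha> y v \<bullet> \<alpha> y v + \<beta> y v \<bullet> \<beta> y v) = (\<Sum>i\<in>UNIV. (x i)\<^sup>2 * (\<kappa> * ((a i)\<^sup>2 + (b i)\<^sup>2)))"
      unfolding 1 orthonormal3_inner_sum[OF e]
      by (simp add: sum_3 algebra_simps power2_eq_square)
    also have "\<dots> \<le> (\<Sum>i\<in>UNIV. (x i)\<^sup>2 * (c i)\<^sup>2)"
      by (intro sum_mono mult_left_mono \<kappa>) simp
    also have "\<dots> = \<gamma> y v \<bullet> \<gamma> y v"
      unfolding 1 orthonormal3_inner_sum[OF e] by (simp add: sum_3 algebra_simps power2_eq_square)
    finally show "?f y \<ge> 0" by simp
  qed
  then have "\<kappa> * (\<alpha> y v \<bullet> \<alpha> y v + \<beta> y v \<bullet> \<beta> y v) \<le> 0" using assms(2) by simp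
  then have "\<alpha> y v \<bullet> \<alpha> y v + \<beta> y v \<bullet> \<beta> y v \<le> 0" using \<open>\<kappa> > 0\<close> by (simp add: mult_le_0_iff)
  then have "\<alpha> y v \<bullet> \<alpha> y v = 0" "\<beta> y v \<bullet> \<beta> y v = 0"
    using inner_ge_zero[of "\<alpha> y v"] inner_ge_zero[of "\<beta> y v"] by linarith+
  then have "\<alpha> y v = 0" "\<beta> y v = 0" by simp_all
  then have "dder p y v = 0" "dder q y v = 0" by (simp_all add: dder_eq[OF assms(1)] qm_simps)
  then show "v = 0" by (rule immersed[OF assms(1)])
qed

text \<open>The columns and the determinant of \<open>\<gamma>\<close>.\<close>

definition col :: "3 \<Rightarrow> real^3 \<Rightarrow> real^3" where "col k y = quat_vec (\<gamma> y (axis k 1))"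

definition \<delta> :: "real^3 \<Rightarrow> real" where "\<delta> y = col 1 y \<bullet> cross3 (col 2 y) (col 3 y)"

definition \<gamma>inv :: "real^3 \<Rightarrow> quat \<Rightarrow> real^3" where
  "\<gamma>inv y z = inverse (\<delta> y) *\<^sub>R
     ((quat_vec z \<bullet> cross3 (col 2 y) (col 3 y)) *\<^sub>R axis 1 1 + (quat_vec z \<bullet> cross3 (col 3 y) (col 1 y)) *\<^sub>R axis 2 1
      + (quat_vec z \<bullet> cross3 (col 1 y) (col 2 y)) *\<^sub>R axis 3 1)"

lemma quat_vec_inj_imaginary: "imaginary z \<Longrightarrow> imaginary z' \<Longrightarrow> quat_vec z = quat_vec z' \<Longrightarrow> z = z'"
proof -
  assume i: "imaginary z" "imaginary z'" and e: "quat_vec z = quat_vec z'"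
  have "quat_vec z $ k = quat_vec z' $ k" for k using e by simp
  from this[of 1] this[of 2] this[of 3] show "z = z'"
    using i by (simp add: imaginary_def quat_vec_def quat_eq_iff)
qed

lemma quat_vec_\<gamma>:
  assumes "y \<in> \<Omega>"
  shows "quat_vec (\<gamma> y v) = v$1 *\<^sub>R col 1 y + v$2 *\<^sub>R col 2 y + v$3 *\<^sub>R col 3 y"
proof -
  have v: "v = v$1 *\<^sub>R axis 1 1 + v$2 *\<^sub>R axis 2 1 + v$3 *\<^sub>R axis 3 1"
    by (simp add: vec_eq_iff forall_3 axis_def)
  have L: "linear (\<lambda>v. quat_vec (\<gamma> y v))"
    using linear_compose[OF \<alpha>\<beta>_linear(3)[OF assms] bounded_linear.linear[OF bounded_linear_quat_vec]] by (simp add: o_def)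
  show ?thesis
    using arg_cong[OF v, of "\<lambda>v. quat_vec (\<gamma> y v)"] unfolding col_def
    by (simp only: linear_add[OF L] linear_scale[OF L])
qed

lemma \<delta>_nonzero: "y \<in> \<Omega> \<Longrightarrow> \<delta> y \<noteq> 0"
  unfolding \<delta>_def
proof (rule triple_product_nonzero)
  fix v :: "real^3" assume y: "y \<in> \<Omega>" and "v$1 *\<^sub>R col 1 y + v$2 *\<^sub>R col 2 y + v$3 *\<^sub>R col 3 y = 0"
  then have "quat_vec (\<gamma> y v) = quat_vec 0" using quat_vec_\<gamma>[OF y] by (simp add: quat_vec_def vec_eq_iff forall_3)
  then have "\<gamma> y v = 0" using quat_vec_inj_imaginary[OF \<alpha>\<beta>_imaginary(3)[OF y]] by (simp add: imaginary_def)
  then show "v = 0" by (rule \<gamma>_injective[OF y])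
qed

lemma \<gamma>_\<gamma>inv:
  assumes y: "y \<in> \<Omega>" and z: "imaginary z"
  shows "\<gamma> y (\<gamma>inv y z) = z"
proof (rule quat_vec_inj_imaginary[OF \<alpha>\<beta>_imaginary(3)[OF y] z])
  have "quat_vec (\<gamma> y (\<gamma>inv y z)) = inverse (\<delta> y) *\<^sub>R ((quat_vec z \<bullet> cross3 (col 2 y) (col 3 y)) *\<^sub>R col 1 y
      + (quat_vec z \<bullet> cross3 (col 3 y) (col 1 y)) *\<^sub>R col 2 y + (quat_vec z \<bullet> cross3 (col 1 y) (col 2 y)) *\<^sub>R col 3 y)"
    unfolding quat_vec_\<gamma>[OF y] by (simp add: \<gamma>inv_def axis_def scaleR_add_right)
  also have "\<dots> = quat_vec z" unfolding three_pairs using \<delta>_nonzero[OF y] by (simp add: \<delta>_def)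
  finally show "quat_vec (\<gamma> y (\<gamma>inv y z)) = quat_vec z" .
qed

lemma \<gamma>inv_\<gamma>: "y \<in> \<Omega> \<Longrightarrow> \<gamma>inv y (\<gamma> y v) = v"
proof -
  assume y: "y \<in> \<Omega>"
  have "\<gamma> y (\<gamma>inv y (\<gamma> y v) - v) = 0"
    using \<gamma>_\<gamma>inv[OF y \<alpha>\<beta>_imaginary(3)[OF y]] \<alpha>\<beta>_linear(3)[OF y] by (simp add: linear_diff)
  then show ?thesis using \<gamma>_injective[OF y] by fastforce
qed

lemma \<gamma>inv_linear: "linear (\<gamma>inv y)"
  by (rule linearI) (simp_all add: \<gamma>inv_def bounded_linear.linear[OF bounded_linear_quat_vec, THEN linear_add]
    bounded_linear.linear[OF bounded_linear_quat_vec, THEN linear_scale] inner_add_left algebra_simps)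

lemma smooth_\<gamma>inv:
  assumes "open S" "S \<subseteq> \<Omega>" "Cinf_on S z"
  shows "Cinf_on S (\<lambda>y. \<gamma>inv y (z y))"
proof -
  have col: "Cinf_on S (col k)" for k unfolding col_def
    by (intro Cinf_on_linear[OF bounded_linear_quat_vec] smooth_fields assms Cinf_on_const)
  note cr = Cinf_on_bilinear[OF bounded_bilinear_cross3 assms(1) col col]
  have "Cinf_on S \<delta>" unfolding \<delta>_def by (intro Cinf_on_inner assms col cr)
  then show ?thesis unfolding \<gamma>inv_def
    by (intro Cinf_on_scaleR Cinf_on_add Cinf_on_inner Cinf_on_inverse Cinf_on_const assms cr
        Cinf_on_linear[OF bounded_linear_quat_vec]) (use \<delta>_nonzero assms in blast)+
qed

text \<open>The operator \<open>\<alpha> \<circ> \<gamma>\<inverse>\<close> on the imaginary quaternions, which depends smoothly on the point and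
  has the constant eigenvalues \<open>\<tau> i\<close>. An orthonormal eigenframe of \<open>T\<close> is the same as a pointwise
  frame in the sense of the hypothesis.\<close>

definition T :: "real^3 \<Rightarrow> quat \<Rightarrow> quat" where "T y z = \<alpha> y (\<gamma>inv y z)"

definition \<tau> :: "3 \<Rightarrow> real" where "\<tau> i = a i / c i"

lemma T_linear: "y \<in> \<Omega> \<Longrightarrow> linear (T y)"
  unfolding T_def using linear_compose[OF \<gamma>inv_linear \<alpha>\<beta>_linear(1)] by (simp add: o_def)

lemma smooth_T: "open S \<Longrightarrow> S \<subseteq> \<Omega> \<Longrightarrow> Cinf_on S z \<Longrightarrow> Cinf_on S (\<lambda>y. T y (z y))"
  unfolding T_def by (intro smooth_fields smooth_\<gamma>inv)

text \<open>Orthonormal frames form a compact set, so eigenframes at points of the dense set that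
  converge to \<open>x\<close> have a subsequence that converges to an eigenframe at \<open>x\<close>.\<close>

lemma eigenframe_exists:
  assumes x: "x \<in> \<Omega>"
  obtains e where "orthonormal3 e" "\<forall>i. T x (e i) = \<tau> i *\<^sub>R e i"
proof -
  have on_dense: "\<exists>e. orthonormal3 e \<and> (\<forall>i. T y (e i) = \<tau> i *\<^sub>R e i)" if y: "y \<in> \<Delta>" for y
  proof -
    have y': "y \<in> \<Omega>" using y dense by blast
    obtain e E where e: "orthonormal3 e" and E: "\<forall>i. \<alpha> y (E i) = a i *\<^sub>R e i" "\<forall>i. \<gamma> y (E i) = c i *\<^sub>R e i"
      by (rule frame_at_dense[OF y])
    have "T y (e i) = \<tau> i *\<^sub>R e i" for i
    proof -
      have "e i = \<gamma> y ((1 / c i) *\<^sub>R E i)" using c_nonzero[of i] by (simp add: linear_scale[OF \<alpha>\<beta>_linear(3)[OF y']] E)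
      then have "\<gamma>inv y (e i) = (1 / c i) *\<^sub>R E i" using \<gamma>inv_\<gamma>[OF y'] by metis
      then show ?thesis by (simp add: T_def \<tau>_def linear_scale[OF \<alpha>\<beta>_linear(1)[OF y']] E)
    qed
    then show ?thesis using e by blast
  qed
  obtain ys where ys: "\<And>n::nat. ys n \<in> \<Delta>" "ys \<longlonglongrightarrow> x"
    using x dense(2) closure_sequential by blast
  obtain e where e: "\<And>n. orthonormal3 (e n)" "\<And>n i. T (ys n) (e n i) = \<tau> i *\<^sub>R e n i"
    using on_dense[OF ys(1)] by metis
  define s where "s n = (\<chi> i. e n i)" for n
  have "norm (s n) \<le> 3" for n
  proof -
    have "norm (s n) \<le> (\<Sum>i\<in>UNIV. norm (s n $ i))" by (simp add: norm_vec_def L2_set_le_sum)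
    also have "\<dots> \<le> (\<Sum>i\<in>(UNIV::3 set). 1)"
      using e(1)[of n] by (intro sum_mono) (simp add: s_def orthonormal3_def norm_eq_sqrt_inner)
    finally show ?thesis by simp
  qed
  then have "bounded (range s)" by (auto intro: boundedI)
  then obtain L r where r: "strict_mono r" "(s \<circ> r) \<longlonglongrightarrow> L"
    using bounded_imp_convergent_subsequence by blast
  have lim: "(\<lambda>n. e (r n) i) \<longlonglongrightarrow> L $ i" for i
    using tendsto_vec_nth[OF r(2), of i] by (simp add: s_def o_def)
  have ysr: "(\<lambda>n. ys (r n)) \<longlonglongrightarrow> x" using LIMSEQ_subseq_LIMSEQ[OF ys(2) r(1)] by (simp add: o_def)
  have ysr\<Omega>: "ys (r n) \<in> \<Omega>" for n using ys dense by blast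
  have "orthonormal3 (\<lambda>i. L $ i)"
  proof -
    have "(\<lambda>n. e (r n) i \<bullet> e (r n) j) \<longlonglongrightarrow> L $ i \<bullet> L $ j" for i j by (intro tendsto_inner lim)
    then have 1: "L $ i \<bullet> L $ j = (if i = j then 1 else 0)" for i j
      using e(1) by (intro LIMSEQ_unique[of "\<lambda>n. e (r n) i \<bullet> e (r n) j"]) (auto simp: orthonormal3_def)
    have "(\<lambda>n. e (r n) i \<bullet> quat_one) \<longlonglongrightarrow> L $ i \<bullet> quat_one" for i by (intro tendsto_inner lim tendsto_const)
    then have 2: "L $ i \<bullet> quat_one = 0" for i
      using e(1) by (intro LIMSEQ_unique[of "\<lambda>n. e (r n) i \<bullet> quat_one"]) (auto simp: orthonormal3_def imaginary_iff_inner)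
    show ?thesis using 1 2 by (simp add: orthonormal3_def imaginary_iff_inner)
  qed
  moreover have "T x (L $ i) = \<tau> i *\<^sub>R L $ i" for i
  proof -
    have ex: "T y z = (\<Sum>b\<in>Basis. (z \<bullet> b) *\<^sub>R T y b)" if "y \<in> \<Omega>" for y z
    proof -
      have "T y z = T y (\<Sum>b\<in>Basis. (z \<bullet> b) *\<^sub>R b)" by (simp add: euclidean_representation)
      then show ?thesis by (simp only: linear_sum[OF T_linear[OF that]] linear_scale[OF T_linear[OF that]])
    qed
    have Tb: "(\<lambda>n. T (ys (r n)) b) \<longlonglongrightarrow> T x b" for b
    proof -
      have "isCont (\<lambda>y. T y b) x"
        using Cinf_on_continuous[OF smooth_T[OF \<Omega> subset_refl Cinf_on_const]] \<Omega> x
        by (simp add: continuous_on_eq_continuous_at)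
      then show ?thesis using ysr isCont_tendsto_compose by blast
    qed
    have "(\<lambda>n. \<Sum>b\<in>Basis. (e (r n) i \<bullet> b) *\<^sub>R T (ys (r n)) b) \<longlonglongrightarrow> (\<Sum>b\<in>Basis. (L $ i \<bullet> b) *\<^sub>R T x b)"
      by (intro tendsto_sum tendsto_scaleR tendsto_inner lim Tb tendsto_const)
    then have "(\<lambda>n. T (ys (r n)) (e (r n) i)) \<longlonglongrightarrow> T x (L $ i)"
      by (simp only: ex[OF ysr\<Omega>, symmetric] ex[OF x, symmetric])
    then have "(\<lambda>n. \<tau> i *\<^sub>R e (r n) i) \<longlonglongrightarrow> T x (L $ i)" by (simp add: e(2))
    moreover have "(\<lambda>n. \<tau> i *\<^sub>R e (r n) i) \<longlonglongrightarrow> \<tau> i *\<^sub>R L $ i" by (intro tendsto_scaleR tendsto_const lim)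
    ultimately show ?thesis using LIMSEQ_unique by blast
  qed
  ultimately show ?thesis using that by blast
qed

lemma T_symmetric:
  assumes y: "y \<in> \<Omega>" and "imaginary u" "imaginary v"
  shows "T y u \<bullet> v = u \<bullet> T y v"
proof -
  obtain e where e: "orthonormal3 e" "\<forall>i. T y (e i) = \<tau> i *\<^sub>R e i" by (rule eigenframe_exists[OF y])
  have T: "T y z = (\<Sum>i\<in>UNIV. (\<tau> i * (z \<bullet> e i)) *\<^sub>R e i)" if "imaginary z" for z
    by (subst orthonormal3_expand[OF e(1) that])
      (simp add: linear_sum[OF T_linear[OF y]] linear_scale[OF T_linear[OF y]] e(2) mult.commute)
  show ?thesis
    unfolding T[OF assms(2)] T[OF assms(3)]
    using orthonormal3_inner_sum[OF e(1), of "\<lambda>i. \<tau> i * (u \<bullet> e i)" "\<lambda>i. v \<bullet> e i"]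
      orthonormal3_inner_sum[OF e(1), of "\<lambda>i. u \<bullet> e i" "\<lambda>i. \<tau> i * (v \<bullet> e i)"]
    by (simp flip: orthonormal3_expand[OF e(1) assms(2)] orthonormal3_expand[OF e(1) assms(3)]) (simp add: mult_ac)
qed

text \<open>One factor of the Lagrange interpolation formula for the spectral projection onto the
  eigenspace of \<open>\<tau> i\<close>.\<close>

definition R :: "3 \<Rightarrow> 3 \<Rightarrow> real^3 \<Rightarrow> quat \<Rightarrow> quat" where
  "R i j y z = (if \<tau> j = \<tau> i then z else (1 / (\<tau> i - \<tau> j)) *\<^sub>R (T y z - \<tau> j *\<^sub>R z))"

definition proj :: "3 \<Rightarrow> real^3 \<Rightarrow> quat \<Rightarrow> quat" where
  "proj i y z = R i 1 y (R i 2 y (R i 3 y z))"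

lemma R_linear: "y \<in> \<Omega> \<Longrightarrow> linear (R i j y)"
  by (rule linearI) (simp_all add: R_def linear_add[OF T_linear] linear_scale[OF T_linear] algebra_simps)

lemma proj_linear: "y \<in> \<Omega> \<Longrightarrow> linear (proj i y)"
  unfolding proj_def
  using linear_compose[OF linear_compose[OF R_linear R_linear] R_linear] by (simp add: o_def)

lemma smooth_R: "open S \<Longrightarrow> S \<subseteq> \<Omega> \<Longrightarrow> Cinf_on S z \<Longrightarrow> Cinf_on S (\<lambda>y. R i j y (z y))"
  unfolding R_def by (cases "\<tau> j = \<tau> i") (auto intro!: Cinf_on_scaleR Cinf_on_diff Cinf_on_const smooth_T)

lemma smooth_proj: "Cinf_on \<Omega> (\<lambda>y. proj i y z)"
  unfolding proj_def by (intro smooth_R \<Omega> Cinf_on_const subset_refl)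

lemma proj_eigenvector:
  assumes "y \<in> \<Omega>" "T y v = \<tau> k *\<^sub>R v"
  shows "proj i y v = (if \<tau> k = \<tau> i then v else 0)"
proof -
  have R: "R i j y v = (if \<tau> j = \<tau> i then v else ((\<tau> k - \<tau> j) / (\<tau> i - \<tau> j)) *\<^sub>R v)" for j
    by (simp add: R_def assms(2) flip: scaleR_left_diff_distrib)
  show ?thesis
  proof (cases "\<tau> k = \<tau> i")
    case True
    then have "R i j y v = v" for j by (simp add: R)
    then show ?thesis using True by (simp add: proj_def)
  next
    case False
    have s: "R i j y (r *\<^sub>R v) = r *\<^sub>R R i j y v" for j r by (rule linear_scale[OF R_linear[OF assms(1)]])
    have k: "R i k y v = 0" using False by (simp add: R)
    have m: "\<exists>r. R i j y v = r *\<^sub>R v" for j by (metis R scaleR_one)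
    obtain r1 r2 r3 where r: "R i 1 y v = r1 *\<^sub>R v" "R i 2 y v = r2 *\<^sub>R v" "R i 3 y v = r3 *\<^sub>R v"
      using m by meson
    have "k = 1 \<or> k = 2 \<or> k = 3" by (rule exhaust_3)
    then have "r1 *\<^sub>R v = 0 \<or> r2 *\<^sub>R v = 0 \<or> r3 *\<^sub>R v = 0" using k r by auto
    then have "r1 * r2 * r3 = 0 \<or> v = 0" by auto
    moreover have "proj i y v = (r1 * r2 * r3) *\<^sub>R v" by (simp add: proj_def r s mult_ac)
    ultimately have "proj i y v = 0" by auto
    then show ?thesis using False by simp
  qed
qed

lemma T_proj:
  assumes y: "y \<in> \<Omega>" and z: "imaginary z"
  shows "T y (proj i y z) = \<tau> i *\<^sub>R proj i y z" "imaginary (proj i y z)"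
proof -
  obtain e where e: "orthonormal3 e" "\<forall>i. T y (e i) = \<tau> i *\<^sub>R e i" by (rule eigenframe_exists[OF y])
  have P: "proj i y z = (\<Sum>k\<in>UNIV. (z \<bullet> e k) *\<^sub>R (if \<tau> k = \<tau> i then e k else 0))"
    by (subst orthonormal3_expand[OF e(1) z])
      (simp add: linear_sum[OF proj_linear[OF y]] linear_scale[OF proj_linear[OF y]] proj_eigenvector[OF y e(2)[rule_format]] if_distrib)
  show "T y (proj i y z) = \<tau> i *\<^sub>R proj i y z"
    unfolding P linear_sum[OF T_linear[OF y]] linear_scale[OF T_linear[OF y]] scaleR_sum_right
    by (rule sum.cong) (auto simp: e(2) linear_0[OF T_linear[OF y]])
  show "imaginary (proj i y z)" unfolding P using e(1) by (simp add: sum_3 orthonormal3_def imaginary_def)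
qed

text \<open>Eigenvectors for different eigenvalues are orthogonal, so the Gram-Schmidt step changes an
  eigenvector only by eigenvectors for the same eigenvalue.\<close>

lemma T_gram_schmidt:
  assumes y: "y \<in> \<Omega>" and u: "imaginary u" "T y u = s *\<^sub>R u" and v: "imaginary v" "T y v = t *\<^sub>R v"
  shows "T y (v - (v \<bullet> u) *\<^sub>R u) = t *\<^sub>R (v - (v \<bullet> u) *\<^sub>R u)"
proof -
  have "v \<bullet> u = 0 \<or> t = s" using T_symmetric[OF y v(1) u(1)] unfolding u(2) v(2) by simp
  then show ?thesis using u v by (auto simp: linear_diff[OF T_linear[OF y]] linear_scale[OF T_linear[OF y]] algebra_simps)
qed

lemma T_normalize:
  "y \<in> \<Omega> \<Longrightarrow> T y v = t *\<^sub>R v \<Longrightarrow> T y (r *\<^sub>R v) = t *\<^sub>R (r *\<^sub>R v)"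
  by (simp add: linear_scale[OF T_linear])

lemma open_nonzero:
  fixes f :: "real^3 \<Rightarrow> quat"
  assumes "open S" "Cinf_on S f"
  shows "open {y \<in> S. f y \<noteq> 0}"
proof -
  have "{y \<in> S. f y \<noteq> 0} = S \<inter> f -` (- {0})" by auto
  then show ?thesis
    using continuous_open_preimage[OF Cinf_on_continuous[OF assms(2)] assms(1) open_Compl[OF closed_singleton[of 0]]] by simp
qed

text \<open>The spectral projections of \<open>T\<close> are smooth because the eigenvalues are constant. Applied to
  the eigenframe at \<open>x\<close> and followed by the Gram-Schmidt process they give a smooth eigenframe
  near \<open>x\<close>, which \<open>\<gamma>\<inverse>\<close> turns into a tangent frame.\<close>

theorem local_adapted_frame:
  assumes x: "x \<in> \<Omega>"
  shows "\<exists>W. x \<in> W \<and> W \<subseteq> \<Omega> \<and> (W, p, q) \<in> realized (a 1) (a 2) (a 3) (b 1) (b 2) (b 3)"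
proof -
  obtain \<epsilon> where \<epsilon>: "orthonormal3 \<epsilon>" "\<forall>i. T x (\<epsilon> i) = \<tau> i *\<^sub>R \<epsilon> i" by (rule eigenframe_exists[OF x])
  have \<epsilon>i: "imaginary (\<epsilon> i)" "\<epsilon> i \<bullet> \<epsilon> i = 1" "i \<noteq> j \<Longrightarrow> \<epsilon> i \<bullet> \<epsilon> j = 0" for i j
    using \<epsilon>(1) by (auto simp: orthonormal3_def)
  have nn: "norm (\<epsilon> i) = 1" for i using \<epsilon>i(2) by (simp add: norm_eq_sqrt_inner)
  define v where "v i y = proj i y (\<epsilon> i)" for i y
  define n where "n f y = (1 / norm (f y)) *\<^sub>R (f y :: quat)" for f and y :: "real^3"
  have vs: "Cinf_on \<Omega> (v i)" for i unfolding v_def by (rule smooth_proj)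
  have vT: "T y (v i y) = \<tau> i *\<^sub>R v i y" "imaginary (v i y)" if "y \<in> \<Omega>" for i y
    unfolding v_def using T_proj[OF that \<epsilon>i(1)] by auto
  have vx: "v i x = \<epsilon> i" for i unfolding v_def using proj_eigenvector[OF x \<epsilon>(2)[rule_format]] by simp
  have nT: "T y (n f y) = t *\<^sub>R n f y" "imaginary (n f y)" if "y \<in> \<Omega>" "T y (f y) = t *\<^sub>R f y" "imaginary (f y)" for y f t
    unfolding n_def using T_normalize[OF that(1,2)] that(3) by (auto simp: imaginary_def)
  have n1: "n f y \<bullet> n f y = 1" if "f y \<noteq> 0" for f y
    using that by (simp add: n_def dot_square_norm power2_eq_square)
  have n0: "n f y \<bullet> u = 0" if "f y \<bullet> u = 0" for f y u using that by (simp add: n_def)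
  define S1 where "S1 = {y \<in> \<Omega>. v 1 y \<noteq> 0}"
  define u1 where "u1 = n (v 1)"
  have S1: "open S1" "S1 \<subseteq> \<Omega>" "x \<in> S1" using open_nonzero[OF \<Omega> vs] x nn[of 1] by (auto simp: S1_def vx)
  have u1s: "Cinf_on S1 u1" unfolding u1_def n_def
    by (rule Cinf_on_normalize[OF S1(1) Cinf_on_subset[OF vs S1(2)]]) (simp add: S1_def)
  have u1x: "u1 x = \<epsilon> 1" by (simp add: u1_def n_def vx nn)
  define w2 where "w2 y = v 2 y - (v 2 y \<bullet> u1 y) *\<^sub>R u1 y" for y
  have w2s: "Cinf_on S1 w2" unfolding w2_def
    by (intro Cinf_on_diff Cinf_on_scaleR Cinf_on_inner u1s S1 Cinf_on_subset[OF vs S1(2)])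
  have w2x: "w2 x = \<epsilon> 2" by (simp add: w2_def vx u1x \<epsilon>i)
  define S2 where "S2 = {y \<in> S1. w2 y \<noteq> 0}"
  define u2 where "u2 = n w2"
  have S2: "open S2" "S2 \<subseteq> S1" "S2 \<subseteq> \<Omega>" "x \<in> S2" using open_nonzero[OF S1(1) w2s] S1 nn[of 2] by (auto simp: S2_def w2x)
  have u2s: "Cinf_on S2 u2" unfolding u2_def n_def
    by (rule Cinf_on_normalize[OF S2(1) Cinf_on_subset[OF w2s S2(2)]]) (simp add: S2_def)
  have u2x: "u2 x = \<epsilon> 2" by (simp add: u2_def n_def w2x nn)
  define w3' where "w3' y = v 3 y - (v 3 y \<bullet> u1 y) *\<^sub>R u1 y" for y
  define w3 where "w3 y = w3' y - (w3' y \<bullet> u2 y) *\<^sub>R u2 y" for y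
  have w3s: "Cinf_on S2 w3" unfolding w3_def w3'_def
    by (intro Cinf_on_diff Cinf_on_scaleR Cinf_on_inner u2s Cinf_on_subset[OF u1s S2(2)] S2 Cinf_on_subset[OF vs S2(3)])
  have w3x: "w3 x = \<epsilon> 3" by (simp add: w3_def w3'_def vx u1x u2x \<epsilon>i)
  define S3' where "S3' = {y \<in> S2. w3 y \<noteq> 0}"
  define u3 where "u3 = n w3"
  have S3': "open S3'" "S3' \<subseteq> S2" "S3' \<subseteq> S1" "S3' \<subseteq> \<Omega>" "x \<in> S3'"
    using open_nonzero[OF S2(1) w3s] S2 nn[of 3] by (auto simp: S3'_def w3x)
  have u3s: "Cinf_on S3' u3" unfolding u3_def n_def
    by (rule Cinf_on_normalize[OF S3'(1) Cinf_on_subset[OF w3s S3'(2)]]) (simp add: S3'_def)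
  have u3x: "u3 x = \<epsilon> 3" by (simp add: u3_def n_def w3x nn)
  have u: "T y (u1 y) = \<tau> 1 *\<^sub>R u1 y" "T y (u2 y) = \<tau> 2 *\<^sub>R u2 y" "T y (u3 y) = \<tau> 3 *\<^sub>R u3 y"
      "imaginary (u1 y)" "imaginary (u2 y)" "imaginary (u3 y)"
      "u1 y \<bullet> u1 y = 1" "u2 y \<bullet> u2 y = 1" "u3 y \<bullet> u3 y = 1" "u1 y \<bullet> u2 y = 0" "u1 y \<bullet> u3 y = 0" "u2 y \<bullet> u3 y = 0"
    if y: "y \<in> S3'" for y
  proof -
    have y\<Omega>: "y \<in> \<Omega>" and nz: "v 1 y \<noteq> 0" "w2 y \<noteq> 0" "w3 y \<noteq> 0"
      using y S3' unfolding S3'_def S2_def S1_def by auto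
    note im = imaginary_iff_inner inner_diff_left
    show 1: "T y (u1 y) = \<tau> 1 *\<^sub>R u1 y" "imaginary (u1 y)" "u1 y \<bullet> u1 y = 1"
      unfolding u1_def using nT[where f="v 1", OF y\<Omega> vT[OF y\<Omega>]] n1[where f="v 1", OF nz(1)] by auto
    have w2: "T y (w2 y) = \<tau> 2 *\<^sub>R w2 y" "imaginary (w2 y)"
      unfolding w2_def using T_gram_schmidt[OF y\<Omega> 1(2,1) vT(2,1)[OF y\<Omega>]] vT(2)[OF y\<Omega>] 1(2) by (auto simp: im)
    show 2: "T y (u2 y) = \<tau> 2 *\<^sub>R u2 y" "imaginary (u2 y)" "u2 y \<bullet> u2 y = 1"
      unfolding u2_def using nT[where f="w2", OF y\<Omega> w2] n1[where f="w2", OF nz(2)] by auto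
    have w3': "T y (w3' y) = \<tau> 3 *\<^sub>R w3' y" "imaginary (w3' y)"
      unfolding w3'_def using T_gram_schmidt[OF y\<Omega> 1(2,1) vT(2,1)[OF y\<Omega>]] vT(2)[OF y\<Omega>] 1(2) by (auto simp: im)
    have w3: "T y (w3 y) = \<tau> 3 *\<^sub>R w3 y" "imaginary (w3 y)"
      unfolding w3_def using T_gram_schmidt[OF y\<Omega> 2(2,1) w3'(2,1)] w3'(2) 2(2) by (auto simp: im)
    show "T y (u3 y) = \<tau> 3 *\<^sub>R u3 y" "imaginary (u3 y)" "u3 y \<bullet> u3 y = 1"
      unfolding u3_def using nT[where f="w3", OF y\<Omega> w3] n1[where f="w3", OF nz(3)] by auto
    have "w2 y \<bullet> u1 y = 0" by (simp add: w2_def inner_diff_left 1(3))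
    then show 12: "u1 y \<bullet> u2 y = 0" using n0[where f=w2] by (simp add: u2_def inner_commute)
    have "w3' y \<bullet> u1 y = 0" by (simp add: w3'_def inner_diff_left 1(3))
    then have "w3 y \<bullet> u1 y = 0" using 12 by (simp add: w3_def inner_diff_right inner_commute)
    then show "u1 y \<bullet> u3 y = 0" using n0[where f=w3] by (simp add: u3_def inner_commute)
    have "w3 y \<bullet> u2 y = 0" by (simp add: w3_def inner_diff_left 2(3))
    then show "u2 y \<bullet> u3 y = 0" using n0[where f=w3] by (simp add: u3_def inner_commute)
  qed
  note us = Cinf_on_subset[OF u1s S3'(3)] Cinf_on_subset[OF u2s S3'(2)] u3s
  \<comment> \<open>the orientation of the frame, \<open>1\<close> or \<open>-1\<close> and locally constant; multiplication of the frame
    by its value at \<open>x\<close> makes the frame positively oriented\<close>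
  define orn where "orn y = (u1 y \<otimes>\<^sub>H u2 y) \<bullet> u3 y" for y
  have o1: "u1 y \<otimes>\<^sub>H u2 y = orn y *\<^sub>R u3 y" "\<bar>orn y\<bar> = 1" if "y \<in> S3'" for y
    unfolding orn_def using quat_triple_product[OF u(4-12)[OF that]] by auto
  have os: "Cinf_on S3' (\<lambda>y. orn x * orn y)" unfolding orn_def
    by (intro Cinf_on_mult Cinf_on_const Cinf_on_inner Cinf_on_quat_mult us S3')
  have op: "open (S3' \<inter> (\<lambda>y. orn x * orn y) -` {0<..})"
    using continuous_open_preimage[OF Cinf_on_continuous[OF os] S3'(1) open_greaterThan] .
  have xin: "x \<in> S3' \<inter> (\<lambda>y. orn x * orn y) -` {0<..}"
    using S3'(5) o1(2)[OF S3'(5)] by (auto simp: abs_if split: if_splits)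
  obtain d where d: "d > 0" "ball x d \<subseteq> S3' \<inter> (\<lambda>y. orn x * orn y) -` {0<..}"
    by (rule openE[OF op xin])
  define W where "W = ball x d"
  have W: "open W" "convex W" "x \<in> W" "W \<subseteq> S3'" "W \<subseteq> \<Omega>" using d S3'(4) by (auto simp: W_def)
  have o2: "orn y = orn x" if "y \<in> W" for y
  proof -
    have "orn x * orn y > 0" using that d by (auto simp: W_def)
    moreover have "\<bar>orn y\<bar> = 1" "\<bar>orn x\<bar> = 1" using o1(2) that W by blast+
    ultimately show ?thesis by (auto simp: abs_if split: if_splits)
  qed
  have ox: "orn x * orn x = 1" using o1(2)[OF S3'(5)] by (metis abs_mult_self_eq mult_1)
  define e1 e2 e3 where "e1 y = orn x *\<^sub>R u1 y" "e2 y = orn x *\<^sub>R u2 y" "e3 y = orn x *\<^sub>R u3 y" for y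
  note e_def = this
  have es: "Cinf_on W e1" "Cinf_on W e2" "Cinf_on W e3"
    unfolding e_def by (intro Cinf_on_scaleR Cinf_on_const W us[THEN Cinf_on_subset[OF _ W(4)]])+
  define E where "E i e y = \<gamma>inv y (c i *\<^sub>R e y)" for i and e :: "real^3 \<Rightarrow> quat" and y
  have Es: "Cinf_on W (E i e)" if "Cinf_on W e" for i e
    unfolding E_def by (intro smooth_\<gamma>inv Cinf_on_scaleR Cinf_on_const W that)
  have dE: "dder p y (E i e y) = a i *\<^sub>R (p y \<otimes>\<^sub>H e y)" "dder q y (E i e y) = b i *\<^sub>R (q y \<otimes>\<^sub>H e y)"
    if y: "y \<in> W" and e: "imaginary (e y)" "T y (e y) = \<tau> i *\<^sub>R e y" for i e y
  proof -
    have y\<Omega>: "y \<in> \<Omega>" using y W by blast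
    have "imaginary (c i *\<^sub>R e y)" using e(1) by (simp add: imaginary_def)
    from \<gamma>_\<gamma>inv[OF y\<Omega> this] have g: "\<gamma> y (E i e y) = c i *\<^sub>R e y" by (simp add: E_def)
    have A: "\<alpha> y (E i e y) = a i *\<^sub>R e y"
      using linear_scale[OF T_linear[OF y\<Omega>], of "c i" "e y"] c_nonzero[of i]
      unfolding E_def by (simp add: T_def[symmetric] e(2) \<tau>_def)
    have B: "\<beta> y (E i e y) = b i *\<^sub>R e y"
      using g A unfolding \<gamma>_def c_def by (simp add: algebra_simps)
    show "dder p y (E i e y) = a i *\<^sub>R (p y \<otimes>\<^sub>H e y)" "dder q y (E i e y) = b i *\<^sub>R (q y \<otimes>\<^sub>H e y)"
      unfolding dder_eq[OF y\<Omega>] A B by (simp_all add: qm_simps)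
  qed
  have e: "imaginary (e1 y)" "imaginary (e2 y)" "imaginary (e3 y)" "e1 y \<bullet> e1 y = 1" "e2 y \<bullet> e2 y = 1"
      "e1 y \<bullet> e2 y = 0" "e1 y \<otimes>\<^sub>H e2 y = e3 y"
      "T y (e1 y) = \<tau> 1 *\<^sub>R e1 y" "T y (e2 y) = \<tau> 2 *\<^sub>R e2 y" "T y (e3 y) = \<tau> 3 *\<^sub>R e3 y" if y: "y \<in> W" for y
  proof -
    have y': "y \<in> S3'" "y \<in> \<Omega>" using y W by blast+
    note uy = u[OF y'(1)]
    show "imaginary (e1 y)" "imaginary (e2 y)" "imaginary (e3 y)"
      using uy by (simp_all add: e_def imaginary_def)
    show "e1 y \<bullet> e1 y = 1" "e2 y \<bullet> e2 y = 1" "e1 y \<bullet> e2 y = 0" using uy ox by (simp_all add: e_def)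
    have "e1 y \<otimes>\<^sub>H e2 y = (orn x * orn x) *\<^sub>R (orn x *\<^sub>R u3 y)"
      by (simp add: e_def qm_simps o1(1)[OF y'(1)] o2[OF y])
    then show "e1 y \<otimes>\<^sub>H e2 y = e3 y" by (simp add: ox e_def)
    show "T y (e1 y) = \<tau> 1 *\<^sub>R e1 y" "T y (e2 y) = \<tau> 2 *\<^sub>R e2 y" "T y (e3 y) = \<tau> 3 *\<^sub>R e3 y"
      unfolding e_def by (intro T_normalize y' uy)+
  qed
  have D: "dder p y (E 1 e1 y) = a 1 *\<^sub>R (p y \<otimes>\<^sub>H e1 y)" "dder q y (E 1 e1 y) = b 1 *\<^sub>R (q y \<otimes>\<^sub>H e1 y)"
    "dder p y (E 2 e2 y) = a 2 *\<^sub>R (p y \<otimes>\<^sub>H e2 y)" "dder q y (E 2 e2 y) = b 2 *\<^sub>R (q y \<otimes>\<^sub>H e2 y)"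
    "dder p y (E 3 e3 y) = a 3 *\<^sub>R (p y \<otimes>\<^sub>H e3 y)" "dder q y (E 3 e3 y) = b 3 *\<^sub>R (q y \<otimes>\<^sub>H e3 y)"
    if y: "y \<in> W" for y
    using dE[where i=1 and e=e1, OF y e(1,8)[OF y]] dE[where i=2 and e=e2, OF y e(2,9)[OF y]]
      dE[where i=3 and e=e3, OF y e(3,10)[OF y]] by simp_all
  have S3W: "p y \<in> S3" "q y \<in> S3" if "y \<in> W" for y using S3 W(5) that by auto
  have "adapted_frame W p q (a 1) (a 2) (a 3) (b 1) (b 2) (b 3) e1 e2 e3 (E 1 e1) (E 2 e2) (E 3 e3)"
    by unfold_locales
      (simp_all add: W(1,2) es Es e(1,2,4-7) D S3W smooth[THEN Cinf_on_subset[OF _ W(5)]], use nonzero in auto)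
  from realizedI[OF this] show ?thesis using W(3,5) by blast
qed

end

section \<open>The angle functions\<close>

text \<open>The factors of the logarithmic differentials of \<open>p\<close> and \<open>q\<close> along a leg with angle function
  \<open>t\<close>; they are equal to \<open>cos (t + pi/6)\<close> and \<open>cos (t - pi/6)\<close>.\<close>

definition slope_a :: "real \<Rightarrow> real" where "slope_a t = sqrt 3 / 2 * cos t - sin t / 2"
definition slope_b :: "real \<Rightarrow> real" where "slope_b t = sqrt 3 / 2 * cos t + sin t / 2"

lemma slope_norm: "(slope_a t)\<^sup>2 + (slope_b t)\<^sup>2 - slope_a t * slope_b t = 3 / 4"
proof -
  have "(slope_a t)\<^sup>2 + (slope_b t)\<^sup>2 - slope_a t * slope_b t = (sqrt 3)\<^sup>2 / 4 * (cos t)\<^sup>2 + 3 / 4 * (sin t)\<^sup>2"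
    by (simp add: slope_a_def slope_b_def power2_eq_square algebra_simps)
  also have "(sqrt 3)\<^sup>2 = 3" by simp
  finally show ?thesis using sin_cos_squared_add[of t] by linarith
qed

text \<open>The eigenvector equation for \<open>P\<close> in one coordinate. Since \<open>P\<close> anticommutes with \<open>J\<close>, the
  composition of \<open>P\<close> with the rotation by the angle \<open>-2 t\<close> in the complex structure \<open>J\<close> is a
  reflection of the plane with coordinates \<open>x\<close> and \<open>y\<close>, and the equation describes its line of
  fixed points.\<close>

lemma angle_equations_solution:
  fixes x y t :: real
  assumes "y = cos (2 * t) * x + sin (2 * t) / sqrt 3 * (2 * y - x)"
    and "x = cos (2 * t) * y + sin (2 * t) / sqrt 3 * (- 2 * x + y)"
  shows "slope_b t * x = slope_a t * y"
proof -
  define C S r where "C = cos t" "S = sin t" "r = sqrt 3"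
  have CS: "C * C + S * S = 1" unfolding C_S_r_def by (simp flip: power2_eq_square)
  have rr: "r * r = 3" "r \<noteq> 0" unfolding C_S_r_def by auto
  have c: "cos (2 * t) = C * C - S * S" "sin (2 * t) = 2 * S * C"
    unfolding C_S_r_def using cos_add[of t t] sin_add[of t t] by simp_all
  define u where "u = sin (2 * t) / sqrt 3"
  have ru: "r * u = 2 * S * C" unfolding u_def c C_S_r_def by simp
  have "y = (C * C - S * S) * x + u * (2 * y - x)" "x = (C * C - S * S) * y + u * (- 2 * x + y)"
    using assms unfolding u_def c(1) by auto
  then have 1: "r * y = r * (C * C - S * S) * x + 2 * S * C * (2 * y - x)"
    and 2: "r * x = r * (C * C - S * S) * y + 2 * S * C * (- 2 * x + y)" using ru by algebra+
  have "(r * C + S) * x = (r * C - S) * y" using CS rr(1) 1 2 by algebra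
  then show ?thesis unfolding slope_a_def slope_b_def C_S_r_def by (simp add: algebra_simps)
qed

lemma nk_J_quat:
  assumes "p \<in> S3" "q \<in> S3"
  shows "nk_J (p, q) (p \<otimes>\<^sub>H x, q \<otimes>\<^sub>H y) = (p \<otimes>\<^sub>H ((1 / sqrt 3) *\<^sub>R (2 *\<^sub>R y - x)), q \<otimes>\<^sub>H ((1 / sqrt 3) *\<^sub>R (y - 2 *\<^sub>R x)))"
  using assms by (simp add: quat_inv_S3 quat_mult_assoc qm_simps algebra_simps)

lemma nk_P_quat:
  assumes "p \<in> S3" "q \<in> S3"
  shows "nk_P (p, q) (p \<otimes>\<^sub>H x, q \<otimes>\<^sub>H y) = (p \<otimes>\<^sub>H y, q \<otimes>\<^sub>H x)"
  using assms by (simp add: quat_inv_S3 quat_mult_assoc)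

lemma S3_left_cancel: "p \<in> S3 \<Longrightarrow> p \<otimes>\<^sub>H x = p \<otimes>\<^sub>H y \<Longrightarrow> x = y"
  by (metis S3_cancel(4))

text \<open>On tangent vectors that are multiples of two imaginary quaternions, the metric and the
  Kaehler form are a scalar product and an area form of the multiples, times the inner product of
  the quaternions.\<close>

lemma nk_metric_quat:
  assumes "p \<in> S3" "q \<in> S3"
  shows "nk_metric (p, q) (p \<otimes>\<^sub>H (a *\<^sub>R e), q \<otimes>\<^sub>H (b *\<^sub>R e)) (p \<otimes>\<^sub>H (a' *\<^sub>R e'), q \<otimes>\<^sub>H (b' *\<^sub>R e'))
      = 4 / 3 * (a * a' + b * b' - (a * b' + a' * b) / 2) * (e \<bullet> e')"
    and "nk_metric (p, q) (nk_J (p, q) (p \<otimes>\<^sub>H (a *\<^sub>R e), q \<otimes>\<^sub>H (b *\<^sub>R e))) (p \<otimes>\<^sub>H (a' *\<^sub>R e'), q \<otimes>\<^sub>H (b' *\<^sub>R e'))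
      = 2 / sqrt 3 * (a' * b - a * b') * (e \<bullet> e')"
proof -
  have pp: "p \<bullet> p = 1" "q \<bullet> q = 1" using assms by (simp_all add: S3_iff)
  define r where "r = 1 / sqrt 3"
  have rr: "r * r = 1 / 3" unfolding r_def by (simp add: real_sqrt_mult_self)
  have J: "nk_J (p, q) (p \<otimes>\<^sub>H (a *\<^sub>R e), q \<otimes>\<^sub>H (b *\<^sub>R e)) = (p \<otimes>\<^sub>H ((r * (2 * b - a)) *\<^sub>R e), q \<otimes>\<^sub>H ((r * (b - 2 * a)) *\<^sub>R e))" for a b e
    unfolding nk_J_quat[OF assms] by (simp add: r_def algebra_simps)
  have in_eq: "(p \<otimes>\<^sub>H (a *\<^sub>R e), q \<otimes>\<^sub>H (b *\<^sub>R e)) \<bullet> (p \<otimes>\<^sub>H (a' *\<^sub>R e'), q \<otimes>\<^sub>H (b' *\<^sub>R e')) = (a * a' + b * b') * (e \<bullet> e')" for a b a' b' e e'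
    by (simp only: inner_Pair inner_quat_mult_left pp) (simp add: algebra_simps)
  have g: "nk_metric (p, q) (p \<otimes>\<^sub>H (a *\<^sub>R e), q \<otimes>\<^sub>H (b *\<^sub>R e)) (p \<otimes>\<^sub>H (a' *\<^sub>R e'), q \<otimes>\<^sub>H (b' *\<^sub>R e'))
      = 4 / 3 * (a * a' + b * b' - (a * b' + a' * b) / 2) * (e \<bullet> e')" for a b a' b' e e'
  proof -
    have "nk_metric (p, q) (p \<otimes>\<^sub>H (a *\<^sub>R e), q \<otimes>\<^sub>H (b *\<^sub>R e)) (p \<otimes>\<^sub>H (a' *\<^sub>R e'), q \<otimes>\<^sub>H (b' *\<^sub>R e'))
       = 1 / 2 * (a * a' + b * b' + (r * r) * ((2 * b - a) * (2 * b' - a') + (b - 2 * a) * (b' - 2 * a'))) * (e \<bullet> e')"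
      unfolding nk_metric_def J in_eq by (simp add: algebra_simps)
    moreover have "1 / 2 * (a * a' + b * b' + (1 / 3) * ((2 * b - a) * (2 * b' - a') + (b - 2 * a) * (b' - 2 * a')))
        = 4 / 3 * (a * a' + b * b' - (a * b' + a' * b) / 2)"
      by (simp add: field_simps)
    ultimately show ?thesis by (simp only: rr)
  qed
  show "nk_metric (p, q) (p \<otimes>\<^sub>H (a *\<^sub>R e), q \<otimes>\<^sub>H (b *\<^sub>R e)) (p \<otimes>\<^sub>H (a' *\<^sub>R e'), q \<otimes>\<^sub>H (b' *\<^sub>R e'))
      = 4 / 3 * (a * a' + b * b' - (a * b' + a' * b) / 2) * (e \<bullet> e')" by (rule g)
  have "nk_metric (p, q) (nk_J (p, q) (p \<otimes>\<^sub>H (a *\<^sub>R e), q \<otimes>\<^sub>H (b *\<^sub>R e))) (p \<otimes>\<^sub>H (a' *\<^sub>R e'), q \<otimes>\<^sub>H (b' *\<^sub>R e'))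
     = 2 * r * (a' * b - a * b') * (e \<bullet> e')"
    unfolding J g by (simp add: field_simps)
  then show "nk_metric (p, q) (nk_J (p, q) (p \<otimes>\<^sub>H (a *\<^sub>R e), q \<otimes>\<^sub>H (b *\<^sub>R e))) (p \<otimes>\<^sub>H (a' *\<^sub>R e'), q \<otimes>\<^sub>H (b' *\<^sub>R e'))
     = 2 / sqrt 3 * (a' * b - a * b') * (e \<bullet> e')" by (simp add: r_def)
qed

text \<open>A vector in the plane is not both orthogonal and parallel to another one unless one of them
  vanishes. This is how orthogonality for the metric together with the Lagrangian condition gives
  orthogonality of the imaginary quaternions.\<close>

lemma slopes_orthogonal:
  fixes a b a' b' k :: real
  assumes n: "a\<^sup>2 + b\<^sup>2 - a * b = 3 / 4" "a'\<^sup>2 + b'\<^sup>2 - a' * b' = 3 / 4"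
    and "(a * a' + b * b' - (a * b' + a' * b) / 2) * k = 0" "(a' * b - a * b') * k = 0"
  shows "k = 0"
proof (rule ccontr)
  assume "k \<noteq> 0"
  then have 1: "a' * b = a * b'" "a * a' + b * b' - (a * b' + a' * b) / 2 = 0" using assms(3,4) by auto
  then have 2: "a * a' + b * b' - a * b' = 0" by simp
  have "a' * (a\<^sup>2 + b\<^sup>2 - a * b) = 0" "b' * (a\<^sup>2 + b\<^sup>2 - a * b) = 0" using 1(1) 2 by algebra+
  then have "a' = 0" "b' = 0" using n(1) by auto
  then show False using n(2) by simp
qed

text \<open>The equation for \<open>P\<close> makes both components of the leg \<open>i\<close> multiples of one imaginary
  quaternion \<open>e i\<close>, with the slopes as factors.\<close>

lemma angle_frame_pointwise:
  assumes pq: "p \<in> S3" "q \<in> S3"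
    and im: "\<And>i. imaginary (x i)" "\<And>i. imaginary (y i)"
    and on: "\<And>i j. nk_metric (p, q) (p \<otimes>\<^sub>H x i, q \<otimes>\<^sub>H y i) (p \<otimes>\<^sub>H x j, q \<otimes>\<^sub>H y j) = (if i = j then 1 else 0)"
    and lag: "\<And>i j. nk_metric (p, q) (nk_J (p, q) (p \<otimes>\<^sub>H x i, q \<otimes>\<^sub>H y i)) (p \<otimes>\<^sub>H x j, q \<otimes>\<^sub>H y j) = 0"
    and ang: "\<And>i. nk_P (p, q) (p \<otimes>\<^sub>H x i, q \<otimes>\<^sub>H y i) = cos (2 * t i) *\<^sub>R (p \<otimes>\<^sub>H x i, q \<otimes>\<^sub>H y i)
        + sin (2 * t i) *\<^sub>R nk_J (p, q) (p \<otimes>\<^sub>H x i, q \<otimes>\<^sub>H y i)"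
  shows "\<exists>e. orthonormal3 e \<and> (\<forall>i. x i = slope_a (t i) *\<^sub>R e i \<and> y i = slope_b (t i) *\<^sub>R e i)"
proof -
  let ?a = "\<lambda>i. slope_a (t i)" and ?b = "\<lambda>i. slope_b (t i)"
  have comb: "y i = cos (2 * t i) *\<^sub>R x i + (sin (2 * t i) / sqrt 3) *\<^sub>R (2 *\<^sub>R y i - x i)"
    "x i = cos (2 * t i) *\<^sub>R y i + (sin (2 * t i) / sqrt 3) *\<^sub>R (y i - 2 *\<^sub>R x i)" for i
  proof -
    have "p \<otimes>\<^sub>H y i = p \<otimes>\<^sub>H (cos (2 * t i) *\<^sub>R x i + (sin (2 * t i) / sqrt 3) *\<^sub>R (2 *\<^sub>R y i - x i))"
      "q \<otimes>\<^sub>H x i = q \<otimes>\<^sub>H (cos (2 * t i) *\<^sub>R y i + (sin (2 * t i) / sqrt 3) *\<^sub>R (y i - 2 *\<^sub>R x i))"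
      using ang[of i] unfolding nk_P_quat[OF pq] nk_J_quat[OF pq] by (simp_all add: qm_simps algebra_simps)
    then show "y i = cos (2 * t i) *\<^sub>R x i + (sin (2 * t i) / sqrt 3) *\<^sub>R (2 *\<^sub>R y i - x i)"
      "x i = cos (2 * t i) *\<^sub>R y i + (sin (2 * t i) / sqrt 3) *\<^sub>R (y i - 2 *\<^sub>R x i)"
      using S3_left_cancel pq by blast+
  qed
  have "?b i * (x i $ k) = ?a i * (y i $ k)" for i k
  proof (rule angle_equations_solution)
    show "y i $ k = cos (2 * t i) * (x i $ k) + sin (2 * t i) / sqrt 3 * (2 * (y i $ k) - x i $ k)"
      using arg_cong[OF comb(1)[of i], of "\<lambda>v. v $ k"] by simp
    show "x i $ k = cos (2 * t i) * (y i $ k) + sin (2 * t i) / sqrt 3 * (- 2 * (x i $ k) + y i $ k)"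
      using arg_cong[OF comb(2)[of i], of "\<lambda>v. v $ k"] by simp
  qed
  then have par: "?b i *\<^sub>R x i = ?a i *\<^sub>R y i" for i by (simp add: vec_eq_iff)
  \<comment> \<open>the dual vector of \<open>(a, b)\<close> for the quadratic form \<open>a\<^sup>2 + b\<^sup>2 - a b\<close> of norm \<open>3/4\<close> recovers
    the common quaternion without a division by a possibly vanishing slope\<close>
  define e where "e i = (4 / 3) *\<^sub>R ((?a i - ?b i / 2) *\<^sub>R x i + (?b i - ?a i / 2) *\<^sub>R y i)" for i
  have xy: "x i = ?a i *\<^sub>R e i" "y i = ?b i *\<^sub>R e i" for i
  proof -
    have k: "?b i * (x i $ k) = ?a i * (y i $ k)" for k using arg_cong[OF par[of i], of "\<lambda>v. v $ k"] by simp
    have N: "4 * ((?a i)\<^sup>2 + (?b i)\<^sup>2 - ?a i * ?b i) = 3" using slope_norm[of "t i"] by simp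
    have x3: "3 * (x i $ k) = 4 * ?a i * ((?a i - ?b i / 2) * (x i $ k) + (?b i - ?a i / 2) * (y i $ k))"
      "3 * (y i $ k) = 4 * ?b i * ((?a i - ?b i / 2) * (x i $ k) + (?b i - ?a i / 2) * (y i $ k))" for k
    proof -
      have "2 * (3 * (x i $ k)) = 4 * ?a i * ((2 * ?a i - ?b i) * (x i $ k) + (2 * ?b i - ?a i) * (y i $ k))"
        "2 * (3 * (y i $ k)) = 4 * ?b i * ((2 * ?a i - ?b i) * (x i $ k) + (2 * ?b i - ?a i) * (y i $ k))"
        using k[of k] N by algebra+
      then show "3 * (x i $ k) = 4 * ?a i * ((?a i - ?b i / 2) * (x i $ k) + (?b i - ?a i / 2) * (y i $ k))"
        "3 * (y i $ k) = 4 * ?b i * ((?a i - ?b i / 2) * (x i $ k) + (?b i - ?a i / 2) * (y i $ k))"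
        by (simp_all add: field_simps)
    qed
    have e3: "3 * (e i $ k) = 4 * ((?a i - ?b i / 2) * (x i $ k) + (?b i - ?a i / 2) * (y i $ k))" for k
      by (simp add: e_def)
    have "3 * (x i $ k) = 3 * (?a i * (e i $ k))" "3 * (y i $ k) = 3 * (?b i * (e i $ k))" for k
      using x3(1)[of k] x3(2)[of k] e3[of k] by algebra+
    then show "x i = ?a i *\<^sub>R e i" "y i = ?b i *\<^sub>R e i"
      by (simp_all add: vec_eq_iff)
  qed
  have eim: "imaginary (e i)" for i using im by (simp add: e_def imaginary_def)
  have g: "4 / 3 * (?a i * ?a j + ?b i * ?b j - (?a i * ?b j + ?a j * ?b i) / 2) * (e i \<bullet> e j) = (if i = j then 1 else 0)" for i j
    using on[of i j] nk_metric_quat(1)[OF pq, of "?a i" "e i" "?b i" "?a j" "e j" "?b j"] by (simp only: xy[symmetric])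
  have h: "2 / sqrt 3 * (?a j * ?b i - ?a i * ?b j) * (e i \<bullet> e j) = 0" for i j
    using lag[of i j] nk_metric_quat(2)[OF pq, of "?a i" "e i" "?b i" "?a j" "e j" "?b j"] by (simp only: xy[symmetric])
  have "e i \<bullet> e j = (if i = j then 1 else 0)" for i j
  proof (cases "i = j")
    case True
    have E: "?a i * ?a i + ?b i * ?b i - (?a i * ?b i + ?a i * ?b i) / 2 = 3 / 4"
      using slope_norm[of "t i"] by (simp add: power2_eq_square)
    show ?thesis using g[of i i] True unfolding E by simp
  next
    case False
    have cancel: "4 / 3 * A * k = 0 \<Longrightarrow> A * k = 0" "2 / sqrt 3 * A * k = 0 \<Longrightarrow> A * k = 0" for A k :: real
      by simp_all
    have "e i \<bullet> e j = 0"
      by (rule slopes_orthogonal[OF slope_norm[of "t i"] slope_norm[of "t j"] cancel(1) cancel(2)[OF h[where i=i and j=j]]])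
        (use g[where i=i and j=j] False in \<open>simp only: if_False\<close>)
    then show ?thesis using False by simp
  qed
  then show ?thesis using eim xy by (intro exI[of _ e]) (auto simp: orthonormal3_def)
qed

section \<open>Charts\<close>

lemma smooth_on_subset: "smooth_on A f \<Longrightarrow> B \<subseteq> A \<Longrightarrow> smooth_on B f"
  unfolding smooth_on_def by (meson Int_mono order_refl subset_iff)

lemma smooth_on_continuous:
  assumes "smooth_on A f"
  shows "continuous_on A f"
  unfolding continuous_on_eq_continuous_within
proof
  fix x assume x: "x \<in> A"
  obtain W g where W: "open W" "x \<in> W" "\<forall>k. Ck_on k W g" "\<forall>y\<in>W \<inter> A. g y = f y"
    using assms x unfolding smooth_on_def by meson
  then have "continuous (at x) g" using Cinf_on_continuous[of W g] by (auto simp: Cinf_on_def continuous_on_eq_continuous_at)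
  then have "continuous (at x within A) g" by (rule continuous_at_imp_continuous_within)
  then show "continuous (at x within A) f"
  proof (rule continuous_transform_within_openin[of _ _ _ "A \<inter> W"])
    show "openin (top_of_set A) (A \<inter> W)" using W(1) by auto
  qed (use x W in auto)
qed

lemma smooth_on_compose_open:
  fixes g :: "'a::euclidean_space \<Rightarrow> 'b::euclidean_space" and h :: "'b \<Rightarrow> 'c::real_normed_vector"
  assumes "smooth_on A g" "open T" "Cinf_on T h" "g ` A \<subseteq> T"
  shows "smooth_on A (\<lambda>x. h (g x))"
  unfolding smooth_on_def
proof
  fix x assume x: "x \<in> A"
  obtain W g' where W: "open W" "x \<in> W" "\<forall>k. Ck_on k W g'" "\<forall>y\<in>W \<inter> A. g' y = g y"
    using assms(1) x unfolding smooth_on_def by meson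
  have g': "Cinf_on W g'" using W by (simp add: Cinf_on_def)
  define O' where "O' = W \<inter> g' -` T"
  have O': "open O'" unfolding O'_def by (rule continuous_open_preimage[OF Cinf_on_continuous[OF g'] W(1) assms(2)])
  have "Cinf_on O' (\<lambda>x. h (g' x))"
    by (rule Cinf_on_compose[OF O' assms(2) _ Cinf_on_subset[OF g'] assms(3)]) (auto simp: O'_def)
  moreover have "x \<in> O'" using x W assms(4) by (auto simp: O'_def)
  ultimately show "\<exists>W g'. open W \<and> x \<in> W \<and> (\<forall>k. Ck_on k W g') \<and> (\<forall>y\<in>W \<inter> A. g' y = h (g y))"
    using O' W(4) by (intro exI[of _ O'] exI[of _ "\<lambda>x. h (g' x)"]) (auto simp: Cinf_on_def O'_def)
qed

locale manifold_chart =
  fixes M :: "'m topology" and \<A> :: "('m, real^3) chart set" and U :: "'m set" and \<phi> :: "'m \<Rightarrow> real^3"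
  assumes manifold: "smooth_manifold M \<A>" and chart: "(U, \<phi>) \<in> \<A>"
begin

abbreviation "\<psi> \<equiv> inv_into U \<phi>"

lemma chart_facts: "openin M U" "open (\<phi> ` U)" "homeomorphic_map (subtopology M U) (top_of_set (\<phi> ` U)) \<phi>" "U \<subseteq> topspace M"
proof -
  show 1: "openin M U" and "open (\<phi> ` U)" "homeomorphic_map (subtopology M U) (top_of_set (\<phi> ` U)) \<phi>"
    using manifold chart unfolding smooth_manifold_def by blast+
  show "U \<subseteq> topspace M" using 1 openin_subset by blast
qed

lemma inj: "inj_on \<phi> U"
  using chart_facts(3,4) unfolding homeomorphic_map_def homeomorphic_eq_everything_map
  by (metis (no_types, lifting) chart_facts(3) homeomorphic_imp_injective_map topspace_subtopology_subset)

lemma \<psi>_\<phi>: "x \<in> U \<Longrightarrow> \<psi> (\<phi> x) = x" and \<phi>_\<psi>: "y \<in> \<phi> ` U \<Longrightarrow> \<phi> (\<psi> y) = y" and \<psi>_in: "y \<in> \<phi> ` U \<Longrightarrow> \<psi> y \<in> U"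
  using inj by (auto simp: f_inv_into_f inv_into_into)

lemma openin_preimage:
  assumes "open V"
  shows "openin M {x \<in> U. \<phi> x \<in> V}"
proof -
  have "continuous_map (subtopology M U) (top_of_set (\<phi> ` U)) \<phi>"
    using chart_facts(3) homeomorphic_imp_continuous_map by blast
  then have "continuous_map (subtopology M U) euclidean \<phi>" using continuous_map_in_subtopology by blast
  then have "openin (subtopology M U) {x \<in> topspace (subtopology M U). \<phi> x \<in> V}"
    using assms openin_continuous_map_preimage by (metis open_openin)
  moreover have "topspace (subtopology M U) = U" using chart_facts(4) by auto
  ultimately show ?thesis using chart_facts(1) openin_trans_full by metis
qed

lemma open_image:
  assumes "openin M V" "V \<subseteq> U"
  shows "open (\<phi> ` V)"
proof -
  have "openin (subtopology M U) V" using assms by (simp add: openin_subset_topspace_eq openin_open_subtopology chart_facts(1))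
  then have "openin (top_of_set (\<phi> ` U)) (\<phi> ` V)"
    using chart_facts(3) homeomorphic_imp_open_map open_map_def by blast
  then show ?thesis using chart_facts(2) openin_open_eq by blast
qed

lemma transition:
  assumes "(V, \<theta>) \<in> \<A>"
  shows "open (\<phi> ` (U \<inter> V))" "Cinf_on (\<phi> ` (U \<inter> V)) (\<theta> \<circ> \<psi>)"
proof -
  have "openin M V" using manifold assms unfolding smooth_manifold_def by blast
  then show 1: "open (\<phi> ` (U \<inter> V))" using open_image chart_facts(1) by blast
  have "smooth_on (\<phi> ` (U \<inter> V)) (\<theta> \<circ> \<psi>)" using manifold assms chart unfolding smooth_manifold_def by blast
  then show "Cinf_on (\<phi> ` (U \<inter> V)) (\<theta> \<circ> \<psi>)" using smooth_on_open_iff[OF 1] by blast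
qed

lemma smooth_in_chart:
  assumes "smooth_map_on \<A> (topspace M) f"
  shows "Cinf_on (\<phi> ` U) (f \<circ> \<psi>)"
proof -
  have "smooth_on (\<phi> ` (U \<inter> topspace M)) (f \<circ> \<psi>)" using assms chart unfolding smooth_map_on_def by blast
  then show ?thesis using chart_facts(2,4) smooth_on_open_iff by (metis inf.absorb1)
qed

text \<open>Composition with the chart turns an embedding of an open set of coordinates into a
  diffeomorphism in the sense of the atlas; smoothness in the other charts follows from the
  transition maps.\<close>

lemma diffeo_from_chart:
  fixes u :: "real^3 \<Rightarrow> 'n::euclidean_space"
  assumes u: "smooth_embedding_onto_open V N u" and V: "V \<subseteq> \<phi> ` U"
  defines "U' \<equiv> {x \<in> U. \<phi> x \<in> V}"
  shows "openin M U'" "diffeo_onto_open M \<A> U' N (u \<circ> \<phi>)"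
proof -
  have uf: "open V" "Cinf_on V u" "inj_on u V" "openin (top_of_set N) (u ` V)" "smooth_on (u ` V) (inv_into V u)"
    using u by (auto simp: smooth_embedding_onto_open_def)
  show o: "openin M U'" unfolding U'_def by (rule openin_preimage[OF uf(1)])
  have img: "\<phi> ` U' = V" using V by (auto simp: U'_def)
  then have img': "(u \<circ> \<phi>) ` U' = u ` V" by (metis image_comp)
  have U'U: "U' \<subseteq> U" by (auto simp: U'_def)
  have h1: "homeomorphic_map (subtopology M U') (top_of_set V) \<phi>"
  proof -
    have "homeomorphic_map (subtopology (subtopology M U) U') (subtopology (top_of_set (\<phi> ` U)) V) \<phi>"
      by (rule homeomorphic_map_subtopologies_alt[OF chart_facts(3)]) (use chart_facts(4) in \<open>auto simp: U'_def\<close>)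
    then show ?thesis using U'U V by (simp add: subtopology_subtopology inf_absorb2)
  qed
  have h2: "homeomorphic_map (top_of_set V) (top_of_set (u ` V)) u"
  proof -
    have "homeomorphic_maps (top_of_set V) (top_of_set (u ` V)) u (inv_into V u)"
      unfolding homeomorphic_maps_def using uf Cinf_on_continuous smooth_on_continuous
      by (auto simp: continuous_map_in_subtopology inv_into_into f_inv_into_f intro: )
    then show ?thesis using homeomorphic_map_maps by blast
  qed
  have h: "homeomorphic_map (subtopology M U') (top_of_set ((u \<circ> \<phi>) ` U')) (u \<circ> \<phi>)"
    unfolding img' by (rule homeomorphic_map_compose[OF h1 h2])
  have inv: "inv_into U' (u \<circ> \<phi>) z = \<psi> (inv_into V u z)" if z: "z \<in> u ` V" for z
  proof -
    have v: "inv_into V u z \<in> V" "u (inv_into V u z) = z" using z by (auto simp: inv_into_into f_inv_into_f)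
    then have U': "\<psi> (inv_into V u z) \<in> U'" "(u \<circ> \<phi>) (\<psi> (inv_into V u z)) = z"
      using V \<psi>_in \<phi>_\<psi> by (auto simp: U'_def subset_iff)
    have "inj_on (u \<circ> \<phi>) U'"
      using inj uf(3) unfolding U'_def by (auto simp: inj_on_def)
    then show ?thesis using U' inv_into_f_f by metis
  qed
  have c1: "smooth_map_on \<A> U' (u \<circ> \<phi>)"
    unfolding smooth_map_on_def
  proof clarify
    fix V2 \<theta> assume c2: "(V2, \<theta>) \<in> \<A>"
    interpret c: manifold_chart M \<A> V2 \<theta> by unfold_locales (use manifold c2 in auto)
    have op: "open (\<theta> ` (V2 \<inter> U'))" using c.open_image[of "V2 \<inter> U'"] c.chart_facts(1) o by blast
    have "Cinf_on (\<theta> ` (V2 \<inter> U')) (\<phi> \<circ> c.\<psi>)"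
      by (rule Cinf_on_subset[OF c.transition(2)[OF chart]]) (use U'U in auto)
    moreover have "(\<phi> \<circ> c.\<psi>) ` \<theta> ` (V2 \<inter> U') \<subseteq> V" using c.\<psi>_\<phi> by (auto simp: U'_def)
    ultimately have "Cinf_on (\<theta> ` (V2 \<inter> U')) (\<lambda>x. u ((\<phi> \<circ> c.\<psi>) x))"
      using Cinf_on_compose[OF op uf(1) _ _ uf(2)] by blast
    then show "smooth_on (\<theta> ` (V2 \<inter> U')) (u \<circ> \<phi> \<circ> c.\<psi>)"
      by (subst smooth_on_open_iff[OF op]) (simp add: o_def)
  qed
  have c2: "smooth_on ((u \<circ> \<phi>) ` (U' \<inter> V2)) (\<theta> \<circ> inv_into U' (u \<circ> \<phi>))" if c2: "(V2, \<theta>) \<in> \<A>" for V2 \<theta>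
  proof -
    let ?A = "(u \<circ> \<phi>) ` (U' \<inter> V2)"
    have A: "?A \<subseteq> u ` V" using img' by blast
    have "smooth_on ?A (\<lambda>z. (\<theta> \<circ> \<psi>) (inv_into V u z))"
    proof (rule smooth_on_compose_open[OF smooth_on_subset[OF uf(5) A] transition[OF c2]])
      show "inv_into V u ` ?A \<subseteq> \<phi> ` (U \<inter> V2)"
        using uf(3) by (auto simp: U'_def)
    qed
    moreover have "(\<theta> \<circ> \<psi>) (inv_into V u z) = (\<theta> \<circ> inv_into U' (u \<circ> \<phi>)) z" if "z \<in> ?A" for z
      using inv[of z] that A by auto
    ultimately show ?thesis unfolding smooth_on_def by (metis IntD2)
  qed
  show "diffeo_onto_open M \<A> U' N (u \<circ> \<phi>)"
    unfolding diffeo_onto_open_def using h c1 c2 uf(4) img' by auto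
qed

lemma congruent_from_model:
  assumes x: "x \<in> U" and W: "W \<subseteq> \<phi> ` U"
    and m: "locally_model W (\<lambda>y. fst (f (\<psi> y))) (\<lambda>y. snd (f (\<psi> y))) N f0 (\<phi> x)"
  shows "\<exists>U' \<theta> F. openin M U' \<and> x \<in> U' \<and> diffeo_onto_open M \<A> U' N \<theta> \<and> nk_isometry F \<and>
        (\<forall>y\<in>U'. f y = F (f0 (\<theta> y)))"
proof -
  obtain V u F where V: "\<phi> x \<in> V" "V \<subseteq> W" "smooth_embedding_onto_open V N u" "nk_isometry F"
    "\<forall>y\<in>V. (fst (f (\<psi> y)), snd (f (\<psi> y))) = F (f0 (u y))"
    using m unfolding locally_model_def by blast
  let ?U' = "{x \<in> U. \<phi> x \<in> V}"
  have "f y = F (f0 ((u \<circ> \<phi>) y))" if "y \<in> ?U'" for y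
    using V(5) that \<psi>_\<phi>[of y] by auto
  moreover have "V \<subseteq> \<phi> ` U" using V(2) W by blast
  ultimately show ?thesis using diffeo_from_chart[OF V(3)] V(1,4) x
    by (intro exI[of _ ?U'] exI[of _ "u \<circ> \<phi>"] exI[of _ F]) auto
qed

end

section \<open>From charts to the manifold\<close>

context manifold_chart
begin

lemma chart_diff_components:
  assumes f: "smooth_map_on \<A> (topspace M) f" and x: "x \<in> U"
  shows "chart_diff (U, \<phi>) f x v = (dder (\<lambda>y. fst (f (\<psi> y))) (\<phi> x) v, dder (\<lambda>y. snd (f (\<psi> y))) (\<phi> x) v)"
proof -
  have s: "Cinf_on (\<phi> ` U) (f \<circ> \<psi>)" by (rule smooth_in_chart[OF f])
  have y: "\<phi> x \<in> \<phi> ` U" using x by blast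
  have "dder (\<lambda>y. fst ((f \<circ> \<psi>) y)) (\<phi> x) v = fst (dder (f \<circ> \<psi>) (\<phi> x) v)"
    by (rule dder_linear[OF bounded_linear_fst s y])
  moreover have "dder (\<lambda>y. snd ((f \<circ> \<psi>) y)) (\<phi> x) v = snd (dder (f \<circ> \<psi>) (\<phi> x) v)"
    by (rule dder_linear[OF bounded_linear_snd s y])
  ultimately show ?thesis by simp
qed

text \<open>The frame at a point may come with a chart other than the given one, but the range of the
  differential is the same for all charts.\<close>

lemma chart_diff_change:
  assumes f: "smooth_map_on \<A> (topspace M) f" and c: "(V, \<theta>) \<in> \<A>" and x: "x \<in> U" "x \<in> V"
  shows "\<exists>w. chart_diff (V, \<theta>) f x v = chart_diff (U, \<phi>) f x w"
proof -
  interpret c: manifold_chart M \<A> V \<theta> by unfold_locales (use manifold c in auto)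
  let ?O = "\<theta> ` (V \<inter> U)"
  have xO: "\<theta> x \<in> ?O" using x by blast
  note tr = c.transition[OF chart]
  have s: "Cinf_on (\<phi> ` U) (f \<circ> \<psi>)" by (rule smooth_in_chart[OF f])
  have \<phi>x: "(\<phi> \<circ> c.\<psi>) (\<theta> x) = \<phi> x" using c.\<psi>_\<phi>[OF x(2)] by simp
  have "dder (f \<circ> c.\<psi>) (\<theta> x) v = dder (\<lambda>y. (f \<circ> \<psi>) ((\<phi> \<circ> c.\<psi>) y)) (\<theta> x) v"
    by (rule dder_cong_on[OF tr(1) xO]) (auto simp: c.\<psi>_\<phi> \<psi>_\<phi>)
  also have "\<dots> = dder (f \<circ> \<psi>) (\<phi> x) (dder (\<phi> \<circ> c.\<psi>) (\<theta> x) v)"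
  proof (rule dder_eqI)
    have "\<phi> x \<in> \<phi> ` U" using x by blast
    then show "((\<lambda>y. (f \<circ> \<psi>) ((\<phi> \<circ> c.\<psi>) y)) has_derivative (\<lambda>v. dder (f \<circ> \<psi>) (\<phi> x) (dder (\<phi> \<circ> c.\<psi>) (\<theta> x) v))) (at (\<theta> x))"
      using has_derivative_compose[OF Cinf_on_derivative[OF tr(2) xO], of "f \<circ> \<psi>"] Cinf_on_derivative[OF s]
      by (simp only: \<phi>x)
  qed
  finally show ?thesis by auto
qed

lemma dense_image:
  assumes D: "M closure_of D = topspace M"
  shows "\<phi> ` U \<subseteq> closure (\<phi> ` (U \<inter> D))"
proof
  fix y assume "y \<in> \<phi> ` U"
  then obtain x where x: "x \<in> U" "y = \<phi> x" by blast
  show "y \<in> closure (\<phi> ` (U \<inter> D))"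
    unfolding closure_approachable
  proof (intro allI impI)
    fix e :: real assume "e > 0"
    let ?N = "{z \<in> U. \<phi> z \<in> ball y e}"
    have N: "openin M ?N" by (rule openin_preimage) simp
    have xN: "x \<in> ?N" using x \<open>e > 0\<close> by simp
    have "x \<in> M closure_of D" using x(1) D chart_facts(4) by blast
    then have "\<forall>T. x \<in> T \<and> openin M T \<longrightarrow> (\<exists>z. z \<in> D \<and> z \<in> T)" by (simp add: in_closure_of)
    then have "\<exists>z. z \<in> D \<and> z \<in> ?N" using N xN by (elim allE[of _ ?N]) (simp only: simp_thms)
    then obtain z where "z \<in> D" "z \<in> ?N" by (elim exE conjE)
    then show "\<exists>z\<in>\<phi> ` (U \<inter> D). dist z y < e" by (auto simp: dist_commute)
  qed
qed

lemma dense_frames_in_chart: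
  assumes lag: "lagrangian_immersion M \<A> f" and D: "M closure_of D = topspace M"
    and frames: "\<And>x. x \<in> D \<Longrightarrow> \<exists>c\<in>\<A>. \<exists>W E. openin M W \<and> x \<in> W \<and> angle_frame_on c W f E (\<lambda>i _. t i)"
  shows "dense_frames (\<phi> ` U) (\<phi> ` (U \<inter> D)) (\<lambda>y. fst (f (\<psi> y))) (\<lambda>y. snd (f (\<psi> y)))
     (\<lambda>i. slope_a (t i)) (\<lambda>i. slope_b (t i))"
proof
  let ?p = "\<lambda>y. fst (f (\<psi> y))" and ?q = "\<lambda>y. snd (f (\<psi> y))"
  have imm: "immersion M \<A> f" using lag by (simp add: lagrangian_immersion_def)
  have smooth_f: "smooth_map_on \<A> (topspace M) f" using imm by (simp add: immersion_def)
  have s: "Cinf_on (\<phi> ` U) (f \<circ> \<psi>)" by (rule smooth_in_chart[OF smooth_f])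
  show "open (\<phi> ` U)" by (rule chart_facts(2))
  show sp: "Cinf_on (\<phi> ` U) ?p" and sq: "Cinf_on (\<phi> ` U) ?q"
    using Cinf_on_linear[OF bounded_linear_fst chart_facts(2) s] Cinf_on_linear[OF bounded_linear_snd chart_facts(2) s] by simp_all
  have fS: "f x \<in> S3xS3" if "x \<in> U" for x using imm that chart_facts(4) by (auto simp: immersion_def)
  show S3: "?p y \<in> S3" "?q y \<in> S3" if "y \<in> \<phi> ` U" for y
    using fS[OF \<psi>_in[OF that]] by (auto simp: S3xS3_def)
  show "v = 0" if y: "y \<in> \<phi> ` U" and d: "dder ?p y v = 0" "dder ?q y v = 0" for y v
  proof -
    obtain x where x: "x \<in> U" "y = \<phi> x" using y by blast
    have "inj (chart_diff (U, \<phi>) f x)" using imm chart x(1) unfolding immersion_def by fastforce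
    moreover have "chart_diff (U, \<phi>) f x v = chart_diff (U, \<phi>) f x 0"
      unfolding chart_diff_components[OF smooth_f x(1)]
      using d x dder_linear_simps(5)[OF sp] dder_linear_simps(5)[OF sq] by simp
    ultimately show "v = 0" by (rule injD)
  qed
  show "\<phi> ` (U \<inter> D) \<subseteq> \<phi> ` U" by blast
  show "\<phi> ` U \<subseteq> closure (\<phi> ` (U \<inter> D))" by (rule dense_image[OF D])
  show "slope_a (t i) \<noteq> 0 \<or> slope_b (t i) \<noteq> 0" for i using slope_norm[of "t i"] by auto
  show "\<exists>e E. orthonormal3 e \<and> (\<forall>i. dder ?p y (E i) = slope_a (t i) *\<^sub>R (?p y \<otimes>\<^sub>H e i) \<and>
       dder ?q y (E i) = slope_b (t i) *\<^sub>R (?q y \<otimes>\<^sub>H e i))" if y: "y \<in> \<phi> ` (U \<inter> D)" for y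
  proof -
    obtain x where x: "x \<in> U" "x \<in> D" "y = \<phi> x" using y by blast
    have yU: "y \<in> \<phi> ` U" using x by blast
    obtain c W E where c: "c \<in> \<A>" "openin M W" "x \<in> W" "angle_frame_on c W f E (\<lambda>i _. t i)"
      using frames[OF x(2)] by blast
    obtain V \<theta> where V: "c = (V, \<theta>)" by fastforce
    have fr: "W \<subseteq> V" "\<And>i j. nk_metric (f x) (chart_diff c f x (E i x)) (chart_diff c f x (E j x)) = (if i = j then 1 else 0)"
      "\<And>i. nk_P (f x) (chart_diff c f x (E i x)) = cos (2 * t i) *\<^sub>R chart_diff c f x (E i x)
         + sin (2 * t i) *\<^sub>R nk_J (f x) (chart_diff c f x (E i x))"
      using c(3,4) unfolding V by (auto simp: Let_def)
    have xV: "x \<in> V" using c(3) fr(1) by blast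
    have "\<forall>i. \<exists>w. chart_diff c f x (E i x) = chart_diff (U, \<phi>) f x w"
      using chart_diff_change[OF smooth_f _ x(1) xV] c(1) V by blast
    then obtain E' where E': "\<And>i. chart_diff c f x (E i x) = chart_diff (U, \<phi>) f x (E' i)" by metis
    define X Y where "X i = quat_cnj (?p y) \<otimes>\<^sub>H dder ?p y (E' i)" "Y i = quat_cnj (?q y) \<otimes>\<^sub>H dder ?q y (E' i)" for i
    have fx: "f x = (?p y, ?q y)" using x \<psi>_\<phi>[OF x(1)] by simp
    have dX: "dder ?p y (E' i) = ?p y \<otimes>\<^sub>H X i" "dder ?q y (E' i) = ?q y \<otimes>\<^sub>H Y i" for i
      unfolding X_Y_def using S3[OF yU] by simp_all
    have Z: "chart_diff c f x (E i x) = (?p y \<otimes>\<^sub>H X i, ?q y \<otimes>\<^sub>H Y i)" for i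
      unfolding E' chart_diff_components[OF smooth_f x(1)] x(3)[symmetric] dX ..
    have lag0: "nk_metric (f x) (nk_J (f x) (chart_diff c f x v)) (chart_diff c f x w) = 0" for v w
      using lag c(1) xV V unfolding lagrangian_immersion_def by fastforce
    have "\<exists>e. orthonormal3 e \<and> (\<forall>i. X i = slope_a (t i) *\<^sub>R e i \<and> Y i = slope_b (t i) *\<^sub>R e i)"
    proof (rule angle_frame_pointwise[of "?p y" "?q y"])
      show "?p y \<in> S3" "?q y \<in> S3" using S3[OF yU] by auto
      show "imaginary (X i)" "imaginary (Y i)" for i
        unfolding X_Y_def
          using logarithmic_derivative_imaginary[OF chart_facts(2) sp S3(1) yU]
            logarithmic_derivative_imaginary[OF chart_facts(2) sq S3(2) yU] by blast+
      show "nk_metric (?p y, ?q y) (?p y \<otimes>\<^sub>H X i, ?q y \<otimes>\<^sub>H Y i) (?p y \<otimes>\<^sub>H X j, ?q y \<otimes>\<^sub>H Y j) = (if i = j then 1 else 0)" for i j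
        using fr(2)[of i j] unfolding Z fx .
      show "nk_metric (?p y, ?q y) (nk_J (?p y, ?q y) (?p y \<otimes>\<^sub>H X i, ?q y \<otimes>\<^sub>H Y i)) (?p y \<otimes>\<^sub>H X j, ?q y \<otimes>\<^sub>H Y j) = 0" for i j
        using lag0[of "E i x" "E j x"] unfolding Z fx .
      show "nk_P (?p y, ?q y) (?p y \<otimes>\<^sub>H X i, ?q y \<otimes>\<^sub>H Y i) = cos (2 * t i) *\<^sub>R (?p y \<otimes>\<^sub>H X i, ?q y \<otimes>\<^sub>H Y i)
        + sin (2 * t i) *\<^sub>R nk_J (?p y, ?q y) (?p y \<otimes>\<^sub>H X i, ?q y \<otimes>\<^sub>H Y i)" for i
        using fr(3)[of i] unfolding Z fx .
    qed
    then obtain e where e: "orthonormal3 e" "\<forall>i. X i = slope_a (t i) *\<^sub>R e i \<and> Y i = slope_b (t i) *\<^sub>R e i" by blast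
    have "dder ?p y (E' i) = slope_a (t i) *\<^sub>R (?p y \<otimes>\<^sub>H e i) \<and> dder ?q y (E' i) = slope_b (t i) *\<^sub>R (?q y \<otimes>\<^sub>H e i)" for i
      unfolding dX using e(2) by (simp add: qm_simps)
    then show ?thesis using e(1) by blast
  qed
qed

end

theorem corollary1:
  fixes M :: "'m topology" and \<A> :: "('m, real^3) chart set" and f :: "'m \<Rightarrow> quat \<times> quat"
  assumes "smooth_manifold M \<A>"
    and "lagrangian_immersion M \<A> f"
    and "constant_angle_functions M \<A> f"
  shows "\<forall>C\<in>connected_components_of M.
      locally_congruent_on M \<A> C f S3 (\<lambda>u. (u, quat_one)) \<or>
      locally_congruent_on M \<A> C f S3 (\<lambda>u. (quat_one, u)) \<or>
      locally_congruent_on M \<A> C f S3 (\<lambda>u. (u, u)) \<or>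
      locally_congruent_on M \<A> C f S3 (\<lambda>u. (u, u \<otimes>\<^sub>H quat_i)) \<or>
      locally_congruent_on M \<A> C f S3 (\<lambda>u. (quat_inv u, u \<otimes>\<^sub>H quat_i \<otimes>\<^sub>H quat_inv u)) \<or>
      locally_congruent_on M \<A> C f S3 (\<lambda>u. (u \<otimes>\<^sub>H quat_i \<otimes>\<^sub>H quat_inv u, quat_inv u)) \<or>
      locally_congruent_on M \<A> C f S3
        (\<lambda>u. (u \<otimes>\<^sub>H quat_i \<otimes>\<^sub>H quat_inv u, u \<otimes>\<^sub>H quat_j \<otimes>\<^sub>H quat_inv u)) \<or>
      locally_congruent_on M \<A> C f (UNIV :: (real^3) set)
        (\<lambda>x. (torus_p (x$1) (x$3), torus_q (x$1) (x$2)))"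
proof
  fix C assume C: "C \<in> connected_components_of M"
  have CM: "C \<subseteq> topspace M" and Ccon: "connectedin M C"
    using C connected_components_of_subset connectedin_connected_components_of by blast+
  obtain t :: "3 \<Rightarrow> real" and D where D: "M closure_of D = topspace M"
    and frames: "\<And>x. x \<in> D \<Longrightarrow> \<exists>c\<in>\<A>. \<exists>W E. openin M W \<and> x \<in> W \<and> angle_frame_on c W f E (\<lambda>i _. t i)"
    using assms(3) unfolding constant_angle_functions_def by blast
  define S where "S = realized (slope_a (t 1)) (slope_a (t 2)) (slope_a (t 3)) (slope_b (t 1)) (slope_b (t 2)) (slope_b (t 3))"
  have single: "single_model S"
    unfolding S_def by (rule single_model_realized[OF slope_norm slope_norm slope_norm])
  have local: "\<exists>U \<phi> W. (U, \<phi>) \<in> \<A> \<and> x \<in> U \<and> \<phi> x \<in> W \<and> open W \<and> W \<subseteq> \<phi> ` U \<and>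
      (W, \<lambda>y. fst (f (inv_into U \<phi> y)), \<lambda>y. snd (f (inv_into U \<phi> y))) \<in> S" if x: "x \<in> topspace M" for x
  proof -
    have "(\<Union>(U, \<phi>)\<in>\<A>. U) = topspace M" using assms(1) unfolding smooth_manifold_def by blast
    then have "x \<in> (\<Union>(U, \<phi>)\<in>\<A>. U)" using x by simp
    then obtain U \<phi> where U: "(U, \<phi>) \<in> \<A>" "x \<in> U" by auto
    interpret manifold_chart M \<A> U \<phi> by unfold_locales (use assms(1) U in auto)
    interpret dense_frames "\<phi> ` U" "\<phi> ` (U \<inter> D)" "\<lambda>y. fst (f (\<psi> y))" "\<lambda>y. snd (f (\<psi> y))"
      "\<lambda>i. slope_a (t i)" "\<lambda>i. slope_b (t i)"
      by (rule dense_frames_in_chart[OF assms(2) D frames])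
    obtain W where W: "\<phi> x \<in> W" "W \<subseteq> \<phi> ` U" "(W, \<lambda>y. fst (f (\<psi> y)), \<lambda>y. snd (f (\<psi> y))) \<in> S"
      using local_adapted_frame[of "\<phi> x"] U(2) unfolding S_def by blast
    have "open W" using W(3) unfolding S_def by (elim realizedE) (rule adapted_frame.W(1))
    then show ?thesis using U W by blast
  qed
  have congruent: "locally_congruent_on M \<A> C f N f0"
    if "\<And>x U \<phi> W. x \<in> C \<Longrightarrow> (U, \<phi>) \<in> \<A> \<Longrightarrow> x \<in> U \<Longrightarrow> \<phi> x \<in> W \<Longrightarrow> open W \<Longrightarrow> W \<subseteq> \<phi> ` U \<Longrightarrow>
      (W, \<lambda>y. fst (f (inv_into U \<phi> y)), \<lambda>y. snd (f (inv_into U \<phi> y))) \<in> S \<Longrightarrow>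
      locally_model W (\<lambda>y. fst (f (inv_into U \<phi> y))) (\<lambda>y. snd (f (inv_into U \<phi> y))) N f0 (\<phi> x)"
    for N :: "'n::euclidean_space set" and f0
    unfolding locally_congruent_on_def
  proof
    fix x assume x: "x \<in> C"
    obtain U \<phi> W where W: "(U, \<phi>) \<in> \<A>" "x \<in> U" "\<phi> x \<in> W" "open W" "W \<subseteq> \<phi> ` U"
      "(W, \<lambda>y. fst (f (inv_into U \<phi> y)), \<lambda>y. snd (f (inv_into U \<phi> y))) \<in> S"
      using local[of x] x CM by blast
    interpret manifold_chart M \<A> U \<phi> by unfold_locales (use assms(1) W in auto)
    show "\<exists>U \<theta> F. openin M U \<and> x \<in> U \<and> diffeo_onto_open M \<A> U N \<theta> \<and> nk_isometry F \<and> (\<forall>y\<in>U. f y = F (f0 (\<theta> y)))"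
      by (rule congruent_from_model[OF W(2,5) that[OF x W]])
  qed
  have easy: "locally_congruent_on M \<A> C f N f0" if "modelled S N f0" for N :: "quat set" and f0
    using that unfolding modelled_def by (intro congruent) blast
  show "locally_congruent_on M \<A> C f S3 (\<lambda>u. (u, quat_one)) \<or>
      locally_congruent_on M \<A> C f S3 (\<lambda>u. (quat_one, u)) \<or>
      locally_congruent_on M \<A> C f S3 (\<lambda>u. (u, u)) \<or>
      locally_congruent_on M \<A> C f S3 (\<lambda>u. (u, u \<otimes>\<^sub>H quat_i)) \<or>
      locally_congruent_on M \<A> C f S3 (\<lambda>u. (quat_inv u, u \<otimes>\<^sub>H quat_i \<otimes>\<^sub>H quat_inv u)) \<or>
      locally_congruent_on M \<A> C f S3 (\<lambda>u. (u \<otimes>\<^sub>H quat_i \<otimes>\<^sub>H quat_inv u, quat_inv u)) \<or>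
      locally_congruent_on M \<A> C f S3
        (\<lambda>u. (u \<otimes>\<^sub>H quat_i \<otimes>\<^sub>H quat_inv u, u \<otimes>\<^sub>H quat_j \<otimes>\<^sub>H quat_inv u)) \<or>
      locally_congruent_on M \<A> C f (UNIV :: (real^3) set)
        (\<lambda>x. (torus_p (x$1) (x$3), torus_q (x$1) (x$2)))"
  proof (cases "sphere_or_torus S")
    case False
    then show ?thesis using single easy unfolding single_model_def by meson
  next
    case True
    \<comment> \<open>the points with a neighbourhood on which \<open>p\<close> lies in a hyperplane, that is, the points
      around which the map is the sphere model; \<open>G\<close> is open and closed, so a component lies in \<open>G\<close>
      or misses it\<close>
    define G where "G = {x \<in> topspace M. \<exists>N. openin M N \<and> x \<in> N \<and> in_hyperplane N (\<lambda>y. fst (f y))}"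
    have G_open: "openin M G"
    proof (subst openin_subopen, intro ballI)
      fix x assume "x \<in> G"
      then obtain N where "openin M N" "x \<in> N" "in_hyperplane N (\<lambda>y. fst (f y))" unfolding G_def by blast
      then show "\<exists>T. openin M T \<and> x \<in> T \<and> T \<subseteq> G"
        using openin_subset[of M N] unfolding G_def by (intro exI[of _ N]) blast
    qed
    have split: "in_hyperplane W p \<and> locally_model W p q S3
          (\<lambda>u. (u \<otimes>\<^sub>H quat_i \<otimes>\<^sub>H quat_inv u, u \<otimes>\<^sub>H quat_j \<otimes>\<^sub>H quat_inv u)) x \<or>
        (\<forall>V. open V \<and> V \<subseteq> W \<and> V \<noteq> {} \<longrightarrow> \<not> in_hyperplane V p) \<and> locally_model W p q (UNIV :: (real^3) set)
          (\<lambda>x. (torus_p (x$1) (x$3), torus_q (x$1) (x$2))) x" if "(W, p, q) \<in> S" "x \<in> W" for W p q x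
      using True that unfolding sphere_or_torus_def by fastforce
    \<comment> \<open>the torus spans on every open set, so no chart domain of torus type contains a point of
      \<open>G\<close>\<close>
    have meets: "\<not> (\<forall>V. open V \<and> V \<subseteq> W \<and> V \<noteq> {} \<longrightarrow> \<not> in_hyperplane V (\<lambda>y. fst (f (inv_into U \<phi> y))))"
      if z: "(U, \<phi>) \<in> \<A>" "z \<in> U" "\<phi> z \<in> W" "open W" "z \<in> G" for U \<phi> W z
    proof -
      interpret manifold_chart M \<A> U \<phi> by unfold_locales (use assms(1) z in auto)
      obtain N where N: "openin M N" "z \<in> N" "in_hyperplane N (\<lambda>y. fst (f y))" using z(5) unfolding G_def by blast
      let ?N = "N \<inter> {x \<in> U. \<phi> x \<in> W}"
      have "openin M ?N" by (rule openin_Int[OF N(1) openin_preimage[OF z(4)]])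
      then have "open (\<phi> ` ?N)" by (rule open_image) blast
      moreover have "\<phi> ` ?N \<subseteq> W" "\<phi> ` ?N \<noteq> {}" using z N(2) by auto
      moreover have "in_hyperplane (\<phi> ` ?N) (\<lambda>y. fst (f (\<psi> y)))"
        using N(3) \<psi>_\<phi> unfolding in_hyperplane_def by fastforce
      ultimately show ?thesis by blast
    qed
    have G_closed: "closedin M G"
    proof -
      have "openin M (topspace M - G)"
      proof (subst openin_subopen, intro ballI)
        fix x assume x: "x \<in> topspace M - G"
        obtain U \<phi> W where W: "(U, \<phi>) \<in> \<A>" "x \<in> U" "\<phi> x \<in> W" "open W" "W \<subseteq> \<phi> ` U"
          "(W, \<lambda>y. fst (f (inv_into U \<phi> y)), \<lambda>y. snd (f (inv_into U \<phi> y))) \<in> S"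
          using local[of x] x by blast
        interpret manifold_chart M \<A> U \<phi> by unfold_locales (use assms(1) W in auto)
        let ?N = "{z \<in> U. \<phi> z \<in> W}"
        have N: "openin M ?N" "x \<in> ?N" using openin_preimage[OF W(4)] W(2,3) by auto
        have "\<not> in_hyperplane W (\<lambda>y. fst (f (\<psi> y)))"
        proof
          assume "in_hyperplane W (\<lambda>y. fst (f (\<psi> y)))"
          then obtain c where "c \<noteq> 0" "\<forall>y\<in>W. c \<bullet> fst (f (\<psi> y)) = 0" unfolding in_hyperplane_def by blast
          then have "c \<bullet> fst (f z) = 0" if "z \<in> ?N" for z using that \<psi>_\<phi>[of z] by auto
          then have "in_hyperplane ?N (\<lambda>y. fst (f y))" using \<open>c \<noteq> 0\<close> unfolding in_hyperplane_def by blast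
          then have "x \<in> G" using N x unfolding G_def by blast
          then show False using x by blast
        qed
        then have torus: "\<forall>V. open V \<and> V \<subseteq> W \<and> V \<noteq> {} \<longrightarrow> \<not> in_hyperplane V (\<lambda>y. fst (f (\<psi> y)))"
          using split[OF W(6,3)] by blast
        have "z \<notin> G" if "z \<in> ?N" for z
          using meets[OF W(1) _ _ W(4), of z] that torus by blast
        then show "\<exists>T. openin M T \<and> x \<in> T \<and> T \<subseteq> topspace M - G"
          using N openin_subset[OF N(1)] by (intro exI[of _ ?N]) blast
      qed
      then show ?thesis unfolding closedin_def G_def by blast
    qed
    have "C \<subseteq> G \<or> disjnt C G" using connectedin_clopen_cases[OF Ccon G_closed G_open] .
    then show ?thesis
    proof
      assume CG: "C \<subseteq> G"
      have "locally_congruent_on M \<A> C f S3 (\<lambda>u. (u \<otimes>\<^sub>H quat_i \<otimes>\<^sub>H quat_inv u, u \<otimes>\<^sub>H quat_j \<otimes>\<^sub>H quat_inv u))"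
      proof (rule congruent)
        fix x U \<phi> W assume "x \<in> C" "(U, \<phi>) \<in> \<A>" "x \<in> U" "\<phi> x \<in> W" "open W" "W \<subseteq> \<phi> ` U"
          and S: "(W, \<lambda>y. fst (f (inv_into U \<phi> y)), \<lambda>y. snd (f (inv_into U \<phi> y))) \<in> S"
        then show "locally_model W (\<lambda>y. fst (f (inv_into U \<phi> y))) (\<lambda>y. snd (f (inv_into U \<phi> y))) S3
            (\<lambda>u. (u \<otimes>\<^sub>H quat_i \<otimes>\<^sub>H quat_inv u, u \<otimes>\<^sub>H quat_j \<otimes>\<^sub>H quat_inv u)) (\<phi> x)"
          using split[OF S, of "\<phi> x"] meets[of U \<phi> x W] CG by blast
      qed
      then show ?thesis by blast
    next
      assume CG: "disjnt C G"
      have "locally_congruent_on M \<A> C f (UNIV :: (real^3) set) (\<lambda>x. (torus_p (x$1) (x$3), torus_q (x$1) (x$2)))"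
      proof (rule congruent)
        fix x U \<phi> W assume x: "x \<in> C" and c: "(U, \<phi>) \<in> \<A>" and W: "x \<in> U" "\<phi> x \<in> W" "open W" "W \<subseteq> \<phi> ` U"
          and S: "(W, \<lambda>y. fst (f (inv_into U \<phi> y)), \<lambda>y. snd (f (inv_into U \<phi> y))) \<in> S"
        interpret manifold_chart M \<A> U \<phi> by unfold_locales (use assms(1) c in auto)
        have "\<not> in_hyperplane W (\<lambda>y. fst (f (\<psi> y)))"
        proof
          assume "in_hyperplane W (\<lambda>y. fst (f (\<psi> y)))"
          then obtain k where "k \<noteq> 0" "\<forall>y\<in>W. k \<bullet> fst (f (\<psi> y)) = 0" unfolding in_hyperplane_def by blast
          then have "k \<bullet> fst (f z) = 0" if "z \<in> {z \<in> U. \<phi> z \<in> W}" for z using that \<psi>_\<phi>[of z] by auto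
          then have "in_hyperplane {z \<in> U. \<phi> z \<in> W} (\<lambda>y. fst (f y))" using \<open>k \<noteq> 0\<close> unfolding in_hyperplane_def by blast
          then have "x \<in> G" using openin_preimage[OF W(3)] W(1,2) chart_facts(4) unfolding G_def by blast
          then show False using x CG unfolding disjnt_def by blast
        qed
        then show "locally_model W (\<lambda>y. fst (f (inv_into U \<phi> y))) (\<lambda>y. snd (f (inv_into U \<phi> y))) (UNIV :: (real^3) set)
            (\<lambda>x. (torus_p (x$1) (x$3), torus_q (x$1) (x$2))) (\<phi> x)"
          using split[OF S W(2)] by blast
      qed
      then show ?thesis by blast
    qed
  qed
qed

end
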